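(* Let $P$ be a properly supported, elliptic, classical pseudo-differential operator of order $m$ on $\mathbb{R}^n$. Then there exists $Q\in\Psi DO^{-m}_{cl}(\mathbb{R}^n)$ such that $PQ-\mathrm{Id}$ and $QP-\mathrm{Id}$ have $C^\infty$ Schwartz kernels.
   Context: Notation: $D_{x_j}=-i\,\partial_{x_j}$, $\langle\theta\rangle=(1+|\theta|^2)^{1/2}$. For $m\in\mathbb{R}$, $S^m(\mathbb{R}^N;\mathbb{R}^k)$ is the set of $a\in C^\infty(\mathbb{R}^N\times\mathbb{R}^k)$ such that for all multi-indices $\alpha,\beta$ and compact $K$ there is $C$ with $|D_x^\alpha D_\theta^\beta a(x,\theta)|\le C\langle\theta\rangle^{m-|\beta|}$ for $x\in K$ and all $\theta$. $\Psi DO^m(\mathbb{R}^n)$ is the set of operators $C_0^\infty(\mathbb{R}^n)\to C^\infty(\mathbb{R}^n)$ whose Schwartz kernel is an oscillatory integral $(2\pi)^{-n}\int e^{i\langle x-y,\xi\rangle}a(x,y,\xi)\,d\xi$ with $a\in S^m(\mathbb{R}^n_x\times\mathbb{R}^n_y;\mathbb{R}^n_\xi)$. An operator is properly supported if both coordinate projections from the support of its kernel to $\mathbb{R}^n$ are proper; a properly supported pseudo-differential operator maps $C_0^\infty$ to $C_0^\infty$ and $C^\infty$ to $C^\infty$. Modulo a smooth kernel, $P\in\Psi DO^m$ can be written with $a=p(x,\xi)\in S^m(\mathbb{R}^n;\mathbb{R}^n)$ (total left symbol). $P$ is classical ($P\in\Psi DO^m_{cl}$) if there are $p_{m-j}(x,\xi)$,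 $j\ge0$, smooth on $\xi\neq0$ and positively homogeneous of degree $m-j$ in $\xi$, with $p-\sum_{j<N}(1-\phi(\xi))p_{m-j}\in S^{m-N}$ for all $N$, where $\phi\in C_0^\infty(\mathbb{R}^n)$ equals $1$ near $0$. The principal symbol is $\sigma_m(P)=p_m$, and $P$ is elliptic of order $m$ if $\sigma_m(P)(x,\xi)\ne0$ for all $x$ and all $\xi\neq0$. *)

theory Defs
  imports "HOL-Analysis.Analysis"
begin

section \<open>Smooth functions, test functions, symbols\<close>

text \<open>
  A multi-index is given by a list of basis vectors, repeated according to multiplicity, and its
  order is the length of the list. On smooth functions the order of the entries is irrelevant.
  Each factor is \<open>-i\<close> times the partial derivative.
\<close>

primrec D_iter ::
    "'a::euclidean_space list \<Rightarrow> ('a \<Rightarrow> complex) \<Rightarrow> 'a \<Rightarrow> complex" where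
  "D_iter [] f = f"
| "D_iter (v # vs) f = (\<lambda>x. - \<i> * frechet_derivative (D_iter vs f) (at x) v)"

text \<open>Only meant for open \<open>S\<close>.\<close>

definition smooth_on :: "'a::euclidean_space set \<Rightarrow> ('a \<Rightarrow> complex) \<Rightarrow> bool" where
  "smooth_on S f \<longleftrightarrow>
    (\<forall>vs. set vs \<subseteq> Basis \<longrightarrow> (\<forall>x\<in>S. D_iter vs f differentiable (at x)))"

definition fun_support :: "('a::topological_space \<Rightarrow> complex) \<Rightarrow> 'a set" where
  "fun_support f = closure {x. f x \<noteq> 0}"

definition test_functions :: "('a::euclidean_space \<Rightarrow> complex) set" where
  "test_functions = {f. smooth_on UNIV f \<and> compact (fun_support f)}"

definition cutoffs :: "('a::euclidean_space \<Rightarrow> complex) set" where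
  "cutoffs = {\<psi> \<in> test_functions. \<forall>\<^sub>F x in nhds 0. \<psi> x = 1}"

definition japanese_bracket :: "'a::real_normed_vector \<Rightarrow> real" where
  "japanese_bracket \<theta> = sqrt (1 + (norm \<theta>)\<^sup>2)"

definition symbol_class ::
    "real \<Rightarrow> ('a::euclidean_space \<times> 'b::euclidean_space \<Rightarrow> complex) set" where
  "symbol_class m = {a. smooth_on UNIV a \<and>
    (\<forall>\<alpha> \<beta> K. set \<alpha> \<subseteq> Basis \<and> set \<beta> \<subseteq> Basis \<and> compact K \<longrightarrow>
      (\<exists>C. \<forall>x\<in>K. \<forall>\<theta>.
        cmod (D_iter (map (\<lambda>u. (u, 0)) \<alpha> @ map (\<lambda>v. (0, v)) \<beta>) a (x, \<theta>))
          \<le> C * japanese_bracket \<theta> powr (m - real (length \<beta>))))}"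


section \<open>Distributions and Schwartz kernels\<close>

text \<open>
  A distribution is a functional whose values are only relevant on test functions.
\<close>

definition distribution :: "(('a::euclidean_space \<Rightarrow> complex) \<Rightarrow> complex) \<Rightarrow> bool" where
  "distribution T \<longleftrightarrow>
    (\<forall>f\<in>test_functions. \<forall>g\<in>test_functions. T (\<lambda>x. f x + g x) = T f + T g) \<and>
    (\<forall>c. \<forall>f\<in>test_functions. T (\<lambda>x. c * f x) = c * T f) \<and>
    (\<forall>K. compact K \<longrightarrow>
      (\<exists>C N. \<forall>f\<in>test_functions. fun_support f \<subseteq> K \<longrightarrow>
        cmod (T f) \<le> C * (\<Sum>vs | set vs \<subseteq> Basis \<and> length vs \<le> N. SUP x. cmod (D_iter vs f x))))"

definition dist_support :: "(('a::euclidean_space \<Rightarrow> complex) \<Rightarrow> complex) \<Rightarrow> 'a set" where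
  "dist_support T =
    - \<Union>{U. open U \<and> (\<forall>f\<in>test_functions. fun_support f \<subseteq> U \<longrightarrow> T f = 0)}"

text \<open>The distribution defined by a (locally integrable) function.\<close>

definition fun_dist ::
    "('a::euclidean_space \<Rightarrow> complex) \<Rightarrow> ('a \<Rightarrow> complex) \<Rightarrow> complex" where
  "fun_dist k f = (LINT x|lborel. k x * f x)"

text \<open>
  Operators from compactly supported smooth functions to smooth functions; the values outside
  \<^const>\<open>test_functions\<close> are irrelevant.
\<close>

definition smooth_operator ::
    "(('a::euclidean_space \<Rightarrow> complex) \<Rightarrow> 'a \<Rightarrow> complex) \<Rightarrow> bool" where
  "smooth_operator A \<longleftrightarrow>
    (\<forall>u\<in>test_functions. smooth_on UNIV (A u)) \<and>
    (\<forall>u\<in>test_functions. \<forall>v\<in>test_functions. A (\<lambda>x. u x + v x) = (\<lambda>x. A u x + A v x)) \<and>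
    (\<forall>c. \<forall>u\<in>test_functions. A (\<lambda>x. c * u x) = (\<lambda>x. c * A u x))"

definition has_schwartz_kernel ::
    "(('a::euclidean_space \<Rightarrow> complex) \<Rightarrow> 'a \<Rightarrow> complex) \<Rightarrow>
      (('a \<times> 'a \<Rightarrow> complex) \<Rightarrow> complex) \<Rightarrow> bool" where
  "has_schwartz_kernel A K \<longleftrightarrow> smooth_operator A \<and> distribution K \<and>
    (\<forall>u\<in>test_functions. \<forall>v\<in>test_functions.
      fun_dist (A u) v = K (\<lambda>(x, y). v x * u y))"

definition has_smooth_kernel ::
    "(('a::euclidean_space \<Rightarrow> complex) \<Rightarrow> 'a \<Rightarrow> complex) \<Rightarrow> bool" where
  "has_smooth_kernel A \<longleftrightarrow> (\<exists>k. smooth_on UNIV k \<and> has_schwartz_kernel A (fun_dist k))"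

text \<open>
  The kernel is unique as a functional on test functions, by density of the tensor products, so
  the support below does not depend on the choice.
\<close>

definition kernel_support ::
    "(('a::euclidean_space \<Rightarrow> complex) \<Rightarrow> 'a \<Rightarrow> complex) \<Rightarrow> ('a \<times> 'a) set" where
  "kernel_support A = dist_support (SOME K. has_schwartz_kernel A K)"

definition properly_supported ::
    "(('a::euclidean_space \<Rightarrow> complex) \<Rightarrow> 'a \<Rightarrow> complex) \<Rightarrow> bool" where
  "properly_supported A \<longleftrightarrow> (\<exists>K. has_schwartz_kernel A K) \<and>
    proper_map (top_of_set (kernel_support A)) euclidean fst \<and>
    proper_map (top_of_set (kernel_support A)) euclidean snd"

text \<open>
  The extension of a properly supported operator to all smooth functions. The value at \<open>x\<close> is
  that of \<open>A (\<psi> u)\<close> at \<open>x\<close> for any test function \<open>\<psi>\<close> equal to 1 near the compact set of all \<open>y\<close>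
  with \<open>(x, y)\<close> in the support of the kernel; it does not depend on \<open>\<psi>\<close>, and it is \<open>A u x\<close> if
  \<open>u\<close> is itself a test function.
\<close>

definition proper_extension ::
    "(('a::euclidean_space \<Rightarrow> complex) \<Rightarrow> 'a \<Rightarrow> complex) \<Rightarrow> ('a \<Rightarrow> complex) \<Rightarrow> 'a \<Rightarrow> complex" where
  "proper_extension A u x = (THE c. \<forall>\<psi>\<in>test_functions.
    (\<exists>U. open U \<and> {y. (x, y) \<in> kernel_support A} \<subseteq> U \<and> (\<forall>y\<in>U. \<psi> y = 1)) \<longrightarrow>
      A (\<lambda>y. \<psi> y * u y) x = c)"


section \<open>Pseudo-differential operators\<close>

text \<open>
  The oscillatory integral \<open>(2 pi)^(-n) \<integral> exp (i (x - y) \<bullet> \<xi>) a(x, y, \<xi>) d\<xi>\<close> as a distribution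
  in \<open>(x, y)\<close>, tested on \<open>f\<close>: insert \<open>\<psi>(\<epsilon> \<xi>)\<close> with a cutoff \<open>\<psi>\<close> equal to 1 near 0, which makes
  the integral absolutely convergent, and let \<open>\<epsilon>\<close> tend to 0 from above. For symbols the limit
  exists and does not depend on \<open>\<psi>\<close>.
\<close>

definition has_oscillatory_integral ::
    "(('a::euclidean_space \<times> 'a) \<times> 'a \<Rightarrow> complex) \<Rightarrow> ('a \<times> 'a \<Rightarrow> complex) \<Rightarrow> complex \<Rightarrow> bool" where
  "has_oscillatory_integral a f I \<longleftrightarrow> (\<forall>\<psi>\<in>cutoffs.
    ((\<lambda>\<epsilon>::real. 1 / (2 * of_real pi) ^ DIM('a) *
        (LINT ((x, y), \<xi>)|lborel.
          exp (\<i> * of_real ((x - y) \<bullet> \<xi>)) * a ((x, y), \<xi>) * \<psi> (\<epsilon> *\<^sub>R \<xi>) * f (x, y)))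
      \<longlongrightarrow> I) (at_right 0))"

definition PsiDO :: "real \<Rightarrow> (('a::euclidean_space \<Rightarrow> complex) \<Rightarrow> 'a \<Rightarrow> complex) set" where
  "PsiDO m = {A. \<exists>a K. a \<in> symbol_class m \<and> has_schwartz_kernel A K \<and>
    (\<forall>f\<in>test_functions. has_oscillatory_integral a f (K f))}"

text \<open>The kernel differs from the oscillatory integral of \<open>p (x, \<xi>)\<close> by a smooth function.\<close>

definition total_left_symbol ::
    "real \<Rightarrow> (('a::euclidean_space \<Rightarrow> complex) \<Rightarrow> 'a \<Rightarrow> complex) \<Rightarrow> ('a \<times> 'a \<Rightarrow> complex) \<Rightarrow> bool" where
  "total_left_symbol m A p \<longleftrightarrow> p \<in> symbol_class m \<and>
    (\<exists>K k. has_schwartz_kernel A K \<and> smooth_on UNIV k \<and>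
      (\<forall>f\<in>test_functions.
        has_oscillatory_integral (\<lambda>((x, y), \<xi>). p (x, \<xi>)) f (K f - fun_dist k f)))"

definition pos_homogeneous ::
    "real \<Rightarrow> ('a \<times> 'b::real_vector \<Rightarrow> complex) \<Rightarrow> bool" where
  "pos_homogeneous r q \<longleftrightarrow>
    (\<forall>x \<xi>. \<forall>t>0. \<xi> \<noteq> 0 \<longrightarrow> q (x, t *\<^sub>R \<xi>) = of_real (t powr r) * q (x, \<xi>))"

text \<open>
  \<open>q j\<close> is the term of degree \<open>m - j\<close>; its values at \<open>\<xi> = 0\<close> are irrelevant. The condition for
  one cutoff \<open>\<phi>\<close> is equivalent to that for all of them.
\<close>

definition classical_expansion ::
    "real \<Rightarrow> (('a::euclidean_space \<Rightarrow> complex) \<Rightarrow> 'a \<Rightarrow> complex) \<Rightarrow>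
      (nat \<Rightarrow> 'a \<times> 'a \<Rightarrow> complex) \<Rightarrow> bool" where
  "classical_expansion m A q \<longleftrightarrow>
    (\<forall>j. smooth_on (UNIV \<times> (- {0})) (q j) \<and> pos_homogeneous (m - real j) (q j)) \<and>
    (\<exists>p. total_left_symbol m A p \<and>
      (\<forall>\<phi>\<in>cutoffs. \<forall>N::nat.
        (\<lambda>(x, \<xi>). p (x, \<xi>) - (\<Sum>j<N. (1 - \<phi> \<xi>) * q j (x, \<xi>))) \<in> symbol_class (m - real N)))"

definition PsiDO_cl :: "real \<Rightarrow> (('a::euclidean_space \<Rightarrow> complex) \<Rightarrow> 'a \<Rightarrow> complex) set" where
  "PsiDO_cl m = {A \<in> PsiDO m. \<exists>q. classical_expansion m A q}"

text \<open>For a classical operator this is uniquely determined on \<open>\<xi> \<noteq> 0\<close>.\<close>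

definition principal_symbol ::
    "real \<Rightarrow> (('a::euclidean_space \<Rightarrow> complex) \<Rightarrow> 'a \<Rightarrow> complex) \<Rightarrow> 'a \<times> 'a \<Rightarrow> complex" where
  "principal_symbol m A = (SOME s. \<exists>q. classical_expansion m A q \<and> s = q 0)"

definition elliptic ::
    "real \<Rightarrow> (('a::euclidean_space \<Rightarrow> complex) \<Rightarrow> 'a \<Rightarrow> complex) \<Rightarrow> bool" where
  "elliptic m A \<longleftrightarrow> (\<forall>x \<xi>. \<xi> \<noteq> 0 \<longrightarrow> principal_symbol m A (x, \<xi>) \<noteq> 0)"

end

theory Submission
  imports Defs "HOL-Probability.Probability"
begin

text \<open>
  Modulo a smooth kernel, \<open>P\<close> is the quantization of its total left symbol \<open>p\<close>, and it makes no
  difference whether the kernel of that quantization is cut off at distance 1 from the diagonal.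
  A truncated operator with symbol \<open>p\<close> composed with the operator with symbol \<open>q\<close> is exactly the
  operator whose symbol is the oscillatory integral
  \<open>(2 pi)^(-n) \<integral>\<integral> exp (i z \<bullet> \<eta>) p(x, \<xi> + \<eta>) \<chi>(z) q(x - z, \<xi>) dz d\<eta>\<close>. Taylor expansion in \<open>\<eta>\<close> and Fourier
  inversion expand it into the usual series in the derivatives of \<open>p\<close> and \<open>q\<close>. For elliptic \<open>p\<close> the equation
  that the series is 1 is solved degree by degree by homogeneous functions, and a Borel sum \<open>q\<close> of these
  makes the composite symbol 1 up to order \<open>-\<infinity>\<close>. As \<open>q\<close> is elliptic too, it has a right parametrix
  itself, and so the right parametrix of \<open>P\<close> is also a left parametrix. The smooth remainder in \<open>P\<close> is the
  whole kernel away from the diagonal, hence properly supported, and its products with the other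
  operators have smooth kernels.
\<close>

section \<open>Calculus of smooth functions\<close>

text \<open>Composition is the obstacle. \<open>Op q\<close> sends test functions to smooth
  functions that need not have compact support, so a product of two such operators need not make
  sense. \<open>OpT\<close> reads its argument only within distance 1, hence acts on all smooth
  functions and preserves test functions; this is why the left factor of a composition is truncated.
  The cutoff is carried along inside the composite symbol instead of being estimated away, so the
  composition formula is exact and all asymptotics sit in one statement about
  \<open>comp_rem\<close>. That remainder obeys the Leibniz rule in the pair of symbols, and a sup
  bound for it is enough to place it in a symbol class. Taking the second symbol to be 1 shows that
  truncation changes an operator only by a smooth kernel. Oscillatory integrals are iterated:
  integrating over space before the covariable leaves a rapidly decreasing function, and the
  regularization by \<open>\<epsilon>\<close> enters only in the comparison with
  \<open>has_oscillatory_integral\<close>. The parametrix is \<open>Op q\<close> without cutoff,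
  since its kernel is literally the oscillatory integral of \<open>q\<close>.\<close>

definition pd :: "'a::euclidean_space \<Rightarrow> ('a \<Rightarrow> complex) \<Rightarrow> 'a \<Rightarrow> complex" where
  "pd v f = (\<lambda>x. - \<i> * frechet_derivative f (at x) v)"

lemma D_iter_Cons: "D_iter (v # vs) f = pd v (D_iter vs f)"
  by (simp add: pd_def)

declare D_iter.simps(2) [simp del]
declare D_iter_Cons [simp]

lemma D_iter_append: "D_iter (us @ vs) f = D_iter us (D_iter vs f)"
  by (induction us) auto

lemma pd_eqI: "(f has_derivative f') (at x) \<Longrightarrow> pd v f x = - \<i> * f' v"
  by (metis pd_def frechet_derivative_at)

lemma pd_cong_open:
  assumes "open S" "x \<in> S" "\<And>y. y \<in> S \<Longrightarrow> f y = g y"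
  shows "pd v f x = pd v g x"
proof -
  have "(f has_derivative D) (at x) \<longleftrightarrow> (g has_derivative D) (at x)" for D
    using has_derivative_transform_within_open[OF _ assms(1,2), of f D UNIV g]
      has_derivative_transform_within_open[OF _ assms(1,2), of g D UNIV f] assms(3) by auto
  then show ?thesis by (simp add: pd_def frechet_derivative_def)
qed

lemma differentiable_cong_open:
  assumes "open S" "x \<in> S" "\<And>y. y \<in> S \<Longrightarrow> f y = g y"
  shows "f differentiable at x \<longleftrightarrow> g differentiable at x"
  unfolding differentiable_def
  using has_derivative_transform_within_open[OF _ assms(1,2), of f _ UNIV g]
      has_derivative_transform_within_open[OF _ assms(1,2), of g _ UNIV f] assms(3) by (metis)

lemma has_derivative_pd:
  assumes "f differentiable at x"
  shows "(f has_derivative (\<lambda>h. \<Sum>b\<in>Basis. of_real (h \<bullet> b) * (\<i> * pd b f x))) (at x)"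
proof -
  let ?F = "frechet_derivative f (at x)"
  have F: "(f has_derivative ?F) (at x)"
    using assms frechet_derivative_works by blast
  then have lin: "linear ?F" by (rule has_derivative_linear)
  have "?F h = (\<Sum>b\<in>Basis. of_real (h \<bullet> b) * (\<i> * pd b f x))" for h
  proof -
    have "?F h = ?F (\<Sum>b\<in>Basis. (h \<bullet> b) *\<^sub>R b)" by (simp add: euclidean_representation)
    also have "\<dots> = (\<Sum>b\<in>Basis. (h \<bullet> b) *\<^sub>R ?F b)"
      by (simp add: linear_sum[OF lin] linear_scale[OF lin])
    finally show ?thesis by (simp add: pd_def scaleR_conv_of_real)
  qed
  then show ?thesis using F by presburger
qed

lemma pd_dir:
  assumes "f differentiable at x"
  shows "pd h f x = (\<Sum>b\<in>Basis. of_real (h \<bullet> b) * pd b f x)"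
  by (subst pd_eqI[OF has_derivative_pd[OF assms]])
    (simp add: sum_distrib_left mult_ac flip: sum_negf)

section \<open>Smoothness as differentiability to every finite order\<close>

primrec Ck :: "nat \<Rightarrow> 'a::euclidean_space set \<Rightarrow> ('a \<Rightarrow> complex) \<Rightarrow> bool" where
  "Ck 0 S f = (\<forall>x\<in>S. f differentiable at x)"
| "Ck (Suc k) S f = ((\<forall>x\<in>S. f differentiable at x) \<and> (\<forall>v\<in>Basis. Ck k S (pd v f)))"

text \<open>\<open>Ck\<close> peels off the innermost derivative, the last entry of the word, so
  closure under products, inverses and compositions becomes an induction on \<open>k\<close> with
  the product or chain rule as its step. The index is shifted against the usual one:
  \<open>Ck k\<close> asks all derivatives of order at most \<open>k\<close> to be differentiable
  themselves.\<close>

lemma Ck_iff: "Ck k S f \<longleftrightarrow>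
  (\<forall>vs. set vs \<subseteq> Basis \<and> length vs \<le> k \<longrightarrow> (\<forall>x\<in>S. D_iter vs f differentiable at x))"
proof (induction k arbitrary: f)
  case 0
  show ?case by auto
next
  case (Suc k)
  show ?case
  proof
    assume L: "Ck (Suc k) S f"
    show "\<forall>vs. set vs \<subseteq> Basis \<and> length vs \<le> Suc k \<longrightarrow> (\<forall>x\<in>S. D_iter vs f differentiable at x)"
    proof safe
      fix vs :: "'a list" and x assume vs: "set vs \<subseteq> Basis" "length vs \<le> Suc k" and x: "x \<in> S"
      show "D_iter vs f differentiable at x"
      proof (cases vs rule: rev_cases)
        case Nil
        then show ?thesis using L x by simp
      next
        case (snoc us v)
        then have "Ck k S (pd v f)" using L vs by auto
        then have "D_iter us (pd v f) differentiable at x"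
          using snoc vs x unfolding Suc.IH by auto
        then show ?thesis by (simp add: snoc D_iter_append)
      qed
    qed
  next
    assume R: "\<forall>vs. set vs \<subseteq> Basis \<and> length vs \<le> Suc k \<longrightarrow> (\<forall>x\<in>S. D_iter vs f differentiable at x)"
    have "Ck k S (pd v f)" if "v \<in> Basis" for v
      unfolding Suc.IH
    proof safe
      fix vs :: "'a list" and x assume "set vs \<subseteq> Basis" "length vs \<le> k" "x \<in> S"
      then show "D_iter vs (pd v f) differentiable at x"
        using R[rule_format, of "vs @ [v]" x] that by (simp add: D_iter_append)
    qed
    then show "Ck (Suc k) S f" using R[rule_format, of "[]"] by simp
  qed
qed

lemma smooth_on_Ck: "smooth_on S f \<longleftrightarrow> (\<forall>k. Ck k S f)"
  unfolding Ck_iff smooth_on_def by auto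

lemma Ck_SucD: "Ck (Suc k) S f \<Longrightarrow> Ck k S f"
  unfolding Ck_iff by auto

lemma Ck_diff: "Ck k S f \<Longrightarrow> x \<in> S \<Longrightarrow> f differentiable at x"
  by (cases k) auto

lemma Ck_cong:
  assumes "open S" "\<And>x. x \<in> S \<Longrightarrow> f x = g x"
  shows "Ck k S f \<longleftrightarrow> Ck k S g"
  using assms(2)
proof (induction k arbitrary: f g)
  case 0
  then show ?case using differentiable_cong_open[OF assms(1)] by (metis Ck.simps(1))
next
  case (Suc k)
  have "Ck k S (pd v f) \<longleftrightarrow> Ck k S (pd v g)" for v
    by (rule Suc.IH) (use Suc.prems pd_cong_open[OF assms(1)] in metis)
  moreover have "(\<forall>x\<in>S. f differentiable at x) \<longleftrightarrow> (\<forall>x\<in>S. g differentiable at x)"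
    using differentiable_cong_open[OF assms(1)] Suc.prems by metis
  ultimately show ?case by simp
qed

lemma pd_const [simp]: "pd v (\<lambda>x. c) = (\<lambda>x. 0)"
  by (simp add: pd_def)

lemma Ck_const: "Ck k S (\<lambda>x. c)"
  by (induction k arbitrary: c) auto

lemma pd_add:
  assumes "f differentiable at x" "g differentiable at x"
  shows "pd v (\<lambda>x. f x + g x) x = pd v f x + pd v g x"
proof -
  have "((\<lambda>x. f x + g x) has_derivative
      (\<lambda>h. frechet_derivative f (at x) h + frechet_derivative g (at x) h)) (at x)"
    using assms frechet_derivative_works by (blast intro: has_derivative_add)
  from pd_eqI[OF this] show ?thesis by (simp add: pd_def algebra_simps)
qed

lemma pd_mult:
  assumes "f differentiable at x" "g differentiable at x"
  shows "pd v (\<lambda>x. f x * g x) x = pd v f x * g x + f x * pd v g x"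
proof -
  have "((\<lambda>x. f x * g x) has_derivative
      (\<lambda>h. f x * frechet_derivative g (at x) h + frechet_derivative f (at x) h * g x)) (at x)"
    using assms frechet_derivative_works by (blast intro: has_derivative_mult)
  from pd_eqI[OF this] show ?thesis by (simp add: pd_def algebra_simps)
qed

lemma pd_cmult:
  assumes "f differentiable at x"
  shows "pd v (\<lambda>x. c * f x) x = c * pd v f x"
  using pd_mult[of "\<lambda>_. c" x f v] assms by simp

lemma differentiable_mult': 
  fixes f g :: "'a::real_normed_vector \<Rightarrow> complex"
  shows "f differentiable at x \<Longrightarrow> g differentiable at x \<Longrightarrow> (\<lambda>x. f x * g x) differentiable at x"
  by (rule differentiable_mult)

lemma Ck_add:
  assumes "open S" "Ck k S f" "Ck k S g"
  shows "Ck k S (\<lambda>x. f x + g x)"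
  using assms(2,3)
proof (induction k arbitrary: f g)
  case 0
  then show ?case by auto
next
  case (Suc k)
  have "Ck k S (pd v (\<lambda>x. f x + g x))" if "v \<in> Basis" for v
  proof -
    have "Ck k S (\<lambda>x. pd v f x + pd v g x)" using Suc that by auto
    then show ?thesis
      by (subst Ck_cong[OF assms(1)]) (use Suc.prems in \<open>auto intro: pd_add\<close>)
  qed
  then show ?case using Suc.prems by auto
qed

lemma Ck_mult:
  assumes "open S" "Ck k S f" "Ck k S g"
  shows "Ck k S (\<lambda>x. f x * g x)"
  using assms(2,3)
proof (induction k arbitrary: f g)
  case 0
  then show ?case by (auto intro: differentiable_mult')
next
  case (Suc k)
  have "Ck k S (pd v (\<lambda>x. f x * g x))" if "v \<in> Basis" for v
  proof -
    have "Ck k S (\<lambda>x. pd v f x * g x + f x * pd v g x)"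
      using Suc that Ck_SucD[OF Suc.prems(1)] Ck_SucD[OF Suc.prems(2)]
      by (auto intro!: Ck_add assms(1))
    then show ?thesis
      by (subst Ck_cong[OF assms(1)]) (use Suc.prems in \<open>auto intro: pd_mult\<close>)
  qed
  then show ?case using Suc.prems by (auto intro: differentiable_mult')
qed

lemma Ck_sum:
  assumes "open S" "\<And>i. i \<in> I \<Longrightarrow> Ck k S (f i)"
  shows "Ck k S (\<lambda>x. \<Sum>i\<in>I. f i x)"
  using assms(2)
proof (induction I rule: infinite_finite_induct)
  case (insert i I)
  then show ?case by (auto intro!: Ck_add assms(1))
qed (auto intro: Ck_const)

text \<open>The derivative of \<open>1 / f\<close> is \<open>- f' (1 / f)^2\<close>, in which only
  \<open>1 / f\<close> itself and a derivative of \<open>f\<close> occur, so each order of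
  \<open>1 / f\<close> follows from the preceding one.\<close>

lemma Ck_inverse:
  assumes "open S" "Ck k S f" "\<And>x. x \<in> S \<Longrightarrow> f x \<noteq> 0"
  shows "Ck k S (\<lambda>x. inverse (f x))"
  using assms(2)
proof (induction k)
  case 0
  then show ?case using assms(3) by (auto intro: differentiable_inverse)
next
  case (Suc k)
  have "Ck k S (pd v (\<lambda>x. inverse (f x)))" if v: "v \<in> Basis" for v
  proof -
    have "Ck k S (\<lambda>x. (- 1) * pd v f x * (inverse (f x) * inverse (f x)))"
      by (intro Ck_mult Ck_const assms(1)) (use Suc v Ck_SucD[OF Suc.prems(1)] in auto)
    moreover have "pd v (\<lambda>x. inverse (f x)) x = (- 1) * pd v f x * (inverse (f x) * inverse (f x))"
      if x: "x \<in> S" for x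
    proof -
      have "((\<lambda>x. inverse (f x)) has_derivative
          (\<lambda>h. - (inverse (f x) * frechet_derivative f (at x) h * inverse (f x)))) (at x)"
        using Ck_diff[OF Suc.prems x] assms(3)[OF x]
        by (intro Deriv.has_derivative_inverse) (simp_all flip: frechet_derivative_works)
      from pd_eqI[OF this] show ?thesis by (simp add: pd_def algebra_simps)
    qed
    ultimately show ?thesis by (subst Ck_cong[OF assms(1)]) auto
  qed
  then show ?case using Suc.prems assms(3) by (auto intro: differentiable_inverse)
qed

lemma differentiable_of_components:
  fixes h :: "'a::euclidean_space \<Rightarrow> 'b::euclidean_space"
  assumes "\<And>b. b \<in> Basis \<Longrightarrow> (\<lambda>x. complex_of_real (h x \<bullet> b)) differentiable at x"
  shows "h differentiable at x"
proof (subst differentiable_componentwise_within, safe)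
  fix b :: 'b assume "b \<in> Basis"
  then have "(\<lambda>x. complex_of_real (h x \<bullet> b)) differentiable at x" by (rule assms)
  then obtain D where "((\<lambda>x. complex_of_real (h x \<bullet> b)) has_derivative D) (at x)"
    unfolding differentiable_def by auto
  from bounded_linear.has_derivative[OF bounded_linear_Re this]
  show "(\<lambda>x. h x \<bullet> b) differentiable at x"
    unfolding differentiable_def by auto
qed

lemma pd_compose:
  fixes h :: "'a::euclidean_space \<Rightarrow> 'b::euclidean_space"
  assumes h: "h differentiable at x" and F: "F differentiable at (h x)"
  shows "pd v (\<lambda>x. F (h x)) x =
    \<i> * (\<Sum>b\<in>Basis. pd v (\<lambda>x. complex_of_real (h x \<bullet> b)) x * pd b F (h x))"
proof -
  let ?h = "frechet_derivative h (at x)"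
  have dh: "(h has_derivative ?h) (at x)" using h frechet_derivative_works by blast
  from has_derivative_compose[OF this has_derivative_pd[OF F]]
  have *: "((\<lambda>x. F (h x)) has_derivative
     (\<lambda>y. \<Sum>b\<in>Basis. of_real (?h y \<bullet> b) * (\<i> * pd b F (h x)))) (at x)" by simp
  have "pd v (\<lambda>x. complex_of_real (h x \<bullet> b)) x = - \<i> * of_real (?h v \<bullet> b)" for b
    by (rule pd_eqI) (auto intro!: derivative_eq_intros dh)
  then show ?thesis
    by (subst pd_eqI[OF *]) (simp add: sum_distrib_left mult_ac flip: sum_negf)
qed

text \<open>The chain rule expresses the derivative through the functions \<open>pd b F\<close>
  after \<open>h\<close>, which is why the induction runs over all outer functions \<open>F\<close>
  at once while \<open>h\<close> stays fixed.\<close>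

lemma Ck_compose:
  fixes h :: "'a::euclidean_space \<Rightarrow> 'b::euclidean_space"
  assumes "open S" "\<And>x. x \<in> S \<Longrightarrow> h x \<in> T"
    "\<And>b. b \<in> Basis \<Longrightarrow> Ck k S (\<lambda>x. complex_of_real (h x \<bullet> b))" "Ck k T F"
  shows "Ck k S (\<lambda>x. F (h x))"
  using assms(3,4)
proof (induction k arbitrary: F)
  case 0
  have "h differentiable at x" if "x \<in> S" for x
    by (rule differentiable_of_components) (use 0 that in auto)
  then show ?case using 0 assms(2) by (auto intro: differentiable_compose)
next
  case (Suc k)
  have dh: "h differentiable at x" if "x \<in> S" for x
    by (rule differentiable_of_components) (use Suc.prems that in auto)
  have dF: "F differentiable at (h x)" if "x \<in> S" for x
    using Suc.prems(2) assms(2) that by auto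
  have "Ck k S (pd v (\<lambda>x. F (h x)))" if v: "v \<in> Basis" for v
  proof -
    have "Ck k S (\<lambda>x. pd b F (h x))" if "b \<in> Basis" for b
      by (rule Suc.IH[OF Ck_SucD[OF Suc.prems(1)]]) (use Suc.prems that in auto)
    then have "Ck k S (\<lambda>x. \<i> * (\<Sum>b\<in>Basis. pd v (\<lambda>x. complex_of_real (h x \<bullet> b)) x * pd b F (h x)))"
      using Suc.prems v by (auto intro!: Ck_mult Ck_const Ck_sum assms(1))
    then show ?thesis
      by (subst Ck_cong[OF assms(1)]) (use dh dF in \<open>auto intro: pd_compose\<close>)
  qed
  then show ?case using dh dF by (auto intro: differentiable_compose)
qed

lemma Ck_linear:
  assumes "bounded_linear h"
  shows "Ck k S (\<lambda>x. complex_of_real (h x))"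
proof (cases k)
  have *: "((\<lambda>x. complex_of_real (h x)) has_derivative (\<lambda>x. complex_of_real (h x))) (at x)" for x
    by (auto intro!: derivative_eq_intros bounded_linear.has_derivative[OF assms, of "\<lambda>x. x"])
  then have d: "(\<lambda>x. complex_of_real (h x)) differentiable at x" for x
    unfolding differentiable_def by blast
  case 0
  then show ?thesis using d by auto
next
  have *: "((\<lambda>x. complex_of_real (h x)) has_derivative (\<lambda>x. complex_of_real (h x))) (at x)" for x
    by (auto intro!: derivative_eq_intros bounded_linear.has_derivative[OF assms, of "\<lambda>x. x"])
  then have d: "(\<lambda>x. complex_of_real (h x)) differentiable at x" for x
    unfolding differentiable_def by blast
  have "pd v (\<lambda>x. complex_of_real (h x)) = (\<lambda>x. - \<i> * of_real (h v))" for v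
    by (rule ext) (rule pd_eqI[OF *])
  then show "Ck k S (\<lambda>x. complex_of_real (h x))" if "k = Suc j" for j
    using d Ck_const by (auto simp: that)
qed

section \<open>Closure properties of smooth functions\<close>

lemma smooth_on_diff: "smooth_on S f \<Longrightarrow> x \<in> S \<Longrightarrow> f differentiable at x"
  unfolding smooth_on_Ck using Ck_diff by blast

lemma smooth_on_subset: "smooth_on S f \<Longrightarrow> T \<subseteq> S \<Longrightarrow> smooth_on T f"
  unfolding smooth_on_def by auto

lemma smooth_on_Un: "smooth_on S f \<Longrightarrow> smooth_on T f \<Longrightarrow> smooth_on (S \<union> T) f"
  unfolding smooth_on_def by auto

lemma smooth_on_cong:
  assumes "open S" "\<And>x. x \<in> S \<Longrightarrow> f x = g x"
  shows "smooth_on S f \<longleftrightarrow> smooth_on S g"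
  unfolding smooth_on_Ck using Ck_cong[of S f g] assms by blast

lemma smooth_on_pd: "smooth_on S f \<Longrightarrow> v \<in> Basis \<Longrightarrow> smooth_on S (pd v f)"
  unfolding smooth_on_Ck by (metis Ck.simps(2))

lemma smooth_on_D_iter: "smooth_on S f \<Longrightarrow> set vs \<subseteq> Basis \<Longrightarrow> smooth_on S (D_iter vs f)"
  by (induction vs) (auto intro: smooth_on_pd)

lemma smooth_on_const [simp]: "smooth_on S (\<lambda>x. c)"
  unfolding smooth_on_Ck using Ck_const by blast

lemma smooth_on_add: "open S \<Longrightarrow> smooth_on S f \<Longrightarrow> smooth_on S g \<Longrightarrow> smooth_on S (\<lambda>x. f x + g x)"
  unfolding smooth_on_Ck by (intro allI Ck_add) auto

lemma smooth_on_mult: "open S \<Longrightarrow> smooth_on S f \<Longrightarrow> smooth_on S g \<Longrightarrow> smooth_on S (\<lambda>x. f x * g x)"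
  unfolding smooth_on_Ck by (intro allI Ck_mult) auto

lemma smooth_on_cmult: "open S \<Longrightarrow> smooth_on S f \<Longrightarrow> smooth_on S (\<lambda>x. c * f x)"
  by (intro smooth_on_mult smooth_on_const)

lemma smooth_on_minus:
  assumes "open S" "smooth_on S f"
  shows "smooth_on S (\<lambda>x. - f x)"
  using smooth_on_cmult[OF assms, of "-1"] by simp

lemma smooth_on_sub:
  assumes "open S" "smooth_on S f" "smooth_on S g"
  shows "smooth_on S (\<lambda>x. f x - g x)"
  using smooth_on_add[OF assms(1,2) smooth_on_minus[OF assms(1,3)]] by simp

lemma smooth_on_sum: "open S \<Longrightarrow> (\<And>i. i \<in> I \<Longrightarrow> smooth_on S (f i)) \<Longrightarrow> smooth_on S (\<lambda>x. \<Sum>i\<in>I. f i x)"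
  unfolding smooth_on_Ck by (intro allI Ck_sum) auto

lemma smooth_on_inverse:
  "open S \<Longrightarrow> smooth_on S f \<Longrightarrow> (\<And>x. x \<in> S \<Longrightarrow> f x \<noteq> 0) \<Longrightarrow> smooth_on S (\<lambda>x. inverse (f x))"
  unfolding smooth_on_Ck by (intro allI Ck_inverse) auto

lemma smooth_on_compose:
  fixes h :: "'a::euclidean_space \<Rightarrow> 'b::euclidean_space"
  assumes "open S" "\<And>x. x \<in> S \<Longrightarrow> h x \<in> T"
    "\<And>b. b \<in> Basis \<Longrightarrow> smooth_on S (\<lambda>x. complex_of_real (h x \<bullet> b))" "smooth_on T F"
  shows "smooth_on S (\<lambda>x. F (h x))"
  unfolding smooth_on_Ck
proof
  fix k show "Ck k S (\<lambda>x. F (h x))"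
    by (rule Ck_compose[where T = T, OF assms(1,2)]) (use assms(3,4) in \<open>auto simp: smooth_on_Ck\<close>)
qed

lemma smooth_on_linear: "bounded_linear h \<Longrightarrow> smooth_on S (\<lambda>x. complex_of_real (h x))"
  unfolding smooth_on_Ck using Ck_linear by blast

lemma smooth_on_compose_affine:
  fixes h :: "'a::euclidean_space \<Rightarrow> 'b::euclidean_space"
  assumes "open S" "\<And>x. x \<in> S \<Longrightarrow> h x + c \<in> T" "bounded_linear h" "smooth_on T F"
  shows "smooth_on S (\<lambda>x. F (h x + c))"
proof (rule smooth_on_compose[OF assms(1,2) _ assms(4)])
  fix b :: 'b
  have "smooth_on S (\<lambda>x. complex_of_real (h x \<bullet> b) + of_real (c \<bullet> b))"
    by (intro smooth_on_add smooth_on_linear bounded_linear_inner_left_comp assms(1,3) smooth_on_const)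
  then show "smooth_on S (\<lambda>x. complex_of_real ((h x + c) \<bullet> b))"
    by (simp add: inner_add_left)
qed

lemma smooth_on_compose_linear:
  fixes h :: "'a::euclidean_space \<Rightarrow> 'b::euclidean_space"
  assumes "bounded_linear h" "smooth_on UNIV F"
  shows "smooth_on UNIV (\<lambda>x. F (h x))"
  using smooth_on_compose_affine[of UNIV h 0 UNIV F] assms by simp

lemma pd_compose_affine:
  fixes h :: "'a::euclidean_space \<Rightarrow> 'b::euclidean_space"
  assumes "bounded_linear h" "F differentiable at (h x + c)"
  shows "pd v (\<lambda>x. F (h x + c)) x = (\<Sum>b\<in>Basis. of_real (h v \<bullet> b) * pd b F (h x + c))"
proof -
  have "((\<lambda>x. h x + c) has_derivative h) (at x)"
    by (auto intro!: derivative_eq_intros bounded_linear.has_derivative[OF assms(1), of "\<lambda>x. x"])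
  from has_derivative_compose[OF this has_derivative_pd[OF assms(2)]]
  have *: "((\<lambda>x. F (h x + c)) has_derivative
     (\<lambda>y. \<Sum>b\<in>Basis. of_real (h y \<bullet> b) * (\<i> * pd b F (h x + c)))) (at x)" by simp
  show ?thesis
    by (subst pd_eqI[OF *]) (simp add: sum_distrib_left mult_ac flip: sum_negf)
qed

lemma pd_compose_affine':
  fixes h :: "'a::euclidean_space \<Rightarrow> 'b::euclidean_space"
  assumes "bounded_linear h" "F differentiable at (h x + c)"
  shows "pd v (\<lambda>x. F (h x + c)) x = pd (h v) F (h x + c)"
  using pd_compose_affine[OF assms] pd_dir[OF assms(2)] by metis

lemma smooth_on_imp_continuous_on: "smooth_on S f \<Longrightarrow> continuous_on S f"
  using smooth_on_diff[of S f] by (meson continuous_at_imp_continuous_on differentiable_imp_continuous_within)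

lemma D_iter_cong_open:
  assumes "open S" "\<And>x. x \<in> S \<Longrightarrow> f x = g x"
  shows "x \<in> S \<Longrightarrow> D_iter vs f x = D_iter vs g x"
proof (induction vs arbitrary: x)
  case (Cons v vs)
  then show ?case using pd_cong_open[OF assms(1)] by (metis D_iter_Cons)
qed (use assms in auto)

lemma D_iter_add:
  assumes "open S" "smooth_on S f" "smooth_on S g" "set vs \<subseteq> Basis"
  shows "x \<in> S \<Longrightarrow> D_iter vs (\<lambda>x. f x + g x) x = D_iter vs f x + D_iter vs g x"
  using assms(4)
proof (induction vs arbitrary: x)
  case (Cons v vs)
  have "pd v (D_iter vs (\<lambda>x. f x + g x)) x = pd v (\<lambda>x. D_iter vs f x + D_iter vs g x) x"
    by (rule pd_cong_open[OF assms(1)]) (use Cons in auto)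
  also have "\<dots> = pd v (D_iter vs f) x + pd v (D_iter vs g) x"
    by (rule pd_add; rule smooth_on_diff[of S]) (use Cons assms in \<open>auto intro: smooth_on_D_iter\<close>)
  finally show ?case by simp
qed auto

lemma D_iter_cmult:
  assumes "open S" "smooth_on S f" "set vs \<subseteq> Basis"
  shows "x \<in> S \<Longrightarrow> D_iter vs (\<lambda>x. c * f x) x = c * D_iter vs f x"
  using assms(3)
proof (induction vs arbitrary: x)
  case (Cons v vs)
  have "pd v (D_iter vs (\<lambda>x. c * f x)) x = pd v (\<lambda>x. c * D_iter vs f x) x"
    by (rule pd_cong_open[OF assms(1)]) (use Cons in auto)
  also have "\<dots> = c * pd v (D_iter vs f) x"
    by (rule pd_cmult; rule smooth_on_diff[of S]) (use Cons assms in \<open>auto intro: smooth_on_D_iter\<close>)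
  finally show ?case by simp
qed auto

lemma D_iter_0 [simp]: "D_iter vs (\<lambda>x. 0) = (\<lambda>x. 0)"
  by (induction vs) auto

lemma D_iter_sum:
  assumes "open S" "\<And>i. i \<in> I \<Longrightarrow> smooth_on S (f i)" "set vs \<subseteq> Basis" "x \<in> S"
  shows "D_iter vs (\<lambda>x. \<Sum>i\<in>I. f i x) x = (\<Sum>i\<in>I. D_iter vs (f i) x)"
  using assms(2)
proof (induction I rule: infinite_finite_induct)
  case (insert i I)
  then show ?case
    by (simp add: D_iter_add[OF assms(1) _ smooth_on_sum[OF assms(1)] assms(3,4)])
qed auto

section \<open>Symmetry of mixed derivatives and Leibniz estimates\<close>

lemma has_vector_derivative_line:
  assumes "f differentiable at (y + t *\<^sub>R u)"
  shows "((\<lambda>t. f (y + t *\<^sub>R u)) has_vector_derivative (\<i> * pd u f (y + t *\<^sub>R u))) (at t within T)"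
proof -
  let ?F = "frechet_derivative f (at (y + t *\<^sub>R u))"
  have F: "(f has_derivative ?F) (at (y + t *\<^sub>R u))"
    using assms frechet_derivative_works by blast
  then have lin: "linear ?F" by (rule has_derivative_linear)
  have "((\<lambda>t. y + t *\<^sub>R u) has_derivative (\<lambda>s. s *\<^sub>R u)) (at t within T)"
    by (auto intro!: derivative_eq_intros)
  from has_derivative_compose[OF this F]
  have "((\<lambda>t. f (y + t *\<^sub>R u)) has_derivative (\<lambda>s. ?F (s *\<^sub>R u))) (at t within T)" .
  then show ?thesis
    by (simp add: has_vector_derivative_def linear_scale[OF lin] pd_def)
qed

text \<open>The increment of \<open>f\<close> along \<open>u\<close> is the integral of its
  derivative along \<open>u\<close>. Differentiating this integral along \<open>v\<close> under the
  integral sign, and the resulting identity along \<open>u\<close> at the base point, produces the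
  two mixed derivatives as derivatives of one function.\<close>

lemma pd_commute:
  fixes f :: "'a::euclidean_space \<Rightarrow> complex"
  assumes S: "open S" "x \<in> S" and f: "smooth_on S f" and uv: "u \<in> Basis" "v \<in> Basis"
  shows "pd u (pd v f) x = pd v (pd u f) x"
proof -
  obtain e where e: "e > 0" "cball x e \<subseteq> S" using S open_contains_cball by blast
  define r where "r = e / 2"
  have r: "r > 0" using e by (simp add: r_def)
  have inS: "x + s *\<^sub>R v + t *\<^sub>R u \<in> S" if "\<bar>s\<bar> \<le> r" "\<bar>t\<bar> \<le> r" for s t
  proof -
    have "norm (s *\<^sub>R v + t *\<^sub>R u) \<le> \<bar>s\<bar> + \<bar>t\<bar>"
      using norm_triangle_ineq[of "s *\<^sub>R v" "t *\<^sub>R u"] uv by (simp add: norm_Basis)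
    also have "\<dots> \<le> e" using that by (simp add: r_def)
    finally show ?thesis using e
      by (metis (no_types) add.assoc add_diff_cancel_left' dist_norm mem_cball norm_minus_commute subsetD)
  qed
  have fu: "smooth_on S (pd u f)" and fv: "smooth_on S (pd v f)"
    and fvu: "smooth_on S (pd v (pd u f))"
    using f uv by (auto intro: smooth_on_pd)
  have cont: "continuous_on A (\<lambda>p. g (x + fst p *\<^sub>R v + snd p *\<^sub>R u))"
    if g: "smooth_on S g" and A: "A \<subseteq> {-r..r} \<times> {-r..r}" for g :: "'a \<Rightarrow> complex" and A
    by (rule continuous_on_compose2[OF smooth_on_imp_continuous_on[OF g]])
      (use A in \<open>force intro!: continuous_intros inS\<close>)+
  have cont1: "continuous_on {0..t} (\<lambda>\<tau>. g (x + s *\<^sub>R v + \<tau> *\<^sub>R u))"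
    if g: "smooth_on S g" and A: "\<bar>s\<bar> \<le> r" "t \<le> r" for g :: "'a \<Rightarrow> complex" and s t
    by (rule continuous_on_compose2[OF smooth_on_imp_continuous_on[OF g]])
      (use A in \<open>force intro!: continuous_intros inS\<close>)+
  have key: "\<i> * pd v f (x + t *\<^sub>R u) - \<i> * pd v f x = integral {0..t} (\<lambda>\<tau>. - pd v (pd u f) (x + \<tau> *\<^sub>R u))"
    if t: "0 \<le> t" "t \<le> r" for t
  proof -
    \<comment> \<open>\<open>h s\<close> is the increment of \<open>f\<close> along \<open>u\<close>
      from the point moved by \<open>s\<close> along \<open>v\<close>; \<open>d1\<close> and
      \<open>d2\<close> are its derivative at 0 computed directly and by the Leibniz rule.\<close>
    define h where "h = (\<lambda>s. integral {0..t} (\<lambda>\<tau>. \<i> * pd u f (x + s *\<^sub>R v + \<tau> *\<^sub>R u)))"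
    have h_eq: "h s = f (x + t *\<^sub>R u + s *\<^sub>R v) - f (x + s *\<^sub>R v)" if s: "\<bar>s\<bar> \<le> r" for s
    proof -
      have "((\<lambda>\<tau>. \<i> * pd u f (x + s *\<^sub>R v + \<tau> *\<^sub>R u)) has_integral
          f (x + s *\<^sub>R v + t *\<^sub>R u) - f (x + s *\<^sub>R v + 0 *\<^sub>R u)) {0..t}"
        by (rule fundamental_theorem_of_calculus[OF t(1)])
          (use t s in \<open>intro has_vector_derivative_line smooth_on_diff[OF f] inS; auto\<close>)
      from integral_unique[OF this] show ?thesis unfolding h_def by (simp add: add_ac)
    qed
    have "((\<lambda>s. f (x + t *\<^sub>R u + s *\<^sub>R v) - f (x + s *\<^sub>R v)) has_vector_derivative
         (\<i> * pd v f (x + t *\<^sub>R u + 0 *\<^sub>R v) - \<i> * pd v f (x + 0 *\<^sub>R v))) (at 0 within {-r..r})"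
      using inS[of 0 t] inS[of 0 0] t r
      by (intro has_vector_derivative_diff has_vector_derivative_line smooth_on_diff[OF f]) auto
    then have d0: "((\<lambda>s. f (x + t *\<^sub>R u + s *\<^sub>R v) - f (x + s *\<^sub>R v)) has_vector_derivative
         (\<i> * pd v f (x + t *\<^sub>R u) - \<i> * pd v f x)) (at 0 within {-r..r})"
      by (simp only: scaleR_zero_left add_0_right)
    have d1: "(h has_vector_derivative
         (\<i> * pd v f (x + t *\<^sub>R u) - \<i> * pd v f x)) (at 0 within {-r..r})"
      by (rule has_vector_derivative_transform[OF _ _ d0]) (use h_eq r in auto)
    have d2: "(h has_vector_derivative
        integral (cbox 0 t) (\<lambda>\<tau>. \<i> * (\<i> * pd v (pd u f) (x + \<tau> *\<^sub>R u + 0 *\<^sub>R v)))) (at 0 within {-r..r})"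
      unfolding h_def interval_cbox[of 0 t]
    proof (rule leibniz_rule_vector_derivative[where fx = "\<lambda>s \<tau>. \<i> * (\<i> * pd v (pd u f) (x + \<tau> *\<^sub>R u + s *\<^sub>R v))"])
      fix s \<tau> assume *: "s \<in> {-r..r}" "\<tau> \<in> cbox 0 t"
      then have "x + \<tau> *\<^sub>R u + s *\<^sub>R v \<in> S" using inS[of s \<tau>] t by (auto simp: add_ac)
      then have "((\<lambda>s. pd u f (x + \<tau> *\<^sub>R u + s *\<^sub>R v)) has_vector_derivative
          (\<i> * pd v (pd u f) (x + \<tau> *\<^sub>R u + s *\<^sub>R v))) (at s within {-r..r})"
        by (intro has_vector_derivative_line smooth_on_diff[OF fu])
      from has_vector_derivative_mult_right[OF this, of \<i>]
      show "((\<lambda>s. \<i> * pd u f (x + s *\<^sub>R v + \<tau> *\<^sub>R u)) has_vector_derivative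
          \<i> * (\<i> * pd v (pd u f) (x + \<tau> *\<^sub>R u + s *\<^sub>R v))) (at s within {-r..r})"
        by (simp add: add_ac)
    next
      fix s assume "s \<in> {-r..r}"
      then show "(\<lambda>\<tau>. \<i> * pd u f (x + s *\<^sub>R v + \<tau> *\<^sub>R u)) integrable_on cbox 0 t"
        using t by (intro integrable_continuous continuous_intros) (auto intro!: cont1[OF fu])
    next
      have "continuous_on ({-r..r} \<times> cbox 0 t) (\<lambda>p. \<i> * (\<i> * pd v (pd u f) (x + fst p *\<^sub>R v + snd p *\<^sub>R u)))"
        using t by (intro continuous_intros cont[OF fvu]) auto
      then show "continuous_on ({-r..r} \<times> cbox 0 t) (\<lambda>(s, \<tau>). \<i> * (\<i> * pd v (pd u f) (x + \<tau> *\<^sub>R u + s *\<^sub>R v)))"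
        by (simp add: case_prod_beta' add_ac)
    qed (use r in auto)
    have "(\<i> * pd v f (x + t *\<^sub>R u) - \<i> * pd v f x) =
        integral (cbox 0 t) (\<lambda>\<tau>. \<i> * (\<i> * pd v (pd u f) (x + \<tau> *\<^sub>R u + 0 *\<^sub>R v)))"
      by (rule vector_derivative_unique_within[OF _ d1 d2])
        (use r in \<open>simp add: trivial_limit_within islimpt_Icc\<close>)
    then show ?thesis by (simp flip: mult.assoc)
  qed
  have "((\<lambda>t. \<i> * pd v f (x + t *\<^sub>R u) - \<i> * pd v f x) has_vector_derivative
      (\<i> * (\<i> * pd u (pd v f) (x + 0 *\<^sub>R u)) - 0)) (at 0 within {0..r})"
    using S(2)
    by (intro has_vector_derivative_diff has_vector_derivative_mult_right has_vector_derivative_line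
        has_vector_derivative_const smooth_on_diff[OF fv]) auto
  then have e0: "((\<lambda>t. \<i> * pd v f (x + t *\<^sub>R u) - \<i> * pd v f x) has_vector_derivative
      (- pd u (pd v f) x)) (at 0 within {0..r})"
    by (simp flip: mult.assoc)
  have e1: "((\<lambda>t. integral {0..t} (\<lambda>\<tau>. - pd v (pd u f) (x + \<tau> *\<^sub>R u))) has_vector_derivative
      (- pd u (pd v f) x)) (at 0 within {0..r})"
    by (rule has_vector_derivative_transform[OF _ _ e0]) (use key r in auto)
  have e2: "((\<lambda>t. integral {0..t} (\<lambda>\<tau>. - pd v (pd u f) (x + \<tau> *\<^sub>R u))) has_vector_derivative
      (- pd v (pd u f) (x + 0 *\<^sub>R u))) (at 0 within {0..r})"
    using cont1[OF fvu, of 0 r] r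
    by (intro integral_has_vector_derivative continuous_intros) auto
  \<comment> \<open>0 is a limit point of \<open>{0..r}\<close>, so one-sided derivatives at 0 are
    unique as well.\<close>
  have "- pd u (pd v f) x = - pd v (pd u f) (x + 0 *\<^sub>R u)"
    by (rule vector_derivative_unique_within[OF _ e1 e2])
      (use r in \<open>simp add: trivial_limit_within islimpt_Icc\<close>)
  then show ?thesis by simp
qed

lemma D_iter_pd_commute:
  assumes S: "open S" and f: "smooth_on S f" and uv: "w \<in> Basis" 
  shows "set vs \<subseteq> Basis \<Longrightarrow> x \<in> S \<Longrightarrow> D_iter vs (pd w f) x = pd w (D_iter vs f) x"
proof (induction vs arbitrary: x)
  case (Cons v vs)
  have "pd v (D_iter vs (pd w f)) x = pd v (pd w (D_iter vs f)) x"
    by (rule pd_cong_open[OF S]) (use Cons in auto)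
  also have "\<dots> = pd w (pd v (D_iter vs f)) x"
    by (rule pd_commute[OF S]) (use Cons f uv in \<open>auto intro: smooth_on_D_iter\<close>)
  finally show ?case by simp
qed auto

text \<open>Serves to sort a mixed word of space and covariable directions into the order that
  \<open>symbol_class\<close> prescribes; moving one direction past a block is
  \<open>D_iter_pd_commute\<close>.\<close>

lemma D_iter_partition:
  assumes S: "open S" and f: "smooth_on S f"
  shows "set vs \<subseteq> Basis \<Longrightarrow> x \<in> S \<Longrightarrow>
    D_iter vs f x = D_iter (filter P vs @ filter (\<lambda>v. \<not> P v) vs) f x"
proof (induction vs arbitrary: x)
  case (Cons v vs)
  have *: "pd v (D_iter vs f) x = pd v (D_iter (filter P vs @ filter (\<lambda>v. \<not> P v) vs) f) x"
    by (rule pd_cong_open[OF S]) (use Cons in auto)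
  show ?case
  proof (cases "P v")
    case True
    then show ?thesis using * by simp
  next
    case False
    have "pd v (D_iter (filter P vs) (D_iter (filter (\<lambda>v. \<not> P v) vs) f)) x
       = D_iter (filter P vs) (pd v (D_iter (filter (\<lambda>v. \<not> P v) vs) f)) x"
      by (rule D_iter_pd_commute[OF S, symmetric]) (use Cons.prems f in \<open>auto intro!: smooth_on_D_iter\<close>)
    then show ?thesis using * False by (simp add: D_iter_append)
  qed
qed auto

text \<open>A Leibniz estimate with one factor \<open>\<rho>\<close> for every direction selected by
  \<open>P\<close>. Each derivative falls on one of the two factors, so the number of terms doubles,
  whence \<open>2 ^ length ws\<close>. For products of symbols \<open>P\<close> selects the
  covariable directions and \<open>\<rho>\<close> is the inverse bracket.\<close>

lemma D_iter_mult_bound: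
  assumes S: "open S" "x \<in> S" and "\<rho> \<ge> 0"
  shows "smooth_on S f \<Longrightarrow> smooth_on S g \<Longrightarrow> set ws \<subseteq> Basis \<Longrightarrow>
    (\<And>vs. set vs \<subseteq> Basis \<Longrightarrow> length vs \<le> length ws \<Longrightarrow> cmod (D_iter vs f x) \<le> A * \<rho> ^ length (filter P vs)) \<Longrightarrow>
    (\<And>vs. set vs \<subseteq> Basis \<Longrightarrow> length vs \<le> length ws \<Longrightarrow> cmod (D_iter vs g x) \<le> B * \<rho> ^ length (filter P vs)) \<Longrightarrow>
    cmod (D_iter ws (\<lambda>x. f x * g x) x) \<le> 2 ^ length ws * A * B * \<rho> ^ length (filter P ws)"
proof (induction ws arbitrary: f g A B rule: rev_induct)
  case Nil
  have "cmod (f x) \<le> A" "cmod (g x) \<le> B" using Nil(4)[of "[]"] Nil(5)[of "[]"] by auto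
  then show ?case by (auto simp: norm_mult intro!: mult_mono order_trans[OF norm_ge_zero])
next
  case (snoc w ws)
  let ?r = "\<rho> ^ length (filter P [w])"
  have w: "w \<in> Basis" and ws: "set ws \<subseteq> Basis" using snoc.prems by auto
  have f': "smooth_on S (pd w f)" and g': "smooth_on S (pd w g)"
    using snoc.prems w by (auto intro: smooth_on_pd)
  have "D_iter ws (pd w (\<lambda>x. f x * g x)) x = D_iter ws (\<lambda>x. pd w f x * g x + f x * pd w g x) x"
    by (rule D_iter_cong_open[OF S(1) _ S(2)])
      (use snoc.prems in \<open>auto intro!: pd_mult smooth_on_diff\<close>)
  also have "\<dots> = D_iter ws (\<lambda>x. pd w f x * g x) x + D_iter ws (\<lambda>x. f x * pd w g x) x"
    by (rule D_iter_add[OF S(1) _ _ ws S(2)])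
      (use snoc.prems f' g' S in \<open>auto intro!: smooth_on_mult\<close>)
  finally have eq: "D_iter (ws @ [w]) (\<lambda>x. f x * g x) x = D_iter ws (\<lambda>x. pd w f x * g x) x + D_iter ws (\<lambda>x. f x * pd w g x) x"
    by (simp add: D_iter_append)
  \<comment> \<open>The derivative just taken is charged to the constant of the factor on which it
    falls, so that the induction hypothesis applies to \<open>pd w f\<close> and \<open>g\<close>,
    and to \<open>f\<close> and \<open>pd w g\<close>.\<close>
  have bf: "cmod (D_iter vs (pd w f) x) \<le> (A * ?r) * \<rho> ^ length (filter P vs)"
    and bg: "cmod (D_iter vs (pd w g) x) \<le> (B * ?r) * \<rho> ^ length (filter P vs)"
    if "set vs \<subseteq> Basis" "length vs \<le> length ws" for vs
    using snoc.prems(4)[of "vs @ [w]"] snoc.prems(5)[of "vs @ [w]"] that w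
    by (auto simp: D_iter_append algebra_simps split: if_splits)
  have 1: "cmod (D_iter ws (\<lambda>x. pd w f x * g x) x) \<le> 2 ^ length ws * (A * ?r) * B * \<rho> ^ length (filter P ws)"
    by (rule snoc.IH[OF f' snoc.prems(2) ws bf]) (use snoc.prems(5) in auto)
  have 2: "cmod (D_iter ws (\<lambda>x. f x * pd w g x) x) \<le> 2 ^ length ws * A * (B * ?r) * \<rho> ^ length (filter P ws)"
    by (rule snoc.IH[OF snoc.prems(1) g' ws _ bg]) (use snoc.prems(4) in auto)
  have "cmod (D_iter (ws @ [w]) (\<lambda>x. f x * g x) x) \<le>
     2 ^ length ws * (A * ?r) * B * \<rho> ^ length (filter P ws) + 2 ^ length ws * A * (B * ?r) * \<rho> ^ length (filter P ws)"
    unfolding eq using 1 2 by (meson add_mono norm_triangle_le)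
  also have "\<dots> = 2 ^ length (ws @ [w]) * A * B * \<rho> ^ length (filter P (ws @ [w]))"
    by (simp add: power_add algebra_simps)
  finally show ?case .
qed


section \<open>Bump functions and parameter integrals\<close>

text \<open>These functions are flat at 0, and differentiation only changes the polynomial.\<close>

definition rflat :: "real poly \<Rightarrow> real \<Rightarrow> real" where
  "rflat p t = (if t > 0 then poly p (1 / t) * exp (- (1 / t)) else 0)"

lemma poly_exp_tendsto: "((\<lambda>x::real. x ^ k * poly p x * exp (- x)) \<longlongrightarrow> 0) at_top"
proof (induction p arbitrary: k)
  case 0
  show ?case by simp
next
  case (pCons a p)
  have "((\<lambda>x::real. a * (x ^ k / exp x) + x ^ Suc k * poly p x * exp (- x)) \<longlongrightarrow> a * 0 + 0) at_top"
    by (intro tendsto_add tendsto_mult tendsto_const tendsto_power_div_exp_0 pCons.IH)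
  then show ?case by (simp add: algebra_simps exp_minus divide_inverse)
qed

text \<open>For \<open>t > 0\<close> the chain rule gives \<open>1 / t^2\<close> times the value of
  \<open>p - p'\<close> at \<open>1 / t\<close>, hence the polynomial \<open>X^2 (p - p')\<close>.
  At 0 the right difference quotient with increment \<open>1 / x\<close> equals
  \<open>x p(x) exp (- x)\<close>, and \<open>poly_exp_tendsto\<close> gives the limit 0.\<close>

lemma rflat_deriv:
  "(rflat p has_real_derivative rflat ([:0, 0, 1:] * (p - pderiv p)) t) (at t)"
proof -
  let ?q = "[:0, 0, 1:] * (p - pderiv p)"
  consider "t > 0" | "t < 0" | "t = 0" by linarith
  then show ?thesis
  proof cases
    case 1
    have "((\<lambda>t. poly p (1 / t) * exp (- (1 / t))) has_real_derivative
       (poly (pderiv p) (1 / t) * (- 1 / t\<^sup>2)) * exp (- (1 / t)) + poly p (1 / t) * (exp (- (1 / t)) * (1 / t\<^sup>2))) (at t)"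
      using 1 by (auto intro!: derivative_eq_intros DERIV_chain2[OF poly_DERIV] simp: power2_eq_square)
    also have "(poly (pderiv p) (1 / t) * (- 1 / t\<^sup>2)) * exp (- (1 / t)) + poly p (1 / t) * (exp (- (1 / t)) * (1 / t\<^sup>2)) = rflat ?q t"
      using 1 by (simp add: rflat_def algebra_simps power2_eq_square)
    finally show ?thesis
      by (rule has_field_derivative_transform_within_open[where S = "{0<..}"]) (use 1 in \<open>auto simp: rflat_def\<close>)
  next
    case 2
    have "((\<lambda>t. 0) has_real_derivative 0) (at t)" by simp
    then have "(rflat p has_real_derivative 0) (at t)"
      by (rule has_field_derivative_transform_within_open[where S = "{..<0}"]) (use 2 in \<open>auto simp: rflat_def\<close>)
    then show ?thesis using 2 by (simp add: rflat_def)
  next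
    case 3
    have "((\<lambda>h. (rflat p (0 + h) - rflat p 0) / h) \<longlongrightarrow> 0) (at 0)"
      unfolding filterlim_at_split
    proof
      show "((\<lambda>h. (rflat p (0 + h) - rflat p 0) / h) \<longlongrightarrow> 0) (at_left 0)"
        by (rule tendsto_eventually) (auto simp: eventually_at_filter rflat_def)
      have "((\<lambda>x. x ^ 1 * poly p x * exp (- x)) \<longlongrightarrow> 0) at_top" by (rule poly_exp_tendsto)
      moreover have "\<forall>\<^sub>F x in at_top. (x::real) ^ 1 * poly p x * exp (- x) =
          (rflat p (0 + inverse x) - rflat p 0) / inverse x"
        using eventually_gt_at_top[of 0] by eventually_elim (simp add: rflat_def field_simps)
      ultimately show "((\<lambda>h. (rflat p (0 + h) - rflat p 0) / h) \<longlongrightarrow> 0) (at_right 0)"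
        unfolding filterlim_at_right_to_top using tendsto_cong by fast
    qed
    then show ?thesis using 3 by (simp add: DERIV_def rflat_def)
  qed
qed

lemma rflat_smooth: "smooth_on UNIV (\<lambda>t. complex_of_real (rflat p t))"
  unfolding smooth_on_Ck
proof
  fix k
  show "Ck k UNIV (\<lambda>t. complex_of_real (rflat p t))"
  proof (induction k arbitrary: p)
    case 0
    have "((\<lambda>t. complex_of_real (rflat p t)) has_vector_derivative
        of_real (rflat ([:0, 0, 1:] * (p - pderiv p)) t)) (at t)" for t
      by (rule has_vector_derivative_of_real) (metis rflat_deriv has_real_derivative_iff_has_vector_derivative)
    then show ?case by (auto simp: has_vector_derivative_def differentiable_def)
  next
    case (Suc k)
    let ?q = "[:0, 0, 1:] * (p - pderiv p)"
    have *: "((\<lambda>t. complex_of_real (rflat p t)) has_derivative (\<lambda>h. h *\<^sub>R of_real (rflat ?q t))) (at t)" for t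
      by (fold has_vector_derivative_def, rule has_vector_derivative_of_real)
        (metis rflat_deriv has_real_derivative_iff_has_vector_derivative)
    have pdeq: "pd 1 (\<lambda>t. complex_of_real (rflat p t)) = (\<lambda>t. - \<i> * of_real (rflat ?q t))"
      by (rule ext, subst pd_eqI[OF *]) simp
    have "Ck k UNIV (\<lambda>t. - \<i> * complex_of_real (rflat ?q t))"
      by (intro Ck_mult Ck_const Suc open_UNIV)
    moreover have "\<forall>t\<in>UNIV. (\<lambda>t. complex_of_real (rflat p t)) differentiable at t"
      using * by (auto simp: differentiable_def)
    ultimately show ?case
      unfolding Ck.simps by (simp only: Basis_real_def Set.ball_simps pdeq) simp
  qed
qed

lemma smooth_on_norm_sq: "smooth_on UNIV (\<lambda>x::'a::euclidean_space. complex_of_real ((norm (x - c))\<^sup>2))"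
proof -
  have "(\<lambda>x::'a. complex_of_real ((norm (x - c))\<^sup>2)) =
     (\<lambda>x. \<Sum>b\<in>Basis. (of_real (x \<bullet> b) + of_real (- (c \<bullet> b))) * (of_real (x \<bullet> b) + of_real (- (c \<bullet> b))))"
    unfolding power2_norm_eq_inner by (rule ext, subst euclidean_inner) (simp add: inner_diff_left)
  then show ?thesis
    by (auto intro!: smooth_on_sum smooth_on_mult smooth_on_sub smooth_on_const smooth_on_linear[of "\<lambda>x. x \<bullet> b" for b] bounded_linear_inner_left)
qed

text \<open>The quotient \<open>e(h) / (e(h) + e(1 - h))\<close> of flat functions is 1 for
  \<open>h \<ge> 1\<close> and 0 for \<open>h \<le> 0\<close>. Taking \<open>h\<close> affine in the
  squared distance keeps it smooth at the centre.\<close>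

lemma bump_exists:
  fixes c :: "'a::euclidean_space"
  assumes "0 \<le> r" "r < R"
  shows "\<exists>\<phi>::'a \<Rightarrow> real. smooth_on UNIV (\<lambda>x. complex_of_real (\<phi> x)) \<and>
    (\<forall>x. 0 \<le> \<phi> x) \<and> (\<forall>x. \<phi> x \<le> 1) \<and> (\<forall>x. dist c x \<le> r \<longrightarrow> \<phi> x = 1) \<and> (\<forall>x. R \<le> dist c x \<longrightarrow> \<phi> x = 0)"
proof -
  let ?e = "rflat [:1:]"
  define h where "h = (\<lambda>x::'a. (R\<^sup>2 - (norm (x - c))\<^sup>2) / (R\<^sup>2 - r\<^sup>2))"
  define \<phi> where "\<phi> = (\<lambda>x. ?e (h x) * inverse (?e (h x) + ?e (1 - h x)))"
  have e: "?e t \<ge> 0" "?e t > 0 \<longleftrightarrow> t > 0" "t \<le> 0 \<Longrightarrow> ?e t = 0" for t by (auto simp: rflat_def)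
  have pos: "?e t + ?e (1 - t) > 0" for t
    using e(1)[of t] e(1)[of "1 - t"] e(2)[of t] e(2)[of "1 - t"] by linarith
  have Rr: "R\<^sup>2 - r\<^sup>2 > 0" using assms by (simp add: power_strict_mono)
  have 1: "h x \<ge> 1" if "dist c x \<le> r" for x
  proof -
    have "(norm (x - c))\<^sup>2 \<le> r\<^sup>2" using that by (intro power_mono) (auto simp: dist_norm norm_minus_commute)
    then show ?thesis using Rr by (simp add: h_def)
  qed
  have 0: "h x \<le> 0" if "R \<le> dist c x" for x
  proof -
    have "R\<^sup>2 \<le> (norm (x - c))\<^sup>2" using that assms by (intro power_mono) (auto simp: dist_norm norm_minus_commute)
    then show ?thesis using Rr by (simp add: h_def divide_nonpos_pos)
  qed
  have sh: "smooth_on UNIV (\<lambda>x. complex_of_real (a + b * h x))" for a b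
  proof -
    have "(\<lambda>x. complex_of_real (a + b * h x)) = (\<lambda>x. of_real (a + b * R\<^sup>2 / (R\<^sup>2 - r\<^sup>2)) + of_real (- b / (R\<^sup>2 - r\<^sup>2)) * complex_of_real ((norm (x - c))\<^sup>2))"
      unfolding h_def by (rule ext, subst of_real_mult[symmetric], subst of_real_add[symmetric]) (simp add: diff_divide_distrib algebra_simps)
    then show ?thesis by (simp only:) (intro smooth_on_add smooth_on_mult smooth_on_const smooth_on_norm_sq open_UNIV)
  qed
  have se: "smooth_on UNIV (\<lambda>x. complex_of_real (?e (a + b * h x)))" for a b
    by (rule smooth_on_compose[where T = UNIV and F = "\<lambda>t. complex_of_real (?e t)" and h = "\<lambda>x. a + b * h x"])
      (use sh in \<open>auto intro: rflat_smooth\<close>)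
  show ?thesis
  proof (intro exI[of _ \<phi>] conjI allI impI)
    have "smooth_on UNIV (\<lambda>x. complex_of_real (?e (h x)) * inverse (complex_of_real (?e (h x)) + complex_of_real (?e (1 - h x))))"
      using se[of 0 1] se[of 1 "-1"] pos
      by (intro smooth_on_mult smooth_on_inverse smooth_on_add) (auto simp flip: of_real_add, smt (verit))
    then show "smooth_on UNIV (\<lambda>x. complex_of_real (\<phi> x))" by (simp add: \<phi>_def)
    show "0 \<le> \<phi> x" for x using e pos[of "h x"] by (auto simp: \<phi>_def intro!: mult_nonneg_nonneg)
    show "\<phi> x \<le> 1" for x using e pos[of "h x"] by (auto simp: \<phi>_def field_simps)
    show "\<phi> x = 1" if "dist c x \<le> r" for x using 1[OF that] pos[of "h x"] e(3)[of "1 - h x"] by (simp add: \<phi>_def)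
    show "\<phi> x = 0" if "R \<le> dist c x" for x using 0[OF that] e(3) by (simp add: \<phi>_def)
  qed
qed

section \<open>Test functions and cutoffs\<close>

lemma test_functionsI:
  assumes "smooth_on UNIV f" "compact L" "\<And>x. x \<notin> L \<Longrightarrow> f x = 0"
  shows "f \<in> test_functions" "fun_support f \<subseteq> L"
proof -
  show sub: "fun_support f \<subseteq> L" unfolding fun_support_def
    by (rule closure_minimal) (use assms compact_imp_closed in auto)
  then show "f \<in> test_functions"
    using assms(1,2) compact_Int_closed[OF assms(2), of "fun_support f"]
    by (auto simp: test_functions_def fun_support_def Int_absorb1)
qed

lemma fun_support_zero: "x \<notin> fun_support f \<Longrightarrow> f x = 0"
  using closure_subset[of "{x. f x \<noteq> 0}"] by (auto simp: fun_support_def)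

lemma test_functionsD:
  assumes "f \<in> test_functions"
  shows "smooth_on UNIV f" "compact (fun_support f)"
  using assms by (auto simp: test_functions_def)

lemma test_functions_add:
  assumes "f \<in> test_functions" "g \<in> test_functions"
  shows "(\<lambda>x. f x + g x) \<in> test_functions"
  by (rule test_functionsI[of _ "fun_support f \<union> fun_support g"])
    (use assms in \<open>auto intro!: smooth_on_add simp: fun_support_zero dest: test_functionsD\<close>)

lemma test_functions_mult:
  assumes "f \<in> test_functions" "smooth_on UNIV g"
  shows "(\<lambda>x. g x * f x) \<in> test_functions"
  by (rule test_functionsI[of _ "fun_support f"])
    (use assms in \<open>auto intro!: smooth_on_mult simp: fun_support_zero dest: test_functionsD\<close>)

lemma test_functions_cmult:
  assumes "f \<in> test_functions"
  shows "(\<lambda>x. c * f x) \<in> test_functions"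
  using test_functions_mult[OF assms smooth_on_const] .

lemma cutoff_exists:
  assumes "e > 0"
  obtains \<psi> :: "'a::euclidean_space \<Rightarrow> complex" where "\<psi> \<in> cutoffs" "\<And>x. norm x \<ge> e \<Longrightarrow> \<psi> x = 0"
    "\<And>x. norm x \<le> e / 2 \<Longrightarrow> \<psi> x = 1"
proof -
  obtain \<phi> :: "'a \<Rightarrow> real" where \<phi>: "smooth_on UNIV (\<lambda>x. complex_of_real (\<phi> x))"
    "\<And>x. dist 0 x \<le> e / 2 \<Longrightarrow> \<phi> x = 1" "\<And>x. e \<le> dist 0 x \<Longrightarrow> \<phi> x = 0"
  proof -
    have "0 \<le> e / 2" "e / 2 < e" using assms by auto
    from bump_exists[OF this, of "0::'a"] show ?thesis using that by auto
  qed
  have "(\<lambda>x. complex_of_real (\<phi> x)) \<in> test_functions"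
    by (rule test_functionsI[of _ "cball 0 e"]) (use \<phi> in auto)
  moreover have "\<forall>\<^sub>F x in nhds (0::'a). complex_of_real (\<phi> x) = 1"
    unfolding eventually_nhds_metric using \<phi>(2) assms
    by (intro exI[of _ "e / 2"]) (auto simp: dist_commute less_imp_le)
  ultimately show ?thesis using \<phi> by (intro that[of "\<lambda>x. of_real (\<phi> x)"]) (auto simp: cutoffs_def)
qed

lemma integrable_compact_support:
  fixes f :: "'a::euclidean_space \<Rightarrow> complex"
  assumes "continuous_on UNIV f" "compact L" "\<And>x. x \<notin> L \<Longrightarrow> f x = 0"
  shows "integrable lborel f"
proof -
  have "integrable lborel (\<lambda>x. indicator L x *\<^sub>R f x)"
    by (rule borel_integrable_compact[OF assms(2)]) (use assms(1) continuous_on_subset in blast)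
  also have "(\<lambda>x. indicator L x *\<^sub>R f x) = f"
    using assms(3) by (auto simp: indicator_def fun_eq_iff)
  finally show ?thesis .
qed

text \<open>If \<open>g x0\<close> were not 0, a bump at \<open>x0\<close>, supported where
  \<open>g\<close> differs from \<open>g x0\<close> by less than half of its modulus, would have a
  nonzero integral against \<open>g\<close>. The restriction to test functions supported in
  \<open>V\<close> allows it to be applied off the support of a kernel.\<close>

lemma fundamental_lemma:
  fixes g :: "'a::euclidean_space \<Rightarrow> complex"
  assumes g: "continuous_on UNIV g" and V: "open V" "x0 \<in> V"
    and z: "\<And>v. v \<in> test_functions \<Longrightarrow> fun_support v \<subseteq> V \<Longrightarrow> (LINT x|lborel. v x * g x) = 0"
  shows "g x0 = 0"
proof (rule ccontr)
  assume nz: "g x0 \<noteq> 0"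
  obtain d1 where d1: "d1 > 0" "cball x0 d1 \<subseteq> V" using V open_contains_cball by blast
  have "isCont g x0" using g by (simp add: continuous_on_eq_continuous_at)
  then obtain d2 where d2: "d2 > 0" "\<And>x. dist x x0 < d2 \<Longrightarrow> dist (g x) (g x0) < cmod (g x0) / 2"
    unfolding continuous_at_eps_delta using nz by (metis half_gt_zero zero_less_norm_iff)
  define d where "d = min d1 (d2 / 2)"
  have d: "d > 0" "d \<le> d1" "d < d2" using d1 d2 by (auto simp: d_def)
  obtain \<phi> :: "'a \<Rightarrow> real" where \<phi>: "smooth_on UNIV (\<lambda>x. complex_of_real (\<phi> x))"
    "\<And>x. 0 \<le> \<phi> x" "\<And>x. dist x0 x \<le> d / 2 \<Longrightarrow> \<phi> x = 1" "\<And>x. d \<le> dist x0 x \<Longrightarrow> \<phi> x = 0"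
  proof -
    have "0 \<le> d / 2" "d / 2 < d" using d by auto
    from bump_exists[OF this, of x0] show ?thesis using that by auto
  qed
  let ?v = "\<lambda>x. complex_of_real (\<phi> x)"
  have v: "?v \<in> test_functions" "fun_support ?v \<subseteq> cball x0 d"
    using test_functionsI[of ?v "cball x0 d"] \<phi> by auto
  have cv: "continuous_on UNIV ?v" using \<phi>(1) by (rule smooth_on_imp_continuous_on)
  have iv: "integrable lborel ?v"
    by (rule integrable_compact_support[OF cv compact_cball[of x0 d]]) (use \<phi> in auto)
  then have ir: "integrable lborel \<phi>" using integrable_Re[OF iv] by simp
  have ig: "integrable lborel (\<lambda>x. ?v x * g x)"
    by (rule integrable_compact_support[OF _ compact_cball[of x0 d]])
      (use \<phi> in \<open>auto intro!: continuous_intros cv g\<close>)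
  have "(LINT x|lborel. ?v x * g x) = 0"
    by (rule z[OF v(1)]) (use v(2) d d1 subset_cball[of d d1 x0] in blast)
  then have "(LINT x|lborel. ?v x * (g x0 - g x)) = g x0 * (LINT x|lborel. ?v x)"
    using iv ig by (simp add: algebra_simps)
  moreover have "cmod (LINT x|lborel. ?v x * (g x0 - g x)) \<le> (LINT x|lborel. \<phi> x * (cmod (g x0) / 2))"
  proof (rule order_trans[OF integral_norm_bound integral_mono])
    show "integrable lborel (\<lambda>x. cmod (?v x * (g x0 - g x)))"
      using iv ig by (intro integrable_norm) (simp add: algebra_simps)
    show "integrable lborel (\<lambda>x. \<phi> x * (cmod (g x0) / 2))" using ir by simp
    fix x
    show "cmod (?v x * (g x0 - g x)) \<le> \<phi> x * (cmod (g x0) / 2)"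
    proof (cases "dist x0 x < d")
      case True
      then show ?thesis using d2(2)[of x] \<phi>(2)[of x] d
        unfolding norm_mult by (intro mult_mono) (auto simp: dist_norm norm_minus_commute)
    qed (use \<phi> in auto)
  qed
  ultimately have "cmod (g x0 * (LINT x|lborel. ?v x)) \<le> (LINT x|lborel. \<phi> x) * (cmod (g x0) / 2)"
    by simp
  then have le: "cmod (g x0) * \<bar>LINT x|lborel. \<phi> x\<bar> \<le> (LINT x|lborel. \<phi> x) * (cmod (g x0) / 2)"
    by (simp add: norm_mult)
  have "0 < measure lborel (ball x0 (d/2))" using d content_ball_pos[of "d/2" x0] by simp
  also have "measure lborel (ball x0 (d/2)) = (LINT x|lborel. indicator (ball x0 (d/2)) x)" by simp
  also have "\<dots> \<le> (LINT x|lborel. \<phi> x)"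
  proof (rule integral_mono)
    show "integrable lborel (indicat_real (ball x0 (d / 2)))"
      by (rule integrable_real_indicator[OF _ emeasure_lborel_ball_finite]) simp
    show "indicat_real (ball x0 (d / 2)) x \<le> \<phi> x" for x
      using \<phi>(2,3)[of x] by (auto simp: indicator_def)
  qed (rule ir)
  finally have pos: "0 < (LINT x|lborel. \<phi> x)" .
  then show False using le nz by (auto simp: mult.commute)
qed

section \<open>Differentiation under the integral sign\<close>

lemma dominated_differentiation:
  fixes f :: "'a::euclidean_space \<Rightarrow> 's \<Rightarrow> complex"
  assumes d: "d > 0"
    and int: "\<And>t. t \<in> ball t0 d \<Longrightarrow> integrable M (f t)"
    and diff: "\<And>t s. t \<in> ball t0 d \<Longrightarrow> (\<lambda>t. f t s) differentiable at t"
    and bd: "\<And>t s b. t \<in> ball t0 d \<Longrightarrow> b \<in> Basis \<Longrightarrow> s \<in> space M \<Longrightarrow> cmod (pd b (\<lambda>t. f t s) t) \<le> g s"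
    and g: "integrable M g"
    and meas: "\<And>b. b \<in> Basis \<Longrightarrow> (\<lambda>s. pd b (\<lambda>t. f t s) t0) \<in> borel_measurable M"
  shows "(\<lambda>t. integral\<^sup>L M (f t)) differentiable at t0"
    and "b \<in> Basis \<Longrightarrow> pd b (\<lambda>t. integral\<^sup>L M (f t)) t0 = (LINT s|M. pd b (\<lambda>t. f t s) t0)"
proof -
  have t0: "t0 \<in> ball t0 d" using d by simp
  have ipd: "integrable M (\<lambda>s. pd b (\<lambda>t. f t s) t0)" if "b \<in> Basis" for b
    by (rule Bochner_Integration.integrable_bound[OF g meas[OF that]])
      (use bd[OF t0 that] in \<open>auto intro!: AE_I2 order_trans[OF _ abs_ge_self]\<close>)
  let ?D = "\<lambda>h s. \<Sum>b\<in>Basis. complex_of_real (h \<bullet> b) * (\<i> * pd b (\<lambda>t. f t s) t0)"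
  let ?I = "\<lambda>h. \<Sum>b\<in>Basis. complex_of_real (h \<bullet> b) * (\<i> * (LINT s|M. pd b (\<lambda>t. f t s) t0))"
  have intD: "integrable M (?D h)" "integral\<^sup>L M (?D h) = ?I h" for h
    using ipd by (auto simp: Bochner_Integration.integral_sum)
  have blI: "bounded_linear ?I"
    by (auto intro!: bounded_linear_sum bounded_linear_mult_left
        bounded_linear_compose[OF bounded_linear_mult_left] bounded_linear_compose[OF bounded_linear_of_real] bounded_linear_inner_left)
  have Dle: "cmod (\<Sum>b\<in>Basis. complex_of_real (h \<bullet> b) * (\<i> * pd b (\<lambda>t. f t s) t)) \<le> (DIM('a) * g s) * norm h"
    if "t \<in> ball t0 d" "s \<in> space M" for h s t
  proof -
    have "cmod (\<Sum>b\<in>Basis. complex_of_real (h \<bullet> b) * (\<i> * pd b (\<lambda>t. f t s) t)) \<le>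
       (\<Sum>b\<in>(Basis::'a set). norm h * g s)"
      using bd[OF that(1) _ that(2)] Basis_le_norm[of _ h]
      by (intro order_trans[OF norm_sum] sum_mono) (auto simp: norm_mult intro!: mult_mono)
    then show ?thesis by (simp add: mult_ac)
  qed
  have fle: "cmod (f (t0 + h) s - f t0 s) \<le> (DIM('a) * g s) * norm h"
    if s: "s \<in> space M" and h: "norm h < d" for h s
  proof -
    have "cmod (f (t0 + h) s - f t0 s) \<le> (DIM('a) * g s) * norm (t0 + h - t0)"
    proof (rule differentiable_bound[of "ball t0 d"])
      fix t assume t: "t \<in> ball t0 d"
      show "((\<lambda>t. f t s) has_derivative (\<lambda>h. \<Sum>b\<in>Basis. complex_of_real (h \<bullet> b) * (\<i> * pd b (\<lambda>t. f t s) t))) (at t within ball t0 d)"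
        by (rule has_derivative_at_withinI[OF has_derivative_pd[OF diff[OF t]]])
      show "onorm (\<lambda>h. \<Sum>b\<in>Basis. complex_of_real (h \<bullet> b) * (\<i> * pd b (\<lambda>t. f t s) t)) \<le> DIM('a) * g s"
        by (rule onorm_le) (rule Dle[OF t s])
    qed (use h d in \<open>auto simp: dist_norm\<close>)
    then show ?thesis by simp
  qed
  have key: "((\<lambda>t. integral\<^sup>L M (f t)) has_derivative ?I) (at t0)"
    unfolding has_derivative_at
  proof (intro conjI blI, unfold tendsto_at_iff_sequentially, intro allI impI)
    fix X :: "nat \<Rightarrow> 'a" assume X: "\<forall>i. X i \<in> UNIV - {0}" "X \<longlonglongrightarrow> 0"
    obtain N where N: "\<And>i. i \<ge> N \<Longrightarrow> norm (X i) < d"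
      using X(2) d unfolding LIMSEQ_def by (metis dist_0_norm dist_commute)
    \<comment> \<open>Dropping an initial segment keeps all points in the ball on which the bounds
      hold.\<close>
    define Y where "Y = (\<lambda>i. X (i + N))"
    have Y: "norm (Y i) < d" "Y i \<noteq> 0" "t0 + Y i \<in> ball t0 d" for i
      using N[of "i + N"] X(1) by (auto simp: Y_def dist_norm)
    have Y0: "Y \<longlonglongrightarrow> 0" unfolding Y_def using X(2) by (rule LIMSEQ_ignore_initial_segment)
    \<comment> \<open>The remainder quotient along the sequence. The mean value inequality on the
      ball bounds the increment, and the bound on the partial derivatives bounds the linear part,
      each by \<open>DIM('a) * g s\<close>; their sum is the majorant for dominated
      convergence.\<close>
    define Q where "Q = (\<lambda>i s. (f (t0 + Y i) s - f t0 s - ?D (Y i) s) / of_real (norm (Y i)))"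
    have "(\<lambda>i. integral\<^sup>L M (Q i)) \<longlonglongrightarrow> integral\<^sup>L M (\<lambda>s. 0)"
    proof (rule integral_dominated_convergence[where w = "\<lambda>s. 2 * (DIM('a) * g s)"])
      show "integrable M (\<lambda>s. 2 * (DIM('a) * g s))" using g by simp
      show "Q i \<in> borel_measurable M" for i
        unfolding Q_def using int[OF Y(3)] int[OF t0] intD(1) by (intro borel_measurable_divide borel_measurable_diff) auto
      show "AE s in M. (\<lambda>i. Q i s) \<longlonglongrightarrow> 0"
      proof (rule AE_I2)
        fix s assume "s \<in> space M"
        have "(\<lambda>h. norm (f (t0 + h) s - f t0 s - ?D h s) / norm h) \<midarrow>0\<rightarrow> 0"
          using has_derivative_pd[OF diff[OF t0, of s]] unfolding has_derivative_at by blast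
        then have "((\<lambda>h. norm (f (t0 + h) s - f t0 s - ?D h s) / norm h) \<circ> Y) \<longlonglongrightarrow> 0"
          unfolding tendsto_at_iff_sequentially using Y0 Y(2) by auto
        then show "(\<lambda>i. Q i s) \<longlonglongrightarrow> 0"
          by (intro tendsto_norm_zero_cancel[of "\<lambda>i. Q i s"]) (simp add: Q_def norm_divide comp_def)
      qed
      show "AE s in M. norm (Q i s) \<le> 2 * (DIM('a) * g s)" for i
      proof (rule AE_I2)
        fix s assume s: "s \<in> space M"
        have "cmod (f (t0 + Y i) s - f t0 s - ?D (Y i) s) \<le> (DIM('a) * g s) * norm (Y i) + (DIM('a) * g s) * norm (Y i)"
          by (rule norm_triangle_le_diff) (intro add_mono fle[OF s Y(1)] Dle[OF t0 s])
        then show "norm (Q i s) \<le> 2 * (DIM('a) * g s)"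
          using Y(2)[of i] by (simp add: Q_def norm_divide field_simps)
      qed
    qed simp
    also have "(\<lambda>i. integral\<^sup>L M (Q i)) = (\<lambda>i. (integral\<^sup>L M (f (t0 + Y i)) - integral\<^sup>L M (f t0) - ?I (Y i)) / of_real (norm (Y i)))"
      unfolding Q_def
      by (rule ext, subst integral_divide_zero, subst Bochner_Integration.integral_diff)
        (use int[OF Y(3)] int[OF t0] intD in auto)
    finally have "(\<lambda>i. (integral\<^sup>L M (f (t0 + Y i)) - integral\<^sup>L M (f t0) - ?I (Y i)) / of_real (norm (Y i))) \<longlonglongrightarrow> 0" by simp
    from tendsto_norm_zero[OF this]
    have "(\<lambda>i. norm (integral\<^sup>L M (f (t0 + Y i)) - integral\<^sup>L M (f t0) - ?I (Y i)) / norm (Y i)) \<longlonglongrightarrow> 0"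
      by (simp add: norm_divide)
    then show "((\<lambda>h. norm (integral\<^sup>L M (f (t0 + h)) - integral\<^sup>L M (f t0) - ?I h) / norm h) \<circ> X) \<longlonglongrightarrow> 0"
      unfolding Y_def comp_def by (rule LIMSEQ_offset)
  qed
  then show "(\<lambda>t. integral\<^sup>L M (f t)) differentiable at t0" by (auto simp: differentiable_def)
  assume b: "b \<in> Basis"
  have "?I b = (\<Sum>b'\<in>Basis. if b' = b then \<i> * (LINT s|M. pd b' (\<lambda>t. f t s) t0) else 0)"
    using b by (intro sum.cong) (auto simp: inner_Basis)
  also have "\<dots> = \<i> * (LINT s|M. pd b (\<lambda>t. f t s) t0)" using b by simp
  finally show "pd b (\<lambda>t. integral\<^sup>L M (f t)) t0 = (LINT s|M. pd b (\<lambda>t. f t s) t0)"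
    by (subst pd_eqI[OF key]) simp
qed

text \<open>While the parameter \<open>t\<close> stays in a compact set, one compact set carries the
  whole support in \<open>z\<close>; a constant on it is then a majorant for differentiation under
  the integral over \<open>z\<close>.\<close>

definition zsupp :: "('t::euclidean_space \<times> 'z::euclidean_space \<Rightarrow> complex) \<Rightarrow> bool" where
  "zsupp f \<longleftrightarrow> (\<forall>K. compact K \<longrightarrow> (\<exists>L. compact L \<and> (\<forall>t\<in>K. \<forall>z. z \<notin> L \<longrightarrow> f (t, z) = 0)))"

lemma zsupp_pd:
  assumes "zsupp f"
  shows "zsupp (pd w f)"
  unfolding zsupp_def
proof (intro allI impI)
  fix K :: "'a set" assume K: "compact K"
  \<comment> \<open>Enlarged by the unit ball, so that \<open>f\<close> vanishes in a neighbourhood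
    of \<open>(t, z)\<close> and not only for parameters in \<open>K\<close>.\<close>
  let ?K = "{x + y |x y. x \<in> K \<and> y \<in> cball 0 1}"
  have "compact ?K" by (rule compact_sums[OF K compact_cball])
  from assms[unfolded zsupp_def, THEN spec, THEN mp, OF this] obtain L where L: "compact L" "\<And>t z. t \<in> ?K \<Longrightarrow> z \<notin> L \<Longrightarrow> f (t, z) = 0"
    by auto
  have "pd w f (t, z) = 0" if "t \<in> K" "z \<notin> L" for t z
  proof -
    have "pd w f (t, z) = pd w (\<lambda>_. 0) (t, z)"
    proof (rule pd_cong_open[of "ball t 1 \<times> (- L)"])
      show "open (ball t 1 \<times> (- L))" using compact_imp_closed[OF L(1)] by (intro open_Times) auto
      fix y assume y: "y \<in> ball t 1 \<times> - L"
      have "fst y = t + (fst y - t)" by simp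
      moreover have "fst y - t \<in> cball 0 1" using y by (auto simp: dist_norm norm_minus_commute)
      ultimately have "fst y \<in> ?K" using that(1) by blast
      then show "f y = 0" using L(2)[of "fst y" "snd y"] y by auto
    qed (use that in auto)
    then show ?thesis by simp
  qed
  then show "\<exists>L. compact L \<and> (\<forall>t\<in>K. \<forall>z. z \<notin> L \<longrightarrow> pd w f (t, z) = 0)" using L(1) by blast
qed

lemma continuous_on_section:
  fixes f :: "'t::topological_space \<times> 'z::topological_space \<Rightarrow> 'c::topological_space"
  shows "continuous_on UNIV f \<Longrightarrow> continuous_on UNIV (\<lambda>z. f (t, z))"
  by (rule continuous_on_compose2[of UNIV f]) (auto intro!: continuous_intros)

lemma integrable_section:
  assumes "continuous_on UNIV f" "zsupp f"
  shows "integrable lborel (\<lambda>z. f (t, z))"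
proof -
  have "\<exists>L. compact L \<and> (\<forall>s\<in>{t}. \<forall>z. z \<notin> L \<longrightarrow> f (s, z) = 0)"
    using assms(2) compact_sing[of t] unfolding zsupp_def by blast
  then obtain L where "compact L" "\<And>z. z \<notin> L \<Longrightarrow> f (t, z) = 0"
    by auto
  then show ?thesis
    by (intro integrable_compact_support[of _ L] continuous_on_section assms(1)) auto
qed

lemma pd_section1:
  assumes "f differentiable at (t, z)"
  shows "(\<lambda>t. f (t, z)) differentiable at t" "pd b (\<lambda>t. f (t, z)) t = pd (b, 0) f (t, z)"
proof -
  have bl: "bounded_linear (\<lambda>t. (t, 0))" by (intro bounded_linear_intros)
  show "pd b (\<lambda>t. f (t, z)) t = pd (b, 0) f (t, z)"
    using pd_compose_affine'[OF bl, of f t "(0, z)" b] assms by simp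
  show "(\<lambda>t. f (t, z)) differentiable at t"
    using differentiable_compose[of f "\<lambda>t. (t, z)" t UNIV] assms
    by (auto intro: differentiable_Pair)
qed

lemma pd_section2:
  assumes "f differentiable at (t, z)"
  shows "(\<lambda>z. f (t, z)) differentiable at z" "pd b (\<lambda>z. f (t, z)) z = pd (0, b) f (t, z)"
proof -
  have bl: "bounded_linear (\<lambda>z. (0, z))" by (intro bounded_linear_intros)
  show "pd b (\<lambda>z. f (t, z)) z = pd (0, b) f (t, z)"
    using pd_compose_affine'[OF bl, of f z "(t, 0)" b] assms by simp
  show "(\<lambda>z. f (t, z)) differentiable at z"
    using differentiable_compose[of f "\<lambda>z. (t, z)" z UNIV] assms
    by (auto intro: differentiable_Pair)
qed

lemma Basis_pair [simp]: "(u, 0) \<in> Basis \<longleftrightarrow> u \<in> Basis" "(0, v) \<in> Basis \<longleftrightarrow> v \<in> Basis"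
  by (auto simp: Basis_prod_def)

lemma set_map_Basis [simp]:
  "set (map (\<lambda>u. (u, 0)) us) \<subseteq> Basis \<longleftrightarrow> set us \<subseteq> Basis"
  "set (map (Pair 0) us) \<subseteq> Basis \<longleftrightarrow> set us \<subseteq> Basis"
  by auto

lemma smooth_on_section1: "smooth_on UNIV f \<Longrightarrow> smooth_on UNIV (\<lambda>t. f (t, z))"
  using smooth_on_compose_affine[of UNIV "\<lambda>t. (t, 0)" "(0, z)" UNIV f]
  by (simp add: bounded_linear_Pair bounded_linear_ident)

lemma smooth_on_section2: "smooth_on UNIV f \<Longrightarrow> smooth_on UNIV (\<lambda>z. f (t, z))"
  using smooth_on_compose_affine[of UNIV "\<lambda>z. (0, z)" "(t, 0)" UNIV f]
  by (simp add: bounded_linear_Pair bounded_linear_ident)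

lemma differentiable_integral:
  fixes f :: "'t::euclidean_space \<times> 'z::euclidean_space \<Rightarrow> complex"
  assumes f: "smooth_on UNIV f" "zsupp f"
  shows "(\<lambda>t. LINT z|lborel. f (t, z)) differentiable at t0"
    and "b \<in> Basis \<Longrightarrow> pd b (\<lambda>t. LINT z|lborel. f (t, z)) t0 = (LINT z|lborel. pd (b, 0) f (t0, z))"
proof -
  have d: "f differentiable at p" for p using smooth_on_diff[OF f(1)] by simp
  obtain L where L: "compact L" "\<And>b t z. b \<in> Basis \<Longrightarrow> t \<in> cball t0 1 \<Longrightarrow> z \<notin> L \<Longrightarrow> pd (b, 0) f (t, z) = 0"
  proof -
    have "\<exists>L. compact L \<and> (\<forall>t\<in>cball t0 1. \<forall>z. z \<notin> L \<longrightarrow> pd (b, 0) f (t, z) = 0)" for b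
      using zsupp_pd[OF f(2), of "(b, 0)"] compact_cball unfolding zsupp_def by blast
    then obtain L where L: "\<And>b. compact (L b)" "\<And>b t z. t \<in> cball t0 1 \<Longrightarrow> z \<notin> L b \<Longrightarrow> pd (b, 0) f (t, z) = 0"
      by metis
    then show ?thesis by (intro that[of "\<Union>b\<in>Basis. L b"]) auto
  qed
  have cont: "continuous_on UNIV (pd (b, 0) f)" if "b \<in> Basis" for b
    using smooth_on_imp_continuous_on[OF smooth_on_pd[OF f(1)]] that by simp
  have "bounded (\<Union>b\<in>Basis. pd (b, 0) f ` (cball t0 1 \<times> L))"
    by (intro bounded_UN finite_Basis ballI compact_imp_bounded compact_continuous_image compact_Times compact_cball L)
      (use cont continuous_on_subset in blast)
  then obtain B where B: "\<And>b t z. b \<in> Basis \<Longrightarrow> t \<in> cball t0 1 \<Longrightarrow> z \<in> L \<Longrightarrow> cmod (pd (b, 0) f (t, z)) \<le> B"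
    unfolding bounded_iff by fastforce
  note dui = dominated_differentiation[where M = lborel and d = 1 and ?t0.0 = t0 and f = "\<lambda>t z. f (t, z)" and g = "\<lambda>z. B * indicator L z"]
  have 1: "integrable lborel (\<lambda>z. f (t, z))" for t
    by (rule integrable_section[OF smooth_on_imp_continuous_on[OF f(1)] f(2)])
  have 2: "cmod (pd b (\<lambda>t. f (t, z)) t) \<le> B * indicator L z" if "t \<in> ball t0 1" "b \<in> Basis" for t z b
    using B[OF that(2), of t z] L(2)[OF that(2), of t z] that(1)
    by (auto simp: pd_section1(2)[OF d] indicator_def)
  have 3: "integrable lborel (\<lambda>z. B * indicator L z)"
    by (intro integrable_mult_right integrable_real_indicator)
      (use L emeasure_compact_finite in \<open>auto intro: borel_compact\<close>)
  have 4: "(\<lambda>z. pd b (\<lambda>t. f (t, z)) t0) \<in> borel_measurable lborel" if "b \<in> Basis" for b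
    using continuous_on_section[OF cont[OF that], of t0]
    by (simp add: pd_section1(2)[OF d] borel_measurable_continuous_onI)
  show "(\<lambda>t. LINT z|lborel. f (t, z)) differentiable at t0"
    by (rule dui(1)) (use 1 2 3 4 pd_section1(1)[OF d] in auto)
  assume b: "b \<in> Basis"
  have "pd b (\<lambda>t. LINT z|lborel. f (t, z)) t0 = (LINT z|lborel. pd b (\<lambda>t. f (t, z)) t0)"
    by (rule dui(2)[OF _ _ _ _ _ _ b]) (use 1 2 3 4 pd_section1(1)[OF d] in auto)
  then show "pd b (\<lambda>t. LINT z|lborel. f (t, z)) t0 = (LINT z|lborel. pd (b, 0) f (t0, z))"
    by (simp add: pd_section1(2)[OF d])
qed

lemma smooth_on_integral:
  fixes f :: "'t::euclidean_space \<times> 'z::euclidean_space \<Rightarrow> complex"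
  assumes f: "smooth_on UNIV f" "zsupp f"
  shows "smooth_on UNIV (\<lambda>t. LINT z|lborel. f (t, z))"
  unfolding smooth_on_Ck
proof
  fix k show "Ck k UNIV (\<lambda>t. LINT z|lborel. f (t, z))"
    using f
  proof (induction k arbitrary: f)
    case (Suc k)
    have "Ck k UNIV (pd v (\<lambda>t. LINT z|lborel. f (t, z)))" if "v \<in> Basis" for v
      using Suc.IH[OF smooth_on_pd[OF Suc.prems(1)] zsupp_pd[OF Suc.prems(2)], of "(v, 0)"] that differentiable_integral(2)[OF Suc.prems]
      by (simp add: fun_eq_iff cong: Ck_cong)
    then show ?case using differentiable_integral(1)[OF Suc.prems] by simp
  qed (use differentiable_integral(1) in auto)
qed

lemma zsupp_fst: 
  assumes "\<And>x. x \<notin> L \<Longrightarrow> g x = 0" "compact L"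
  shows "zsupp (\<lambda>(t, z). g (z + t))"
  unfolding zsupp_def
proof (intro allI impI)
  fix K :: "'a set" assume K: "compact K"
  show "\<exists>M. compact M \<and> (\<forall>t\<in>K. \<forall>z. z \<notin> M \<longrightarrow> (case (t, z) of (t, z) \<Rightarrow> g (z + t)) = 0)"
  proof (intro exI conjI ballI allI impI)
    show "compact {x - y |x y. x \<in> L \<and> y \<in> K}" by (rule compact_differences[OF assms(2) K])
    fix t z assume tz: "t \<in> K" "z \<notin> {x - y |x y. x \<in> L \<and> y \<in> K}"
    have "z = (z + t) - t" by simp
    then have "z + t \<notin> L" using tz by blast
    then show "(case (t, z) of (t, z) \<Rightarrow> g (z + t)) = 0" using assms by simp
  qed
qed

section \<open>Changes of variables and integration by parts\<close>

lemma lborel_integral_shift: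
  fixes g :: "'a::euclidean_space \<Rightarrow> 'b::{banach, second_countable_topology}"
  assumes "g \<in> borel_measurable borel"
  shows "(LINT z|lborel. g (z + t)) = (LINT z|lborel. g z)"
proof -
  have "(LINT z|lborel. g z) = (LINT z|distr lborel borel ((+) t). g z)" by (simp add: lborel_distr_plus)
  also have "\<dots> = (LINT z|lborel. g (t + z))" by (rule integral_distr) (use assms in auto)
  finally show ?thesis by (simp add: add.commute)
qed

lemma lborel_integral_scale:
  fixes g :: "'a::euclidean_space \<Rightarrow> 'b::{banach, second_countable_topology}"
  assumes "g \<in> borel_measurable borel" "c \<noteq> 0"
  shows "(LINT z|lborel. g z) = \<bar>c\<bar> ^ DIM('a) *\<^sub>R (LINT z|lborel. g (t + c *\<^sub>R z))"
proof -
  have "(LINT z|lborel. g z) = (LINT z|density (distr lborel borel (\<lambda>x. t + c *\<^sub>R x)) (\<lambda>_. \<bar>c\<bar> ^ DIM('a)). g z)"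
    using lborel_affine[OF assms(2), of t] by simp
  also have "\<dots> = (LINT z|distr lborel borel (\<lambda>x. t + c *\<^sub>R x). \<bar>c\<bar> ^ DIM('a) *\<^sub>R g z)"
    by (rule integral_density) (use assms in auto)
  also have "\<dots> = (LINT z|lborel. \<bar>c\<bar> ^ DIM('a) *\<^sub>R g (t + c *\<^sub>R z))"
    by (rule integral_distr) (use assms in auto)
  finally show ?thesis by simp
qed

lemma lborel_integral_reflect:
  fixes g :: "'a::euclidean_space \<Rightarrow> 'b::{banach, second_countable_topology}"
  assumes "g \<in> borel_measurable borel"
  shows "(LINT z|lborel. g (t - z)) = (LINT z|lborel. g z)"
  using lborel_integral_scale[OF assms, of "-1" t] by simp

text \<open>The integral of \<open>g (z + t)\<close> does not depend on \<open>t\<close>, and its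
  derivative at \<open>t = 0\<close> is the integral of \<open>pd v g\<close>.\<close>

lemma integral_pd_eq_0:
  assumes g: "smooth_on UNIV g" and L: "compact L" "\<And>x. x \<notin> L \<Longrightarrow> g x = 0" and v: "v \<in> Basis"
  shows "(LINT z|lborel. pd v g z) = 0"
proof -
  let ?f = "\<lambda>(t, z). g (z + t)"
  have bl: "bounded_linear (\<lambda>p. snd p + fst p)" by (intro bounded_linear_intros)
  have f: "smooth_on UNIV ?f"
    using smooth_on_compose_linear[OF bl g] by (simp add: case_prod_beta')
  have "pd v (\<lambda>t. LINT z|lborel. ?f (t, z)) 0 = (LINT z|lborel. pd (v, 0) ?f (0, z))"
    by (rule differentiable_integral(2)[OF f zsupp_fst[OF L(2,1)] v])
  moreover have "(\<lambda>t. LINT z|lborel. ?f (t, z)) = (\<lambda>t. LINT z|lborel. g z)"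
    using lborel_integral_shift[OF borel_measurable_continuous_onI[OF smooth_on_imp_continuous_on[OF g]]] by simp
  moreover have "pd (v, 0) ?f (0, z) = pd v g z" for z
    using pd_compose_affine'[OF bl, of g "(0, z)" 0 "(v, 0)"] smooth_on_diff[OF g]
    by (simp add: case_prod_beta')
  ultimately show ?thesis by simp
qed

lemma integral_by_parts:
  assumes g: "smooth_on UNIV g" and L: "compact L" "\<And>x. x \<notin> L \<Longrightarrow> g x = 0" and v: "v \<in> Basis"
    and h: "smooth_on UNIV h"
  shows "(LINT z|lborel. h z * pd v g z) = - (LINT z|lborel. pd v h z * g z)"
proof -
  have pL: "pd v g x = 0" if "x \<notin> L" for x
    using pd_cong_open[of "- L" x g "\<lambda>_. 0" v] L that compact_imp_closed[OF L(1)] by auto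
  have i1: "integrable lborel (\<lambda>z. h z * pd v g z)" and i2: "integrable lborel (\<lambda>z. pd v h z * g z)"
    using g h v pL L
    by (auto intro!: integrable_compact_support[OF _ L(1)] smooth_on_mult smooth_on_imp_continuous_on smooth_on_pd)
  have "0 = (LINT z|lborel. pd v (\<lambda>z. h z * g z) z)"
    by (rule integral_pd_eq_0[symmetric, OF _ L(1) _ v]) (use g h L in \<open>auto intro: smooth_on_mult\<close>)
  also have "\<dots> = (LINT z|lborel. pd v h z * g z + h z * pd v g z)"
    using smooth_on_diff[OF g] smooth_on_diff[OF h] by (simp add: pd_mult)
  also have "\<dots> = (LINT z|lborel. pd v h z * g z) + (LINT z|lborel. h z * pd v g z)"
    using i1 i2 by simp
  finally show ?thesis by (simp add: add_eq_0_iff)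
qed

lemma Ck_exp:
  assumes "open S" "Ck k S f"
  shows "Ck k S (\<lambda>x. exp (f x))"
  using assms(2)
proof (induction k)
  have d: "((\<lambda>x. exp (f x)) has_derivative (\<lambda>h. exp (f x) * frechet_derivative f (at x) h)) (at x)"
    if "f differentiable at x" for x
    using that has_derivative_compose[of f _ x UNIV exp "\<lambda>h. exp (f x) * h"] DERIV_exp[of "f x"]
    by (auto simp: frechet_derivative_works has_field_derivative_def)
  case 0
  then show ?case using d by (auto simp: differentiable_def)
next
  have d: "((\<lambda>x. exp (f x)) has_derivative (\<lambda>h. exp (f x) * frechet_derivative f (at x) h)) (at x)"
    if "f differentiable at x" for x
    using that has_derivative_compose[of f _ x UNIV exp "\<lambda>h. exp (f x) * h"] DERIV_exp[of "f x"]
    by (auto simp: frechet_derivative_works has_field_derivative_def)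
  case (Suc k)
  have "Ck k S (pd v (\<lambda>x. exp (f x)))" if "v \<in> Basis" for v
  proof -
    have "Ck k S (\<lambda>x. pd v f x * exp (f x))"
      using Suc Ck_SucD[OF Suc.prems] that by (auto intro!: Ck_mult assms(1))
    moreover have "pd v (\<lambda>x. exp (f x)) x = pd v f x * exp (f x)" if "x \<in> S" for x
      using pd_eqI[OF d] Suc.prems that by (simp add: pd_def)
    ultimately show ?thesis by (subst Ck_cong[OF assms(1)]) auto
  qed
  then show ?case using Suc.prems d unfolding Ck.simps differentiable_def by blast
qed

lemma smooth_on_exp: "open S \<Longrightarrow> smooth_on S f \<Longrightarrow> smooth_on S (\<lambda>x. exp (f x))"
  unfolding smooth_on_Ck by (intro allI Ck_exp) auto


section \<open>The Fourier transform of test functions\<close>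

abbreviation jb :: "'a::real_normed_vector \<Rightarrow> real" where "jb \<equiv> japanese_bracket"

lemma jb_ge_1 [simp]: "jb x \<ge> 1"
  by (simp add: japanese_bracket_def)

lemma jb_pos [simp]: "jb x > 0" "jb x \<ge> 0" "jb x \<noteq> 0"
  using jb_ge_1[of x] by linarith+

lemma jb_minus [simp]: "jb (- x) = jb x"
  by (simp add: japanese_bracket_def)

lemma jb_ge_norm: "norm x \<le> jb x"
  unfolding japanese_bracket_def by (rule real_le_rsqrt) simp

lemma jb_le_norm: "jb x \<le> 1 + norm x"
  unfolding japanese_bracket_def by (rule real_le_lsqrt) (auto simp: power2_eq_square algebra_simps)

lemma jb_le_sum: "jb (x::'a::euclidean_space) \<le> 1 + (\<Sum>b\<in>Basis. \<bar>x \<bullet> b\<bar>)"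
  using jb_le_norm[of x] norm_le_l1[of x] by linarith

lemma jb_mono: "norm x \<le> norm y \<Longrightarrow> jb x \<le> jb y"
  unfolding japanese_bracket_def by (auto intro: power_mono)

lemma continuous_on_jb [continuous_intros]: "continuous_on S f \<Longrightarrow> continuous_on S (\<lambda>x. jb (f x))"
  unfolding japanese_bracket_def by (intro continuous_intros)

lemma measurable_jb [measurable]: "jb \<in> borel_measurable borel"
  unfolding japanese_bracket_def by measurable

lemma peetre1: "jb (x + y) \<le> 2 * jb x * jb y"
proof -
  have "(norm (x + y))\<^sup>2 \<le> (norm x + norm y)\<^sup>2" by (intro power_mono norm_triangle_ineq) auto
  also have "\<dots> \<le> 2 * (norm x)\<^sup>2 + 2 * (norm y)\<^sup>2"
    using sum_squares_bound[of "norm x" "norm y"] by (simp add: power2_sum)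
  finally have "1 + (norm (x + y))\<^sup>2 \<le> 4 * ((1 + (norm x)\<^sup>2) * (1 + (norm y)\<^sup>2))"
    using mult_nonneg_nonneg[OF zero_le_power2[of "norm x"] zero_le_power2[of "norm y"]]
      zero_le_power2[of "norm x"] zero_le_power2[of "norm y"]
    unfolding distrib_left distrib_right by linarith
  then have "sqrt (1 + (norm (x + y))\<^sup>2) \<le> sqrt (4 * ((1 + (norm x)\<^sup>2) * (1 + (norm y)\<^sup>2)))"
    by (rule real_sqrt_le_mono)
  then show ?thesis by (simp add: japanese_bracket_def real_sqrt_mult)
qed

text \<open>For negative \<open>s\<close> the inequality \<open>peetre1\<close> is applied to
  \<open>x = (x + y) + (- y)\<close>, which is why the last bracket carries
  \<open>\<bar>s\<bar>\<close> for both signs.\<close>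

lemma peetre:
  "jb (x + y) powr s \<le> 2 powr \<bar>s\<bar> * jb x powr s * jb y powr \<bar>s\<bar>"
proof (cases "s \<ge> 0")
  case True
  have "jb (x + y) powr s \<le> (2 * jb x * jb y) powr s"
    by (rule powr_mono2[OF True]) (auto simp: peetre1)
  then show ?thesis using True by (simp add: powr_mult)
next
  case False
  have "jb x \<le> 2 * jb (x + y) * jb y" using peetre1[of "x + y" "- y"] by simp
  then have "jb x powr (- s) \<le> (2 * jb (x + y) * jb y) powr (- s)"
    by (rule powr_mono2[rotated 2]) (use False in auto)
  then have "jb x powr (- s) \<le> 2 powr (- s) * jb (x + y) powr (- s) * jb y powr (- s)"
    by (simp add: powr_mult)
  then show ?thesis using False
    by (simp add: powr_minus field_simps)
qed

lemma jb_powr_mono: "s \<le> t \<Longrightarrow> jb x powr s \<le> jb x powr t"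
  by (rule powr_mono) auto

text \<open>Lebesgue measure is the image of the product of one-dimensional ones, so product
  functions reduce to integrals over the line. Two such functions matter: the Gaussian and the
  majorant in \<open>integrable_jb\<close>.\<close>

lemma lborel_prod_Basis:
  fixes f :: "'a::euclidean_space \<Rightarrow> real \<Rightarrow> 'b::{real_normed_field,banach,second_countable_topology}"
  assumes f: "\<And>b. b \<in> Basis \<Longrightarrow> integrable lborel (f b)"
  shows "integrable lborel (\<lambda>x::'a. \<Prod>b\<in>Basis. f b (x \<bullet> b))"
    and "(LINT x|lborel. (\<Prod>b\<in>(Basis::'a set). f b (x \<bullet> b))) = (\<Prod>b\<in>Basis. (LINT t|lborel. f b t))"
proof -
  interpret P: product_sigma_finite "\<lambda>_::'a. lborel :: real measure" ..
  let ?T = "\<lambda>y. \<Sum>b\<in>(Basis::'a set). y b *\<^sub>R b"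
  have T: "?T \<in> (\<Pi>\<^sub>M b\<in>(Basis::'a set). lborel) \<rightarrow>\<^sub>M borel" by measurable
  have F: "(\<lambda>x::'a. \<Prod>b\<in>Basis. f b (x \<bullet> b)) \<in> borel_measurable borel"
  proof (rule borel_measurable_prod)
    fix b :: 'a assume "b \<in> Basis"
    from borel_measurable_integrable[OF f[OF this]] have [measurable]: "f b \<in> borel_measurable borel" by simp
    show "(\<lambda>x. f b (x \<bullet> b)) \<in> borel_measurable borel" by measurable
  qed
  have eq: "(\<Prod>b\<in>Basis. f b (?T y \<bullet> b)) = (\<Prod>b\<in>Basis. f b (y b))" for y
    by (intro prod.cong refl) (simp only: inner_sum_left_Basis)
  have i: "integrable (\<Pi>\<^sub>M b\<in>(Basis::'a set). lborel) (\<lambda>y. \<Prod>b\<in>Basis. f b (y b))"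
    by (rule P.product_integrable_prod) (use f in auto)
  show "integrable lborel (\<lambda>x::'a. \<Prod>b\<in>Basis. f b (x \<bullet> b))"
    unfolding lborel_eq[where 'a='a] by (subst integrable_distr_eq[OF T F]) (simp add: eq i)
  have "(LINT x|lborel. (\<Prod>b\<in>(Basis::'a set). f b (x \<bullet> b))) = (LINT y|(\<Pi>\<^sub>M b\<in>(Basis::'a set). lborel). (\<Prod>b\<in>Basis. f b (y b)))"
    unfolding lborel_eq[where 'a='a] by (subst integral_distr[OF T F]) (simp add: eq)
  also have "\<dots> = (\<Prod>b\<in>Basis. (LINT t|lborel. f b t))"
    by (rule P.product_integral_prod) (use f in auto)
  finally show "(LINT x|lborel. (\<Prod>b\<in>(Basis::'a set). f b (x \<bullet> b))) = (\<Prod>b\<in>Basis. (LINT t|lborel. f b t))" .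
qed

text \<open>Comparison with the product of the functions \<open>1 / (1 + (x \<bullet> b)^2)\<close>,
  each integrable over the line and each at least \<open>1 / (1 + |x|^2)\<close>. This is the origin
  of the exponent \<open>- 2 * DIM('a)\<close> that recurs in all later majorants.\<close>

lemma integrable_jb:
  assumes "s \<le> - 2 * real (DIM('a))"
  shows "integrable lborel (\<lambda>x::'a::euclidean_space. jb x powr s)"
proof -
  have 1: "integrable lborel (\<lambda>x::real. inverse (1 + x\<^sup>2))"
    using integrable_inverse_1_plus_square by (simp add: set_integrable_def einterval_def)
  have 2: "integrable lborel (\<lambda>x::'a. \<Prod>b\<in>Basis. inverse (1 + (x \<bullet> b)\<^sup>2))"
    by (rule lborel_prod_Basis(1)) (rule 1)
  show ?thesis
  proof (rule Bochner_Integration.integrable_bound[OF 2])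
    show "(\<lambda>x::'a. jb x powr s) \<in> borel_measurable lborel" by measurable
    show "AE x in lborel. norm (jb (x::'a) powr s) \<le> norm (\<Prod>b\<in>Basis. inverse (1 + (x \<bullet> b)\<^sup>2))"
    proof (rule AE_I2)
      fix x :: 'a
      have "jb x powr s \<le> jb x powr (- 2 * real (DIM('a)))" by (rule jb_powr_mono[OF assms])
      also have "\<dots> = inverse ((1 + (norm x)\<^sup>2) ^ DIM('a))"
        by (simp add: powr_minus powr_realpow' japanese_bracket_def flip: powr_realpow)
          (simp add: powr_realpow powr_half_sqrt[symmetric] powr_powr add_pos_nonneg)
      also have "\<dots> = (\<Prod>b\<in>(Basis::'a set). inverse (1 + (norm x)\<^sup>2))" by (simp add: power_inverse)
      also have "\<dots> \<le> (\<Prod>b\<in>Basis. inverse (1 + (x \<bullet> b)\<^sup>2))"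
      proof (intro prod_mono conjI le_imp_inverse_le)
        fix b :: 'a assume "b \<in> Basis"
        then have "\<bar>x \<bullet> b\<bar> \<le> norm x" by (rule Basis_le_norm)
        then show "1 + (x \<bullet> b)\<^sup>2 \<le> 1 + (norm x)\<^sup>2"
          using power_mono[of "\<bar>x \<bullet> b\<bar>" "norm x" 2] by simp
      qed (auto simp: add_pos_nonneg)
      finally show "norm (jb x powr s) \<le> norm (\<Prod>b\<in>Basis. inverse (1 + (x \<bullet> b)\<^sup>2))" by simp
    qed
  qed
qed

section \<open>Phases and the Fourier transform\<close>

definition ph :: "'a::euclidean_space \<Rightarrow> 'a \<Rightarrow> complex" where
  "ph z \<eta> = exp (\<i> * of_real (z \<bullet> \<eta>))"

lemma norm_ph [simp]: "cmod (ph z \<eta>) = 1"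
  by (simp add: ph_def)

lemma ph_0 [simp]: "ph 0 \<eta> = 1" "ph z 0 = 1"
  by (simp_all add: ph_def)

lemma ph_add_left: "ph (x + y) \<eta> = ph x \<eta> * ph y \<eta>"
  by (simp add: ph_def inner_add_left exp_add algebra_simps)

lemma ph_add_right: "ph x (\<xi> + \<eta>) = ph x \<xi> * ph x \<eta>"
  by (simp add: ph_def inner_add_right exp_add algebra_simps)

lemma ph_scale: "ph (c *\<^sub>R x) \<eta> = ph x (c *\<^sub>R \<eta>)"
  by (simp add: ph_def)

lemma continuous_on_ph [continuous_intros]:
  "continuous_on S f \<Longrightarrow> continuous_on S g \<Longrightarrow> continuous_on S (\<lambda>x. ph (f x) (g x))"
  unfolding ph_def by (intro continuous_intros)

lemma smooth_on_ph: "smooth_on UNIV (\<lambda>(z, \<eta>). ph z \<eta>)"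
proof -
  have "smooth_on UNIV (\<lambda>p::'a \<times> 'a. \<Sum>b\<in>Basis. complex_of_real (fst p \<bullet> b) * complex_of_real (snd p \<bullet> b))"
    by (intro smooth_on_sum smooth_on_mult smooth_on_linear bounded_linear_intros open_UNIV)
  also have "(\<lambda>p::'a \<times> 'a. \<Sum>b\<in>Basis. complex_of_real (fst p \<bullet> b) * complex_of_real (snd p \<bullet> b))
      = (\<lambda>p. complex_of_real (fst p \<bullet> snd p))"
    by (simp add: euclidean_inner[of "fst p" "snd p" for p])
  finally have "smooth_on UNIV (\<lambda>p::'a \<times> 'a. exp (\<i> * complex_of_real (fst p \<bullet> snd p)))"
    by (intro smooth_on_exp smooth_on_mult smooth_on_const open_UNIV)
  then show ?thesis by (simp add: ph_def case_prod_beta')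
qed

lemma smooth_on_ph1: "smooth_on UNIV (\<lambda>z. ph z \<eta>)"
  using smooth_on_section1[OF smooth_on_ph, of \<eta>] by simp

lemma pd_ph1: "pd v (\<lambda>z. ph z \<eta>) z = of_real (v \<bullet> \<eta>) * ph z \<eta>"
proof -
  have "((\<lambda>z. ph z \<eta>) has_derivative (\<lambda>h. (\<i> * of_real (h \<bullet> \<eta>)) * ph z \<eta>)) (at z)"
    unfolding ph_def
    by (rule has_derivative_eq_rhs, rule has_derivative_compose[where g = exp and g' = "\<lambda>h. exp (\<i> * of_real (z \<bullet> \<eta>)) * h"])
      (auto intro!: derivative_eq_intros DERIV_exp[unfolded has_field_derivative_def] simp: fun_eq_iff mult_ac)
  from pd_eqI[OF this, of v] show ?thesis by (simp flip: mult.assoc)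
qed

text \<open>The sign in the exponent is plus and nothing is normalized, because the integration
  variable will be the difference \<open>z = x - y\<close>. The usual transform of \<open>u\<close>
  at \<open>\<xi>\<close> is therefore \<open>ft u (- \<xi>)\<close>.\<close>

definition ft :: "('a::euclidean_space \<Rightarrow> complex) \<Rightarrow> 'a \<Rightarrow> complex" where
  "ft g \<eta> = (LINT z|lborel. ph z \<eta> * g z)"

lemma ft_pd:
  assumes g: "smooth_on UNIV g" and L: "compact L" "\<And>x. x \<notin> L \<Longrightarrow> g x = 0" and v: "v \<in> Basis"
  shows "ft (pd v g) \<eta> = - of_real (v \<bullet> \<eta>) * ft g \<eta>"
  unfolding ft_def
  by (subst integral_by_parts[OF g L v smooth_on_ph1]) (simp_all add: pd_ph1 mult.assoc)

lemma ft_bound: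
  assumes g: "continuous_on UNIV g" and L: "compact L" "\<And>x. x \<notin> L \<Longrightarrow> g x = 0" and B: "\<And>z. cmod (g z) \<le> B"
  shows "cmod (ft g \<eta>) \<le> B * measure lborel L"
proof -
  have ii: "integrable lborel (indicat_real L)"
    using emeasure_compact_finite[OF L(1)] L(1) by (intro integrable_real_indicator) (auto intro: borel_compact)
  have "cmod (ft g \<eta>) \<le> (LINT z|lborel. B * indicator L z)"
    unfolding ft_def
  proof (rule order_trans[OF integral_norm_bound integral_mono])
    show "integrable lborel (\<lambda>z. cmod (ph z \<eta> * g z))"
      by (intro integrable_norm integrable_compact_support[OF _ L(1)])
        (use L g in \<open>auto intro!: continuous_intros\<close>)
    show "integrable lborel (\<lambda>z. B * indicat_real L z)" using ii by simp
    show "cmod (ph z \<eta> * g z) \<le> B * indicat_real L z" for z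
      using B[of z] L(2)[of z] by (auto simp: norm_mult indicator_def)
  qed
  then show ?thesis using L(1) by (simp add: borel_compact)
qed

text \<open>By \<open>jb_le_sum\<close> one factor \<open>jb \<eta>\<close> costs
  \<open>ft g\<close> itself and the transforms of its \<open>DIM('a)\<close> first derivatives,
  whence \<open>1 + DIM('a)\<close>. The constant depends on \<open>g\<close> only through
  \<open>B\<close> and \<open>L\<close>, which makes the estimate uniform in families of
  functions.\<close>

lemma ft_decay:
  fixes g :: "'a::euclidean_space \<Rightarrow> complex"
  assumes g: "smooth_on UNIV g" and L: "compact L" "\<And>x. x \<notin> L \<Longrightarrow> g x = 0"
    and B: "\<And>vs z. set vs \<subseteq> Basis \<Longrightarrow> length vs \<le> M \<Longrightarrow> cmod (D_iter vs g z) \<le> B"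
  shows "jb \<eta> ^ M * cmod (ft g \<eta>) \<le> (1 + real DIM('a)) ^ M * B * measure lborel L"
  using g L(2) B
proof (induction M arbitrary: g)
  case 0
  then show ?case using ft_bound[OF smooth_on_imp_continuous_on L(1), of g B \<eta>] by (metis (no_types) "0.prems" D_iter.simps(1) empty_subsetI list.size(3) mult_1 order_refl power_0 set_empty2)
next
  case (Suc M)
  let ?C = "(1 + real DIM('a)) ^ M * B * measure lborel L"
  have le1: "jb \<eta> ^ M * cmod (ft g \<eta>) \<le> ?C"
    by (rule Suc.IH) (use Suc.prems in auto)
  have le2: "jb \<eta> ^ M * cmod (ft (pd v g) \<eta>) \<le> ?C" if v: "v \<in> Basis" for v
  proof (rule Suc.IH)
    show "pd v g x = 0" if "x \<notin> L" for x
      using pd_cong_open[of "- L" x g "\<lambda>_. 0" v] Suc.prems(2) that compact_imp_closed[OF L(1)] by auto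
    show "cmod (D_iter vs (pd v g) z) \<le> B" if "set vs \<subseteq> Basis" "length vs \<le> M" for vs z
      using Suc.prems(3)[of "vs @ [v]" z] that v by (simp add: D_iter_append)
  qed (use Suc.prems v in \<open>auto intro: smooth_on_pd\<close>)
  have "jb \<eta> * cmod (ft g \<eta>) \<le> (1 + (\<Sum>b\<in>Basis. \<bar>\<eta> \<bullet> b\<bar>)) * cmod (ft g \<eta>)"
    by (intro mult_right_mono jb_le_sum) auto
  also have "\<dots> = cmod (ft g \<eta>) + (\<Sum>b\<in>Basis. cmod (ft (pd b g) \<eta>))"
    using Suc.prems by (simp add: ft_pd[OF _ L(1)] norm_mult distrib_right sum_distrib_right inner_commute)
  finally have "jb \<eta> ^ M * (jb \<eta> * cmod (ft g \<eta>)) \<le> jb \<eta> ^ M * (cmod (ft g \<eta>) + (\<Sum>b\<in>Basis. cmod (ft (pd b g) \<eta>)))"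
    by (rule mult_left_mono) simp
  also have "\<dots> = jb \<eta> ^ M * cmod (ft g \<eta>) + (\<Sum>b\<in>Basis. jb \<eta> ^ M * cmod (ft (pd b g) \<eta>))"
    by (simp add: algebra_simps sum_distrib_left)
  also have "\<dots> \<le> ?C + (\<Sum>b\<in>(Basis::'a set). ?C)"
    by (intro add_mono le1 sum_mono le2)
  also have "\<dots> = (1 + real DIM('a)) ^ Suc M * B * measure lborel L"
    by (simp add: algebra_simps)
  finally show ?case by (simp add: mult_ac)
qed

text \<open>A majorant in product form makes absolute integrability immediate; the later
  interchanges of integrals over unbounded domains are arranged to have one.\<close>

lemma Fubini_bound:
  fixes H :: "'a::euclidean_space \<times> 'b::euclidean_space \<Rightarrow> complex"
  assumes H: "H \<in> borel_measurable borel"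
    and ab: "integrable lborel a" "integrable lborel b"
    and le: "\<And>x y. cmod (H (x, y)) \<le> a x * b y"
  shows "integrable lborel H"
    and "(LINT x|lborel. (LINT y|lborel. H (x, y))) = (LINT y|lborel. (LINT x|lborel. H (x, y)))"
    and "(LINT p|lborel. H p) = (LINT x|lborel. (LINT y|lborel. H (x, y)))"
    and "integrable lborel (\<lambda>x. LINT y|lborel. H (x, y))"
    and "integrable lborel (\<lambda>y. LINT x|lborel. H (x, y))"
proof -
  have Hm: "H \<in> borel_measurable (lborel \<Otimes>\<^sub>M lborel)" using H by (simp add: lborel_prod)
  have m2: "(\<lambda>y. H (x, y)) \<in> borel_measurable lborel" for x
    using measurable_Pair2[OF Hm] by simp
  have i2: "integrable lborel (\<lambda>y. H (x, y))" for x
    by (rule Bochner_Integration.integrable_bound[OF _ m2, of "\<lambda>y. a x * b y"])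
      (use ab le in \<open>auto intro!: AE_I2 order_trans[OF le abs_ge_self]\<close>)
  have i1: "integrable lborel (\<lambda>x. LINT y|lborel. cmod (H (x, y)))"
  proof (rule Bochner_Integration.integrable_bound[of _ "\<lambda>x. a x * (LINT y|lborel. b y)"])
    show "(\<lambda>x. LINT y|lborel. cmod (H (x, y))) \<in> borel_measurable lborel"
      using Hm by (intro lborel.borel_measurable_lebesgue_integral) (simp add: case_prod_beta')
    show "AE x in lborel. norm (LINT y|lborel. cmod (H (x, y))) \<le> norm (a x * (LINT y|lborel. b y))"
    proof (rule AE_I2)
      fix x
      have "(LINT y|lborel. cmod (H (x, y))) \<le> (LINT y|lborel. a x * b y)"
        by (rule integral_mono) (use i2 ab le in auto)
      moreover have "0 \<le> (LINT y|lborel. cmod (H (x, y)))" by (rule Bochner_Integration.integral_nonneg) auto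
      ultimately show "norm (LINT y|lborel. cmod (H (x, y))) \<le> norm (a x * (LINT y|lborel. b y))" by simp
    qed
  qed (use ab in simp)
  have ii: "integrable (lborel \<Otimes>\<^sub>M lborel) H"
    by (rule lborel_pair.Fubini_integrable[OF Hm]) (use i1 i2 in auto)
  then show "integrable lborel H" by (simp add: lborel_prod)
  have ii': "integrable (lborel \<Otimes>\<^sub>M lborel) (case_prod (\<lambda>x y. H (x, y)))" using ii by simp
  show "(LINT x|lborel. (LINT y|lborel. H (x, y))) = (LINT y|lborel. (LINT x|lborel. H (x, y)))"
    using lborel_pair.Fubini_integral[OF ii'] by simp
  show "(LINT p|lborel. H p) = (LINT x|lborel. (LINT y|lborel. H (x, y)))"
    using lborel_pair.integral_fst'[OF ii] by (simp add: lborel_prod)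
  show "integrable lborel (\<lambda>x. LINT y|lborel. H (x, y))"
    by (rule lborel_pair.integrable_fst'[OF ii])
  show "integrable lborel (\<lambda>y. LINT x|lborel. H (x, y))"
    using lborel_pair.integrable_snd[OF ii'] .
qed

lemma D_iter_bounded_compact:
  fixes f :: "'a::euclidean_space \<Rightarrow> complex"
  assumes f: "smooth_on UNIV f" and K: "compact K"
  shows "\<exists>B\<ge>0. \<forall>vs. set vs \<subseteq> Basis \<and> length vs \<le> M \<longrightarrow> (\<forall>x\<in>K. cmod (D_iter vs f x) \<le> B)"
proof -
  let ?V = "{vs. set vs \<subseteq> (Basis::'a set) \<and> length vs \<le> M}"
  have "finite ?V" by (rule finite_lists_length_le) simp
  then have "bounded (\<Union>vs\<in>?V. D_iter vs f ` K)"
    by (intro bounded_UN ballI compact_imp_bounded compact_continuous_image K)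
      (use smooth_on_imp_continuous_on[OF smooth_on_D_iter[OF f]] continuous_on_subset in blast)+
  then obtain B where "\<And>vs x. vs \<in> ?V \<Longrightarrow> x \<in> K \<Longrightarrow> cmod (D_iter vs f x) \<le> B"
    unfolding bounded_iff by fastforce
  then show ?thesis by (intro exI[of _ "max B 0"]) (auto simp: le_max_iff_disj)
qed

lemma D_iter_zero_outside:
  assumes "compact L" "\<And>x. x \<notin> L \<Longrightarrow> g x = 0" "x \<notin> L"
  shows "D_iter vs g x = 0"
  using D_iter_cong_open[of "- L" g "\<lambda>_. 0" x vs] assms compact_imp_closed by auto

lemma D_iter_bounded:
  fixes g :: "'a::euclidean_space \<Rightarrow> complex"
  assumes g: "smooth_on UNIV g" and L: "compact L" "\<And>x. x \<notin> L \<Longrightarrow> g x = 0"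
  obtains B where "B \<ge> 0" "\<And>vs z. set vs \<subseteq> Basis \<Longrightarrow> length vs \<le> M \<Longrightarrow> cmod (D_iter vs g z) \<le> B"
proof -
  obtain B where B: "B \<ge> 0" "\<forall>vs. set vs \<subseteq> Basis \<and> length vs \<le> M \<longrightarrow> (\<forall>x\<in>L. cmod (D_iter vs g x) \<le> B)"
    using D_iter_bounded_compact[OF g L(1), of M] by blast
  have "cmod (D_iter vs g z) \<le> B" if "set vs \<subseteq> Basis" "length vs \<le> M" for vs z
    using B that D_iter_zero_outside[OF L, where x = z and vs = vs] by (cases "z \<in> L") auto
  then show ?thesis using B(1) that by blast
qed

lemma smooth_on_ft:
  assumes g: "smooth_on UNIV g" and L: "compact L" "\<And>x. x \<notin> L \<Longrightarrow> g x = 0"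
  shows "smooth_on UNIV (ft g)"
proof -
  have "smooth_on UNIV (\<lambda>\<eta>. LINT z|lborel. (\<lambda>(\<eta>, z). ph z \<eta> * g z) (\<eta>, z))"
  proof (rule smooth_on_integral)
    have "smooth_on UNIV (\<lambda>p::'a\<times>'a. (\<lambda>(z, \<eta>). ph z \<eta>) (snd p, fst p) * g (snd p))"
      by (intro smooth_on_mult open_UNIV smooth_on_compose_linear[OF _ g] smooth_on_compose_linear[OF _ smooth_on_ph] bounded_linear_intros)
    then show "smooth_on UNIV (\<lambda>(\<eta>, z). ph z \<eta> * g z)" by (simp add: case_prod_beta')
    show "zsupp (\<lambda>(\<eta>, z). ph z \<eta> * g z)" unfolding zsupp_def using L by auto
  qed
  then show ?thesis by (simp add: ft_def[abs_def])
qed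

lemma ft_decay':
  fixes g :: "'a::euclidean_space \<Rightarrow> complex"
  assumes g: "smooth_on UNIV g" and L: "compact L" "\<And>x. x \<notin> L \<Longrightarrow> g x = 0"
  obtains C where "C \<ge> 0" "\<And>\<eta>. cmod (ft g \<eta>) \<le> C * jb \<eta> powr s"
proof -
  obtain M :: nat where M: "- s \<le> real M" using real_arch_simple by blast
  obtain B where B: "B \<ge> 0" "\<And>vs z. set vs \<subseteq> Basis \<Longrightarrow> length vs \<le> M \<Longrightarrow> cmod (D_iter vs g z) \<le> B"
    using D_iter_bounded[OF g L, of M] by metis
  let ?C = "(1 + real DIM('a)) ^ M * B * measure lborel L"
  have "cmod (ft g \<eta>) \<le> ?C * jb \<eta> powr s" for \<eta>
  proof -
    have "jb \<eta> ^ M * cmod (ft g \<eta>) \<le> ?C" by (rule ft_decay[OF g L B(2)])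
    then have "cmod (ft g \<eta>) \<le> ?C * jb \<eta> powr (- real M)"
      by (simp add: powr_minus powr_realpow field_simps)
    also have "\<dots> \<le> ?C * jb \<eta> powr s"
      using M B(1) by (intro mult_left_mono jb_powr_mono) auto
    finally show ?thesis .
  qed
  then show ?thesis using B(1) by (intro that[of ?C]) auto
qed

lemma integrable_ft:
  fixes g :: "'a::euclidean_space \<Rightarrow> complex"
  assumes g: "smooth_on UNIV g" and L: "compact L" "\<And>x. x \<notin> L \<Longrightarrow> g x = 0"
  shows "integrable lborel (ft g)"
proof -
  obtain C where C: "C \<ge> 0" "\<And>\<eta>. cmod (ft g \<eta>) \<le> C * jb \<eta> powr (- 2 * real DIM('a))"
    by (rule ft_decay'[OF g L, where s = "- 2 * real DIM('a)"]) (use that in auto)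
  show ?thesis
  proof (rule Bochner_Integration.integrable_bound[of _ "\<lambda>\<eta>. C * jb \<eta> powr (- 2 * real DIM('a))"])
    show "integrable lborel (\<lambda>\<eta>::'a. C * jb \<eta> powr (- 2 * real DIM('a)))"
      using integrable_jb[where 'a='a] by simp
    show "ft g \<in> borel_measurable lborel"
      using smooth_on_imp_continuous_on[OF smooth_on_ft[OF g L]] by (simp add: borel_measurable_continuous_onI)
    show "AE x in lborel. cmod (ft g x) \<le> norm (C * jb x powr (- 2 * real DIM('a)))"
      using C by (auto intro!: AE_I2 simp: abs_mult)
  qed
qed

section \<open>Gaussians and Fourier inversion\<close>

lemma gauss1:
  "integrable lborel (\<lambda>s. complex_of_real (exp (- s\<^sup>2 / 2)) * exp (\<i> * of_real (t * s)))"
  "(LINT s|lborel. complex_of_real (exp (- s\<^sup>2 / 2)) * exp (\<i> * of_real (t * s))) = of_real (sqrt (2 * pi) * exp (- t\<^sup>2 / 2))"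
proof -
  have i: "integrable lborel std_normal_density"
    using integrable_std_normal_moment[of 0] by simp
  have eq: "(\<lambda>s. complex_of_real (exp (- s\<^sup>2 / 2)) * exp (\<i> * of_real (t * s)))
     = (\<lambda>s. of_real (sqrt (2 * pi)) * (std_normal_density s *\<^sub>R iexp (t * s)))"
    by (auto simp: std_normal_density_def fun_eq_iff scaleR_conv_of_real)
  have i2: "integrable lborel (\<lambda>s. std_normal_density s *\<^sub>R iexp (t * s))"
    by (rule Bochner_Integration.integrable_bound[OF i]) auto
  show "integrable lborel (\<lambda>s. complex_of_real (exp (- s\<^sup>2 / 2)) * exp (\<i> * of_real (t * s)))"
    unfolding eq by (intro integrable_mult_right i2)
  \<comment> \<open>Up to the factor \<open>sqrt (2 * pi)\<close> the integral is the characteristic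
    function of the standard normal distribution.\<close>
  have "complex_of_real (exp (- (t^2) / 2)) = char std_normal_distribution t"
    by (simp add: char_std_normal_distribution)
  also have "\<dots> = (LINT s|lborel. std_normal_density s *\<^sub>R iexp (t * s))"
    unfolding char_def by (rule integral_density) auto
  finally have fin: "complex_of_real (exp (- (t^2) / 2)) = (LINT s|lborel. std_normal_density s *\<^sub>R iexp (t * s))" .
  show "(LINT s|lborel. complex_of_real (exp (- s\<^sup>2 / 2)) * exp (\<i> * of_real (t * s))) = of_real (sqrt (2 * pi) * exp (- t\<^sup>2 / 2))"
    unfolding eq integral_mult_right_zero by (simp only: of_real_mult[of "sqrt _"] fin)
qed

definition gauss :: "'a::euclidean_space \<Rightarrow> complex" where
  "gauss x = of_real (exp (- (norm x)\<^sup>2 / 2))"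

lemma gauss_prod: "gauss x * ph w x = (\<Prod>b\<in>Basis. complex_of_real (exp (- (x \<bullet> b)\<^sup>2 / 2)) * exp (\<i> * of_real ((w \<bullet> b) * (x \<bullet> b))))"
proof -
  have 1: "(norm x)\<^sup>2 = (\<Sum>b\<in>Basis. (x \<bullet> b)\<^sup>2)"
    unfolding power2_norm_eq_inner by (subst euclidean_inner) (simp add: power2_eq_square)
  have 2: "w \<bullet> x = (\<Sum>b\<in>Basis. (w \<bullet> b) * (x \<bullet> b))" by (rule euclidean_inner)
  show ?thesis
    unfolding gauss_def ph_def 1 2 prod.distrib
    by (simp add: exp_sum[symmetric] sum_negf sum_divide_distrib sum_distrib_left flip: of_real_prod)
qed

lemma gauss_n:
  fixes w :: "'a::euclidean_space"
  shows "integrable lborel (\<lambda>x. gauss x * ph w x)"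
    "(LINT x|lborel. gauss x * ph w x) = of_real (sqrt (2 * pi)) ^ DIM('a) * gauss w"
proof -
  let ?f = "\<lambda>b s. complex_of_real (exp (- s\<^sup>2 / 2)) * exp (\<i> * of_real ((w \<bullet> b) * s))"
  show "integrable lborel (\<lambda>x. gauss x * ph w x)"
    unfolding gauss_prod by (rule lborel_prod_Basis(1)[of ?f]) (rule gauss1)
  have "(LINT x|lborel. gauss x * ph w x) = (\<Prod>b\<in>Basis. of_real (sqrt (2 * pi) * exp (- (w \<bullet> b)\<^sup>2 / 2)))"
    unfolding gauss_prod by (subst lborel_prod_Basis(2)[of ?f]) (simp_all only: gauss1)
  also have "\<dots> = of_real (sqrt (2 * pi)) ^ DIM('a) * (\<Prod>b\<in>Basis. of_real (exp (- (w \<bullet> b)\<^sup>2 / 2)))"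
    by (simp add: prod.distrib)
  also have "(\<Prod>b\<in>Basis. complex_of_real (exp (- (w \<bullet> b)\<^sup>2 / 2))) = gauss w"
    using gauss_prod[of w 0] by (simp add: ph_def)
  finally show "(LINT x|lborel. gauss x * ph w x) = of_real (sqrt (2 * pi)) ^ DIM('a) * gauss w" .
qed

text \<open>Inverting the order of integration directly would not converge, so a Gaussian
  \<open>gauss (e k *\<^sub>R \<eta>)\<close> is inserted and \<open>e k\<close> tends to 0. The
  value at 0 is all that is stated, since replacing \<open>g\<close> by a translate gives the
  others.\<close>

lemma fourier_inversion:
  fixes g :: "'a::euclidean_space \<Rightarrow> complex"
  assumes g: "smooth_on UNIV g" and L: "compact L" "\<And>x. x \<notin> L \<Longrightarrow> g x = 0"
  shows "(LINT \<eta>|lborel. ft g \<eta>) = (2 * of_real pi) ^ DIM('a) * g 0"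
proof -
  let ?n = "DIM('a)"
  define cs where "cs = complex_of_real (sqrt (2 * pi)) ^ ?n"
  define e where "e = (\<lambda>k. 1 / (real k + 1))"
  have e0: "e k > 0" for k by (simp add: e_def)
  have elim: "e \<longlonglongrightarrow> 0" unfolding e_def by real_asymp
  have cg: "continuous_on UNIV g" using g by (rule smooth_on_imp_continuous_on)
  have ce: "continuous_on UNIV (\<lambda>w. g (c *\<^sub>R w))" for c
    by (rule continuous_on_compose2[OF cg]) (auto intro!: continuous_intros)
  have cft: "continuous_on UNIV (ft g)" by (rule smooth_on_imp_continuous_on[OF smooth_on_ft[OF g L]])
  have cgau: "continuous_on UNIV (gauss :: 'a \<Rightarrow> complex)" unfolding gauss_def by (auto intro!: continuous_intros)
  have cgs: "continuous_on UNIV (\<lambda>\<eta>::'a. gauss (c *\<^sub>R \<eta>))" for c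
    by (rule continuous_on_compose2[OF cgau]) (auto intro!: continuous_intros)
  have ngau: "cmod (gauss x) \<le> 1" for x :: 'a by (simp add: gauss_def)
  have gau0: "gauss (0::'a) = 1" by (simp add: gauss_def)
  have igau: "integrable lborel (gauss :: 'a \<Rightarrow> complex)"
    using gauss_n(1)[of "0::'a"] by simp
  obtain G where G: "\<And>x. cmod (g x) \<le> G"
    using D_iter_bounded[OF g L, of 0] by (metis D_iter.simps(1) empty_subsetI le0 list.size(3) set_empty2)
  \<comment> \<open>The substitution \<open>\<eta> := e k *\<^sub>R \<eta>\<close> turns its
    integral into that of \<open>gauss (e k *\<^sub>R \<eta>) * ft g \<eta>\<close> (fact
    \<open>a\<close>); interchanging the integrals instead moves the transform onto the Gaussian
    (fact \<open>b\<close>). Both sides have limits.\<close>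
  define F where "F = (\<lambda>k \<eta>. gauss \<eta> * ft (\<lambda>w. g (e k *\<^sub>R w)) \<eta>)"
  have supp: "compact ((\<lambda>x. (1 / e k) *\<^sub>R x) ` L)" "\<And>w. w \<notin> (\<lambda>x. (1 / e k) *\<^sub>R x) ` L \<Longrightarrow> g (e k *\<^sub>R w) = 0" for k
  proof -
    show "compact ((\<lambda>x. (1 / e k) *\<^sub>R x) ` L)" by (rule compact_scaling[OF L(1)])
    fix w assume w: "w \<notin> (\<lambda>x. (1 / e k) *\<^sub>R x) ` L"
    have "w = (1 / e k) *\<^sub>R (e k *\<^sub>R w)" using e0[of k] by simp
    then show "g (e k *\<^sub>R w) = 0" using w L(2) by (metis imageI)
  qed
  have ige: "integrable lborel (\<lambda>w. g (e k *\<^sub>R w))" for k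
    by (rule integrable_compact_support[OF ce supp])
  have sge: "smooth_on UNIV (\<lambda>w. g (e k *\<^sub>R w))" for k
    by (rule smooth_on_compose_linear[OF _ g]) (intro bounded_linear_intros)
  have ftscale: "ft g \<eta> = of_real (e k ^ ?n) * ft (\<lambda>w. g (e k *\<^sub>R w)) (e k *\<^sub>R \<eta>)" for k \<eta>
    unfolding ft_def
    by (subst lborel_integral_scale[of "\<lambda>z. ph z \<eta> * g z" "e k" 0])
      (use e0[of k] cg in \<open>auto simp: ph_scale scaleR_conv_of_real intro!: borel_measurable_continuous_onI continuous_intros\<close>)
  have a: "(LINT \<eta>|lborel. F k \<eta>) = (LINT \<eta>|lborel. gauss (e k *\<^sub>R \<eta>) * ft g \<eta>)" for k
  proof -
    have "(LINT \<eta>|lborel. F k \<eta>) = e k ^ ?n *\<^sub>R (LINT \<eta>|lborel. F k (0 + e k *\<^sub>R \<eta>))"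
      by (subst lborel_integral_scale[of "F k" "e k" 0])
        (use e0[of k] cgau smooth_on_imp_continuous_on[OF smooth_on_ft[OF sge supp]] in
          \<open>auto simp: F_def intro!: borel_measurable_continuous_onI continuous_intros\<close>)
    also have "\<dots> = (LINT \<eta>|lborel. gauss (e k *\<^sub>R \<eta>) * ft g \<eta>)"
      using e0[of k] by (simp add: F_def ftscale[of _ k] scaleR_conv_of_real mult_ac flip: integral_mult_right_zero)
    finally show ?thesis .
  qed
  have "(\<lambda>k. LINT \<eta>|lborel. F k \<eta>) \<longlonglongrightarrow> (LINT \<eta>|lborel. ft g \<eta>)"
    unfolding a
  proof (rule integral_dominated_convergence[where w = "\<lambda>\<eta>. cmod (ft g \<eta>)"])
    show "integrable lborel (\<lambda>x. cmod (ft g x))" using integrable_ft[OF g L] by simp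
    show "AE \<eta> in lborel. (\<lambda>k. gauss (e k *\<^sub>R \<eta>) * ft g \<eta>) \<longlonglongrightarrow> ft g \<eta>"
    proof (rule AE_I2)
      fix \<eta> :: 'a
      have "(\<lambda>k. e k *\<^sub>R \<eta>) \<longlonglongrightarrow> 0 *\<^sub>R \<eta>" by (intro tendsto_intros elim)
      then have "(\<lambda>k. gauss (e k *\<^sub>R \<eta>)) \<longlonglongrightarrow> gauss (0::'a)"
        using cgau by (intro continuous_on_tendsto_compose[OF cgau]) auto
      then have "(\<lambda>k. gauss (e k *\<^sub>R \<eta>) * ft g \<eta>) \<longlonglongrightarrow> gauss (0::'a) * ft g \<eta>" by (intro tendsto_intros)
      then show "(\<lambda>k. gauss (e k *\<^sub>R \<eta>) * ft g \<eta>) \<longlonglongrightarrow> ft g \<eta>" by (simp add: gau0)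
    qed
    show "AE \<eta> in lborel. cmod (gauss (e k *\<^sub>R \<eta>) * ft g \<eta>) \<le> cmod (ft g \<eta>)" for k
      using ngau by (auto intro!: AE_I2 mult_left_le_one_le simp: norm_mult)
    show "(\<lambda>\<eta>. gauss (e k *\<^sub>R \<eta>) * ft g \<eta>) \<in> borel_measurable lborel" for k
      using cgs cft by (auto intro!: borel_measurable_continuous_onI continuous_intros)
  qed (use cft in \<open>auto intro!: borel_measurable_continuous_onI\<close>)
  moreover have b: "(LINT \<eta>|lborel. F k \<eta>) = (LINT w|lborel. g (e k *\<^sub>R w) * (cs * gauss w))" for k
  proof -
    let ?H = "\<lambda>(\<eta>::'a, w). gauss \<eta> * (ph w \<eta> * g (e k *\<^sub>R w))"
    have "(LINT \<eta>|lborel. F k \<eta>) = (LINT \<eta>|lborel. (LINT w|lborel. ?H (\<eta>, w)))"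
      by (simp add: F_def ft_def)
    also have "\<dots> = (LINT w|lborel. (LINT \<eta>|lborel. ?H (\<eta>, w)))"
    proof (rule Fubini_bound(2))
      show "?H \<in> borel_measurable borel"
        by (auto intro!: borel_measurable_continuous_onI continuous_intros continuous_on_compose2[OF cgau]
            continuous_on_compose2[OF ce] simp: case_prod_beta')
      show "integrable lborel (\<lambda>\<eta>::'a. cmod (gauss \<eta>))" using igau by simp
      show "integrable lborel (\<lambda>w. cmod (g (e k *\<^sub>R w)))" using ige by simp
    qed (simp add: norm_mult)
    also have "\<dots> = (LINT w|lborel. (LINT \<eta>|lborel. g (e k *\<^sub>R w) * (gauss \<eta> * ph w \<eta>)))"
      by (simp add: mult_ac)
    also have "\<dots> = (LINT w|lborel. g (e k *\<^sub>R w) * (cs * gauss w))"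
      by (simp only: integral_mult_right_zero gauss_n(2) cs_def)
    finally show ?thesis .
  qed
  moreover have "(\<lambda>k. LINT \<eta>|lborel. F k \<eta>) \<longlonglongrightarrow> (LINT w|lborel. g 0 * (cs * gauss (w::'a)))"
    unfolding b
  proof (rule integral_dominated_convergence[where w = "\<lambda>w::'a. G * cmod (cs * gauss w)" and M = lborel
        and f = "\<lambda>w::'a. g 0 * (cs * gauss w)" and s = "\<lambda>k w. g (e k *\<^sub>R w) * (cs * gauss w)"])
    show "integrable lborel (\<lambda>w::'a. G * cmod (cs * gauss w))" using igau by simp
    show "AE w in lborel. (\<lambda>k. g (e k *\<^sub>R w) * (cs * gauss w)) \<longlonglongrightarrow> g 0 * (cs * gauss w)"
    proof (rule AE_I2)
      fix w :: 'a
      have "(\<lambda>k. e k *\<^sub>R w) \<longlonglongrightarrow> 0 *\<^sub>R w" by (intro tendsto_intros elim)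
      then have "(\<lambda>k. g (e k *\<^sub>R w)) \<longlonglongrightarrow> g 0"
        by (intro continuous_on_tendsto_compose[OF cg]) auto
      then show "(\<lambda>k. g (e k *\<^sub>R w) * (cs * gauss w)) \<longlonglongrightarrow> g 0 * (cs * gauss w)" by (intro tendsto_intros)
    qed
    show "AE w in lborel. cmod (g (e k *\<^sub>R w) * (cs * gauss w)) \<le> G * cmod (cs * gauss w)" for k
      by (rule AE_I2) (simp only: norm_mult[of "g _"], rule mult_right_mono[OF G norm_ge_zero])
    show "(\<lambda>w. g (e k *\<^sub>R w) * (cs * gauss w)) \<in> borel_measurable lborel" for k
      using ce cgau by (auto intro!: borel_measurable_continuous_onI continuous_intros)
  qed (use cgau in \<open>auto intro!: borel_measurable_continuous_onI continuous_intros\<close>)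
  ultimately have "(LINT \<eta>|lborel. ft g \<eta>) = (LINT w|lborel. g 0 * (cs * gauss (w::'a)))"
    using LIMSEQ_unique by blast
  also have "\<dots> = g 0 * (cs * cs)"
    using gauss_n(2)[of "0::'a"] by (simp add: gau0 cs_def)
  \<comment> \<open>One factor \<open>cs\<close> comes from the transform of the Gaussian, the other
    from its total integral.\<close>
  also have "cs * cs = (2 * of_real pi) ^ ?n"
    unfolding cs_def power_mult_distrib[symmetric] of_real_mult[symmetric] by simp
  finally show ?thesis by (simp add: mult.commute)
qed

text \<open>Differentiating the remainder of order \<open>N + 1\<close> gives the remainder of order
  \<open>N\<close> of the derivative, and the mean value inequality on \<open>{0..1}\<close>
  integrates the bound. The factor \<open>1 / N!\<close> is given away, since only the dependence on
  \<open>B\<close> matters.\<close>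

lemma taylor_bound:
  fixes f :: "nat \<Rightarrow> real \<Rightarrow> complex"
  assumes "\<And>k t. k < N \<Longrightarrow> t \<in> {0..1} \<Longrightarrow> (f k has_vector_derivative f (Suc k) t) (at t within {0..1})"
    and "\<And>t. t \<in> {0..1} \<Longrightarrow> cmod (f N t) \<le> B" and "t \<in> {0..1}"
  shows "cmod (f 0 t - (\<Sum>k<N. of_real (t ^ k / fact k) * f k 0)) \<le> B"
  using assms
proof (induction N arbitrary: f t)
  case (Suc N)
  let ?g = "\<lambda>t. f 0 t - (\<Sum>k<Suc N. of_real (t ^ k / fact k) * f k 0)"
  let ?g' = "\<lambda>t. f 1 t - (\<Sum>k<N. of_real (t ^ k / fact k) * f (Suc k) 0)"
  have IH: "cmod (?g' t) \<le> B" if "t \<in> {0..1}" for t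
    using Suc.IH[of "\<lambda>k. f (Suc k)" t] Suc.prems that by simp
  have d: "(?g has_vector_derivative ?g' s) (at s within {0..1})" if s: "s \<in> {0..1}" for s
  proof -
    have "((\<lambda>t::real. t ^ k / fact k) has_real_derivative real k * s ^ (k - 1) / fact k) (at s within {0..1})" for k
      by (auto intro!: derivative_eq_intros)
    from has_vector_derivative_mult_left[OF has_vector_derivative_of_real[OF this]]
    have "((\<lambda>t. complex_of_real (t ^ k / fact k) * f k 0) has_vector_derivative
       of_real (real k * s ^ (k - 1) / fact k) * f k 0) (at s within {0..1})" for k .
    then have "(?g has_vector_derivative f (Suc 0) s - (\<Sum>k<Suc N. of_real (real k * s ^ (k - 1) / fact k) * f k 0)) (at s within {0..1})"
      using Suc.prems(1)[of 0 s] s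
      by (intro has_vector_derivative_diff has_vector_derivative_sum) auto
    moreover have "(\<Sum>k<Suc N. complex_of_real (real k * s ^ (k - 1) / fact k) * f k 0) =
        (\<Sum>k<N. of_real (s ^ k / fact k) * f (Suc k) 0)"
      by (subst sum.lessThan_Suc_shift) (auto intro!: sum.cong simp: divide_simps)
    ultimately show ?thesis by (simp only: One_nat_def)
  qed
  have "cmod (?g t - ?g 0) \<le> B * norm (t - 0)"
  proof (rule differentiable_bound[of "{0..1}"])
    fix s :: real assume s: "s \<in> {0..1}"
    show "(?g has_derivative (\<lambda>h. h *\<^sub>R ?g' s)) (at s within {0..1})"
      using d[OF s] by (simp add: has_vector_derivative_def)
    show "onorm (\<lambda>h. h *\<^sub>R ?g' s) \<le> B"
      by (rule onorm_le) (use IH[OF s] in \<open>auto simp: mult.commute[of B] intro!: mult_left_mono\<close>)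
  qed (use Suc.prems in auto)
  also have "\<dots> \<le> B * 1"
    using Suc.prems order_trans[OF norm_ge_zero IH[of 0]] by (intro mult_left_mono) auto
  also have "?g 0 = 0"
    by (simp add: sum.lessThan_Suc_shift del: sum.lessThan_Suc)
  finally show ?case by simp
qed simp


section \<open>Symbols\<close>

text \<open>The number of \<open>\<xi>\<close>-directions in a word of basis vectors of the product space.\<close>

definition cnt :: "('x::euclidean_space \<times> 'y::euclidean_space) list \<Rightarrow> nat" where
  "cnt ws = length (filter (\<lambda>w. fst w = 0) ws)"

lemma cnt_simps [simp]: "cnt [] = 0" "cnt (us @ vs) = cnt us + cnt vs"
  "cnt (w # ws) = (if fst w = 0 then 1 else 0) + cnt ws"
  by (auto simp: cnt_def)

lemma Basis_cases:
  fixes w :: "'x::euclidean_space \<times> 'y::euclidean_space"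
  assumes "w \<in> Basis"
  obtains v where "w = (0, v)" "v \<in> Basis" "fst w = 0" | u where "w = (u, 0)" "u \<in> Basis" "fst w \<noteq> 0"
  using assms unfolding Basis_prod_def by (auto dest: nonzero_Basis)

text \<open>Two changes against \<open>symbol_class\<close>: the estimate may be restricted to a set
  \<open>S\<close>, so that homogeneous functions can be treated away from \<open>\<xi> = 0\<close>,
  and words mix both kinds of directions in any order, so that derivatives of symbols are symbols
  without reordering.\<close>

definition symb :: "('x::euclidean_space \<times> 'y::euclidean_space) set \<Rightarrow> real \<Rightarrow> ('x \<times> 'y \<Rightarrow> complex) \<Rightarrow> bool" where
  "symb S m a \<longleftrightarrow> smooth_on S a \<and> (\<forall>ws K. set ws \<subseteq> Basis \<and> compact K \<longrightarrow>
    (\<exists>C. \<forall>x\<in>K. \<forall>\<xi>. (x, \<xi>) \<in> S \<longrightarrow> cmod (D_iter ws a (x, \<xi>)) \<le> C * jb \<xi> powr (m - real (cnt ws))))"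

lemma symb_smooth: "symb S m a \<Longrightarrow> smooth_on S a"
  by (simp add: symb_def)

lemma symbE:
  assumes "symb S m a" "set ws \<subseteq> Basis" "compact K"
  shows "\<exists>C\<ge>0. \<forall>x\<in>K. \<forall>\<xi>. (x, \<xi>) \<in> S \<longrightarrow> cmod (D_iter ws a (x, \<xi>)) \<le> C * jb \<xi> powr (m - real (cnt ws))"
proof -
  obtain C where C: "\<forall>x\<in>K. \<forall>\<xi>. (x, \<xi>) \<in> S \<longrightarrow> cmod (D_iter ws a (x, \<xi>)) \<le> C * jb \<xi> powr (m - real (cnt ws))"
    using assms unfolding symb_def by meson
  have le: "C * jb \<xi> powr (m - real (cnt ws)) \<le> max C 0 * jb \<xi> powr (m - real (cnt ws))" for \<xi> :: 'b
    by (intro mult_right_mono) auto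
  show ?thesis
    by (intro exI[of _ "max C 0"] conjI ballI allI impI order_trans[OF _ le]) (use C in auto)
qed

lemma symb_bound:
  assumes "symb S m a" "compact K"
  shows "\<exists>C\<ge>0. \<forall>x\<in>K. \<forall>\<xi>. (x, \<xi>) \<in> S \<longrightarrow> cmod (a (x, \<xi>)) \<le> C * jb \<xi> powr m"
  using symbE[OF assms(1) _ assms(2), of "[]"] by simp

lemma symbE_fin:
  fixes a :: "'x::euclidean_space \<times> 'y::euclidean_space \<Rightarrow> complex"
  assumes "symb S m a" "compact K"
  shows "\<exists>C\<ge>0. \<forall>ws. set ws \<subseteq> Basis \<and> length ws \<le> M \<longrightarrow> (\<forall>x\<in>K. \<forall>\<xi>. (x, \<xi>) \<in> S \<longrightarrow>
    cmod (D_iter ws a (x, \<xi>)) \<le> C * jb \<xi> powr (m - real (cnt ws)))"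
proof -
  let ?V = "{ws. set ws \<subseteq> (Basis :: ('x \<times> 'y) set) \<and> length ws \<le> M}"
  have fin: "finite ?V" by (rule finite_lists_length_le) simp
  have "\<forall>ws\<in>?V. \<exists>C. C \<ge> 0 \<and> (\<forall>x\<in>K. \<forall>\<xi>. (x, \<xi>) \<in> S \<longrightarrow> cmod (D_iter ws a (x, \<xi>)) \<le> C * jb \<xi> powr (m - real (cnt ws)))"
    using symbE[OF assms(1) _ assms(2)] by simp
  from bchoice[OF this] obtain C where C: "\<forall>ws\<in>?V. C ws \<ge> 0 \<and> (\<forall>x\<in>K. \<forall>\<xi>. (x, \<xi>) \<in> S \<longrightarrow> cmod (D_iter ws a (x, \<xi>)) \<le> C ws * jb \<xi> powr (m - real (cnt ws)))"
    by auto
  show ?thesis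
  proof (intro exI[of _ "\<Sum>ws\<in>?V. C ws"] conjI allI impI ballI)
    show "0 \<le> (\<Sum>ws\<in>?V. C ws)" using C by (intro sum_nonneg) auto
    fix ws x \<xi> assume ws: "set ws \<subseteq> (Basis :: ('x \<times> 'y) set) \<and> length ws \<le> M" "x \<in> K" "(x, \<xi>) \<in> S"
    then have V: "ws \<in> ?V" by simp
    have le: "C ws \<le> (\<Sum>ws\<in>?V. C ws)" using C by (intro member_le_sum[OF V _ fin]) auto
    have "cmod (D_iter ws a (x, \<xi>)) \<le> C ws * jb \<xi> powr (m - real (cnt ws))"
      using C V ws by blast
    also have "\<dots> \<le> (\<Sum>ws\<in>?V. C ws) * jb \<xi> powr (m - real (cnt ws))"
      by (rule mult_right_mono[OF le]) simp
    finally show "cmod (D_iter ws a (x, \<xi>)) \<le> (\<Sum>ws\<in>?V. C ws) * jb \<xi> powr (m - real (cnt ws))" .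
  qed
qed

lemma symb_D_iter:
  assumes "symb S m a" "set vs \<subseteq> Basis"
  shows "symb S (m - real (cnt vs)) (D_iter vs a)"
  unfolding symb_def
proof (intro conjI allI impI)
  show "smooth_on S (D_iter vs a)" using assms by (auto intro: smooth_on_D_iter symb_smooth)
  fix ws :: "('a \<times> 'b) list" and K :: "'a set" assume *: "set ws \<subseteq> Basis \<and> compact K"
  have "set (ws @ vs) \<subseteq> Basis" using * assms(2) by simp
  from symbE[OF assms(1) this, of K] obtain C where "\<forall>x\<in>K. \<forall>\<xi>. (x, \<xi>) \<in> S \<longrightarrow> cmod (D_iter (ws @ vs) a (x, \<xi>)) \<le> C * jb \<xi> powr (m - real (cnt (ws @ vs)))"
    using * by blast
  then show "\<exists>C. \<forall>x\<in>K. \<forall>\<xi>. (x, \<xi>) \<in> S \<longrightarrow> cmod (D_iter ws (D_iter vs a) (x, \<xi>)) \<le> C * jb \<xi> powr (m - real (cnt vs) - real (cnt ws))"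
    by (intro exI[of _ C]) (auto simp: D_iter_append algebra_simps)
qed

lemma symb_pd:
  assumes "symb S m a" "w \<in> Basis"
  shows "symb S (m - (if fst w = 0 then 1 else 0)) (pd w a)"
  using symb_D_iter[OF assms(1), of "[w]"] assms(2) by (auto split: if_splits)

lemma symb_mono:
  assumes "symb S m a" "m \<le> m'"
  shows "symb S m' a"
  unfolding symb_def
proof (intro conjI allI impI)
  show "smooth_on S a" using assms(1) by (rule symb_smooth)
  fix ws :: "('a \<times> 'b) list" and K :: "'a set" assume *: "set ws \<subseteq> Basis \<and> compact K"
  obtain C where C: "C \<ge> 0" "\<forall>x\<in>K. \<forall>\<xi>. (x, \<xi>) \<in> S \<longrightarrow> cmod (D_iter ws a (x, \<xi>)) \<le> C * jb \<xi> powr (m - real (cnt ws))"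
    using symbE[OF assms(1), of ws K] * by blast
  have "C * jb \<xi> powr (m - real (cnt ws)) \<le> C * jb \<xi> powr (m' - real (cnt ws))" for \<xi> :: 'b
    using C(1) assms(2) by (intro mult_left_mono jb_powr_mono) auto
  then show "\<exists>C. \<forall>x\<in>K. \<forall>\<xi>. (x, \<xi>) \<in> S \<longrightarrow> cmod (D_iter ws a (x, \<xi>)) \<le> C * jb \<xi> powr (m' - real (cnt ws))"
    using C(2) order_trans by blast
qed

lemma symb_pd':
  assumes "symb S m a" "w \<in> Basis"
  shows "symb S m (pd w a)"
  by (rule symb_mono[OF symb_pd[OF assms]]) auto

lemma symb_subset: "symb S m a \<Longrightarrow> T \<subseteq> S \<Longrightarrow> symb T m a"
  unfolding symb_def by (meson smooth_on_subset subsetD)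

lemma symb_cong:
  assumes "open S" "\<And>p. p \<in> S \<Longrightarrow> a p = b p"
  shows "symb S m a \<longleftrightarrow> symb S m b"
proof -
  have "D_iter ws a p = D_iter ws b p" if "p \<in> S" for ws p
    by (rule D_iter_cong_open[OF assms that])
  moreover have "smooth_on S a \<longleftrightarrow> smooth_on S b"
    using smooth_on_cong[of S a b] assms by auto
  ultimately show ?thesis
    unfolding symb_def by (simp cong: conj_cong imp_cong)
qed

lemma symb_add:
  assumes S: "open S" and ab: "symb S m a" "symb S m b"
  shows "symb S m (\<lambda>p. a p + b p)"
  unfolding symb_def
proof (intro conjI allI impI)
  show "smooth_on S (\<lambda>p. a p + b p)" using ab by (intro smooth_on_add S symb_smooth)
  fix ws :: "('a \<times> 'b) list" and K :: "'a set" assume *: "set ws \<subseteq> Basis \<and> compact K"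
  obtain C where C: "\<And>x \<xi>. x \<in> K \<Longrightarrow> (x, \<xi>) \<in> S \<Longrightarrow> cmod (D_iter ws a (x, \<xi>)) \<le> C * jb \<xi> powr (m - real (cnt ws))"
    using symbE[OF ab(1), of ws K] * by meson
  obtain C' where C': "\<And>x \<xi>. x \<in> K \<Longrightarrow> (x, \<xi>) \<in> S \<Longrightarrow> cmod (D_iter ws b (x, \<xi>)) \<le> C' * jb \<xi> powr (m - real (cnt ws))"
    using symbE[OF ab(2), of ws K] * by meson
  show "\<exists>C. \<forall>x\<in>K. \<forall>\<xi>. (x, \<xi>) \<in> S \<longrightarrow> cmod (D_iter ws (\<lambda>p. a p + b p) (x, \<xi>)) \<le> C * jb \<xi> powr (m - real (cnt ws))"
  proof (intro exI ballI allI impI)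
    fix x \<xi> assume x: "x \<in> K" "(x, \<xi>) \<in> S"
    have "cmod (D_iter ws (\<lambda>p. a p + b p) (x, \<xi>)) \<le> C * jb \<xi> powr (m - real (cnt ws)) + C' * jb \<xi> powr (m - real (cnt ws))"
      unfolding D_iter_add[OF S symb_smooth[OF ab(1)] symb_smooth[OF ab(2)] conjunct1[OF *] x(2)]
      by (intro norm_triangle_le add_mono C C' x)
    then show "cmod (D_iter ws (\<lambda>p. a p + b p) (x, \<xi>)) \<le> (C + C') * jb \<xi> powr (m - real (cnt ws))"
      by (simp add: algebra_simps)
  qed
qed

lemma symb_mult:
  assumes S: "open S" and ab: "symb S m a" "symb S m' b"
  shows "symb S (m + m') (\<lambda>p. a p * b p)"
  unfolding symb_def
proof (intro conjI allI impI)
  show "smooth_on S (\<lambda>p. a p * b p)" using ab by (intro smooth_on_mult S symb_smooth)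
  fix ws :: "('a \<times> 'b) list" and K :: "'a set" assume *: "set ws \<subseteq> Basis \<and> compact K"
  let ?P = "\<lambda>w::'a \<times> 'b. fst w = 0"
  \<comment> \<open>Each covariable derivative is read as one factor \<open>1 / jb \<xi>\<close>,
    the form in which \<open>D_iter_mult_bound\<close> counts derivatives.\<close>
  have pw: "c * jb \<xi> powr (r - real (cnt vs)) = (c * jb \<xi> powr r) * (inverse (jb \<xi>)) ^ length (filter ?P vs)"
    for c r and \<xi> :: 'b and vs :: "('a \<times> 'b) list"
    by (simp add: powr_diff powr_realpow cnt_def field_simps)
  obtain C where C: "C \<ge> 0" "\<And>vs x \<xi>. set vs \<subseteq> Basis \<Longrightarrow> length vs \<le> length ws \<Longrightarrow> x \<in> K \<Longrightarrow> (x, \<xi>) \<in> S \<Longrightarrow>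
      cmod (D_iter vs a (x, \<xi>)) \<le> C * jb \<xi> powr (m - real (cnt vs))"
    using symbE_fin[OF ab(1), of K "length ws"] * by meson
  obtain C' where C': "C' \<ge> 0" "\<And>vs x \<xi>. set vs \<subseteq> Basis \<Longrightarrow> length vs \<le> length ws \<Longrightarrow> x \<in> K \<Longrightarrow> (x, \<xi>) \<in> S \<Longrightarrow>
      cmod (D_iter vs b (x, \<xi>)) \<le> C' * jb \<xi> powr (m' - real (cnt vs))"
    using symbE_fin[OF ab(2), of K "length ws"] * by meson
  show "\<exists>C. \<forall>x\<in>K. \<forall>\<xi>. (x, \<xi>) \<in> S \<longrightarrow> cmod (D_iter ws (\<lambda>p. a p * b p) (x, \<xi>)) \<le> C * jb \<xi> powr (m + m' - real (cnt ws))"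
  proof (intro exI ballI allI impI)
    fix x \<xi> assume x: "x \<in> K" "(x, \<xi>) \<in> S"
    have "cmod (D_iter ws (\<lambda>p. a p * b p) (x, \<xi>)) \<le> 2 ^ length ws * (C * jb \<xi> powr m) * (C' * jb \<xi> powr m') * (inverse (jb \<xi>)) ^ length (filter ?P ws)"
    proof (rule D_iter_mult_bound[OF S x(2) _ symb_smooth[OF ab(1)] symb_smooth[OF ab(2)]])
      show "cmod (D_iter vs a (x, \<xi>)) \<le> C * jb \<xi> powr m * inverse (jb \<xi>) ^ length (filter ?P vs)"
        if "set vs \<subseteq> Basis" "length vs \<le> length ws" for vs
        using C(2)[OF that x] unfolding pw .
      show "cmod (D_iter vs b (x, \<xi>)) \<le> C' * jb \<xi> powr m' * inverse (jb \<xi>) ^ length (filter ?P vs)"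
        if "set vs \<subseteq> Basis" "length vs \<le> length ws" for vs
        using C'(2)[OF that x] unfolding pw .
    qed (use * in auto)
    then show "cmod (D_iter ws (\<lambda>p. a p * b p) (x, \<xi>)) \<le> (2 ^ length ws * C * C') * jb \<xi> powr (m + m' - real (cnt ws))"
      unfolding pw by (simp add: powr_add mult_ac)
  qed
qed

lemma symb_fst:
  assumes "smooth_on UNIV f"
  shows "symb UNIV 0 (\<lambda>(x, \<xi>). f x)"
proof -
  \<comment> \<open>Covariable derivatives annihilate functions of \<open>x\<close> altogether. The
    induction therefore records that \<open>g\<close> is 0 as soon as one has occurred, and then any
    decay is available.\<close>
  have *: "set ws \<subseteq> Basis \<Longrightarrow> \<exists>g. smooth_on UNIV g \<and> D_iter ws (\<lambda>(x, \<xi>). f x) = (\<lambda>(x::'a, \<xi>::'b). g x) \<and> (cnt ws > 0 \<longrightarrow> g = (\<lambda>_. 0))" for ws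
  proof (induction ws)
    case Nil
    then show ?case using assms by auto
  next
    case (Cons w ws)
    then obtain g where g: "smooth_on UNIV g" "D_iter ws (\<lambda>(x, \<xi>). f x) = (\<lambda>(x::'a, \<xi>::'b). g x)" "cnt ws > 0 \<longrightarrow> g = (\<lambda>_. 0)"
      by auto
    have pdw: "pd w (\<lambda>(x::'a, \<xi>::'b). g x) = (\<lambda>(x, \<xi>). pd (fst w) g x)"
      using pd_compose_affine'[OF bounded_linear_fst, of g _ 0 w] smooth_on_diff[OF g(1)]
      by (auto simp: case_prod_beta')
    have pd0: "pd 0 g = (\<lambda>_. 0)"
      using pd_dir[OF smooth_on_diff[OF g(1)], of _ 0] by auto
    have "w \<in> Basis" using Cons.prems by simp
    then show ?case
      by (cases rule: Basis_cases)
        (use g pdw pd0 in \<open>auto simp: intro!: exI[of _ "pd (fst w) g"] smooth_on_pd\<close>)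
  qed
  show ?thesis
    unfolding symb_def
  proof (intro conjI allI impI)
    show "smooth_on UNIV (\<lambda>(x::'a, \<xi>::'b). f x)"
      using smooth_on_compose_linear[OF bounded_linear_fst assms] by (simp add: case_prod_beta')
    fix ws :: "('a \<times> 'b) list" and K :: "'a set" assume K: "set ws \<subseteq> Basis \<and> compact K"
    then obtain g where g: "smooth_on UNIV g" "D_iter ws (\<lambda>(x, \<xi>). f x) = (\<lambda>(x::'a, \<xi>::'b). g x)" "cnt ws > 0 \<longrightarrow> g = (\<lambda>_. 0)"
      using * by blast
    have "bounded (g ` K)"
      using K smooth_on_imp_continuous_on[OF g(1)]
      by (intro compact_imp_bounded compact_continuous_image) (auto intro: continuous_on_subset)
    then obtain C where C: "\<And>x. x \<in> K \<Longrightarrow> cmod (g x) \<le> C" unfolding bounded_iff by auto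
    then have "\<forall>x\<in>K. cmod (g x) \<le> C * jb \<xi> powr (0 - real (cnt ws))" for \<xi> :: 'b
      using g(3) order_trans[OF norm_ge_zero C] by (cases "cnt ws = 0") auto
    then show "\<exists>C. \<forall>x\<in>K. \<forall>\<xi>. (x, \<xi>) \<in> UNIV \<longrightarrow> cmod (D_iter ws (\<lambda>(x, \<xi>). f x) (x, \<xi>)) \<le> C * jb \<xi> powr (0 - real (cnt ws))"
      unfolding g(2) by (intro exI[of _ C]) auto
  qed
qed

lemma symb_const: "symb UNIV 0 (\<lambda>p. c)"
  using symb_fst[of "\<lambda>_. c"] by (simp add: case_prod_beta')

lemma symb_cmult: 
  assumes "open S" "symb S m a"
  shows "symb S m (\<lambda>p. c * a p)"
  using symb_mult[OF assms(1) symb_subset[OF symb_const] assms(2)] by simp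

lemma symb_zero: "symb S m (\<lambda>p. 0)"
  unfolding symb_def by (auto intro!: exI[of _ 0])

lemma symb_sum:
  assumes "open S" "\<And>i. i \<in> I \<Longrightarrow> symb S m (a i)"
  shows "symb S m (\<lambda>p. \<Sum>i\<in>I. a i p)"
  using assms(2)
proof (induction I rule: infinite_finite_induct)
  case (insert i I)
  then show ?case by (auto intro!: symb_add assms(1))
qed (auto intro: symb_zero)

text \<open>Near bounded \<open>\<xi>\<close> the symbol estimates hold by compactness.\<close>

lemma symb_from_region:
  fixes a :: "'x::euclidean_space \<times> 'y::euclidean_space \<Rightarrow> complex"
  assumes a: "smooth_on UNIV a" and r: "symb (UNIV \<times> {\<xi>. norm \<xi> > R}) m a"
  shows "symb UNIV m a"
  unfolding symb_def
proof (intro conjI allI impI a)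
  fix ws :: "('x \<times> 'y) list" and K :: "'x set" assume K: "set ws \<subseteq> Basis \<and> compact K"
  obtain C where C: "C \<ge> 0" "\<And>x \<xi>. x \<in> K \<Longrightarrow> (x, \<xi>) \<in> UNIV \<times> {\<xi>. norm \<xi> > R} \<Longrightarrow> cmod (D_iter ws a (x, \<xi>)) \<le> C * jb \<xi> powr (m - real (cnt ws))"
    using symbE[OF r, of ws K] K by meson
  obtain B where B: "B \<ge> 0" "\<And>p. p \<in> K \<times> cball 0 R \<Longrightarrow> cmod (D_iter ws a p) \<le> B"
  proof -
    have "compact (K \<times> cball (0::'y) R)" using K by (intro compact_Times compact_cball) auto
    from D_iter_bounded_compact[OF a this, of "length ws"] show ?thesis using K that by blast
  qed
  let ?s = "m - real (cnt ws)"
  let ?B = "B * (1 + \<bar>R\<bar>) powr \<bar>?s\<bar>"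
  show "\<exists>C. \<forall>x\<in>K. \<forall>\<xi>. (x, \<xi>) \<in> UNIV \<longrightarrow> cmod (D_iter ws a (x, \<xi>)) \<le> C * jb \<xi> powr ?s"
  proof (intro exI ballI allI impI)
    fix x \<xi> assume x: "x \<in> K"
    show "cmod (D_iter ws a (x, \<xi>)) \<le> (C + ?B) * jb \<xi> powr ?s"
    proof (cases "norm \<xi> > R")
      case True
      then have "cmod (D_iter ws a (x, \<xi>)) \<le> C * jb \<xi> powr ?s" using C(2)[OF x, of \<xi>] by simp
      also have "\<dots> \<le> (C + ?B) * jb \<xi> powr ?s" using B(1) by (intro mult_right_mono) auto
      finally show ?thesis .
    next
      case False
      have "cmod (D_iter ws a (x, \<xi>)) \<le> B * 1" using B(2)[of "(x, \<xi>)"] x False by auto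
      also have "1 \<le> (1 + \<bar>R\<bar>) powr \<bar>?s\<bar> * jb \<xi> powr ?s"
      proof -
        have "jb \<xi> \<le> 1 + \<bar>R\<bar>" using jb_le_norm[of \<xi>] False by linarith
        then have "jb \<xi> powr \<bar>?s\<bar> \<le> (1 + \<bar>R\<bar>) powr \<bar>?s\<bar>" by (intro powr_mono2) auto
        then have "jb \<xi> powr \<bar>?s\<bar> * jb \<xi> powr (- \<bar>?s\<bar>) \<le> (1 + \<bar>R\<bar>) powr \<bar>?s\<bar> * jb \<xi> powr ?s"
          by (intro mult_mono jb_powr_mono) auto
        then show ?thesis by (simp flip: powr_add)
      qed
      then have "B * 1 \<le> B * ((1 + \<bar>R\<bar>) powr \<bar>?s\<bar> * jb \<xi> powr ?s)" by (rule mult_left_mono) (rule B(1))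
      also have "\<dots> \<le> (C + ?B) * jb \<xi> powr ?s" using C(1) by (simp add: algebra_simps)
      finally show ?thesis .
    qed
  qed
qed

lemma open_region: "open (UNIV \<times> {\<xi>::'y::real_normed_vector. norm \<xi> > R} :: ('x::topological_space \<times> 'y) set)"
  by (intro open_Times open_UNIV open_Collect_less continuous_intros)

text \<open>Needed where the covariable is shifted by a parameter, as in
  \<open>p (x, \<xi> + \<eta>)\<close> with \<open>\<xi>\<close> a parameter. Over compact sets of
  \<open>y\<close> the shift by \<open>B y\<close> costs a constant by Peetre's inequality; a
  derivative in \<open>y\<close> that reaches the covariable through \<open>B\<close> lowers the
  order more than required.\<close>

lemma symb_pullback:
  fixes a :: "'x::euclidean_space \<times> 'e::euclidean_space \<Rightarrow> complex" and A :: "'y::euclidean_space \<Rightarrow> 'x"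
  assumes A: "bounded_linear A" and B: "bounded_linear B" and a: "symb UNIV m a"
  shows "symb UNIV m (\<lambda>(y, \<eta>). a (A y, B y + \<eta>))"
proof -
  let ?h = "\<lambda>p::'y \<times> 'e. (A (fst p), B (fst p) + snd p)"
  have bl: "bounded_linear ?h"
    by (intro bounded_linear_intros bounded_linear_compose[OF A] bounded_linear_compose[OF B])
  have eq: "(\<lambda>(y, \<eta>). a (A y, B y + \<eta>)) = (\<lambda>p. a (?h p))" for a :: "'x \<times> 'e \<Rightarrow> complex" by auto
  have main: "\<exists>C. \<forall>y\<in>K. \<forall>\<eta>. cmod (D_iter ws (\<lambda>p. a (?h p)) (y, \<eta>)) \<le> C * jb \<eta> powr (m - real (cnt ws))"
    if "set ws \<subseteq> Basis" "compact K" "symb UNIV m a" for ws K m and a :: "'x \<times> 'e \<Rightarrow> complex"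
    using that(1,3)
  proof (induction ws arbitrary: m a rule: rev_induct)
    case Nil
    have AK: "compact (A ` K)" by (intro compact_continuous_image linear_continuous_on A that)
    have BK: "compact (B ` K)" by (intro compact_continuous_image linear_continuous_on B that)
    obtain C where C: "C \<ge> 0" "\<And>x \<xi>. x \<in> A ` K \<Longrightarrow> cmod (a (x, \<xi>)) \<le> C * jb \<xi> powr m"
      using symb_bound[OF Nil(2) AK] by auto
    obtain b where b: "\<And>y. y \<in> K \<Longrightarrow> norm (B y) \<le> b"
      using compact_imp_bounded[OF BK] unfolding bounded_iff by auto
    show ?case
    proof (intro exI ballI allI)
      fix y \<eta> assume y: "y \<in> K"
      have "cmod (a (?h (y, \<eta>))) \<le> C * jb (\<eta> + B y) powr m"
        using C(2)[of "A y" "B y + \<eta>"] y by (simp add: add.commute)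
      also have "\<dots> \<le> C * (2 powr \<bar>m\<bar> * jb \<eta> powr m * jb (B y) powr \<bar>m\<bar>)"
        by (intro mult_left_mono peetre C)
      also have "\<dots> \<le> C * (2 powr \<bar>m\<bar> * jb \<eta> powr m * (1 + b) powr \<bar>m\<bar>)"
        using b[OF y] jb_le_norm[of "B y"] by (intro mult_left_mono powr_mono2 C mult_nonneg_nonneg) auto
      finally show "cmod (D_iter [] (\<lambda>p. a (?h p)) (y, \<eta>)) \<le> (C * 2 powr \<bar>m\<bar> * (1 + b) powr \<bar>m\<bar>) * jb \<eta> powr (m - real (cnt ([]::('y \<times> 'e) list)))"
        by (simp add: mult_ac)
    qed
  next
    case (snoc w ws)
    have w: "w \<in> Basis" and ws: "set ws \<subseteq> Basis" using snoc.prems by auto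
    let ?c = "\<lambda>b. complex_of_real (?h w \<bullet> b)"
    have sa: "smooth_on UNIV a" using snoc.prems(2) by (rule symb_smooth)
    have pd: "pd w (\<lambda>p. a (?h p)) = (\<lambda>p. \<Sum>b\<in>Basis. ?c b * pd b a (?h p))"
      using pd_compose_affine[OF bl, of a _ 0 w] smooth_on_diff[OF sa] by auto
    have sm: "smooth_on UNIV (\<lambda>p. pd b a (?h p))" if "b \<in> Basis" for b
      by (rule smooth_on_compose_linear[OF bl smooth_on_pd[OF sa that]])
    have D: "D_iter (ws @ [w]) (\<lambda>p. a (?h p)) q = (\<Sum>b\<in>Basis. ?c b * D_iter ws (\<lambda>p. pd b a (?h p)) q)" for q
    proof -
      have "D_iter (ws @ [w]) (\<lambda>p. a (?h p)) q = D_iter ws (\<lambda>p. \<Sum>b\<in>Basis. ?c b * pd b a (?h p)) q"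
        by (simp add: D_iter_append pd)
      also have "\<dots> = (\<Sum>b\<in>Basis. D_iter ws (\<lambda>p. ?c b * pd b a (?h p)) q)"
        using sm by (intro D_iter_sum[of UNIV]) (auto intro!: smooth_on_cmult ws[THEN subsetD])
      also have "\<dots> = (\<Sum>b\<in>Basis. ?c b * D_iter ws (\<lambda>p. pd b a (?h p)) q)"
        using sm ws by (intro sum.cong refl D_iter_cmult[of UNIV]) auto
      finally show ?thesis .
    qed
    have "\<exists>C. \<forall>y\<in>K. \<forall>\<eta>. cmod (?c b * D_iter ws (\<lambda>p. pd b a (?h p)) (y, \<eta>)) \<le> C * jb \<eta> powr (m - real (cnt (ws @ [w])))"
      if b: "b \<in> Basis" for b
    proof (cases "fst w = 0 \<and> fst b \<noteq> 0")
      case True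
      \<comment> \<open>A covariable direction is mapped to a covariable direction, so no term
        arises in which a derivative in \<open>\<eta>\<close> would fail to lower the order.\<close>
      then have "?h w \<bullet> b = 0" using w b A B
        by (auto elim!: Basis_cases simp: linear_0[OF bounded_linear.linear[OF A]] linear_0[OF bounded_linear.linear[OF B]])
      then show ?thesis by (intro exI[of _ 0]) simp
    next
      case False
      have "symb UNIV (m - (if fst w = 0 then 1 else 0)) (pd b a)"
        by (rule symb_mono[OF symb_pd[OF snoc.prems(2) b]]) (use False in auto)
      from snoc.IH[OF ws this] obtain C where C: "\<forall>y\<in>K. \<forall>\<eta>. cmod (D_iter ws (\<lambda>p. pd b a (?h p)) (y, \<eta>)) \<le> C * jb \<eta> powr (m - (if fst w = 0 then 1 else 0) - real (cnt ws))"
        by blast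
      show ?thesis
      proof (intro exI ballI allI)
        fix y \<eta> assume y: "y \<in> K"
        have "cmod (?c b * D_iter ws (\<lambda>p. pd b a (?h p)) (y, \<eta>)) \<le> cmod (?c b) * (C * jb \<eta> powr (m - (if fst w = 0 then 1 else 0) - real (cnt ws)))"
          unfolding norm_mult using C y by (intro mult_left_mono) auto
        also have "m - (if fst w = 0 then 1 else 0) - real (cnt ws) = m - real (cnt (ws @ [w]))" by simp
        finally show "cmod (?c b * D_iter ws (\<lambda>p. pd b a (?h p)) (y, \<eta>)) \<le> (cmod (?c b) * C) * jb \<eta> powr (m - real (cnt (ws @ [w])))"
          by (simp add: mult_ac)
      qed
    qed
    then have "\<forall>b\<in>Basis. \<exists>C. \<forall>y\<in>K. \<forall>\<eta>. cmod (?c b * D_iter ws (\<lambda>p. pd b a (?h p)) (y, \<eta>)) \<le> C * jb \<eta> powr (m - real (cnt (ws @ [w])))"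
      by blast
    from bchoice[OF this] obtain C where C: "\<And>b y \<eta>. b \<in> Basis \<Longrightarrow> y \<in> K \<Longrightarrow> cmod (?c b * D_iter ws (\<lambda>p. pd b a (?h p)) (y, \<eta>)) \<le> C b * jb \<eta> powr (m - real (cnt (ws @ [w])))"
      by blast
    show ?case
    proof (intro exI ballI allI)
      fix y \<eta> assume y: "y \<in> K"
      have "cmod (D_iter (ws @ [w]) (\<lambda>p. a (?h p)) (y, \<eta>)) \<le> (\<Sum>b\<in>Basis. C b * jb \<eta> powr (m - real (cnt (ws @ [w]))))"
        unfolding D by (intro order_trans[OF norm_sum] sum_mono C y)
      then show "cmod (D_iter (ws @ [w]) (\<lambda>p. a (?h p)) (y, \<eta>)) \<le> (\<Sum>b\<in>Basis. C b) * jb \<eta> powr (m - real (cnt (ws @ [w])))"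
        by (simp add: sum_distrib_right)
    qed
  qed
  show ?thesis
    unfolding symb_def eq
    using smooth_on_compose_linear[OF bl symb_smooth[OF a]] main[OF _ _ a] by auto
qed

lemma symb_pullback_fst:
  fixes a :: "'x::euclidean_space \<times> 'e::euclidean_space \<Rightarrow> complex" and A :: "'y::euclidean_space \<Rightarrow> 'x"
  assumes A: "bounded_linear A" and a: "symb UNIV m a"
  shows "symb UNIV m (\<lambda>(y, \<eta>). a (A y, \<eta>))"
  using symb_pullback[OF A bounded_linear_zero a] by simp

lemma symbol_class_symb: "a \<in> symbol_class m \<longleftrightarrow> symb UNIV m a"
proof
  assume a: "a \<in> symbol_class m"
  then have sa: "smooth_on UNIV a" by (simp add: symbol_class_def)
  show "symb UNIV m a"
    unfolding symb_def
  proof (intro conjI allI impI sa)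
    fix ws :: "('a \<times> 'b) list" and K :: "'a set" assume K: "set ws \<subseteq> Basis \<and> compact K"
    let ?P = "\<lambda>w::'a \<times> 'b. fst w \<noteq> 0"
    let ?\<alpha> = "map fst (filter ?P ws)" and ?\<beta> = "map snd (filter (\<lambda>w. \<not> ?P w) ws)"
    have 1: "w = (fst w, 0)" "fst w \<in> Basis" if "w \<in> set ws" "?P w" for w
      using Basis_cases[of w] K that by (metis fst_conv subsetD)+
    have 2: "w = (0, snd w)" "snd w \<in> Basis" if "w \<in> set ws" "\<not> ?P w" for w
      using Basis_cases[of w] K that by (metis snd_conv subsetD)+
    have "map (\<lambda>x. (fst x, 0)) (filter ?P ws) = filter ?P ws"
      by (rule map_idI) (simp add: 1(1)[symmetric])
    then have e1: "filter ?P ws = map (\<lambda>u. (u, 0)) ?\<alpha>" by (simp add: comp_def)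
    have "map (\<lambda>x. (0, snd x)) (filter (\<lambda>w. \<not> ?P w) ws) = filter (\<lambda>w. \<not> ?P w) ws"
      by (rule map_idI) (simp add: 2(1)[symmetric])
    then have e2: "filter (\<lambda>w. \<not> ?P w) ws = map (\<lambda>v. (0, v)) ?\<beta>" by (simp add: comp_def)
    have l: "length ?\<beta> = cnt ws" by (simp add: cnt_def)
    have "set ?\<alpha> \<subseteq> Basis" "set ?\<beta> \<subseteq> Basis" using 1 2 by auto
    then obtain C where C: "\<forall>x\<in>K. \<forall>\<theta>. cmod (D_iter (map (\<lambda>u. (u, 0)) ?\<alpha> @ map (\<lambda>v. (0, v)) ?\<beta>) a (x, \<theta>))
          \<le> C * jb \<theta> powr (m - real (length ?\<beta>))"
      using a K unfolding symbol_class_def by blast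
    have "D_iter ws a p = D_iter (map (\<lambda>u. (u, 0)) ?\<alpha> @ map (\<lambda>v. (0, v)) ?\<beta>) a p" for p
      unfolding e1[symmetric] e2[symmetric]
      by (rule D_iter_partition[OF open_UNIV sa]) (use K in auto)
    then show "\<exists>C. \<forall>x\<in>K. \<forall>\<xi>. (x, \<xi>) \<in> UNIV \<longrightarrow> cmod (D_iter ws a (x, \<xi>)) \<le> C * jb \<xi> powr (m - real (cnt ws))"
      using C unfolding l by auto
  qed
next
  assume a: "symb UNIV m a"
  have c: "set \<alpha> \<subseteq> Basis \<Longrightarrow> cnt (map (\<lambda>u. (u, 0)) \<alpha> @ map (\<lambda>v. (0, v)) \<beta>) = length \<beta>" for \<alpha> :: "'a list" and \<beta> :: "'b list"
  proof (induction \<alpha>)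
    case Nil
    show ?case by (induction \<beta>) auto
  qed (auto dest: nonzero_Basis)
  show "a \<in> symbol_class m"
    unfolding symbol_class_def
  proof (intro CollectI conjI allI impI)
    show "smooth_on UNIV a" using a by (rule symb_smooth)
    fix \<alpha> :: "'a list" and \<beta> :: "'b list" and K :: "'a set"
    assume *: "set \<alpha> \<subseteq> Basis \<and> set \<beta> \<subseteq> Basis \<and> compact K"
    then have "set (map (\<lambda>u. (u, 0)) \<alpha> @ map (\<lambda>v. (0, v)) \<beta>) \<subseteq> Basis" by auto
    moreover have l: "cnt (map (\<lambda>u. (u, 0)) \<alpha> @ map (\<lambda>v. (0, v)) \<beta>) = length \<beta>"
      using c * by blast
    ultimately show "\<exists>C. \<forall>x\<in>K. \<forall>\<theta>. cmod (D_iter (map (\<lambda>u. (u, 0)) \<alpha> @ map (\<lambda>v. (0, v)) \<beta>) a (x, \<theta>))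
          \<le> C * jb \<theta> powr (m - real (length \<beta>))"
      using symbE[OF a, of "map (\<lambda>u. (u, 0)) \<alpha> @ map (\<lambda>v. (0, v)) \<beta>" K, unfolded l] * by blast
  qed
qed


section \<open>Oscillatory integrals\<close>

lemma D_iter_affine_Basis:
  fixes h :: "'a::euclidean_space \<Rightarrow> 'b::euclidean_space"
  assumes h: "bounded_linear h" "\<And>v. v \<in> Basis \<Longrightarrow> h v \<in> Basis" and F: "smooth_on UNIV F"
  shows "set vs \<subseteq> Basis \<Longrightarrow> D_iter vs (\<lambda>z. F (h z + c)) z = D_iter (map h vs) F (h z + c)"
proof (induction vs arbitrary: z)
  case (Cons v vs)
  have "D_iter vs (\<lambda>z. F (h z + c)) = (\<lambda>z. D_iter (map h vs) F (h z + c))"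
    using Cons by auto
  moreover have "D_iter (map h vs) F differentiable at (h z + c)"
    using Cons.prems h(2) by (intro smooth_on_diff[OF smooth_on_D_iter[OF F]]) auto
  ultimately show ?case by (simp add: pd_compose_affine'[OF h(1)])
qed simp

text \<open>\<open>t\<close> is the parameter, \<open>z\<close> the space variable to be integrated
  out and \<open>\<eta>\<close> the covariable. As for \<open>zsupp\<close>, the support in
  \<open>z\<close> is compact locally uniformly in \<open>t\<close>, and here also uniformly in
  \<open>\<eta>\<close>.\<close>

definition amp :: "real \<Rightarrow> (('t::euclidean_space \<times> 'a::euclidean_space) \<times> 'a \<Rightarrow> complex) \<Rightarrow> bool" where
  "amp m b \<longleftrightarrow> symb UNIV m b \<and>
    (\<forall>K. compact K \<longrightarrow> (\<exists>L. compact L \<and> (\<forall>t\<in>K. \<forall>z. z \<notin> L \<longrightarrow> (\<forall>\<eta>. b ((t, z), \<eta>) = 0))))"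

lemma ampD: "amp m b \<Longrightarrow> symb UNIV m b" "amp m b \<Longrightarrow> smooth_on UNIV b"
  by (auto simp: amp_def intro: symb_smooth)

lemma amp_supp:
  assumes "amp m b" "compact K"
  shows "\<exists>L. compact L \<and> (\<forall>t\<in>K. \<forall>z. z \<notin> L \<longrightarrow> (\<forall>\<eta>. b ((t, z), \<eta>) = 0))"
  using assms by (simp add: amp_def)

lemma amp_section:
  assumes "amp m b"
  shows "smooth_on UNIV (\<lambda>z. b ((t, z), \<xi>))"
    "\<exists>L. compact L \<and> (\<forall>z. z \<notin> L \<longrightarrow> b ((t, z), \<xi>) = 0)"
proof -
  show "smooth_on UNIV (\<lambda>z. b ((t, z), \<xi>))"
    by (rule smooth_on_section2[OF smooth_on_section1[OF ampD(2)[OF assms], of \<xi>], of t])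
  show "\<exists>L. compact L \<and> (\<forall>z. z \<notin> L \<longrightarrow> b ((t, z), \<xi>) = 0)"
    using amp_supp[OF assms compact_sing[of t]] by blast
qed

lemma amp_pd:
  assumes b: "amp m b" and w: "w \<in> Basis"
  shows "amp m (pd ((w, 0), 0) b)"
  unfolding amp_def
proof (intro conjI allI impI)
  show "symb UNIV m (pd ((w, 0), 0) b)" using symb_pd'[OF ampD(1)[OF b], of "((w, 0), 0)"] w by simp
  fix K :: "'a set" assume K: "compact K"
  let ?K = "{x + y |x y. x \<in> K \<and> y \<in> cball 0 1}"
  have "compact ?K" by (rule compact_sums[OF K compact_cball])
  from amp_supp[OF b this] obtain L where L: "compact L" "\<And>t z \<eta>. t \<in> ?K \<Longrightarrow> z \<notin> L \<Longrightarrow> b ((t, z), \<eta>) = 0"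
    by blast
  have "pd ((w, 0), 0) b ((t, z), \<eta>) = 0" if "t \<in> K" "z \<notin> L" for t z \<eta>
  proof -
    have "pd ((w, 0), 0) b ((t, z), \<eta>) = pd ((w, 0), 0) (\<lambda>_. 0) ((t, z), \<eta>)"
    proof (rule pd_cong_open[of "(ball t 1 \<times> (- L)) \<times> UNIV"])
      show "open ((ball t 1 \<times> (- L)) \<times> UNIV)" using compact_imp_closed[OF L(1)] by (intro open_Times) auto
      fix y assume y: "y \<in> (ball t 1 \<times> - L) \<times> (UNIV :: 'b set)"
      obtain t' z' \<eta>' where y': "y = ((t', z'), \<eta>')" by (cases y) auto
      have "t' = t + (t' - t)" by simp
      moreover have "t' - t \<in> cball 0 1" using y y' by (auto simp: dist_norm norm_minus_commute)
      ultimately have "t' \<in> ?K" using that(1) by blast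
      then show "b y = 0" using L(2) y y' by auto
    qed (use that in auto)
    then show ?thesis by simp
  qed
  then show "\<exists>L. compact L \<and> (\<forall>t\<in>K. \<forall>z. z \<notin> L \<longrightarrow> (\<forall>\<eta>. pd ((w, 0), 0) b ((t, z), \<eta>) = 0))"
    using L(1) by blast
qed

text \<open>The covariable \<open>\<xi>\<close> of the amplitude and the variable
  \<open>\<eta>\<close> of the transform are kept apart: growth of order \<open>m\<close> in the
  one, decay of any order \<open>s\<close> in the other. On the diagonal this makes oscillatory
  integrals converge; off the diagonal it drives the estimates of \<open>composition\<close> and
  \<open>comp_rem_bound\<close>.\<close>

lemma ft_amp_decay:
  fixes b :: "('t::euclidean_space \<times> 'a::euclidean_space) \<times> 'a \<Rightarrow> complex"
  assumes b: "amp m b" and K: "compact K"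
  shows "\<exists>C\<ge>0. \<forall>t\<in>K. \<forall>\<xi> \<eta>. cmod (ft (\<lambda>z. b ((t, z), \<xi>)) \<eta>) \<le> C * jb \<xi> powr m * jb \<eta> powr s"
proof -
  obtain M :: nat where M: "- s \<le> real M" using real_arch_simple by blast
  obtain L where L: "compact L" "\<And>t z \<eta>. t \<in> K \<Longrightarrow> z \<notin> L \<Longrightarrow> b ((t, z), \<eta>) = 0"
    using amp_supp[OF b K] by blast
  obtain C where C: "C \<ge> 0" "\<And>ws p \<xi>. set ws \<subseteq> Basis \<Longrightarrow> length ws \<le> M \<Longrightarrow> p \<in> K \<times> L \<Longrightarrow>
      cmod (D_iter ws b (p, \<xi>)) \<le> C * jb \<xi> powr (m - real (cnt ws))"
    using symbE_fin[OF ampD(1)[OF b] compact_Times[OF K L(1)], of M] by auto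
  let ?C = "(1 + real DIM('a)) ^ M * C * measure lborel L"
  have "cmod (ft (\<lambda>z. b ((t, z), \<xi>)) \<eta>) \<le> ?C * jb \<xi> powr m * jb \<eta> powr s" if t: "t \<in> K" for t \<xi> \<eta>
  proof -
    let ?g = "\<lambda>z. b ((t, z), \<xi>)"
    have Lg: "?g z = 0" if "z \<notin> L" for z using L(2)[OF t that] .
    have bl: "bounded_linear (\<lambda>z::'a. ((0::'t, z), 0::'a))" by (intro bounded_linear_intros)
    have D: "D_iter vs ?g z = D_iter (map (\<lambda>v. ((0, v), 0)) vs) b ((t, z), \<xi>)" if "set vs \<subseteq> Basis" for vs z
      using D_iter_affine_Basis[OF bl _ ampD(2)[OF b], of vs "((t, 0), \<xi>)" z] that by simp
    have "jb \<eta> ^ M * cmod (ft ?g \<eta>) \<le> (1 + real DIM('a)) ^ M * (C * jb \<xi> powr m) * measure lborel L"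
    proof (rule ft_decay[OF amp_section(1)[OF b] L(1) Lg])
      fix vs and z :: 'a assume vs: "set vs \<subseteq> (Basis :: 'a set)" "length vs \<le> M"
      show "cmod (D_iter vs ?g z) \<le> C * jb \<xi> powr m"
      proof (cases "z \<in> L")
        case True
        let ?ws = "map (\<lambda>v. ((0::'t, v), 0::'a)) vs"
        have "cmod (D_iter ?ws b ((t, z), \<xi>)) \<le> C * jb \<xi> powr (m - real (cnt ?ws))"
          by (rule C(2)) (use vs t True in auto)
        also have "\<dots> \<le> C * jb \<xi> powr m" by (intro mult_left_mono jb_powr_mono C(1)) auto
        finally show ?thesis unfolding D[OF vs(1)] .
      next
        case False
        then show ?thesis using D_iter_zero_outside[OF L(1) Lg, where x = z and vs = vs] C(1) by simp
      qed
    qed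
    then have "cmod (ft ?g \<eta>) \<le> ?C * jb \<xi> powr m * jb \<eta> powr (- real M)"
      by (simp add: powr_minus powr_realpow field_simps)
    also have "\<dots> \<le> ?C * jb \<xi> powr m * jb \<eta> powr s"
      using M C(1) by (intro mult_left_mono jb_powr_mono) auto
    finally show ?thesis .
  qed
  then show ?thesis using C(1) by (intro exI[of _ ?C]) auto
qed

lemma smooth_on_ft_amp:
  fixes b :: "('t::euclidean_space \<times> 'a::euclidean_space) \<times> 'a \<Rightarrow> complex"
  assumes b: "amp m b"
  shows "smooth_on UNIV (\<lambda>((t, \<xi>), \<eta>). ft (\<lambda>z. b ((t, z), \<xi>)) \<eta>)"
    and "w \<in> Basis \<Longrightarrow> pd ((w, 0), 0) (\<lambda>((t, \<xi>), \<eta>). ft (\<lambda>z. b ((t, z), \<xi>)) \<eta>) ((t, \<xi>), \<eta>) =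
      ft (\<lambda>z. pd ((w, 0), 0) b ((t, z), \<xi>)) \<eta>"
proof -
  let ?f = "\<lambda>p :: (('t \<times> 'a) \<times> 'a) \<times> 'a. ph (snd p) (snd (fst p)) * b ((fst (fst (fst p)), snd p), snd (fst (fst p)))"
  have bl: "bounded_linear (\<lambda>p :: (('t \<times> 'a) \<times> 'a) \<times> 'a. ((fst (fst (fst p)), snd p), snd (fst (fst p))))"
    "bounded_linear (\<lambda>p :: (('t \<times> 'a) \<times> 'a) \<times> 'a. (snd p, snd (fst p)))"
    by (intro bounded_linear_intros)+
  have s1: "smooth_on UNIV (\<lambda>p :: (('t \<times> 'a) \<times> 'a) \<times> 'a. ph (snd p) (snd (fst p)))"
    using smooth_on_compose_linear[OF bl(2) smooth_on_ph] by simp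
  have s2: "smooth_on UNIV (\<lambda>p :: (('t \<times> 'a) \<times> 'a) \<times> 'a. b ((fst (fst (fst p)), snd p), snd (fst (fst p))))"
    by (rule smooth_on_compose_linear[OF bl(1) ampD(2)[OF b]])
  have f: "smooth_on UNIV ?f" by (intro smooth_on_mult open_UNIV s1 s2)
  have z: "zsupp ?f"
    unfolding zsupp_def
  proof (intro allI impI)
    fix K :: "(('t \<times> 'a) \<times> 'a) set" assume "compact K"
    then have "compact ((\<lambda>p. fst (fst p)) ` K)" by (intro compact_continuous_image continuous_intros)
    from amp_supp[OF b this] show "\<exists>L. compact L \<and> (\<forall>t\<in>K. \<forall>z. z \<notin> L \<longrightarrow> ?f (t, z) = 0)" by fastforce
  qed
  have eq: "(\<lambda>((t, \<xi>), \<eta>). ft (\<lambda>z. b ((t, z), \<xi>)) \<eta>) = (\<lambda>q. LINT z|lborel. ?f (q, z))"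
    by (auto simp: ft_def)
  show "smooth_on UNIV (\<lambda>((t, \<xi>), \<eta>). ft (\<lambda>z. b ((t, z), \<xi>)) \<eta>)"
    unfolding eq by (rule smooth_on_integral[OF f z])
  assume w: "w \<in> Basis"
  have A: "pd (((w, 0), 0), 0) ?f (((t, \<xi>), \<eta>), z) = ph z \<eta> * pd ((w, 0), 0) b ((t, z), \<xi>)" for z
  proof -
    have "pd (((w, 0), 0), 0) (\<lambda>p :: (('t \<times> 'a) \<times> 'a) \<times> 'a. ph (snd p) (snd (fst p))) (((t, \<xi>), \<eta>), z) = 0"
      using pd_compose_affine'[OF bl(2), of "\<lambda>(z, \<eta>). ph z \<eta>" "(((t, \<xi>), \<eta>), z)" 0 "(((w, 0), 0), 0)"]
        smooth_on_diff[OF smooth_on_ph[where 'a='a]] pd_dir[OF smooth_on_diff[OF smooth_on_ph[where 'a='a]], of _ 0]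
      by (simp add: zero_prod_def[symmetric])
    moreover have "pd (((w, 0), 0), 0) (\<lambda>p. b ((fst (fst (fst p)), snd p), snd (fst (fst p)))) (((t, \<xi>), \<eta>), z) = pd ((w, 0), 0) b ((t, z), \<xi>)"
      using pd_compose_affine'[OF bl(1), of b "(((t, \<xi>), \<eta>), z)" 0 "(((w, 0), 0), 0)"]
        smooth_on_diff[OF ampD(2)[OF b]] by (simp add: zero_prod_def)
    ultimately show ?thesis
      by (subst pd_mult) (use smooth_on_diff[OF s1] smooth_on_diff[OF s2] in auto)
  qed
  have "pd ((w, 0), 0) (\<lambda>q. LINT z|lborel. ?f (q, z)) ((t, \<xi>), \<eta>) = (LINT z|lborel. pd (((w, 0), 0), 0) ?f (((t, \<xi>), \<eta>), z))"
    by (rule differentiable_integral(2)[OF f z]) (use w in simp)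
  then show "pd ((w, 0), 0) (\<lambda>((t, \<xi>), \<eta>). ft (\<lambda>z. b ((t, z), \<xi>)) \<eta>) ((t, \<xi>), \<eta>) =
      ft (\<lambda>z. pd ((w, 0), 0) b ((t, z), \<xi>)) \<eta>"
    unfolding eq A by (simp only: ft_def)
qed

text \<open>The oscillatory integral of \<open>exp (i z \<bullet> \<eta>) b((t, z), \<eta>)\<close> as an iterated integral: the one over \<open>z\<close>
  already decays rapidly in \<open>\<eta>\<close>, so that no regularization is needed.\<close>

definition osc_fiber :: "(('t::euclidean_space \<times> 'a::euclidean_space) \<times> 'a \<Rightarrow> complex) \<Rightarrow> 't \<times> 'a \<Rightarrow> complex" where
  "osc_fiber b = (\<lambda>(t, \<eta>). ft (\<lambda>z. b ((t, z), \<eta>)) \<eta>)"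

lemma osc_fiber_smooth:
  fixes b :: "('t::euclidean_space \<times> 'a::euclidean_space) \<times> 'a \<Rightarrow> complex"
  assumes b: "amp m b"
  shows "smooth_on UNIV (osc_fiber b)" and "w \<in> Basis \<Longrightarrow> pd (w, 0) (osc_fiber b) = osc_fiber (pd ((w, 0), 0) b)"
proof -
  let ?F = "\<lambda>((t, \<xi>), \<eta>). ft (\<lambda>z. b ((t, z), \<xi>)) \<eta>"
  have bl: "bounded_linear (\<lambda>p :: 't \<times> 'a. (p, snd p))" by (intro bounded_linear_intros)
  have eq: "osc_fiber b = (\<lambda>p. ?F (p, snd p))" by (auto simp: osc_fiber_def)
  show "smooth_on UNIV (osc_fiber b)"
    unfolding eq by (rule smooth_on_compose_linear[OF bl smooth_on_ft_amp(1)[OF b]])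
  assume w: "w \<in> Basis"
  show "pd (w, 0) (osc_fiber b) = osc_fiber (pd ((w, 0), 0) b)"
  proof
    fix p :: "'t \<times> 'a"
    obtain t \<eta> where p: "p = (t, \<eta>)" by (cases p)
    have "pd (w, 0) (osc_fiber b) p = pd ((w, 0), 0) ?F (p, snd p)"
      unfolding eq using pd_compose_affine'[OF bl, of ?F p 0 "(w, 0)"] smooth_on_diff[OF smooth_on_ft_amp(1)[OF b]] by simp
    then show "pd (w, 0) (osc_fiber b) p = osc_fiber (pd ((w, 0), 0) b) p"
      unfolding p using smooth_on_ft_amp(2)[OF b w, of t \<eta> \<eta>] by (simp add: osc_fiber_def)
  qed
qed

text \<open>On the diagonal \<open>\<xi> = \<eta>\<close>, decay of order \<open>s - m\<close> in
  the variable of the transform beats the growth of order \<open>m\<close> of the amplitude.\<close>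

lemma osc_fiber_decay:
  fixes b :: "('t::euclidean_space \<times> 'a::euclidean_space) \<times> 'a \<Rightarrow> complex"
  assumes b: "amp m b" and K: "compact K"
  shows "\<exists>C\<ge>0. \<forall>t\<in>K. \<forall>\<eta>. cmod (osc_fiber b (t, \<eta>)) \<le> C * jb \<eta> powr s"
proof -
  obtain C where C: "C \<ge> 0" "\<forall>t\<in>K. \<forall>\<xi> \<eta>. cmod (ft (\<lambda>z. b ((t, z), \<xi>)) \<eta>) \<le> C * jb \<xi> powr m * jb \<eta> powr (s - m)"
    using ft_amp_decay[OF b K] by blast
  have "cmod (osc_fiber b (t, \<eta>)) \<le> C * jb \<eta> powr s" if "t \<in> K" for t \<eta>
  proof -
    have "cmod (osc_fiber b (t, \<eta>)) \<le> C * jb \<eta> powr m * jb \<eta> powr (s - m)" using C(2) that by (simp add: osc_fiber_def)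
    also have "\<dots> = C * jb \<eta> powr s" by (simp add: mult.assoc flip: powr_add)
    finally show ?thesis .
  qed
  then show ?thesis using C(1) by blast
qed

text \<open>Locally uniform integrable majorants for all derivatives in the parameter, which is what
  repeated differentiation under the integral over \<open>\<eta>\<close> asks for. The exponent is
  the one of \<open>integrable_jb\<close>.\<close>

definition tdecay :: "('t::euclidean_space \<times> 'a::euclidean_space \<Rightarrow> complex) \<Rightarrow> bool" where
  "tdecay F \<longleftrightarrow> smooth_on UNIV F \<and> (\<forall>us K. set us \<subseteq> Basis \<and> compact K \<longrightarrow>
    (\<exists>C\<ge>0. \<forall>t\<in>K. \<forall>\<eta>. cmod (D_iter (map (\<lambda>u. (u, 0)) us) F (t, \<eta>)) \<le> C * jb \<eta> powr (- 2 * real DIM('a))))"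

lemma tdecay_pd: "tdecay F \<Longrightarrow> w \<in> Basis \<Longrightarrow> tdecay (pd (w, 0) F)"
  unfolding tdecay_def
proof (intro conjI allI impI)
  assume F: "smooth_on UNIV F \<and> (\<forall>us K. set us \<subseteq> Basis \<and> compact K \<longrightarrow>
    (\<exists>C\<ge>0. \<forall>t\<in>K. \<forall>\<eta>. cmod (D_iter (map (\<lambda>u. (u, 0)) us) F (t, \<eta>)) \<le> C * jb \<eta> powr (- 2 * real DIM('b))))"
    and w: "w \<in> Basis"
  show "smooth_on UNIV (pd (w, 0) F)" using F w by (intro smooth_on_pd) auto
  fix us :: "'a list" and K :: "'a set" assume "set us \<subseteq> Basis \<and> compact K"
  then show "\<exists>C\<ge>0. \<forall>t\<in>K. \<forall>\<eta>. cmod (D_iter (map (\<lambda>u. (u, 0)) us) (pd (w, 0) F) (t, \<eta>)) \<le> C * jb \<eta> powr (- 2 * real DIM('b))"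
    using F[THEN conjunct2, rule_format, of "us @ [w]" K] w by (simp add: D_iter_append)
qed

lemma tdecay_integrable:
  fixes F :: "'t::euclidean_space \<times> 'a::euclidean_space \<Rightarrow> complex"
  assumes "tdecay F"
  shows "integrable lborel (\<lambda>\<eta>. F (t, \<eta>))"
proof -
  obtain C where C: "C \<ge> 0" "\<forall>\<eta>. cmod (F (t, \<eta>)) \<le> C * jb \<eta> powr (- 2 * real DIM('a))"
    using assms[unfolded tdecay_def, THEN conjunct2, rule_format, of "[]" "{t}"] by auto
  show ?thesis
  proof (rule Bochner_Integration.integrable_bound[of _ "\<lambda>\<eta>. C * jb \<eta> powr (- 2 * real DIM('a))"])
    show "integrable lborel (\<lambda>\<eta>::'a. C * jb \<eta> powr (- 2 * real DIM('a)))"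
      using integrable_jb[where 'a='a] by simp
    show "(\<lambda>\<eta>. F (t, \<eta>)) \<in> borel_measurable lborel"
      using continuous_on_section[OF smooth_on_imp_continuous_on] assms
      by (auto simp: tdecay_def intro!: borel_measurable_continuous_onI)
    show "AE x in lborel. cmod (F (t, x)) \<le> norm (C * jb x powr (- 2 * real DIM('a)))"
      using C by (auto intro!: AE_I2 simp: abs_mult)
  qed
qed

lemma tdecay_diff:
  fixes F :: "'t::euclidean_space \<times> 'a::euclidean_space \<Rightarrow> complex"
  assumes F: "tdecay F"
  shows "(\<lambda>t. LINT \<eta>|lborel. F (t, \<eta>)) differentiable at t0"
    and "w \<in> Basis \<Longrightarrow> pd w (\<lambda>t. LINT \<eta>|lborel. F (t, \<eta>)) t0 = (LINT \<eta>|lborel. pd (w, 0) F (t0, \<eta>))"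
proof -
  have sF: "smooth_on UNIV F" using F by (simp add: tdecay_def)
  have d: "F differentiable at p" for p using smooth_on_diff[OF sF] by simp
  have "\<forall>w\<in>Basis. \<exists>C\<ge>0. \<forall>t\<in>cball t0 1. \<forall>\<eta>. cmod (pd (w, 0) F (t, \<eta>)) \<le> C * jb \<eta> powr (- 2 * real DIM('a))"
  proof
    fix w :: 't assume "w \<in> Basis"
    then show "\<exists>C\<ge>0. \<forall>t\<in>cball t0 1. \<forall>\<eta>. cmod (pd (w, 0) F (t, \<eta>)) \<le> C * jb \<eta> powr (- 2 * real DIM('a))"
      using F[unfolded tdecay_def, THEN conjunct2, rule_format, of "[w]" "cball t0 1"] by simp
  qed
  from bchoice[OF this] obtain C where C: "\<And>w. w \<in> Basis \<Longrightarrow> C w \<ge> 0"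
    "\<And>w t \<eta>. w \<in> Basis \<Longrightarrow> t \<in> cball t0 1 \<Longrightarrow> cmod (pd (w, 0) F (t, \<eta>)) \<le> C w * jb \<eta> powr (- 2 * real DIM('a))"
    by blast
  let ?g = "\<lambda>\<eta>::'a. (\<Sum>w\<in>Basis. C w) * jb \<eta> powr (- 2 * real DIM('a))"
  note dui = dominated_differentiation[where M = lborel and d = 1 and ?t0.0 = t0 and f = "\<lambda>t \<eta>. F (t, \<eta>)" and g = ?g]
  have 1: "integrable lborel (\<lambda>\<eta>. F (t, \<eta>))" for t by (rule tdecay_integrable[OF F])
  have 2: "cmod (pd w (\<lambda>t. F (t, \<eta>)) t) \<le> ?g \<eta>" if "t \<in> ball t0 1" "w \<in> Basis" for t \<eta> w
  proof -
    have "cmod (pd w (\<lambda>t. F (t, \<eta>)) t) \<le> C w * jb \<eta> powr (- 2 * real DIM('a))"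
      using C(2)[OF that(2), of t \<eta>] that(1) by (simp add: pd_section1(2)[OF d])
    also have "\<dots> \<le> ?g \<eta>" using C(1) that(2) by (intro mult_right_mono member_le_sum) auto
    finally show ?thesis .
  qed
  have 3: "integrable lborel ?g" using integrable_jb[where 'a='a] by simp
  have 4: "(\<lambda>\<eta>. pd w (\<lambda>t. F (t, \<eta>)) t0) \<in> borel_measurable lborel" if "w \<in> Basis" for w
    using continuous_on_section[OF smooth_on_imp_continuous_on[OF smooth_on_pd[OF sF, of "(w, 0)"]], of t0] that
    by (simp add: pd_section1(2)[OF d] borel_measurable_continuous_onI)
  show "(\<lambda>t. LINT \<eta>|lborel. F (t, \<eta>)) differentiable at t0"
    by (rule dui(1)) (use 1 2 3 4 pd_section1(1)[OF d] in auto)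
  assume w: "w \<in> Basis"
  have "pd w (\<lambda>t. LINT \<eta>|lborel. F (t, \<eta>)) t0 = (LINT \<eta>|lborel. pd w (\<lambda>t. F (t, \<eta>)) t0)"
    by (rule dui(2)[OF _ _ _ _ _ _ w]) (use 1 2 3 4 pd_section1(1)[OF d] in auto)
  then show "pd w (\<lambda>t. LINT \<eta>|lborel. F (t, \<eta>)) t0 = (LINT \<eta>|lborel. pd (w, 0) F (t0, \<eta>))"
    by (simp add: pd_section1(2)[OF d])
qed

lemma tdecay_smooth:
  assumes F: "tdecay F"
  shows "smooth_on UNIV (\<lambda>t. LINT \<eta>|lborel. F (t, \<eta>))"
  unfolding smooth_on_Ck
proof
  fix k show "Ck k UNIV (\<lambda>t. LINT \<eta>|lborel. F (t, \<eta>))"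
    using F
  proof (induction k arbitrary: F)
    case (Suc k)
    have "Ck k UNIV (pd v (\<lambda>t. LINT \<eta>|lborel. F (t, \<eta>)))" if "v \<in> Basis" for v
      using Suc.IH[OF tdecay_pd[OF Suc.prems that]] tdecay_diff(2)[OF Suc.prems that]
      by (simp add: fun_eq_iff cong: Ck_cong)
    then show ?case using tdecay_diff(1)[OF Suc.prems] by simp
  qed (use tdecay_diff(1) in auto)
qed

text \<open>A parameter derivative of the fiber is the fiber of the differentiated amplitude, again
  of order \<open>m\<close>, so \<open>osc_fiber_decay\<close> covers all of them.\<close>

lemma osc_fiber_tdecay:
  assumes b: "amp m b"
  shows "tdecay (osc_fiber b)"
  unfolding tdecay_def
proof (intro conjI allI impI osc_fiber_smooth[OF b])
  fix us :: "'a list" and K :: "'a set" assume *: "set us \<subseteq> Basis \<and> compact K"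
  then have "set us \<subseteq> Basis" ..
  then have "\<exists>b'. amp m b' \<and> D_iter (map (\<lambda>u. (u, 0)) us) (osc_fiber b) = osc_fiber b'"
  proof (induction us)
    case (Cons u us)
    then obtain b' where b': "amp m b'" "D_iter (map (\<lambda>u. (u, 0)) us) (osc_fiber b) = osc_fiber b'" by auto
    then show ?case using amp_pd[OF b'(1), of u] osc_fiber_smooth(2)[OF b'(1), of u] Cons.prems by auto
  qed (use b in auto)
  then obtain b' where b': "amp m b'" "D_iter (map (\<lambda>u. (u, 0)) us) (osc_fiber b) = osc_fiber b'" by blast
  show "\<exists>C\<ge>0. \<forall>t\<in>K. \<forall>\<eta>. cmod (D_iter (map (\<lambda>u. (u, 0)) us) (osc_fiber b) (t, \<eta>)) \<le> C * jb \<eta> powr (- 2 * real DIM('b))"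
    unfolding b'(2) by (rule osc_fiber_decay[OF b'(1)]) (use * in auto)
qed

definition osc_int :: "(('t::euclidean_space \<times> 'a::euclidean_space) \<times> 'a \<Rightarrow> complex) \<Rightarrow> 't \<Rightarrow> complex" where
  "osc_int b t = 1 / (2 * of_real pi) ^ DIM('a) * (LINT \<eta>|lborel. osc_fiber b (t, \<eta>))"

lemma osc_int_smooth:
  assumes b: "amp m b"
  shows "smooth_on UNIV (osc_int b)" and "w \<in> Basis \<Longrightarrow> pd w (osc_int b) = osc_int (pd ((w, 0), 0) b)"
proof -
  show "smooth_on UNIV (osc_int b)"
    unfolding osc_int_def[abs_def] by (intro smooth_on_mult smooth_on_const open_UNIV tdecay_smooth[OF osc_fiber_tdecay[OF b]])
  assume w: "w \<in> Basis"
  show "pd w (osc_int b) = osc_int (pd ((w, 0), 0) b)"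
    unfolding osc_int_def[abs_def]
    by (rule ext, subst pd_cmult) (simp_all add: tdecay_diff[OF osc_fiber_tdecay[OF b]] w osc_fiber_smooth(2)[OF b w])
qed

lemma osc_int_add:
  assumes "amp m b" "amp m' b'"
  shows "osc_int (\<lambda>p. b p + b' p) t = osc_int b t + osc_int b' t"
proof -
  have i: "integrable lborel (\<lambda>z. ph z \<eta> * b ((t, z), \<eta>))" if b: "amp m b" for m \<eta> and b :: "('a \<times> 'b) \<times> 'b \<Rightarrow> complex"
  proof -
    obtain L where L: "compact L" "\<And>z. z \<notin> L \<Longrightarrow> b ((t, z), \<eta>) = 0" using amp_section(2)[OF b] by blast
    show ?thesis
      by (rule integrable_compact_support[OF _ L(1)])
        (use L smooth_on_imp_continuous_on[OF amp_section(1)[OF b]] in \<open>auto intro!: continuous_intros\<close>)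
  qed
  have "osc_fiber (\<lambda>p. b p + b' p) (t, \<eta>) = osc_fiber b (t, \<eta>) + osc_fiber b' (t, \<eta>)" for \<eta>
    unfolding osc_fiber_def ft_def using i[OF assms(1)] i[OF assms(2)] by (simp add: distrib_left)
  then show ?thesis
    unfolding osc_int_def using tdecay_integrable[OF osc_fiber_tdecay[OF assms(1)]] tdecay_integrable[OF osc_fiber_tdecay[OF assms(2)]]
    by (simp add: distrib_left)
qed

section \<open>The fixed cutoff and the amplitudes of the operators\<close>

definition cutoff :: "'a::euclidean_space \<Rightarrow> complex" where
  "cutoff = (SOME \<psi>. \<psi> \<in> cutoffs \<and> (\<forall>x. norm x \<ge> 1 \<longrightarrow> \<psi> x = 0) \<and> (\<forall>x. norm x \<le> 1 / 2 \<longrightarrow> \<psi> x = 1))"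

lemma cut_props: "(cutoff :: 'a::euclidean_space \<Rightarrow> complex) \<in> cutoffs \<and>
    (\<forall>x::'a. norm x \<ge> 1 \<longrightarrow> cutoff x = 0) \<and> (\<forall>x::'a. norm x \<le> 1 / 2 \<longrightarrow> cutoff x = 1)"
proof -
  have "\<exists>\<psi>::'a \<Rightarrow> complex. \<psi> \<in> cutoffs \<and> (\<forall>x. norm x \<ge> 1 \<longrightarrow> \<psi> x = 0) \<and> (\<forall>x. norm x \<le> 1 / 2 \<longrightarrow> \<psi> x = 1)"
    by (rule cutoff_exists[OF zero_less_one]) blast
  from someI_ex[OF this] show ?thesis unfolding cutoff_def .
qed

lemma cut_smooth: "smooth_on UNIV cutoff"
  using cut_props test_functionsD(1) unfolding cutoffs_def by blast

lemma cut_0: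
  assumes "x \<notin> cball 0 1"
  shows "cutoff x = 0"
proof -
  have "norm x \<ge> 1" using assms by simp
  then show ?thesis using cut_props by blast
qed

lemma cut_1:
  assumes "x \<in> ball 0 (1/2)"
  shows "cutoff x = 1"
proof -
  have "norm x \<le> 1 / 2" using assms by simp
  then show ?thesis using cut_props by blast
qed

lemma image_Basis [simp]: "Pair 0 ` A \<subseteq> Basis \<longleftrightarrow> A \<subseteq> Basis" "(\<lambda>u. (u, 0)) ` A \<subseteq> Basis \<longleftrightarrow> A \<subseteq> Basis"
  by auto

lemma zsupp_compact: "compact L \<Longrightarrow> (\<And>t z. z \<notin> L \<Longrightarrow> f (t, z) = 0) \<Longrightarrow> zsupp f"
  unfolding zsupp_def by blast

lemma zsupp_diff:
  assumes "compact L" "\<And>x. x \<notin> L \<Longrightarrow> u x = 0"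
  shows "zsupp (\<lambda>s. u (fst s - snd s))"
  unfolding zsupp_def
proof (intro allI impI)
  fix K :: "'a set" assume K: "compact K"
  show "\<exists>M. compact M \<and> (\<forall>t\<in>K. \<forall>z. z \<notin> M \<longrightarrow> u (fst (t, z) - snd (t, z)) = 0)"
  proof (intro exI conjI ballI allI impI)
    show "compact {x - y |x y. x \<in> K \<and> y \<in> L}" by (rule compact_differences[OF K assms(1)])
    fix t z assume tz: "t \<in> K" "z \<notin> {x - y |x y. x \<in> K \<and> y \<in> L}"
    have "z = t - (t - z)" by simp
    then have "t - z \<notin> L" using tz by blast
    then show "u (fst (t, z) - snd (t, z)) = 0" using assms by simp
  qed
qed

text \<open>The amplitudes below all have this shape: a symbol carries the dependence on the
  covariable, and a factor free of it carries the support in \<open>z\<close>.\<close>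

lemma amp_intro:
  assumes A: "symb UNIV m A" and f: "smooth_on UNIV f" "zsupp f"
  shows "amp m (\<lambda>(s, \<eta>). A (s, \<eta>) * f s)"
  unfolding amp_def
proof (intro conjI allI impI)
  show "symb UNIV m (\<lambda>(s, \<eta>). A (s, \<eta>) * f s)"
    using symb_mult[OF open_UNIV A symb_fst[OF f(1)]] by (simp add: case_prod_beta')
  fix K :: "'a set" assume "compact K"
  with f(2) obtain L where L: "compact L" "\<forall>t\<in>K. \<forall>z. z \<notin> L \<longrightarrow> f (t, z) = 0"
    unfolding zsupp_def by blast
  then show "\<exists>L. compact L \<and> (\<forall>t\<in>K. \<forall>z. z \<notin> L \<longrightarrow> (\<forall>\<eta>. (case ((t, z), \<eta>) of (s, \<eta>) \<Rightarrow> A (s, \<eta>) * f s) = 0))"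
    by (intro exI[of _ L]) auto
qed

lemma ft_cmult: "ft (\<lambda>z. c * g z) \<eta> = c * ft g \<eta>"
  unfolding ft_def by (simp add: mult.left_commute flip: integral_mult_right_zero)

text \<open>Amplitudes in the variable \<open>z\<close>, the difference of the points that the kernel couples. The cutoff
  in \<open>z\<close> confines the kernel to a strip around the diagonal; \<open>Op\<close> lacks it, \<open>OpT\<close> (truncated) has it.\<close>

definition amp_Op :: "('a::euclidean_space \<times> 'a \<Rightarrow> complex) \<Rightarrow> ('a \<Rightarrow> complex) \<Rightarrow> ('a \<times> 'a) \<times> 'a \<Rightarrow> complex" where
  "amp_Op a u = (\<lambda>(s, \<eta>). a (fst s, \<eta>) * u (fst s - snd s))"

definition amp_OpT :: "('a::euclidean_space \<times> 'a \<Rightarrow> complex) \<Rightarrow> ('a \<Rightarrow> complex) \<Rightarrow> ('a \<times> 'a) \<times> 'a \<Rightarrow> complex" where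
  "amp_OpT a u = (\<lambda>(s, \<eta>). a (fst s, \<eta>) * (cutoff (snd s) * u (fst s - snd s)))"

text \<open>The parameter is the pair \<open>(x, \<xi>)\<close>. The truncated operator with symbol
  \<open>p\<close> is to act on \<open>y \<mapsto> ph y \<xi> * q (y, \<xi>)\<close>; taking out the
  phase \<open>ph x \<xi>\<close> shifts the covariable of \<open>p\<close> by
  \<open>\<xi>\<close>.\<close>

definition amp_comp :: "('a::euclidean_space \<times> 'a \<Rightarrow> complex) \<Rightarrow> ('a \<times> 'a \<Rightarrow> complex) \<Rightarrow> (('a \<times> 'a) \<times> 'a) \<times> 'a \<Rightarrow> complex" where
  "amp_comp p q = (\<lambda>(s, \<eta>). p (fst (fst s), snd (fst s) + \<eta>) * (cutoff (snd s) * q (fst (fst s) - snd s, snd (fst s))))"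

text \<open>With the pair \<open>(x, y)\<close> as parameter, \<open>amp_left\<close> and
  \<open>amp_right\<close> yield the kernels of the truncated operator with symbol \<open>a\<close>
  composed on the left and on the right with the integral operator with kernel \<open>r\<close>. In
  the latter case the intermediate point is \<open>y + z\<close>, at which both the symbol and the
  second argument of \<open>r\<close> are taken.\<close>

definition amp_left :: "('a::euclidean_space \<times> 'a \<Rightarrow> complex) \<Rightarrow> ('a \<times> 'a \<Rightarrow> complex) \<Rightarrow> (('a \<times> 'a) \<times> 'a) \<times> 'a \<Rightarrow> complex" where
  "amp_left a r = (\<lambda>(s, \<eta>). a (fst (fst s), \<eta>) * (cutoff (snd s) * r (fst (fst s) - snd s, snd (fst s))))"

definition amp_right :: "('a::euclidean_space \<times> 'a \<Rightarrow> complex) \<Rightarrow> ('a \<times> 'a \<Rightarrow> complex) \<Rightarrow> (('a \<times> 'a) \<times> 'a) \<times> 'a \<Rightarrow> complex" where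
  "amp_right a r = (\<lambda>(s, \<eta>). a (snd (fst s) + snd s, \<eta>) * (cutoff (snd s) * r (fst (fst s), snd (fst s) + snd s)))"

lemma zsupp_cut: "zsupp (\<lambda>s. cutoff (snd s) * g s)"
  by (rule zsupp_compact[OF compact_cball[of 0 1]]) (simp add: cut_0)

lemma smooth_cut_snd: "smooth_on UNIV (\<lambda>s::'t::euclidean_space \<times> 'a::euclidean_space. cutoff (snd s))"
  by (rule smooth_on_compose_linear[OF bounded_linear_snd cut_smooth])

lemma amplitude_Op:
  assumes a: "symb UNIV m a" and u: "u \<in> test_functions"
  shows "amp m (amp_Op a u)"
proof -
  have 1: "symb UNIV m (\<lambda>(s, \<eta>). a (fst s, \<eta>))" by (rule symb_pullback_fst[OF bounded_linear_fst a])
  have 2: "smooth_on UNIV (\<lambda>s. u (fst s - snd s))"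
    by (rule smooth_on_compose_linear[OF _ test_functionsD(1)[OF u]]) (intro bounded_linear_intros)
  have 3: "zsupp (\<lambda>s. u (fst s - snd s))"
    by (rule zsupp_diff[OF test_functionsD(2)[OF u]]) (rule fun_support_zero)
  show ?thesis using amp_intro[OF 1 2 3] by (simp add: amp_Op_def)
qed

lemma amplitude_OpT:
  assumes a: "symb UNIV m a" and u: "smooth_on UNIV u"
  shows "amp m (amp_OpT a u)"
proof -
  have 1: "symb UNIV m (\<lambda>(s, \<eta>). a (fst s, \<eta>))" by (rule symb_pullback_fst[OF bounded_linear_fst a])
  have 2: "smooth_on UNIV (\<lambda>s. cutoff (snd s) * u (fst s - snd s))"
    by (intro smooth_on_mult open_UNIV smooth_cut_snd smooth_on_compose_linear[OF _ u] bounded_linear_intros)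
  show ?thesis using amp_intro[OF 1 2 zsupp_cut] by (simp add: amp_OpT_def)
qed

lemma amplitude_comp:
  assumes p: "symb UNIV m p" and q: "smooth_on UNIV q"
  shows "amp m (amp_comp p q)"
proof -
  have 1: "symb UNIV m (\<lambda>(s, \<eta>). p (fst (fst s), snd (fst s) + \<eta>))"
    by (rule symb_pullback[OF _ _ p]; intro bounded_linear_intros)
  have 2: "smooth_on UNIV (\<lambda>s. cutoff (snd s) * q (fst (fst s) - snd s, snd (fst s)))"
    by (intro smooth_on_mult open_UNIV smooth_cut_snd smooth_on_compose_linear[OF _ q] bounded_linear_intros)
  show ?thesis using amp_intro[OF 1 2 zsupp_cut] by (simp add: amp_comp_def)
qed

lemma amplitude_left:
  assumes a: "symb UNIV m a" and r: "smooth_on UNIV r"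
  shows "amp m (amp_left a r)"
proof -
  have 1: "symb UNIV m (\<lambda>(s, \<eta>). a (fst (fst s), \<eta>))"
    by (rule symb_pullback_fst[OF _ a]) (intro bounded_linear_intros)
  have 2: "smooth_on UNIV (\<lambda>s. cutoff (snd s) * r (fst (fst s) - snd s, snd (fst s)))"
    by (intro smooth_on_mult open_UNIV smooth_cut_snd smooth_on_compose_linear[OF _ r] bounded_linear_intros)
  show ?thesis using amp_intro[OF 1 2 zsupp_cut] by (simp add: amp_left_def)
qed

lemma amplitude_right:
  assumes a: "symb UNIV m a" and r: "smooth_on UNIV r"
  shows "amp m (amp_right a r)"
proof -
  have 1: "symb UNIV m (\<lambda>(s, \<eta>). a (snd (fst s) + snd s, \<eta>))"
    by (rule symb_pullback_fst[OF _ a]) (intro bounded_linear_intros)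
  have 2: "smooth_on UNIV (\<lambda>s. cutoff (snd s) * r (fst (fst s), snd (fst s) + snd s))"
    by (intro smooth_on_mult open_UNIV smooth_cut_snd smooth_on_compose_linear[OF _ r] bounded_linear_intros)
  show ?thesis using amp_intro[OF 1 2 zsupp_cut] by (simp add: amp_right_def)
qed

section \<open>Operators, composite symbols and their Leibniz rule\<close>

definition Op :: "('a::euclidean_space \<times> 'a \<Rightarrow> complex) \<Rightarrow> ('a \<Rightarrow> complex) \<Rightarrow> 'a \<Rightarrow> complex" where
  "Op a u = osc_int (amp_Op a u)"

definition OpT :: "('a::euclidean_space \<times> 'a \<Rightarrow> complex) \<Rightarrow> ('a \<Rightarrow> complex) \<Rightarrow> 'a \<Rightarrow> complex" where
  "OpT a u = osc_int (amp_OpT a u)"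

definition comp_sym :: "('a::euclidean_space \<times> 'a \<Rightarrow> complex) \<Rightarrow> ('a \<times> 'a \<Rightarrow> complex) \<Rightarrow> 'a \<times> 'a \<Rightarrow> complex" where
  "comp_sym p q = osc_int (amp_comp p q)"

definition words :: "nat \<Rightarrow> 'a::euclidean_space list set" where
  "words k = {vs. set vs \<subseteq> Basis \<and> length vs = k}"

text \<open>A multi-index \<open>\<alpha>\<close> of order \<open>k\<close> is the multi-index of \<open>k! / \<alpha>!\<close> words, so that \<open>1 / k!\<close> replaces the
  usual \<open>1 / \<alpha>!\<close>; the factor \<open>i^k\<close> undoes the \<open>-i\<close> in the derivatives of \<open>p\<close>.\<close>

definition comp_term :: "nat \<Rightarrow> ('a::euclidean_space \<times> 'a \<Rightarrow> complex) \<Rightarrow> ('a \<times> 'a \<Rightarrow> complex) \<Rightarrow> 'a \<times> 'a \<Rightarrow> complex" where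
  "comp_term k p q = (\<lambda>s. \<i> ^ k / fact k *
    (\<Sum>vs\<in>words k. D_iter (map (Pair 0) vs) p s * D_iter (map (\<lambda>v. (v, 0)) vs) q s))"

definition comp_rem :: "nat \<Rightarrow> ('a::euclidean_space \<times> 'a \<Rightarrow> complex) \<Rightarrow> ('a \<times> 'a \<Rightarrow> complex) \<Rightarrow> 'a \<times> 'a \<Rightarrow> complex" where
  "comp_rem N p q = (\<lambda>s. comp_sym p q s - (\<Sum>k<N. comp_term k p q s))"

lemma finite_words [simp]: "finite (words k :: 'a::euclidean_space list set)"
  unfolding words_def by (rule finite_lists_length_eq) simp

lemma wordsD: "vs \<in> words k \<Longrightarrow> set vs \<subseteq> Basis" "vs \<in> words k \<Longrightarrow> length vs = k"
  by (auto simp: words_def)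

lemma sum_words_Suc:
  fixes f :: "'a::euclidean_space list \<Rightarrow> complex"
  shows "(\<Sum>vs\<in>words (Suc k). f vs) = (\<Sum>v\<in>Basis. \<Sum>vs\<in>words k. f (v # vs))"
proof -
  have "words (Suc k) = (\<lambda>(v, vs). v # vs) ` (Basis \<times> (words k :: 'a list set))"
    by (force simp: words_def length_Suc_conv image_iff)
  moreover have "inj_on (\<lambda>(v, vs). v # vs) (Basis \<times> (words k :: 'a list set))"
    by (auto simp: inj_on_def)
  ultimately have "(\<Sum>vs\<in>words (Suc k). f vs) = (\<Sum>p\<in>Basis \<times> (words k :: 'a list set). f (fst p # snd p))"
    by (simp add: sum.reindex case_prod_beta')
  then show ?thesis by (simp add: sum.cartesian_product case_prod_beta')
qed

lemma cnt_map_Pair0 [simp]: "cnt (map (Pair 0) vs) = length vs"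
  by (induction vs) auto

lemma cnt_map_fst [simp]: "set vs \<subseteq> Basis \<Longrightarrow> cnt (map (\<lambda>v. (v, 0)) vs) = 0"
  by (induction vs) (auto dest: nonzero_Basis)

lemma comp_term_symb:
  assumes S: "open S" and p: "symb S m p" and q: "symb S m' q"
  shows "symb S (m + m' - real k) (comp_term k p q)"
proof -
  have "symb S (m + m' - real k) (\<lambda>s. D_iter (map (Pair 0) vs) p s * D_iter (map (\<lambda>v. (v, 0)) vs) q s)"
    if "vs \<in> words k" for vs
    using symb_mult[OF S symb_D_iter[OF p, of "map (Pair 0) vs"] symb_D_iter[OF q, of "map (\<lambda>v. (v, 0)) vs"]] wordsD[OF that]
    by (simp add: algebra_simps del: map_eq_conv)
  then show ?thesis unfolding comp_term_def by (intro symb_cmult symb_sum S)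
qed

lemma comp_term_smooth:
  assumes S: "open S" and p: "smooth_on S p" and q: "smooth_on S q"
  shows "smooth_on S (comp_term k p q)"
  unfolding comp_term_def
  by (intro smooth_on_mult smooth_on_sum smooth_on_const S smooth_on_D_iter[OF p] smooth_on_D_iter[OF q])
    (simp_all add: wordsD)

lemma comp_term_pd:
  assumes S: "open S" and p: "smooth_on S p" and q: "smooth_on S q" and w: "w \<in> Basis" and x: "x \<in> S"
  shows "pd w (comp_term k p q) x = comp_term k (pd w p) q x + comp_term k p (pd w q) x"
proof -
  let ?f = "\<lambda>vs s. D_iter (map (Pair 0) vs) p s * D_iter (map (\<lambda>v. (v, 0)) vs) q s"
  have sp: "smooth_on S (D_iter (map (Pair 0) vs) p)" and sq: "smooth_on S (D_iter (map (\<lambda>v. (v, 0)) vs) q)"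
    if "vs \<in> words k" for vs using wordsD[OF that] p q by (intro smooth_on_D_iter; simp)+
  have sf: "smooth_on S (?f vs)" if "vs \<in> words k" for vs
    by (intro smooth_on_mult S sp sq that)
  have dp: "D_iter (map (Pair 0) vs) p differentiable at x" if "vs \<in> words k" for vs
    using smooth_on_diff[OF sp[OF that] x] .
  have dq: "D_iter (map (\<lambda>v. (v, 0)) vs) q differentiable at x" if "vs \<in> words k" for vs
    using smooth_on_diff[OF sq[OF that] x] .
  have "pd w (comp_term k p q) x = \<i> ^ k / fact k * pd w (\<lambda>s. \<Sum>vs\<in>words k. ?f vs s) x"
    unfolding comp_term_def by (rule pd_cmult) (rule smooth_on_diff[OF smooth_on_sum[OF S sf] x])
  also have "pd w (\<lambda>s. \<Sum>vs\<in>words k. ?f vs s) x = (\<Sum>vs\<in>words k. pd w (?f vs) x)"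
    using D_iter_sum[OF S sf, where I = "words k" and vs = "[w]" and x = x] w x by simp
  also have "\<dots> = (\<Sum>vs\<in>words k. D_iter (map (Pair 0) vs) (pd w p) x * D_iter (map (\<lambda>v. (v, 0)) vs) q x
      + D_iter (map (Pair 0) vs) p x * D_iter (map (\<lambda>v. (v, 0)) vs) (pd w q) x)"
    by (intro sum.cong refl)
      (simp add: wordsD pd_mult dp dq D_iter_pd_commute[OF S p w _ x] D_iter_pd_commute[OF S q w _ x])
  finally show ?thesis by (simp add: comp_term_def sum.distrib distrib_left)
qed

lemma comp_sym_smooth:
  assumes p: "symb UNIV m p" and q: "smooth_on UNIV q"
  shows "smooth_on UNIV (comp_sym p q)"
  unfolding comp_sym_def by (rule osc_int_smooth(1)[OF amplitude_comp[OF p q]])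

text \<open>A change of the parameter \<open>(x, \<xi>)\<close> moves only the arguments of
  \<open>p\<close> and \<open>q\<close> in \<open>amp_comp\<close>; the cutoff depends on
  \<open>z\<close> alone. Hence the product rule has two terms, in parallel with
  \<open>comp_term_pd\<close>, and it passes to the remainder.\<close>

lemma comp_sym_pd:
  fixes p q :: "'a::euclidean_space \<times> 'a \<Rightarrow> complex"
  assumes p: "symb UNIV m p" and q: "smooth_on UNIV q" and w: "w \<in> Basis"
  shows "pd w (comp_sym p q) x = comp_sym (pd w p) q x + comp_sym p (pd w q) x"
proof -
  let ?l1 = "\<lambda>s::(('a \<times> 'a) \<times> 'a) \<times> 'a. (fst (fst (fst s)), snd (fst (fst s)) + snd s)"
  let ?l2 = "\<lambda>s::(('a \<times> 'a) \<times> 'a) \<times> 'a. (fst (fst (fst s)) - snd (fst s), snd (fst (fst s)))"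
  let ?l3 = "\<lambda>s::(('a \<times> 'a) \<times> 'a) \<times> 'a. snd (fst s)"
  have bl: "bounded_linear ?l1" "bounded_linear ?l2" "bounded_linear ?l3" by (intro bounded_linear_intros)+
  have sp: "smooth_on UNIV p" using p by (rule symb_smooth)
  have dp: "p differentiable at y" and dq: "q differentiable at y" for y
    using smooth_on_diff[OF sp] smooth_on_diff[OF q] by auto
  have dc: "cutoff differentiable at (y::'a)" for y using smooth_on_diff[OF cut_smooth] by simp
  have d1: "(\<lambda>s. p (?l1 s)) differentiable at s" for s
    by (rule smooth_on_diff[OF smooth_on_compose_linear[OF bl(1) sp]]) simp
  have d2: "(\<lambda>s. q (?l2 s)) differentiable at s" for s
    by (rule smooth_on_diff[OF smooth_on_compose_linear[OF bl(2) q]]) simp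
  have d3: "(\<lambda>s. cutoff (?l3 s)) differentiable at s" for s
    by (rule smooth_on_diff[OF smooth_on_compose_linear[OF bl(3) cut_smooth]]) simp
  have e1: "pd ((w, 0), 0) (\<lambda>s. p (?l1 s)) s = pd w p (?l1 s)" for s
    using pd_compose_affine'[OF bl(1), of p s 0 "((w, 0), 0)"] dp by simp
  have e2: "pd ((w, 0), 0) (\<lambda>s. q (?l2 s)) s = pd w q (?l2 s)" for s
    using pd_compose_affine'[OF bl(2), of q s 0 "((w, 0), 0)"] dq by simp
  have e3: "pd ((w, 0), 0) (\<lambda>s. cutoff (?l3 s)) s = 0" for s
    using pd_compose_affine'[OF bl(3), of cutoff s 0 "((w, 0), 0)"] dc pd_dir[OF dc, of 0] by simp
  have "pd ((w, 0), 0) (amp_comp p q) = (\<lambda>s. amp_comp (pd w p) q s + amp_comp p (pd w q) s)"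
  proof
    fix s
    have "amp_comp p q = (\<lambda>s. p (?l1 s) * (cutoff (?l3 s) * q (?l2 s)))" by (auto simp: amp_comp_def)
    then show "pd ((w, 0), 0) (amp_comp p q) s = amp_comp (pd w p) q s + amp_comp p (pd w q) s"
      by (simp only:) (subst pd_mult[OF d1 differentiable_mult'[OF d3 d2]], subst pd_mult[OF d3 d2],
        simp add: e1 e2 e3 amp_comp_def case_prod_beta')
  qed
  then show ?thesis
    unfolding comp_sym_def osc_int_smooth(2)[OF amplitude_comp[OF p q] w]
    using osc_int_add[OF amplitude_comp[OF symb_pd'[OF p w] q] amplitude_comp[OF p smooth_on_pd[OF q w]]] by simp
qed

lemma comp_rem_smooth:
  assumes p: "symb UNIV m p" and q: "smooth_on UNIV q"
  shows "smooth_on UNIV (comp_rem N p q)"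
  unfolding comp_rem_def
  by (intro smooth_on_sub smooth_on_sum open_UNIV comp_sym_smooth[OF p q] comp_term_smooth q symb_smooth[OF p])

lemma comp_rem_pd:
  assumes p: "symb UNIV m p" and q: "smooth_on UNIV q" and w: "w \<in> Basis"
  shows "pd w (comp_rem N p q) = (\<lambda>x. comp_rem N (pd w p) q x + comp_rem N p (pd w q) x)"
proof
  fix x
  have sp: "smooth_on UNIV p" using p by (rule symb_smooth)
  have sT: "smooth_on UNIV (\<lambda>x. \<Sum>k<N. comp_term k p q x)" by (intro smooth_on_sum open_UNIV comp_term_smooth sp q)
  have "pd w (comp_rem N p q) x = pd w (\<lambda>x. comp_sym p q x + (-1) * (\<Sum>k<N. comp_term k p q x)) x" by (simp add: comp_rem_def)
  also have "\<dots> = pd w (comp_sym p q) x + (-1) * pd w (\<lambda>x. \<Sum>k<N. comp_term k p q x) x"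
    by (subst pd_add) (use smooth_on_diff[OF comp_sym_smooth[OF p q]] smooth_on_diff[OF sT]
      smooth_on_diff[OF smooth_on_cmult[OF open_UNIV sT, of "-1"]] in \<open>auto simp: pd_cmult[of _ _ _ "-1", simplified]\<close>)
  also have "pd w (\<lambda>x. \<Sum>k<N. comp_term k p q x) x = (\<Sum>k<N. pd w (comp_term k p q) x)"
    using D_iter_sum[OF open_UNIV comp_term_smooth[OF open_UNIV sp q], where I = "{..<N}" and vs = "[w]" and x = x] w by simp
  finally show "pd w (comp_rem N p q) x = comp_rem N (pd w p) q x + comp_rem N p (pd w q) x"
    by (simp add: comp_rem_def comp_sym_pd[OF p q w] comp_term_pd[OF open_UNIV sp q w] sum.distrib)
qed


section \<open>Expansion of composite symbols\<close>

lemma words_0 [simp]: "words 0 = {[]}"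
  by (auto simp: words_def)

definition monomial :: "'a::euclidean_space list \<Rightarrow> 'a \<Rightarrow> real" where
  "monomial vs \<eta> = prod_list (map (\<lambda>v. v \<bullet> \<eta>) vs)"

lemma monomial_simps [simp]: "monomial [] \<eta> = 1" "monomial (v # vs) \<eta> = (v \<bullet> \<eta>) * monomial vs \<eta>"
  by (auto simp: monomial_def)

lemma monomial_bound: "set vs \<subseteq> Basis \<Longrightarrow> \<bar>monomial vs \<eta>\<bar> \<le> jb \<eta> ^ length vs"
proof (induction vs)
  case (Cons v vs)
  have "\<bar>v \<bullet> \<eta>\<bar> \<le> norm \<eta>" using Cons.prems Basis_le_norm[of v \<eta>] by (simp add: inner_commute)
  also have "\<dots> \<le> jb \<eta>" by (rule jb_ge_norm)
  finally show ?case using Cons by (auto simp: abs_mult intro!: mult_mono)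
qed simp

lemma ft_D_iter:
  assumes g: "smooth_on UNIV g" and L: "compact L" "\<And>x. x \<notin> L \<Longrightarrow> g x = 0"
  shows "set vs \<subseteq> Basis \<Longrightarrow> ft (D_iter vs g) \<eta> = (- 1) ^ length vs * of_real (monomial vs \<eta>) * ft g \<eta>"
proof (induction vs)
  case (Cons v vs)
  have "ft (pd v (D_iter vs g)) \<eta> = - of_real (v \<bullet> \<eta>) * ft (D_iter vs g) \<eta>"
    by (rule ft_pd[OF smooth_on_D_iter[OF g] L(1) D_iter_zero_outside[OF L]]) (use Cons.prems in auto)
  then show ?case using Cons by simp
qed simp

text \<open>Fourier inversion for \<open>D_iter vs g\<close>: monomials in \<open>\<eta>\<close>
  become derivatives at 0, with one sign from \<open>ft_pd\<close> for each factor.\<close>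

lemma moment:
  fixes g :: "'a::euclidean_space \<Rightarrow> complex"
  assumes g: "smooth_on UNIV g" and L: "compact L" "\<And>x. x \<notin> L \<Longrightarrow> g x = 0" and vs: "set vs \<subseteq> Basis"
  shows "integrable lborel (\<lambda>\<eta>. of_real (monomial vs \<eta>) * ft g \<eta>)"
    and "(LINT \<eta>|lborel. of_real (monomial vs \<eta>) * ft g \<eta>) = (2 * of_real pi) ^ DIM('a) * ((- 1) ^ length vs * D_iter vs g 0)"
proof -
  have sq: "(- 1) ^ length vs * ((- 1) ^ length vs * c) = (c::complex)" for c
    by (simp flip: mult.assoc power_mult_distrib)
  have eq: "(\<lambda>\<eta>. of_real (monomial vs \<eta>) * ft g \<eta>) = (\<lambda>\<eta>. (- 1) ^ length vs * ft (D_iter vs g) \<eta>)"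
    by (simp add: ft_D_iter[OF g L vs] mult.assoc sq)
  note D = smooth_on_D_iter[OF g vs] L(1) D_iter_zero_outside[OF L]
  show "integrable lborel (\<lambda>\<eta>. of_real (monomial vs \<eta>) * ft g \<eta>)"
    unfolding eq by (intro integrable_mult_right integrable_ft[OF D])
  show "(LINT \<eta>|lborel. of_real (monomial vs \<eta>) * ft g \<eta>) = (2 * of_real pi) ^ DIM('a) * ((- 1) ^ length vs * D_iter vs g 0)"
    unfolding eq integral_mult_right_zero by (subst fourier_inversion[OF D]) simp_all
qed

lemma pd_uminus_dir:
  assumes "f differentiable at x"
  shows "pd (- v) f x = - pd v f x"
  using pd_dir[OF assms, of "- v"] pd_dir[OF assms, of v] by (simp add: sum_negf)

lemma D_iter_reflect:
  assumes F: "smooth_on UNIV F"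
  shows "set vs \<subseteq> Basis \<Longrightarrow> D_iter vs (\<lambda>z. F (x - z)) z = (- 1) ^ length vs * D_iter vs F (x - z)"
proof (induction vs arbitrary: z)
  case (Cons v vs)
  have bl: "bounded_linear (uminus :: 'a \<Rightarrow> 'a)" by (rule bounded_linear_minus[OF bounded_linear_ident])
  have d: "D_iter vs F differentiable at y" for y
    using Cons.prems by (intro smooth_on_diff[OF smooth_on_D_iter[OF F]]) auto
  have "D_iter vs (\<lambda>z. F (x - z)) = (\<lambda>z. (- 1) ^ length vs * D_iter vs F (- z + x))"
    using Cons by (auto simp: algebra_simps)
  moreover have "pd v (\<lambda>z. D_iter vs F (- z + x)) z = - pd v (D_iter vs F) (- z + x)"
    using pd_compose_affine'[OF bl d, where v = v and x = z and c = x] pd_uminus_dir[OF d] by simp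
  moreover have "(\<lambda>z. D_iter vs F (- z + x)) differentiable at z"
    by (rule smooth_on_diff[OF smooth_on_compose_affine[OF open_UNIV _ bl smooth_on_D_iter[OF F]]]) (use Cons.prems in auto)
  ultimately show ?case by (simp add: pd_cmult)
qed simp

text \<open>Along the segment from \<open>\<xi>\<close> to \<open>\<xi> + \<eta>\<close> the
  \<open>k\<close>-th derivative is a sum over all words of length \<open>k\<close>; every
  differentiation contributes a factor \<open>\<i>\<close>, which undoes the \<open>- \<i>\<close>
  in \<open>pd\<close>.\<close>

lemma taylor_symbol:
  fixes p :: "'a::euclidean_space \<times> 'a \<Rightarrow> complex"
  assumes p: "smooth_on UNIV p"
    and B: "\<And>t vs. t \<in> {0..1} \<Longrightarrow> vs \<in> words N \<Longrightarrow> cmod (D_iter (map (Pair 0) vs) p (x, \<xi> + t *\<^sub>R \<eta>)) \<le> B"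
  shows "cmod (p (x, \<xi> + \<eta>) - (\<Sum>k<N. \<i> ^ k / fact k * (\<Sum>vs\<in>words k. of_real (monomial vs \<eta>) * D_iter (map (Pair 0) vs) p (x, \<xi>))))
    \<le> card (words N :: 'a list set) * (jb \<eta> ^ N * B)"
proof -
  define f where "f = (\<lambda>k t. \<i> ^ k * (\<Sum>vs\<in>words k. of_real (monomial vs \<eta>) * D_iter (map (Pair 0) vs) p (x, \<xi> + t *\<^sub>R \<eta>)))"
  have "cmod (f 0 1 - (\<Sum>k<N. of_real (1 ^ k / fact k) * f k 0)) \<le> card (words N :: 'a list set) * (jb \<eta> ^ N * B)"
  proof (rule taylor_bound)
    fix k and t :: real
    let ?G = "\<lambda>vs \<xi>. D_iter (map (Pair 0) vs) p (x, \<xi>)"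
    have d: "D_iter (map (Pair 0) vs) p differentiable at y" if "vs \<in> words k" for vs y
      using wordsD[OF that] by (intro smooth_on_diff[OF smooth_on_D_iter[OF p]]) auto
    have "((\<lambda>t. ?G vs (\<xi> + t *\<^sub>R \<eta>)) has_vector_derivative \<i> * (\<Sum>v\<in>Basis. of_real (v \<bullet> \<eta>) * ?G (v # vs) (\<xi> + t *\<^sub>R \<eta>))) (at t within {0..1})"
      if vs: "vs \<in> words k" for vs
    proof -
      have "((\<lambda>t. ?G vs (\<xi> + t *\<^sub>R \<eta>)) has_vector_derivative \<i> * pd \<eta> (?G vs) (\<xi> + t *\<^sub>R \<eta>)) (at t within {0..1})"
        by (rule has_vector_derivative_line[OF pd_section2(1)[OF d[OF vs]]])
      also have "pd \<eta> (?G vs) (\<xi> + t *\<^sub>R \<eta>) = (\<Sum>v\<in>Basis. of_real (\<eta> \<bullet> v) * pd v (?G vs) (\<xi> + t *\<^sub>R \<eta>))"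
        by (rule pd_dir[OF pd_section2(1)[OF d[OF vs]]])
      also have "\<dots> = (\<Sum>v\<in>Basis. of_real (v \<bullet> \<eta>) * ?G (v # vs) (\<xi> + t *\<^sub>R \<eta>))"
        by (simp add: pd_section2(2)[OF d[OF vs]] inner_commute)
      finally show ?thesis .
    qed
    then have "((\<lambda>t. f k t) has_vector_derivative \<i> ^ k * (\<Sum>vs\<in>words k. of_real (monomial vs \<eta>) * (\<i> * (\<Sum>v\<in>Basis. of_real (v \<bullet> \<eta>) * ?G (v # vs) (\<xi> + t *\<^sub>R \<eta>))))) (at t within {0..1})"
      unfolding f_def by (intro has_vector_derivative_mult_right has_vector_derivative_sum)
    also have "\<i> ^ k * (\<Sum>vs\<in>words k. of_real (monomial vs \<eta>) * (\<i> * (\<Sum>v\<in>Basis. of_real (v \<bullet> \<eta>) * ?G (v # vs) (\<xi> + t *\<^sub>R \<eta>)))) = f (Suc k) t"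
      unfolding f_def sum_words_Suc
      by (subst sum.swap) (simp add: sum_distrib_left mult_ac)
    finally show "(f k has_vector_derivative f (Suc k) t) (at t within {0..1})" .
  next
    fix t :: real assume t: "t \<in> {0..1}"
    have "cmod (f N t) = cmod (\<Sum>vs\<in>words N. of_real (monomial vs \<eta>) * D_iter (map (Pair 0) vs) p (x, \<xi> + t *\<^sub>R \<eta>))"
      by (simp add: f_def norm_mult norm_power)
    also have "\<dots> \<le> (\<Sum>vs\<in>words N. cmod (of_real (monomial vs \<eta>) * D_iter (map (Pair 0) vs) p (x, \<xi> + t *\<^sub>R \<eta>)))"
      by (rule norm_sum)
    also have "\<dots> \<le> (\<Sum>vs\<in>(words N :: 'a list set). jb \<eta> ^ N * B)"
    proof (rule sum_mono)
      fix vs :: "'a list" assume vs: "vs \<in> words N"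
      have "\<bar>monomial vs \<eta>\<bar> \<le> jb \<eta> ^ N" using monomial_bound[of vs \<eta>] wordsD[OF vs] by simp
      then show "cmod (of_real (monomial vs \<eta>) * D_iter (map (Pair 0) vs) p (x, \<xi> + t *\<^sub>R \<eta>)) \<le> jb \<eta> ^ N * B"
        unfolding norm_mult norm_of_real using B[OF t vs] by (intro mult_mono) auto
    qed
    finally show "cmod (f N t) \<le> card (words N :: 'a list set) * (jb \<eta> ^ N * B)" by simp
  qed simp
  moreover have "f 0 1 = p (x, \<xi> + \<eta>)" by (simp add: f_def)
  ultimately show ?thesis by (simp add: f_def mult_ac)
qed

lemma comp_sym_expand:
  fixes p q :: "'a::euclidean_space \<times> 'a \<Rightarrow> complex"
  shows "comp_sym p q (x, \<xi>) = 1 / (2 * of_real pi) ^ DIM('a) *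
     (LINT \<eta>|lborel. p (x, \<xi> + \<eta>) * ft (\<lambda>z. cutoff z * q (x - z, \<xi>)) \<eta>)"
  by (simp add: comp_sym_def osc_int_def osc_fiber_def amp_comp_def ft_cmult)

lemma comp_sym_integrable:
  fixes p q :: "'a::euclidean_space \<times> 'a \<Rightarrow> complex"
  assumes p: "symb UNIV m p" and q: "smooth_on UNIV q"
  shows "integrable lborel (\<lambda>\<eta>. p (x, \<xi> + \<eta>) * ft (\<lambda>z. cutoff z * q (x - z, \<xi>)) \<eta>)"
  using tdecay_integrable[OF osc_fiber_tdecay[OF amplitude_comp[OF p q]], of "(x, \<xi>)"]
  by (simp add: osc_fiber_def amp_comp_def ft_cmult)

text \<open>Here the covariable \<open>\<xi>\<close> is that of \<open>q\<close> and stays frozen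
  under the transform; the statement is meant for \<open>ft_amp_decay\<close>, whose variable
  \<open>\<eta>\<close> is a separate one.\<close>

lemma amp_section_cut:
  assumes q: "symb UNIV m q"
  shows "amp m (\<lambda>(s, \<xi>). q (fst s - snd s, \<xi>) * cutoff (snd s))"
proof -
  have 1: "symb UNIV m (\<lambda>(s, \<xi>). q (fst s - snd s, \<xi>))"
    by (rule symb_pullback_fst[OF _ q]) (intro bounded_linear_intros)
  have 2: "zsupp (\<lambda>s. cutoff (snd s))" using zsupp_cut[of "\<lambda>_. 1"] by simp
  show ?thesis using amp_intro[OF 1 smooth_cut_snd 2] by simp
qed

lemma section_cut_smooth:
  fixes q :: "'a::euclidean_space \<times> 'a \<Rightarrow> complex"
  assumes q: "smooth_on UNIV q"
  shows "smooth_on UNIV (\<lambda>z. cutoff z * q (x - z, \<xi>))"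
    and "z \<notin> cball 0 1 \<Longrightarrow> cutoff z * q (x - z, \<xi>) = 0"
proof -
  have bl: "bounded_linear (\<lambda>z::'a. (- z, 0::'a))"
    by (intro bounded_linear_Pair bounded_linear_minus bounded_linear_ident bounded_linear_zero)
  have "smooth_on UNIV (\<lambda>z. q ((- z, 0) + (x, \<xi>)))"
    by (rule smooth_on_compose_affine[OF open_UNIV _ bl q]) simp
  then show "smooth_on UNIV (\<lambda>z. cutoff z * q (x - z, \<xi>))"
    by (intro smooth_on_mult cut_smooth open_UNIV) simp
qed (simp add: cut_0)

text \<open>Near \<open>z = 0\<close> the cutoff is 1 and drops out of the derivatives. The sign
  comes from the reflection \<open>z \<mapsto> x - z\<close> and cancels the one in
  \<open>moment\<close>.\<close>

lemma section_cut_D_iter: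
  fixes q :: "'a::euclidean_space \<times> 'a \<Rightarrow> complex"
  assumes q: "smooth_on UNIV q" and vs: "set vs \<subseteq> Basis"
  shows "D_iter vs (\<lambda>z. cutoff z * q (x - z, \<xi>)) 0 = (- 1) ^ length vs * D_iter (map (\<lambda>v. (v, 0)) vs) q (x, \<xi>)"
proof -
  have bl: "bounded_linear (\<lambda>z::'a. (z, 0::'a))" by (intro bounded_linear_intros)
  have "D_iter vs (\<lambda>z. cutoff z * q (x - z, \<xi>)) 0 = D_iter vs (\<lambda>z. q (x - z, \<xi>)) 0"
    by (rule D_iter_cong_open[of "ball 0 (1/2)"]) (simp_all add: cut_1)
  also have "\<dots> = (- 1) ^ length vs * D_iter vs (\<lambda>y. q (y, \<xi>)) (x - 0)"
    by (rule D_iter_reflect[OF smooth_on_section1[OF q] vs])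
  also have "D_iter vs (\<lambda>y. q (y, \<xi>)) (x - 0) = D_iter (map (\<lambda>v. (v, 0)) vs) q (x, \<xi>)"
    using D_iter_affine_Basis[OF bl _ q vs, of "(0, \<xi>)" x] by simp
  finally show ?thesis .
qed

text \<open>Integrating the \<open>k\<close>-th Taylor term in \<open>\<eta>\<close> against the
  transform in \<open>z\<close> turns each monomial into a derivative of \<open>q\<close> at
  \<open>x\<close>, so \<open>comp_term\<close> is hit exactly and no error enters before the Taylor
  remainder.\<close>

lemma comp_term_expand:
  fixes p q :: "'a::euclidean_space \<times> 'a \<Rightarrow> complex" and x \<xi> :: 'a and k :: nat
  assumes p: "smooth_on UNIV p" and q: "smooth_on UNIV q"
  defines "G \<equiv> ft (\<lambda>z. cutoff z * q (x - z, \<xi>))"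
  defines "h \<equiv> \<lambda>\<eta>. (\<i> ^ k / fact k * (\<Sum>vs\<in>words k. of_real (monomial vs \<eta>) * D_iter (map (Pair 0) vs) p (x, \<xi>))) * G \<eta>"
  shows "integrable lborel h" "comp_term k p q (x, \<xi>) = 1 / (2 * of_real pi) ^ DIM('a) * (LINT \<eta>|lborel. h \<eta>)"
proof -
  note g = section_cut_smooth(1)[OF q, of x \<xi>] compact_cball[of 0 1] section_cut_smooth(2)[OF q, of _ x \<xi>]
  let ?c = "\<lambda>vs. \<i> ^ k / fact k * D_iter (map (Pair 0) vs) p (x, \<xi>)"
  have h: "h = (\<lambda>\<eta>. \<Sum>vs\<in>words k. ?c vs * (of_real (monomial vs \<eta>) * G \<eta>))"
    unfolding h_def by (simp add: sum_distrib_left sum_distrib_right mult_ac)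
  have i: "integrable lborel (\<lambda>\<eta>. ?c vs * (of_real (monomial vs \<eta>) * G \<eta>))" if "vs \<in> words k" for vs
    unfolding G_def by (intro integrable_mult_right moment(1)[OF g wordsD(1)[OF that]])
  show "integrable lborel h" unfolding h using i by (rule Bochner_Integration.integrable_sum)
  have "(LINT \<eta>|lborel. h \<eta>) = (\<Sum>vs\<in>words k. ?c vs * (LINT \<eta>|lborel. of_real (monomial vs \<eta>) * G \<eta>))"
    unfolding h using i by (simp add: Bochner_Integration.integral_sum)
  also have "\<dots> = (\<Sum>vs\<in>words k. ?c vs * ((2 * of_real pi) ^ DIM('a) * D_iter (map (\<lambda>v. (v, 0)) vs) q (x, \<xi>)))"
  proof (intro sum.cong refl)
    fix vs :: "'a list" assume vs: "vs \<in> words k"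
    have "(LINT \<eta>|lborel. of_real (monomial vs \<eta>) * G \<eta>) = (2 * of_real pi) ^ DIM('a) * ((- 1) ^ length vs * ((- 1) ^ length vs * D_iter (map (\<lambda>v. (v, 0)) vs) q (x, \<xi>)))"
      unfolding G_def by (subst moment(2)[OF g wordsD(1)[OF vs]]) (simp_all add: section_cut_D_iter[OF q wordsD(1)[OF vs]])
    also have "(- 1) ^ length vs * ((- 1) ^ length vs * D_iter (map (\<lambda>v. (v, 0)) vs) q (x, \<xi>)) = D_iter (map (\<lambda>v. (v, 0)) vs) q (x, \<xi>)"
      by (simp flip: mult.assoc power_mult_distrib)
    finally show "?c vs * (LINT \<eta>|lborel. of_real (monomial vs \<eta>) * G \<eta>) = ?c vs * ((2 * of_real pi) ^ DIM('a) * D_iter (map (\<lambda>v. (v, 0)) vs) q (x, \<xi>))"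
      by simp
  qed
  also have "\<dots> = (2 * of_real pi) ^ DIM('a) * comp_term k p q (x, \<xi>)"
    by (simp add: comp_term_def sum_distrib_left mult_ac)
  finally show "comp_term k p q (x, \<xi>) = 1 / (2 * of_real pi) ^ DIM('a) * (LINT \<eta>|lborel. h \<eta>)" by simp
qed

text \<open>Taylor expansion of \<open>p (x, \<xi> + \<eta>)\<close> in \<open>\<eta>\<close>; Peetre's inequality trades the growth of the remainder for
  powers of \<open>\<eta>\<close>, which the rapidly decaying Fourier transform in \<open>z\<close> absorbs.\<close>

lemma comp_rem_bound:
  fixes p q :: "'a::euclidean_space \<times> 'a \<Rightarrow> complex"
  assumes p: "symb UNIV m p" and q: "symb UNIV m' q" and K: "compact K"
  shows "\<exists>C\<ge>0. \<forall>x\<in>K. \<forall>\<xi>. cmod (comp_rem N p q (x, \<xi>)) \<le> C * jb \<xi> powr (m + m' - real N)"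
proof -
  let ?s = "m - real N" and ?n = "real DIM('a)"
  \<comment> \<open>The decay asked of the transform in \<open>z\<close>: \<open>N\<close> for the
    monomials of the remainder, \<open>\<bar>m - N\<bar>\<close> for Peetre's inequality, and
    \<open>2 * ?n\<close> for integrability over \<open>\<eta>\<close>.\<close>
  let ?\<sigma> = "- (real N + \<bar>?s\<bar> + 2 * ?n)"
  have sp: "smooth_on UNIV p" and sq: "smooth_on UNIV q" using p q by (auto intro: symb_smooth)
  obtain C1 where C1: "C1 \<ge> 0" "\<And>vs x \<xi>. vs \<in> words N \<Longrightarrow> x \<in> K \<Longrightarrow> cmod (D_iter (map (Pair 0) vs) p (x, \<xi>)) \<le> C1 * jb \<xi> powr ?s"
  proof -
    obtain C where C: "C \<ge> 0" "\<forall>ws. set ws \<subseteq> Basis \<and> length ws \<le> N \<longrightarrow> (\<forall>x\<in>K. \<forall>\<xi>. (x, \<xi>) \<in> UNIV \<longrightarrow>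
        cmod (D_iter ws p (x, \<xi>)) \<le> C * jb \<xi> powr (m - real (cnt ws)))"
      using symbE_fin[OF p K, of N] by blast
    show ?thesis
    proof (rule that[OF C(1)])
      fix vs :: "'a list" and x \<xi> assume "vs \<in> words N" "x \<in> K"
      then show "cmod (D_iter (map (Pair 0) vs) p (x, \<xi>)) \<le> C * jb \<xi> powr ?s"
        using C(2)[rule_format, of "map (Pair 0) vs" x \<xi>] by (simp add: wordsD)
    qed
  qed
  obtain C2 where C2: "C2 \<ge> 0" "\<And>x \<xi> \<eta>. x \<in> K \<Longrightarrow> cmod (ft (\<lambda>z. cutoff z * q (x - z, \<xi>)) \<eta>) \<le> C2 * jb \<xi> powr m' * jb \<eta> powr ?\<sigma>"
    using ft_amp_decay[OF amp_section_cut[OF q] K, of ?\<sigma>] by (auto simp: mult.commute)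
  let ?W = "real (card (words N :: 'a list set))"
  let ?cn = "1 / (2 * complex_of_real pi) ^ DIM('a)"
  let ?I = "LINT \<eta>|lborel. jb (\<eta>::'a) powr (- 2 * ?n)"
  let ?C = "cmod ?cn * (?W * C1 * 2 powr \<bar>?s\<bar> * C2 * ?I)"
  have I0: "?I \<ge> 0" by (rule Bochner_Integration.integral_nonneg) simp
  have "cmod (comp_rem N p q (x, \<xi>)) \<le> ?C * jb \<xi> powr (m + m' - real N)" if x: "x \<in> K" for x \<xi>
  proof -
    let ?G = "ft (\<lambda>z. cutoff z * q (x - z, \<xi>))"
    let ?P = "\<lambda>k \<eta>. \<i> ^ k / fact k * (\<Sum>vs\<in>words k. of_real (monomial vs \<eta>) * D_iter (map (Pair 0) vs) p (x, \<xi>))"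
    \<comment> \<open>The Taylor polynomial is subtracted under the integral. Its terms integrate to
      the \<open>comp_term\<close>s, so the remainder is the integral of this one function, which
      can be bounded pointwise.\<close>
    let ?H = "\<lambda>\<eta>. (p (x, \<xi> + \<eta>) - (\<Sum>k<N. ?P k \<eta>)) * ?G \<eta>"
    have eqH: "?H = (\<lambda>\<eta>. p (x, \<xi> + \<eta>) * ?G \<eta> - (\<Sum>k<N. ?P k \<eta> * ?G \<eta>))"
      by (simp add: left_diff_distrib sum_distrib_right)
    have iP: "integrable lborel (\<lambda>\<eta>. ?P k \<eta> * ?G \<eta>)" for k by (rule comp_term_expand(1)[OF sp sq])
    have iC: "integrable lborel (\<lambda>\<eta>. p (x, \<xi> + \<eta>) * ?G \<eta>)" by (rule comp_sym_integrable[OF p sq])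
    have iH: "integrable lborel ?H" unfolding eqH using iC iP by simp
    have E: "comp_rem N p q (x, \<xi>) = ?cn * (LINT \<eta>|lborel. ?H \<eta>)"
      unfolding comp_rem_def comp_sym_expand comp_term_expand(2)[OF sp sq] eqH
      using iC iP by (simp add: Bochner_Integration.integral_sum right_diff_distrib sum_distrib_left)
    have le: "cmod (?H \<eta>) \<le> (?W * C1 * 2 powr \<bar>?s\<bar> * C2 * jb \<xi> powr (m + m' - real N)) * jb \<eta> powr (- 2 * ?n)" for \<eta>
    proof -
      have "cmod (p (x, \<xi> + \<eta>) - (\<Sum>k<N. ?P k \<eta>)) \<le> ?W * (jb \<eta> ^ N * (C1 * (2 powr \<bar>?s\<bar> * jb \<xi> powr ?s * jb \<eta> powr \<bar>?s\<bar>)))"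
      proof (rule taylor_symbol[OF sp])
        fix t :: real and vs :: "'a list" assume t: "t \<in> {0..1}" and vs: "vs \<in> words N"
        have "cmod (D_iter (map (Pair 0) vs) p (x, \<xi> + t *\<^sub>R \<eta>)) \<le> C1 * jb (\<xi> + t *\<^sub>R \<eta>) powr ?s"
          by (rule C1(2)[OF vs x])
        also have "\<dots> \<le> C1 * (2 powr \<bar>?s\<bar> * jb \<xi> powr ?s * jb (t *\<^sub>R \<eta>) powr \<bar>?s\<bar>)"
          by (intro mult_left_mono peetre C1(1))
        also have "\<dots> \<le> C1 * (2 powr \<bar>?s\<bar> * jb \<xi> powr ?s * jb \<eta> powr \<bar>?s\<bar>)"
          using t C1(1) by (intro mult_left_mono powr_mono2 jb_mono) (auto intro: mult_left_le_one_le)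
        finally show "cmod (D_iter (map (Pair 0) vs) p (x, \<xi> + t *\<^sub>R \<eta>)) \<le> C1 * (2 powr \<bar>?s\<bar> * jb \<xi> powr ?s * jb \<eta> powr \<bar>?s\<bar>)" .
      qed
      then have "cmod (?H \<eta>) \<le> (?W * (jb \<eta> ^ N * (C1 * (2 powr \<bar>?s\<bar> * jb \<xi> powr ?s * jb \<eta> powr \<bar>?s\<bar>)))) * (C2 * jb \<xi> powr m' * jb \<eta> powr ?\<sigma>)"
        unfolding norm_mult by (intro mult_mono C2(2) x) (use C1(1) in auto)
      also have "\<dots> = (?W * C1 * 2 powr \<bar>?s\<bar> * C2) * (jb \<xi> powr ?s * jb \<xi> powr m') * (jb \<eta> powr real N * jb \<eta> powr \<bar>?s\<bar> * jb \<eta> powr ?\<sigma>)"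
        by (simp add: powr_realpow mult_ac)
      also have "\<dots> = (?W * C1 * 2 powr \<bar>?s\<bar> * C2) * jb \<xi> powr (m + m' - real N) * jb \<eta> powr (- 2 * ?n)"
        by (simp add: algebra_simps flip: powr_add)
      finally show ?thesis by (simp add: mult_ac)
    qed
    have "cmod (LINT \<eta>|lborel. ?H \<eta>) \<le> (LINT \<eta>|lborel. (?W * C1 * 2 powr \<bar>?s\<bar> * C2 * jb \<xi> powr (m + m' - real N)) * jb (\<eta>::'a) powr (- 2 * ?n))"
      by (rule order_trans[OF integral_norm_bound integral_mono])
        (use iH le integrable_jb[of "- 2 * ?n", where 'a='a] in \<open>auto intro: integrable_norm\<close>)
    also have "\<dots> = (?W * C1 * 2 powr \<bar>?s\<bar> * C2 * jb \<xi> powr (m + m' - real N)) * ?I" by simp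
    finally have "cmod (comp_rem N p q (x, \<xi>)) \<le> cmod ?cn * ((?W * C1 * 2 powr \<bar>?s\<bar> * C2 * jb \<xi> powr (m + m' - real N)) * ?I)"
      unfolding E norm_mult by (rule mult_left_mono) simp
    then show ?thesis by (simp add: mult_ac)
  qed
  then show ?thesis using C1(1) C2(1) I0 by (intro exI[of _ ?C]) (auto intro!: mult_nonneg_nonneg)
qed

text \<open>By \<open>comp_rem_pd\<close> a derivative of the remainder is a sum of two remainders
  in which \<open>p\<close> or \<open>q\<close> is differentiated, with its order lowered by one for
  a covariable direction. Induction over the word, for all \<open>p\<close>, \<open>q\<close> and
  orders at once, reduces everything to \<open>comp_rem_bound\<close>.\<close>

theorem comp_rem_symb:
  fixes p q :: "'a::euclidean_space \<times> 'a \<Rightarrow> complex"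
  assumes p: "symb UNIV m p" and q: "symb UNIV m' q"
  shows "symb UNIV (m + m' - real N) (comp_rem N p q)"
  unfolding symb_def
proof (intro conjI allI impI)
  show "smooth_on UNIV (comp_rem N p q)" by (rule comp_rem_smooth[OF p symb_smooth[OF q]])
  fix ws :: "('a \<times> 'a) list" and K :: "'a set" assume "set ws \<subseteq> Basis \<and> compact K"
  then have ws: "set ws \<subseteq> Basis" and K: "compact K" by auto
  have "\<exists>C\<ge>0. \<forall>x\<in>K. \<forall>\<xi>. cmod (D_iter ws (comp_rem N p q) (x, \<xi>)) \<le> C * jb \<xi> powr (m + m' - real N - real (cnt ws))"
    using ws p q
  proof (induction ws arbitrary: p q m m' rule: rev_induct)
    case Nil
    then show ?case using comp_rem_bound[OF Nil(2,3) K, of N] by simp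
  next
    case (snoc w ws)
    have w: "w \<in> Basis" and ws: "set ws \<subseteq> Basis" using snoc.prems by auto
    note p = snoc.prems(2) and q = snoc.prems(3)
    let ?d = "if fst w = 0 then 1 else 0 :: real"
    have eq: "D_iter (ws @ [w]) (comp_rem N p q) y = D_iter ws (comp_rem N (pd w p) q) y + D_iter ws (comp_rem N p (pd w q)) y" for y
      unfolding D_iter_append by (simp add: comp_rem_pd[OF p symb_smooth[OF q] w])
        (rule D_iter_add[OF open_UNIV comp_rem_smooth[OF symb_pd[OF p w] symb_smooth[OF q]] comp_rem_smooth[OF p symb_smooth[OF symb_pd[OF q w]]] ws UNIV_I])
    obtain C where C: "C \<ge> 0" "\<forall>x\<in>K. \<forall>\<xi>. cmod (D_iter ws (comp_rem N (pd w p) q) (x, \<xi>)) \<le> C * jb \<xi> powr ((m - ?d) + m' - real N - real (cnt ws))"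
      using snoc.IH[OF ws symb_pd[OF p w] q] by blast
    obtain C' where C': "C' \<ge> 0" "\<forall>x\<in>K. \<forall>\<xi>. cmod (D_iter ws (comp_rem N p (pd w q)) (x, \<xi>)) \<le> C' * jb \<xi> powr (m + (m' - ?d) - real N - real (cnt ws))"
      using snoc.IH[OF ws p symb_pd[OF q w]] by blast
    have o: "(m - ?d) + m' - real N - real (cnt ws) = m + m' - real N - real (cnt (ws @ [w]))"
      "m + (m' - ?d) - real N - real (cnt ws) = m + m' - real N - real (cnt (ws @ [w]))" by auto
    show ?case
    proof (intro exI[of _ "C + C'"] conjI ballI allI)
      fix x \<xi> assume x: "x \<in> K"
      have "cmod (D_iter (ws @ [w]) (comp_rem N p q) (x, \<xi>)) \<le> C * jb \<xi> powr (m + m' - real N - real (cnt (ws @ [w]))) + C' * jb \<xi> powr (m + m' - real N - real (cnt (ws @ [w])))"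
        unfolding eq using C(2)[unfolded o] C'(2)[unfolded o] x by (intro norm_triangle_le add_mono) auto
      then show "cmod (D_iter (ws @ [w]) (comp_rem N p q) (x, \<xi>)) \<le> (C + C') * jb \<xi> powr (m + m' - real N - real (cnt (ws @ [w])))"
        by (simp add: distrib_right)
    qed (use C(1) C'(1) in simp)
  qed
  then show "\<exists>C. \<forall>x\<in>K. \<forall>\<xi>. (x, \<xi>) \<in> UNIV \<longrightarrow> cmod (D_iter ws (comp_rem N p q) (x, \<xi>)) \<le> C * jb \<xi> powr (m + m' - real N - real (cnt ws))"
    by auto
qed

section \<open>Operators and smooth kernels\<close>

definition kernel_op :: "('a::euclidean_space \<times> 'a \<Rightarrow> complex) \<Rightarrow> ('a \<Rightarrow> complex) \<Rightarrow> 'a \<Rightarrow> complex" where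
  "kernel_op r u x = (LINT y|lborel. r (x, y) * u y)"

definition rapid :: "('a::euclidean_space \<times> 'b::euclidean_space \<Rightarrow> complex) \<Rightarrow> bool" where
  "rapid d \<longleftrightarrow> (\<forall>M::nat. symb UNIV (- real M) d)"

lemma rapidD: "rapid d \<Longrightarrow> symb UNIV m d"
proof -
  assume d: "rapid d"
  obtain M :: nat where "- m \<le> real M" using real_arch_simple by blast
  then show ?thesis using d symb_mono[of UNIV "- real M" d m] unfolding rapid_def by auto
qed

lemma test_cont: "u \<in> test_functions \<Longrightarrow> continuous_on UNIV u"
  using smooth_on_imp_continuous_on test_functionsD(1) by blast

lemma integrable_test: "u \<in> test_functions \<Longrightarrow> integrable lborel u"
  by (rule integrable_compact_support[OF test_cont test_functionsD(2)]) (auto intro: fun_support_zero)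

lemma ph_diff: "ph (x - z) \<eta> = ph x \<eta> * ph z (- \<eta>)"
  using ph_add_left[of x "- z" \<eta>] by (simp add: ph_def)

text \<open>The substitution \<open>y = x - z\<close> leads from the difference variable back to the
  usual formula of left quantization.\<close>

lemma Op_expand:
  fixes u :: "'a::euclidean_space \<Rightarrow> complex"
  assumes u: "u \<in> test_functions"
  shows "Op a u x = 1 / (2 * of_real pi) ^ DIM('a) * (LINT \<xi>|lborel. ph x \<xi> * (a (x, \<xi>) * ft u (- \<xi>)))"
proof -
  have "ft (\<lambda>z. u (x - z)) \<eta> = ph x \<eta> * ft u (- \<eta>)" for \<eta>
  proof -
    have "ft (\<lambda>z. u (x - z)) \<eta> = (LINT z|lborel. (\<lambda>y. ph (x - y) \<eta> * u y) (x - z))"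
      by (simp add: ft_def)
    also have "\<dots> = (LINT y|lborel. ph (x - y) \<eta> * u y)"
      by (rule lborel_integral_reflect)
        (use test_cont[OF u] in \<open>auto intro!: borel_measurable_continuous_onI continuous_intros\<close>)
    also have "\<dots> = ph x \<eta> * ft u (- \<eta>)"
      unfolding ft_def ph_diff by (simp add: mult.assoc)
    finally show ?thesis .
  qed
  then show ?thesis by (simp add: Op_def osc_int_def osc_fiber_def amp_Op_def ft_cmult mult_ac)
qed

lemma OpT_expand:
  fixes u :: "'a::euclidean_space \<Rightarrow> complex"
  shows "OpT a u x = 1 / (2 * of_real pi) ^ DIM('a) * (LINT \<eta>|lborel. a (x, \<eta>) * ft (\<lambda>z. cutoff z * u (x - z)) \<eta>)"
  by (simp add: OpT_def osc_int_def osc_fiber_def amp_OpT_def ft_cmult)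

lemma Op_smooth: "symb UNIV m a \<Longrightarrow> u \<in> test_functions \<Longrightarrow> smooth_on UNIV (Op a u)"
  unfolding Op_def by (rule osc_int_smooth(1)[OF amplitude_Op])

lemma OpT_smooth: "symb UNIV m a \<Longrightarrow> smooth_on UNIV u \<Longrightarrow> smooth_on UNIV (OpT a u)"
  unfolding OpT_def by (rule osc_int_smooth(1)[OF amplitude_OpT])

lemma Op_add:
  assumes "symb UNIV m a" "u \<in> test_functions" "v \<in> test_functions"
  shows "Op a (\<lambda>x. u x + v x) x = Op a u x + Op a v x"
  unfolding Op_def using osc_int_add[OF amplitude_Op[OF assms(1,2)] amplitude_Op[OF assms(1,3)], of x]
  by (simp add: amp_Op_def case_prod_beta' distrib_left)

lemma OpT_add:
  assumes "symb UNIV m a" "smooth_on UNIV u" "smooth_on UNIV v"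
  shows "OpT a (\<lambda>x. u x + v x) x = OpT a u x + OpT a v x"
  unfolding OpT_def using osc_int_add[OF amplitude_OpT[OF assms(1,2)] amplitude_OpT[OF assms(1,3)], of x]
  by (simp add: amp_OpT_def case_prod_beta' distrib_left)

lemma Op_symbol_add:
  assumes "symb UNIV m a" "symb UNIV m' b" "u \<in> test_functions"
  shows "Op (\<lambda>p. a p + b p) u x = Op a u x + Op b u x"
  unfolding Op_def using osc_int_add[OF amplitude_Op[OF assms(1,3)] amplitude_Op[OF assms(2,3)], of x]
  by (simp add: amp_Op_def case_prod_beta' distrib_right)

lemma osc_int_cmult: "osc_int (\<lambda>p. c * b p) t = c * osc_int b t"
  by (simp add: osc_int_def osc_fiber_def ft_cmult)

lemma Op_cmult: "Op a (\<lambda>x. c * u x) x = c * Op a u x"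
  unfolding Op_def using osc_int_cmult[of c "amp_Op a u" x] by (simp add: amp_Op_def case_prod_beta' mult_ac)

lemma OpT_cmult: "OpT a (\<lambda>x. c * u x) x = c * OpT a u x"
  unfolding OpT_def using osc_int_cmult[of c "amp_OpT a u" x] by (simp add: amp_OpT_def case_prod_beta' mult_ac)

lemma OpT_diff:
  assumes "symb UNIV m a" "smooth_on UNIV u" "smooth_on UNIV v"
  shows "OpT a (\<lambda>x. u x - v x) x = OpT a u x - OpT a v x"
  using OpT_add[OF assms(1,2) smooth_on_cmult[OF open_UNIV assms(3)], of "-1" x] OpT_cmult[of a "-1" v x] by simp

lemma OpT_local:
  assumes "\<And>z. z \<in> cball 0 1 \<Longrightarrow> u (x - z) = v (x - z)"
  shows "OpT a u x = OpT a v x"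
proof -
  have "cutoff z * u (x - z) = cutoff z * v (x - z)" for z
    using assms[of z] cut_0[of z] by (cases "z \<in> cball 0 1") auto
  then have "(\<lambda>z. cutoff z * u (x - z)) = (\<lambda>z. cutoff z * v (x - z))" by (rule ext)
  then show ?thesis unfolding OpT_expand by (simp only:)
qed

text \<open>The value at \<open>x\<close> depends on \<open>u\<close> only within distance 1 of
  \<open>x\<close>, so the support grows by at most the unit ball.\<close>

lemma OpT_test:
  assumes a: "symb UNIV m a" and u: "u \<in> test_functions"
  shows "OpT a u \<in> test_functions"
proof (rule test_functionsI(1))
  let ?M = "{x + y |x y. x \<in> fun_support u \<and> y \<in> cball 0 1}"
  show "smooth_on UNIV (OpT a u)" by (rule OpT_smooth[OF a test_functionsD(1)[OF u]])
  show "compact ?M" by (rule compact_sums[OF test_functionsD(2)[OF u] compact_cball])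
  fix x assume x: "x \<notin> ?M"
  have z: "u (x - z) = 0" if "z \<in> cball 0 1" for z
  proof -
    have "x = (x - z) + z" by simp
    then have "x - z \<notin> fun_support u" using x that by blast
    then show ?thesis by (simp add: fun_support_zero)
  qed
  have "OpT a u x = OpT a (\<lambda>_. 0) x" by (rule OpT_local) (rule z)
  then show "OpT a u x = 0" using OpT_cmult[of a 0 "\<lambda>_. 0" x] by simp
qed

text \<open>Fourier inversion at \<open>z = 0\<close> for the function
  \<open>z \<mapsto> u (x - z)\<close>.\<close>

lemma Op_one:
  fixes u :: "'a::euclidean_space \<Rightarrow> complex"
  assumes u: "u \<in> test_functions"
  shows "Op (\<lambda>_. 1) u x = u x"
proof -
  have bl: "bounded_linear (uminus :: 'a \<Rightarrow> 'a)" by (rule bounded_linear_minus[OF bounded_linear_ident])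
  have s: "smooth_on UNIV (\<lambda>z. u (x - z))"
    using smooth_on_compose_affine[OF open_UNIV _ bl test_functionsD(1)[OF u], of x] by simp
  have c: "compact {x - y |y. y \<in> fun_support u}"
    using compact_differences[OF compact_sing[of x] test_functionsD(2)[OF u]] by simp
  have z: "u (x - z) = 0" if "z \<notin> {x - y |y. y \<in> fun_support u}" for z
  proof -
    have "z = x - (x - z)" by simp
    then have "x - z \<notin> fun_support u" using that by blast
    then show ?thesis by (rule fun_support_zero)
  qed
  have "(LINT \<eta>|lborel. ft (\<lambda>z. u (x - z)) \<eta>) = (2 * of_real pi) ^ DIM('a) * u (x - 0)"
    by (rule fourier_inversion[OF s c z])
  then show ?thesis by (simp add: Op_def osc_int_def osc_fiber_def amp_Op_def)
qed

lemma test_ft_decay: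
  fixes u :: "'a::euclidean_space \<Rightarrow> complex"
  assumes u: "u \<in> test_functions"
  shows "\<exists>C\<ge>0. \<forall>\<xi>. cmod (ft u (- \<xi>)) \<le> C * jb \<xi> powr s"
proof -
  obtain C where C: "C \<ge> 0" "\<And>\<eta>. cmod (ft u \<eta>) \<le> C * jb \<eta> powr s"
    by (rule ft_decay'[OF test_functionsD[OF u] fun_support_zero[of _ u], where s = s]) (use that in auto)
  have "cmod (ft u (- \<xi>)) \<le> C * jb \<xi> powr s" for \<xi> using C(2)[of "- \<xi>"] by simp
  then show ?thesis using C(1) by blast
qed

lemma test_ft_cont: "u \<in> test_functions \<Longrightarrow> continuous_on UNIV (ft u)"
  by (rule smooth_on_imp_continuous_on[OF smooth_on_ft[OF test_functionsD]]) (auto intro: fun_support_zero)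

lemma Fubini_compact:
  fixes H :: "'a::euclidean_space \<times> 'b::euclidean_space \<Rightarrow> complex"
  assumes H: "continuous_on UNIV H" and K: "compact K" and L: "compact L"
    and z: "\<And>x y. x \<notin> K \<or> y \<notin> L \<Longrightarrow> H (x, y) = 0"
  shows "(LINT x|lborel. (LINT y|lborel. H (x, y))) = (LINT y|lborel. (LINT x|lborel. H (x, y)))"
proof -
  have "bounded (H ` (K \<times> L))"
    by (intro compact_imp_bounded compact_continuous_image compact_Times K L continuous_on_subset[OF H]) auto
  then obtain B where B: "\<And>x y. x \<in> K \<Longrightarrow> y \<in> L \<Longrightarrow> cmod (H (x, y)) \<le> B" unfolding bounded_iff by auto
  show ?thesis
  proof (rule Fubini_bound(2))
    show "H \<in> borel_measurable borel" by (rule borel_measurable_continuous_onI[OF H])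
    show "integrable lborel (\<lambda>x. B * indicat_real K x)" "integrable lborel (indicat_real L)"
      using emeasure_compact_finite[OF K] emeasure_compact_finite[OF L]
      by (intro integrable_mult_right integrable_real_indicator borel_compact K L; simp add: borel_compact K L)+
    show "cmod (H (x, y)) \<le> B * indicat_real K x * indicat_real L y" for x y
      using B[of x y] z[of x y] by (auto simp: indicator_def)
  qed
qed

text \<open>Inserting the formula for \<open>Op q u\<close> and interchanging integrals twice
  leaves, for each \<open>\<xi>\<close>, an integral over \<open>\<eta>\<close> of
  \<open>p (x, \<eta>)\<close> against the transform in \<open>z\<close> at
  \<open>\<eta> - \<xi>\<close>; the translation \<open>\<eta> := \<eta> + \<xi>\<close> makes it
  \<open>comp_sym\<close>. The cutoff of the left factor stays inside the symbol, so there is no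
  remainder.\<close>

lemma composition:
  fixes p q :: "'a::euclidean_space \<times> 'a \<Rightarrow> complex" and u :: "'a \<Rightarrow> complex"
  assumes p: "symb UNIV m p" and q: "symb UNIV m' q" and u: "u \<in> test_functions"
  shows "OpT p (Op q u) x = Op (comp_sym p q) u x"
proof -
  let ?n = "real DIM('a)"
  let ?cn = "1 / (2 * complex_of_real pi) ^ DIM('a)"
  \<comment> \<open>The decay of the transform in \<open>z\<close> that beats the growth of
    \<open>p\<close> by an integrable margin. Peetre's inequality at \<open>\<eta> - \<xi>\<close>
    moves this decay to \<open>\<eta>\<close> at the price of order \<open>\<sigma>\<close> in
    \<open>\<xi>\<close>, which is charged to the decay of \<open>ft u\<close> in
    \<open>Cu\<close>.\<close>
  define \<sigma> where "\<sigma> = \<bar>m\<bar> + 2 * ?n"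
  have s0: "\<bar>- \<sigma>\<bar> = \<sigma>" "m - \<sigma> \<le> - 2 * ?n" "- \<sigma> - 2 * ?n \<le> - 2 * ?n" by (auto simp: \<sigma>_def)
  define G where "G = (\<lambda>\<xi> \<eta>. ft (\<lambda>z. cutoff z * q (x - z, \<xi>)) \<eta>)"
  note amq = amp_section_cut[OF q]
  have cu: "continuous_on UNIV u" and cfu: "continuous_on UNIV (ft u)" by (rule test_cont[OF u] test_ft_cont[OF u])+
  have cp: "continuous_on UNIV p" and cq: "continuous_on UNIV q"
    using p q by (auto intro: smooth_on_imp_continuous_on symb_smooth)
  have cc: "continuous_on UNIV (cutoff :: 'a \<Rightarrow> complex)" by (rule smooth_on_imp_continuous_on[OF cut_smooth])
  have cG: "continuous_on UNIV (\<lambda>(\<xi>, \<eta>). G \<xi> \<eta>)"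
  proof -
    have "continuous_on UNIV (\<lambda>w::'a \<times> 'a. (\<lambda>((t, \<xi>), \<eta>). ft (\<lambda>z. (\<lambda>(s, \<xi>). q (fst s - snd s, \<xi>) * cutoff (snd s)) ((t, z), \<xi>)) \<eta>) ((x, fst w), snd w))"
      by (rule continuous_on_compose2[OF smooth_on_imp_continuous_on[OF smooth_on_ft_amp(1)[OF amq]]])
        (auto intro!: continuous_intros)
    then show ?thesis by (simp add: G_def case_prod_beta' mult.commute)
  qed
  obtain CG where CG: "CG \<ge> 0" "\<And>\<xi> \<eta>. cmod (G \<xi> \<eta>) \<le> CG * jb \<xi> powr m' * jb \<eta> powr (- \<sigma>)"
    using ft_amp_decay[OF amq compact_sing[of x], of "- \<sigma>"] by (auto simp: G_def mult.commute)
  obtain Cp where Cp: "Cp \<ge> 0" "\<And>\<eta>. cmod (p (x, \<eta>)) \<le> Cp * jb \<eta> powr m"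
    using symb_bound[OF p compact_sing[of x]] by auto
  obtain Cq where Cq: "Cq \<ge> 0" "\<And>z \<xi>. z \<in> cball 0 1 \<Longrightarrow> cmod (q (x - z, \<xi>) * cutoff z) \<le> Cq * jb \<xi> powr m'"
    using symb_bound[OF ampD(1)[OF amq] compact_Times[OF compact_sing[of x] compact_cball[of 0 1]]] by auto
  obtain Cu where Cu: "Cu \<ge> 0" "\<And>\<xi>. cmod (ft u (- \<xi>)) \<le> Cu * jb \<xi> powr (- m' - \<sigma> - 2 * ?n)"
    using test_ft_decay[OF u] by blast
  have ij: "integrable lborel (\<lambda>\<xi>::'a. jb \<xi> powr s)" if "s \<le> - 2 * ?n" for s
    using integrable_jb[OF that] .
  have step1: "ft (\<lambda>z. cutoff z * Op q u (x - z)) \<eta> = ?cn * (LINT \<xi>|lborel. ph x \<xi> * (ft u (- \<xi>) * G \<xi> (\<eta> - \<xi>)))" for \<eta>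
  proof -
    let ?H = "\<lambda>(z, \<xi>). ph z \<eta> * (cutoff z * (ph (x - z) \<xi> * (q (x - z, \<xi>) * ft u (- \<xi>))))"
    have "ft (\<lambda>z. cutoff z * Op q u (x - z)) \<eta> = (LINT z|lborel. ?cn * (LINT \<xi>|lborel. ?H (z, \<xi>)))"
      unfolding ft_def Op_expand[OF u] by (simp add: mult_ac)
    also have "\<dots> = ?cn * (LINT z|lborel. (LINT \<xi>|lborel. ?H (z, \<xi>)))" by (rule integral_mult_right_zero)
    also have "(LINT z|lborel. (LINT \<xi>|lborel. ?H (z, \<xi>))) = (LINT \<xi>|lborel. (LINT z|lborel. ?H (z, \<xi>)))"
    proof (rule Fubini_bound(2))
      show "?H \<in> borel_measurable borel"
        unfolding case_prod_beta'
        by (intro borel_measurable_continuous_onI continuous_intros continuous_on_compose2[OF cc]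
            continuous_on_compose2[OF cq] continuous_on_compose2[OF cfu]) auto
      show "integrable lborel (\<lambda>z::'a. Cq * indicat_real (cball 0 1) z)"
        using emeasure_compact_finite[OF compact_cball[of "0::'a" 1]]
        by (intro integrable_mult_right integrable_real_indicator) auto
      show "integrable lborel (\<lambda>\<xi>::'a. Cu * jb \<xi> powr (- \<sigma> - 2 * ?n))"
        by (intro integrable_mult_right ij s0)
      fix z \<xi> :: 'a
      show "cmod (?H (z, \<xi>)) \<le> Cq * indicat_real (cball 0 1) z * (Cu * jb \<xi> powr (- \<sigma> - 2 * ?n))"
      proof (cases "z \<in> cball 0 1")
        case True
        have "cmod (?H (z, \<xi>)) = cmod (q (x - z, \<xi>) * cutoff z) * cmod (ft u (- \<xi>))" by (simp add: norm_mult)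
        also have "\<dots> \<le> (Cq * jb \<xi> powr m') * (Cu * jb \<xi> powr (- m' - \<sigma> - 2 * ?n))"
          by (intro mult_mono Cq(2) Cu(2) True) (use Cq(1) in auto)
        also have "\<dots> = Cq * (Cu * (jb \<xi> powr m' * jb \<xi> powr (- m' - \<sigma> - 2 * ?n)))" by (simp add: mult_ac)
        also have "jb \<xi> powr m' * jb \<xi> powr (- m' - \<sigma> - 2 * ?n) = jb \<xi> powr (- \<sigma> - 2 * ?n)" by (simp flip: powr_add)
        finally show ?thesis using True by simp
      qed (simp add: cut_0)
    qed
    also have "(LINT \<xi>|lborel. (LINT z|lborel. ?H (z, \<xi>))) = (LINT \<xi>|lborel. ph x \<xi> * (ft u (- \<xi>) * G \<xi> (\<eta> - \<xi>)))"
    proof (intro Bochner_Integration.integral_cong refl)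
      fix \<xi>
      have "?H (z, \<xi>) = (ph x \<xi> * ft u (- \<xi>)) * (ph z (\<eta> - \<xi>) * (cutoff z * q (x - z, \<xi>)))" for z
        using ph_add_right[of z \<eta> "- \<xi>"] by (simp add: ph_diff mult_ac)
      then show "(LINT z|lborel. ?H (z, \<xi>)) = ph x \<xi> * (ft u (- \<xi>) * G \<xi> (\<eta> - \<xi>))"
        unfolding G_def ft_def[of "\<lambda>z. cutoff z * q (x - z, \<xi>)"] by (simp only: integral_mult_right_zero mult.assoc)
    qed
    finally show ?thesis .
  qed
  let ?H = "\<lambda>(\<eta>, \<xi>). p (x, \<eta>) * (ph x \<xi> * (ft u (- \<xi>) * G \<xi> (\<eta> - \<xi>)))"
  have "OpT p (Op q u) x = ?cn * (LINT \<eta>|lborel. ?cn * (LINT \<xi>|lborel. ?H (\<eta>, \<xi>)))"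
    unfolding OpT_expand step1 by (simp add: mult_ac flip: integral_mult_right_zero)
  also have "\<dots> = ?cn * (?cn * (LINT \<eta>|lborel. (LINT \<xi>|lborel. ?H (\<eta>, \<xi>))))" by (simp only: integral_mult_right_zero)
  also have "(LINT \<eta>|lborel. (LINT \<xi>|lborel. ?H (\<eta>, \<xi>))) = (LINT \<xi>|lborel. (LINT \<eta>|lborel. ?H (\<eta>, \<xi>)))"
  proof (rule Fubini_bound(2))
    show "?H \<in> borel_measurable borel"
      unfolding case_prod_beta'
      by (intro borel_measurable_continuous_onI continuous_intros
          continuous_on_compose2[OF cp] continuous_on_compose2[OF cfu]
          continuous_on_compose2[OF cG, where f = "\<lambda>w. (snd w, fst w - snd w)", simplified]) auto
    show "integrable lborel (\<lambda>\<eta>::'a. (Cp * CG * 2 powr \<sigma>) * jb \<eta> powr (m - \<sigma>))"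
      by (intro integrable_mult_right ij s0)
    show "integrable lborel (\<lambda>\<xi>::'a. Cu * jb \<xi> powr (- 2 * ?n))"
      by (intro integrable_mult_right ij) auto
    fix \<eta> \<xi> :: 'a
    have pee: "jb (\<eta> - \<xi>) powr (- \<sigma>) \<le> 2 powr \<sigma> * jb \<eta> powr (- \<sigma>) * jb \<xi> powr \<sigma>"
      using peetre[of \<eta> "- \<xi>" "- \<sigma>"] unfolding s0 by simp
    have "cmod (G \<xi> (\<eta> - \<xi>)) \<le> CG * jb \<xi> powr m' * (2 powr \<sigma> * jb \<eta> powr (- \<sigma>) * jb \<xi> powr \<sigma>)"
      by (rule order_trans[OF CG(2)]) (intro mult_left_mono pee mult_nonneg_nonneg CG(1), simp)
    then have "cmod (?H (\<eta>, \<xi>)) \<le> (Cp * jb \<eta> powr m) * ((Cu * jb \<xi> powr (- m' - \<sigma> - 2 * ?n)) *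
        (CG * jb \<xi> powr m' * (2 powr \<sigma> * jb \<eta> powr (- \<sigma>) * jb \<xi> powr \<sigma>)))"
      unfolding prod.case norm_mult norm_ph mult_1 using Cp(1) Cu(1) CG(1)
      by (intro mult_mono Cp(2) Cu(2)) auto
    also have "\<dots> = (Cp * CG * 2 powr \<sigma>) * (jb \<eta> powr m * jb \<eta> powr (- \<sigma>)) *
        (Cu * (jb \<xi> powr (- m' - \<sigma> - 2 * ?n) * jb \<xi> powr m' * jb \<xi> powr \<sigma>))" by (simp add: mult_ac)
    also have "\<dots> = (Cp * CG * 2 powr \<sigma>) * jb \<eta> powr (m - \<sigma>) * (Cu * jb \<xi> powr (- 2 * ?n))"
      by (simp flip: powr_add)
    finally show "cmod (?H (\<eta>, \<xi>)) \<le> (Cp * CG * 2 powr \<sigma>) * jb \<eta> powr (m - \<sigma>) * (Cu * jb \<xi> powr (- 2 * ?n))" .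
  qed
  also have "?cn * (LINT \<xi>|lborel. (LINT \<eta>|lborel. ?H (\<eta>, \<xi>))) = (LINT \<xi>|lborel. ph x \<xi> * (comp_sym p q (x, \<xi>) * ft u (- \<xi>)))"
  proof -
    have "?cn * (LINT \<eta>|lborel. ?H (\<eta>, \<xi>)) = ph x \<xi> * (comp_sym p q (x, \<xi>) * ft u (- \<xi>))" for \<xi>
    proof -
      have "(LINT \<eta>|lborel. ?H (\<eta>, \<xi>)) = (ph x \<xi> * ft u (- \<xi>)) * (LINT \<eta>|lborel. p (x, \<eta>) * G \<xi> (\<eta> - \<xi>))"
        by (simp add: mult_ac flip: integral_mult_right_zero)
      also have "(LINT \<eta>|lborel. p (x, \<eta>) * G \<xi> (\<eta> - \<xi>)) = (LINT \<eta>|lborel. p (x, \<eta> + \<xi>) * G \<xi> (\<eta> + \<xi> - \<xi>))"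
        by (rule lborel_integral_shift[symmetric, of "\<lambda>\<eta>. p (x, \<eta>) * G \<xi> (\<eta> - \<xi>)"])
          (auto intro!: borel_measurable_continuous_onI continuous_intros continuous_on_compose2[OF cp]
            continuous_on_compose2[OF cG, where f = "\<lambda>w. (\<xi>, w - \<xi>)", simplified])
      finally show ?thesis by (simp add: comp_sym_expand G_def add.commute mult_ac)
    qed
    then show ?thesis by (simp flip: integral_mult_right_zero)
  qed
  finally show ?thesis unfolding Op_expand[OF u] .
qed

section \<open>Symbols of order minus infinity and their kernels\<close>

lemma symb_pdI:
  assumes a: "smooth_on S a"
    and b: "\<And>K. compact K \<Longrightarrow> \<exists>C. \<forall>x\<in>K. \<forall>\<xi>. (x, \<xi>) \<in> S \<longrightarrow> cmod (a (x, \<xi>)) \<le> C * jb \<xi> powr m"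
    and d: "\<And>w. w \<in> Basis \<Longrightarrow> symb S (m - (if fst w = 0 then 1 else 0)) (pd w a)"
  shows "symb S m a"
  unfolding symb_def
proof (intro conjI allI impI a)
  fix ws :: "('a \<times> 'b) list" and K :: "'a set" assume *: "set ws \<subseteq> Basis \<and> compact K"
  show "\<exists>C. \<forall>x\<in>K. \<forall>\<xi>. (x, \<xi>) \<in> S \<longrightarrow> cmod (D_iter ws a (x, \<xi>)) \<le> C * jb \<xi> powr (m - real (cnt ws))"
  proof (cases ws rule: rev_cases)
    case Nil
    then show ?thesis using b * by simp
  next
    case (snoc us w)
    then have w: "w \<in> Basis" "set us \<subseteq> Basis" using * by auto
    have eq: "m - (if fst w = 0 then 1 else 0) - real (cnt us) = m - real (cnt ws)" using snoc by simp
    obtain C where C: "\<forall>x\<in>K. \<forall>\<xi>. (x, \<xi>) \<in> S \<longrightarrow> cmod (D_iter us (pd w a) (x, \<xi>)) \<le> C * jb \<xi> powr (m - (if fst w = 0 then 1 else 0) - real (cnt us))"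
      using symbE[OF d[OF w(1)] w(2), of K] * by blast
    show ?thesis
      using C unfolding eq by (intro exI[of _ C]) (simp only: snoc D_iter_append D_iter_Cons D_iter.simps(1))
  qed
qed

lemma symb_linear: "symb UNIV 1 (\<lambda>(s::'t::euclidean_space, \<xi>::'a::euclidean_space). complex_of_real (v \<bullet> \<xi>))"
proof (rule symb_pdI)
  have bl: "bounded_linear (\<lambda>p::'t \<times> 'a. v \<bullet> snd p)" by (intro bounded_linear_intros)
  show s: "smooth_on UNIV (\<lambda>(s::'t, \<xi>::'a). complex_of_real (v \<bullet> \<xi>))"
    using smooth_on_linear[OF bl] by (simp add: case_prod_beta')
  have "((\<lambda>p::'t \<times> 'a. complex_of_real (v \<bullet> snd p)) has_derivative (\<lambda>p. complex_of_real (v \<bullet> snd p))) (at p)" for p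
    by (auto intro!: derivative_eq_intros bounded_linear.has_derivative[OF bl, of "\<lambda>x. x"])
  from pd_eqI[OF this] have pd: "pd w (\<lambda>(s::'t, \<xi>::'a). complex_of_real (v \<bullet> \<xi>)) = (\<lambda>p. - \<i> * of_real (v \<bullet> snd w))" for w
    by (intro ext) (simp add: case_prod_beta')
  show "symb UNIV (1 - (if fst w = 0 then 1 else 0)) (pd w (\<lambda>(s::'t, \<xi>::'a). complex_of_real (v \<bullet> \<xi>)))" for w
    unfolding pd by (rule symb_mono[OF symb_const]) auto
  show "\<exists>C. \<forall>x\<in>K. \<forall>\<xi>. (x, \<xi>) \<in> UNIV \<longrightarrow> cmod (case (x, \<xi>) of (s, \<xi>) \<Rightarrow> complex_of_real (v \<bullet> \<xi>)) \<le> C * jb \<xi> powr 1" for K :: "'t set"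
  proof (intro exI[of _ "norm v"] ballI allI impI)
    fix x :: 't and \<xi> :: 'a
    have "\<bar>v \<bullet> \<xi>\<bar> \<le> norm v * norm \<xi>" by (rule Cauchy_Schwarz_ineq2)
    also have "\<dots> \<le> norm v * jb \<xi>" by (intro mult_left_mono jb_ge_norm) auto
    finally show "cmod (case (x, \<xi>) of (s, \<xi>) \<Rightarrow> complex_of_real (v \<bullet> \<xi>)) \<le> norm v * jb \<xi> powr 1" by simp
  qed
qed

lemma rapid_mult:
  assumes "symb UNIV m a" "rapid d"
  shows "rapid (\<lambda>p. a p * d p)"
  unfolding rapid_def
proof
  fix M :: nat
  show "symb UNIV (- real M) (\<lambda>p. a p * d p)"
    using symb_mult[OF open_UNIV assms(1) rapidD[OF assms(2), of "- m - real M"]] by simp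
qed

lemma rapid_add: "rapid a \<Longrightarrow> rapid b \<Longrightarrow> rapid (\<lambda>p. a p + b p)"
  unfolding rapid_def by (auto intro: symb_add)

lemma rapid_pd: "rapid d \<Longrightarrow> w \<in> Basis \<Longrightarrow> rapid (pd w d)"
  unfolding rapid_def by (auto intro: symb_pd')

text \<open>A space derivative of the phase produces a factor linear in \<open>\<xi>\<close>, a
  symbol of order 1, which rapidly decreasing symbols absorb. So every derivative keeps the form of
  a phase times a rapidly decreasing symbol.\<close>

lemma tdecay_ph:
  fixes e :: "('a::euclidean_space \<times> 'a) \<times> 'a \<Rightarrow> complex"
  assumes e: "rapid e"
  shows "tdecay (\<lambda>(s, \<xi>). ph (fst s - snd s) \<xi> * e (s, \<xi>))"
proof -
  let ?l = "\<lambda>p::('a \<times> 'a) \<times> 'a. (fst (fst p) - snd (fst p), snd p)"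
  have bl: "bounded_linear ?l" by (intro bounded_linear_intros)
  have sph: "smooth_on UNIV (\<lambda>p. (\<lambda>(z, \<eta>). ph z \<eta>) (?l p))"
    by (rule smooth_on_compose_linear[OF bl smooth_on_ph])
  have se: "smooth_on UNIV e" if "rapid e" for e :: "('a \<times> 'a) \<times> 'a \<Rightarrow> complex"
    using rapidD[OF that] by (rule symb_smooth)
  let ?F = "\<lambda>e (s, \<xi>). ph (fst s - snd s) \<xi> * e (s, \<xi>)"
  have pd: "pd (w, 0) (?F e) = ?F (\<lambda>p. (case p of (s, \<xi>) \<Rightarrow> complex_of_real ((fst w - snd w) \<bullet> \<xi>)) * e p + pd (w, 0) e p)"
    if e: "rapid e" for e and w :: "'a \<times> 'a"
  proof
    fix p :: "('a \<times> 'a) \<times> 'a"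
    have "pd (w, 0) (\<lambda>p. (\<lambda>(z, \<eta>). ph z \<eta>) (?l p)) p = pd (fst w - snd w, 0) (\<lambda>(z, \<eta>). ph z \<eta>) (?l p)"
      using pd_compose_affine'[OF bl, of "\<lambda>(z, \<eta>). ph z \<eta>" p 0 "(w, 0)"] smooth_on_diff[OF smooth_on_ph[where 'a='a]] by simp
    also have "\<dots> = pd (fst w - snd w) (\<lambda>z. ph z (snd p)) (fst (fst p) - snd (fst p))"
      using pd_section1(2)[OF smooth_on_diff[OF smooth_on_ph[where 'a='a]]] by simp
    finally have 1: "pd (w, 0) (\<lambda>p. (\<lambda>(z, \<eta>). ph z \<eta>) (?l p)) p = of_real ((fst w - snd w) \<bullet> snd p) * ph (fst (fst p) - snd (fst p)) (snd p)"
      by (simp add: pd_ph1)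
    have "?F e = (\<lambda>p. (\<lambda>(z, \<eta>). ph z \<eta>) (?l p) * e p)" by (auto simp: case_prod_beta')
    then have "pd (w, 0) (?F e) p = pd (w, 0) (\<lambda>p. (\<lambda>(z, \<eta>). ph z \<eta>) (?l p)) p * e p + (\<lambda>(z, \<eta>). ph z \<eta>) (?l p) * pd (w, 0) e p"
      by (simp only:) (rule pd_mult[OF smooth_on_diff[OF sph] smooth_on_diff[OF se[OF e]]]; simp)
    then show "pd (w, 0) (?F e) p = ?F (\<lambda>p. (case p of (s, \<xi>) \<Rightarrow> complex_of_real ((fst w - snd w) \<bullet> \<xi>)) * e p + pd (w, 0) e p) p"
      unfolding 1 by (simp add: case_prod_beta' distrib_left mult_ac)
  qed
  have it: "\<exists>e'. rapid e' \<and> D_iter (map (\<lambda>u. (u, 0)) us) (?F e) = ?F e'" if "set us \<subseteq> Basis" for us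
    using that
  proof (induction us)
    case Nil
    then show ?case using e by auto
  next
    case (Cons w us)
    then obtain e' where e': "rapid e'" "D_iter (map (\<lambda>u. (u, 0)) us) (?F e) = ?F e'" by auto
    have "rapid (\<lambda>p. (case p of (s, \<xi>) \<Rightarrow> complex_of_real ((fst w - snd w) \<bullet> \<xi>)) * e' p + pd (w, 0) e' p)"
      using Cons.prems by (intro rapid_add rapid_mult[OF symb_linear] rapid_pd e') simp
    then show ?case using e' pd[OF e'(1), of w] by auto
  qed
  show ?thesis
    unfolding tdecay_def
  proof (intro conjI allI impI)
    show "smooth_on UNIV (?F e)"
      using smooth_on_mult[OF open_UNIV sph se[OF e]] by (simp add: case_prod_beta')
    fix us :: "('a \<times> 'a) list" and K :: "('a \<times> 'a) set" assume *: "set us \<subseteq> Basis \<and> compact K"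
    then obtain e' where e': "rapid e'" "D_iter (map (\<lambda>u. (u, 0)) us) (?F e) = ?F e'" using it by blast
    obtain C where "C \<ge> 0" "\<forall>x\<in>K. \<forall>\<xi>. (x, \<xi>) \<in> UNIV \<longrightarrow> cmod (e' (x, \<xi>)) \<le> C * jb \<xi> powr (- 2 * real DIM('a))"
      using symb_bound[OF rapidD[OF e'(1)], of K "- 2 * real DIM('a)"] * by blast
    then show "\<exists>C\<ge>0. \<forall>t\<in>K. \<forall>\<eta>. cmod (D_iter (map (\<lambda>u. (u, 0)) us) (?F e) (t, \<eta>)) \<le> C * jb \<eta> powr (- 2 * real DIM('a))"
      unfolding e'(2) by (intro exI[of _ C]) (auto simp: norm_mult)
  qed
qed

lemma kernel_op_swap:
  fixes F :: "('a::euclidean_space \<times> 'a) \<times> 'a \<Rightarrow> complex" and u :: "'a \<Rightarrow> complex"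
  assumes F: "tdecay F" and u: "u \<in> test_functions"
  shows "(LINT \<eta>|lborel. (LINT y|lborel. F ((x, y), \<eta>) * u y)) = (LINT y|lborel. (LINT \<eta>|lborel. F ((x, y), \<eta>)) * u y)"
proof -
  have K: "compact ({x} \<times> fun_support u)" by (intro compact_Times compact_sing test_functionsD[OF u])
  obtain C where C: "C \<ge> 0" "\<And>y \<eta>. y \<in> fun_support u \<Longrightarrow> cmod (F ((x, y), \<eta>)) \<le> C * jb \<eta> powr (- 2 * real DIM('a))"
    using F[unfolded tdecay_def, THEN conjunct2, rule_format, of "[]" "{x} \<times> fun_support u"] K by auto
  have cF: "continuous_on UNIV F" using F by (auto simp: tdecay_def intro: smooth_on_imp_continuous_on)
  let ?H = "\<lambda>(\<eta>, y). F ((x, y), \<eta>) * u y"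
  have "(LINT \<eta>|lborel. (LINT y|lborel. ?H (\<eta>, y))) = (LINT y|lborel. (LINT \<eta>|lborel. ?H (\<eta>, y)))"
  proof (rule Fubini_bound(2))
    show "?H \<in> borel_measurable borel"
      unfolding case_prod_beta'
      by (intro borel_measurable_continuous_onI continuous_intros continuous_on_compose2[OF cF]
          continuous_on_compose2[OF test_cont[OF u]]) auto
    show "integrable lborel (\<lambda>\<eta>::'a. C * jb \<eta> powr (- 2 * real DIM('a)))"
      by (intro integrable_mult_right integrable_jb) auto
    show "integrable lborel (\<lambda>y. cmod (u y))" using integrable_test[OF u] by simp
    show "cmod (?H (\<eta>, y)) \<le> C * jb \<eta> powr (- 2 * real DIM('a)) * cmod (u y)" for \<eta> y
      using C(2)[of y \<eta>] fun_support_zero[of y u]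
      by (cases "y \<in> fun_support u") (auto simp: norm_mult intro!: mult_right_mono)
  qed
  then show ?thesis by simp
qed

text \<open>For a symbol of order minus infinity the integral over \<open>\<xi>\<close> of
  \<open>ph (x - y) \<xi> * d (x, \<xi>)\<close> converges absolutely together with all its
  derivatives and, up to the constant, is the kernel.\<close>

lemma Op_rapid:
  fixes d :: "'a::euclidean_space \<times> 'a \<Rightarrow> complex"
  assumes d: "rapid d"
  shows "\<exists>k. smooth_on UNIV k \<and> (\<forall>u\<in>test_functions. \<forall>x. Op d u x = kernel_op k u x)"
proof -
  let ?cn = "1 / (2 * complex_of_real pi) ^ DIM('a)"
  let ?e = "\<lambda>(s::'a \<times> 'a, \<xi>). d (fst s, \<xi>)"
  have e: "rapid ?e"
    using d unfolding rapid_def by (auto intro: symb_pullback_fst[OF bounded_linear_fst])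
  let ?F = "\<lambda>(s, \<xi>). ph (fst s - snd s) \<xi> * ?e (s, \<xi>)"
  have F: "tdecay ?F" by (rule tdecay_ph[OF e])
  let ?k = "\<lambda>s. ?cn * (LINT \<xi>|lborel. ?F (s, \<xi>))"
  have k: "smooth_on UNIV ?k"
    by (intro smooth_on_mult smooth_on_const open_UNIV tdecay_smooth[OF F])
  have "Op d u x = kernel_op ?k u x" if u: "u \<in> test_functions" for u x
  proof -
    have "ph x \<xi> * (d (x, \<xi>) * ft u (- \<xi>)) = (LINT y|lborel. ?F ((x, y), \<xi>) * u y)" for \<xi>
      unfolding ft_def ph_diff by (simp add: mult_ac flip: integral_mult_right_zero)
    then have "Op d u x = ?cn * (LINT \<xi>|lborel. (LINT y|lborel. ?F ((x, y), \<xi>) * u y))"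
      unfolding Op_expand[OF u] by (simp only:)
    also have "(LINT \<xi>|lborel. (LINT y|lborel. ?F ((x, y), \<xi>) * u y)) = (LINT y|lborel. (LINT \<xi>|lborel. ?F ((x, y), \<xi>)) * u y)"
      by (rule kernel_op_swap[OF F u])
    finally show ?thesis unfolding kernel_op_def by (simp only: mult.assoc integral_mult_right_zero)
  qed
  then show ?thesis using k by blast
qed

section \<open>Compositions with smooth kernels\<close>

lemma kernel_op_osc_int:
  fixes b :: "(('a::euclidean_space \<times> 'a) \<times> 'a) \<times> 'a \<Rightarrow> complex"
  assumes b: "amp m b" and u: "u \<in> test_functions"
  shows "1 / (2 * of_real pi) ^ DIM('a) * (LINT \<eta>|lborel. (LINT y|lborel. osc_fiber b ((x, y), \<eta>) * u y)) = kernel_op (osc_int b) u x"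
  unfolding kernel_op_swap[OF osc_fiber_tdecay[OF b] u] kernel_op_def osc_int_def by (simp only: mult.assoc integral_mult_right_zero)

lemma kernel_op_smooth:
  assumes r: "smooth_on UNIV r" and u: "u \<in> test_functions"
  shows "smooth_on UNIV (kernel_op r u)"
proof -
  have "smooth_on UNIV (\<lambda>x. LINT y|lborel. (\<lambda>s. r s * u (snd s)) (x, y))"
  proof (rule smooth_on_integral)
    show "smooth_on UNIV (\<lambda>s. r s * u (snd s))"
      by (intro smooth_on_mult open_UNIV r smooth_on_compose_linear[OF bounded_linear_snd test_functionsD(1)[OF u]])
    show "zsupp (\<lambda>s. r s * u (snd s))"
      by (rule zsupp_compact[OF test_functionsD(2)[OF u]]) (simp add: fun_support_zero)
  qed
  then show ?thesis by (simp add: kernel_op_def[abs_def])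
qed

text \<open>\<open>y\<close> is only a parameter while \<open>OpT a\<close> acts on \<open>r\<close>
  in its first argument, so the composite kernel is again an \<open>osc_int\<close>, and
  \<open>osc_int_smooth\<close> makes it smooth.\<close>

lemma OpT_kernel_op:
  fixes a r :: "'a::euclidean_space \<times> 'a \<Rightarrow> complex"
  assumes a: "symb UNIV m a" and r: "smooth_on UNIV r" and u: "u \<in> test_functions"
  shows "OpT a (kernel_op r u) x = kernel_op (osc_int (amp_left a r)) u x"
proof -
  let ?cn = "1 / (2 * complex_of_real pi) ^ DIM('a)"
  have cr: "continuous_on UNIV r" by (rule smooth_on_imp_continuous_on[OF r])
  have cc: "continuous_on UNIV (cutoff :: 'a \<Rightarrow> complex)" by (rule smooth_on_imp_continuous_on[OF cut_smooth])
  have "a (x, \<eta>) * ft (\<lambda>z. cutoff z * kernel_op r u (x - z)) \<eta> = (LINT y|lborel. osc_fiber (amp_left a r) ((x, y), \<eta>) * u y)" for \<eta>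
  proof -
    let ?H = "\<lambda>(z, y). ph z \<eta> * (cutoff z * (r (x - z, y) * u y))"
    have H: "?H (z, y) = ph z \<eta> * (cutoff z * r (x - z, y)) * u y" for z y by simp
    have "ft (\<lambda>z. cutoff z * kernel_op r u (x - z)) \<eta> = (LINT z|lborel. (LINT y|lborel. ?H (z, y)))"
      unfolding ft_def kernel_op_def by (simp flip: integral_mult_right_zero)
    also have "\<dots> = (LINT y|lborel. (LINT z|lborel. ?H (z, y)))"
    proof (rule Fubini_compact[OF _ compact_cball[of 0 1] test_functionsD(2)[OF u]])
      show "continuous_on UNIV ?H"
        unfolding case_prod_beta'
        by (intro continuous_intros continuous_on_compose2[OF cr]
            continuous_on_compose2[OF test_cont[OF u]] continuous_on_compose2[OF cc]) auto
      show "?H (z, y) = 0" if "z \<notin> cball 0 1 \<or> y \<notin> fun_support u" for z y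
        using that cut_0[of z] fun_support_zero[of y u] by auto
    qed
    also have "\<dots> = (LINT y|lborel. ft (\<lambda>z. cutoff z * r (x - z, y)) \<eta> * u y)"
      unfolding ft_def H integral_mult_left_zero ..
    finally have "a (x, \<eta>) * ft (\<lambda>z. cutoff z * kernel_op r u (x - z)) \<eta> = a (x, \<eta>) * (LINT y|lborel. ft (\<lambda>z. cutoff z * r (x - z, y)) \<eta> * u y)"
      by (simp only:)
    also have "\<dots> = (LINT y|lborel. a (x, \<eta>) * (ft (\<lambda>z. cutoff z * r (x - z, y)) \<eta> * u y))"
      by (simp only: integral_mult_right_zero)
    finally show ?thesis by (simp add: osc_fiber_def amp_left_def ft_cmult mult.assoc)
  qed
  then have "OpT a (kernel_op r u) x = ?cn * (LINT \<eta>|lborel. (LINT y|lborel. osc_fiber (amp_left a r) ((x, y), \<eta>) * u y))"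
    unfolding OpT_expand by (simp only:)
  then show ?thesis using kernel_op_osc_int[OF amplitude_left[OF a r] u] by simp
qed

text \<open>The substitution \<open>y := y + z\<close> between two interchanges of integrals moves
  the operator from \<open>u\<close> onto the second argument of \<open>r\<close>; what arises is
  again an amplitude with parameter \<open>(x, y)\<close>.\<close>

lemma kernel_op_OpT:
  fixes a r :: "'a::euclidean_space \<times> 'a \<Rightarrow> complex"
  assumes a: "symb UNIV m a" and r: "smooth_on UNIV r" and u: "u \<in> test_functions"
  shows "kernel_op r (OpT a u) x = kernel_op (osc_int (amp_right a r)) u x"
proof -
  let ?cn = "1 / (2 * complex_of_real pi) ^ DIM('a)"
  let ?M = "{x + y |x y. x \<in> fun_support u \<and> y \<in> cball 0 1}"
  have cr: "continuous_on UNIV r" by (rule smooth_on_imp_continuous_on[OF r])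
  have ca: "continuous_on UNIV a" by (rule smooth_on_imp_continuous_on[OF symb_smooth[OF a]])
  have cu: "continuous_on UNIV u" by (rule test_cont[OF u])
  have cc: "continuous_on UNIV (cutoff :: 'a \<Rightarrow> complex)" by (rule smooth_on_imp_continuous_on[OF cut_smooth])
  have M: "compact ?M" by (rule compact_sums[OF test_functionsD(2)[OF u] compact_cball])
  have uM: "cutoff z * u (y - z) = 0" if "y \<notin> ?M" for y z
  proof (cases "z \<in> cball 0 1")
    case True
    have "y = (y - z) + z" by simp
    then have "y - z \<notin> fun_support u" using that True by blast
    then show ?thesis by (simp add: fun_support_zero)
  qed (simp add: cut_0)
  note amT = amplitude_OpT[OF a test_functionsD(1)[OF u]]
  have IzT: "osc_fiber (amp_OpT a u) (y, \<eta>) = (LINT z|lborel. ph z \<eta> * (a (y, \<eta>) * (cutoff z * u (y - z))))" for y \<eta>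
    by (simp add: osc_fiber_def amp_OpT_def ft_def)
  have IzM: "osc_fiber (amp_OpT a u) (y, \<eta>) = 0" if "y \<notin> ?M" for y \<eta>
    unfolding IzT uM[OF that] by simp
  have cI: "continuous_on UNIV (osc_fiber (amp_OpT a u))" by (rule smooth_on_imp_continuous_on[OF osc_fiber_smooth(1)[OF amT]])
  obtain C where C: "C \<ge> 0" "\<forall>t\<in>?M. \<forall>\<eta>. cmod (osc_fiber (amp_OpT a u) (t, \<eta>)) \<le> C * jb \<eta> powr (- 2 * real DIM('a))"
    using osc_fiber_decay[OF amT M, of "- 2 * real DIM('a)"] by blast
  have "compact (r ` ({x} \<times> ?M))"
    by (intro compact_continuous_image compact_Times compact_sing M continuous_on_subset[OF cr]) auto
  then obtain B where B: "B \<ge> 0" "\<And>y. y \<in> ?M \<Longrightarrow> cmod (r (x, y)) \<le> B"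
    unfolding compact_eq_bounded_closed bounded_pos by (auto intro: less_imp_le)
  let ?H = "\<lambda>(y, \<eta>). r (x, y) * osc_fiber (amp_OpT a u) (y, \<eta>)"
  have "kernel_op r (OpT a u) x = (LINT y|lborel. ?cn * (LINT \<eta>|lborel. ?H (y, \<eta>)))"
    unfolding kernel_op_def OpT_def osc_int_def by (simp add: mult_ac)
  also have "\<dots> = ?cn * (LINT y|lborel. (LINT \<eta>|lborel. ?H (y, \<eta>)))" by (rule integral_mult_right_zero)
  also have "(LINT y|lborel. (LINT \<eta>|lborel. ?H (y, \<eta>))) = (LINT \<eta>|lborel. (LINT y|lborel. ?H (y, \<eta>)))"
  proof (rule Fubini_bound(2))
    show "?H \<in> borel_measurable borel"
      unfolding case_prod_beta'
      by (intro borel_measurable_continuous_onI continuous_intros continuous_on_compose2[OF cr] continuous_on_compose2[OF cI]) auto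
    show "integrable lborel (\<lambda>y::'a. B * indicat_real ?M y)"
      using emeasure_compact_finite[OF M] M by (intro integrable_mult_right integrable_real_indicator) (auto intro: borel_compact)
    show "integrable lborel (\<lambda>\<eta>::'a. C * jb \<eta> powr (- 2 * real DIM('a)))"
      by (intro integrable_mult_right integrable_jb) auto
    show "cmod (?H (y, \<eta>)) \<le> B * indicat_real ?M y * (C * jb \<eta> powr (- 2 * real DIM('a)))" for y \<eta>
    proof (cases "y \<in> ?M")
      case True
      then have "cmod (r (x, y)) * cmod (osc_fiber (amp_OpT a u) (y, \<eta>)) \<le> B * (C * jb \<eta> powr (- 2 * real DIM('a)))"
        using B C by (intro mult_mono) auto
      then show ?thesis using True by (simp add: norm_mult)
    qed (simp add: IzM)
  qed
  also have "(LINT \<eta>|lborel. (LINT y|lborel. ?H (y, \<eta>))) = (LINT \<eta>|lborel. (LINT y|lborel. osc_fiber (amp_right a r) ((x, y), \<eta>) * u y))"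
  proof (rule Bochner_Integration.integral_cong[OF refl])
    fix \<eta> :: 'a
    let ?G = "\<lambda>(y, z). r (x, y) * (ph z \<eta> * (a (y, \<eta>) * (cutoff z * u (y - z))))"
    let ?G' = "\<lambda>(z, y). r (x, y + z) * (ph z \<eta> * (a (y + z, \<eta>) * (cutoff z * u y)))"
    have G': "?G' (z, y) = ph z \<eta> * (a (y + z, \<eta>) * (cutoff z * r (x, y + z))) * u y" for z y by simp
    have "(LINT y|lborel. ?H (y, \<eta>)) = (LINT y|lborel. (LINT z|lborel. ?G (y, z)))"
      by (simp add: IzT)
    also have "\<dots> = (LINT z|lborel. (LINT y|lborel. ?G (y, z)))"
    proof (rule Fubini_compact[OF _ M compact_cball[of 0 1]])
      show "continuous_on UNIV ?G"
        unfolding case_prod_beta'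
        by (intro continuous_intros continuous_on_compose2[OF cr] continuous_on_compose2[OF ca]
            continuous_on_compose2[OF cu] continuous_on_compose2[OF cc]) auto
      show "?G (y, z) = 0" if "y \<notin> ?M \<or> z \<notin> cball 0 1" for y z
        using that cut_0[of z] uM[of y z] by auto
    qed
    also have "\<dots> = (LINT z|lborel. (LINT y|lborel. ?G' (z, y)))"
    proof (rule Bochner_Integration.integral_cong[OF refl])
      fix z
      have "(LINT y|lborel. ?G' (z, y)) = (LINT y|lborel. (\<lambda>y. ?G (y, z)) (y + z))" by simp
      also have "\<dots> = (LINT y|lborel. ?G (y, z))"
        unfolding prod.case
        by (rule lborel_integral_shift)
          (intro borel_measurable_continuous_onI continuous_intros continuous_on_compose2[OF cr] continuous_on_compose2[OF ca]
            continuous_on_compose2[OF cu]; auto)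
      finally show "(LINT y|lborel. ?G (y, z)) = (LINT y|lborel. ?G' (z, y))" by (simp only:)
    qed
    also have "\<dots> = (LINT y|lborel. (LINT z|lborel. ?G' (z, y)))"
    proof (rule Fubini_compact[OF _ compact_cball[of 0 1] test_functionsD(2)[OF u]])
      show "continuous_on UNIV ?G'"
        unfolding case_prod_beta'
        by (intro continuous_intros continuous_on_compose2[OF cr] continuous_on_compose2[OF ca]
            continuous_on_compose2[OF cu] continuous_on_compose2[OF cc]) auto
      show "?G' (z, y) = 0" if "z \<notin> cball 0 1 \<or> y \<notin> fun_support u" for y z
        using that cut_0[of z] fun_support_zero[of y u] by auto
    qed
    also have "\<dots> = (LINT y|lborel. osc_fiber (amp_right a r) ((x, y), \<eta>) * u y)"
      unfolding osc_fiber_def amp_right_def ft_def G' integral_mult_left_zero by simp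
    finally show "(LINT y|lborel. ?H (y, \<eta>)) = (LINT y|lborel. osc_fiber (amp_right a r) ((x, y), \<eta>) * u y)" .
  qed
  also have "?cn * \<dots> = kernel_op (osc_int (amp_right a r)) u x" by (rule kernel_op_osc_int[OF amplitude_right[OF a r] u])
  finally show ?thesis .
qed

text \<open>The condition \<open>zsupp\<close> says that for \<open>(x, y)\<close> in a compact set
  only intermediate points of one compact set contribute. Proper support of one of the two kernels
  will provide it.\<close>

lemma kernel_op_kernel_op:
  fixes r1 r2 :: "'a::euclidean_space \<times> 'a \<Rightarrow> complex"
  assumes r: "smooth_on UNIV r1" "smooth_on UNIV r2" and u: "u \<in> test_functions"
    and z: "zsupp (\<lambda>(s, z). r1 (fst s, z) * r2 (z, snd s))"
  shows "kernel_op r1 (kernel_op r2 u) x = kernel_op (\<lambda>s. LINT z|lborel. r1 (fst s, z) * r2 (z, snd s)) u x"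
proof -
  have cr: "continuous_on UNIV r1" "continuous_on UNIV r2" using r by (auto intro: smooth_on_imp_continuous_on)
  let ?H = "\<lambda>(z, y). r1 (x, z) * (r2 (z, y) * u y)"
  have H: "?H (z, y) = r1 (x, z) * r2 (z, y) * u y" for z y by simp
  have "compact ({x} \<times> fun_support u)" by (intro compact_Times compact_sing test_functionsD[OF u])
  from z[unfolded zsupp_def, THEN spec, THEN mp, OF this]
  obtain L where L: "compact L" "\<And>y z. y \<in> fun_support u \<Longrightarrow> z \<notin> L \<Longrightarrow> r1 (x, z) * r2 (z, y) = 0"
    by auto
  have "kernel_op r1 (kernel_op r2 u) x = (LINT z|lborel. (LINT y|lborel. ?H (z, y)))"
    unfolding kernel_op_def by (simp flip: integral_mult_right_zero)
  also have "\<dots> = (LINT y|lborel. (LINT z|lborel. ?H (z, y)))"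
  proof (rule Fubini_compact[OF _ L(1) test_functionsD(2)[OF u]])
    show "continuous_on UNIV ?H"
      unfolding case_prod_beta'
      by (intro continuous_intros continuous_on_compose2[OF cr(1)] continuous_on_compose2[OF cr(2)]
          continuous_on_compose2[OF test_cont[OF u]]) auto
    show "?H (z, y) = 0" if "z \<notin> L \<or> y \<notin> fun_support u" for y z
      using that L(2)[of y z] fun_support_zero[of y u] by (cases "y \<in> fun_support u") auto
  qed
  also have "\<dots> = kernel_op (\<lambda>s. LINT z|lborel. r1 (fst s, z) * r2 (z, snd s)) u x"
    unfolding kernel_op_def H integral_mult_left_zero by simp
  finally show ?thesis .
qed

lemma kernel_op_kernel_op_smooth:
  fixes r1 r2 :: "'a::euclidean_space \<times> 'a \<Rightarrow> complex"
  assumes r: "smooth_on UNIV r1" "smooth_on UNIV r2"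
    and z: "zsupp (\<lambda>(s, z). r1 (fst s, z) * r2 (z, snd s))"
  shows "smooth_on UNIV (\<lambda>s. LINT z|lborel. r1 (fst s, z) * r2 (z, snd s))"
proof -
  have "smooth_on UNIV (\<lambda>p::('a \<times> 'a) \<times> 'a. r1 (fst (fst p), snd p) * r2 (snd p, snd (fst p)))"
    by (intro smooth_on_mult open_UNIV smooth_on_compose_linear[OF _ r(1)] smooth_on_compose_linear[OF _ r(2)] bounded_linear_intros)
  then have "smooth_on UNIV (\<lambda>(s, z). r1 (fst s, z) * r2 (z, snd s))" by (simp add: case_prod_beta')
  from smooth_on_integral[OF this z] show ?thesis by simp
qed


section \<open>Classical symbols\<close>

lemma pd_scale_dir:
  assumes "f differentiable at x"
  shows "pd (c *\<^sub>R v) f x = of_real c * pd v f x"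
  using pd_dir[OF assms, of "c *\<^sub>R v"] pd_dir[OF assms, of v]
  by (simp add: sum_distrib_left mult.assoc)

abbreviation S0 :: "('a::euclidean_space \<times> 'b::euclidean_space) set" where
  "S0 \<equiv> UNIV \<times> (- {0})"

lemma open_S0 [simp]: "open S0"
  by (intro open_Times) auto

lemma bounded_linear_scale_snd: "bounded_linear (\<lambda>p::'a::euclidean_space \<times> 'b::euclidean_space. (fst p, t *\<^sub>R snd p))"
  by (intro bounded_linear_intros)

text \<open>Differentiate \<open>q (x, t \<xi>) = t^r q (x, \<xi>)\<close>: a covariable derivative
  brings out one factor \<open>t\<close> on the left and so lowers the degree by one.\<close>

lemma hom_pd:
  fixes q :: "'a::euclidean_space \<times> 'b::euclidean_space \<Rightarrow> complex"
  assumes q: "smooth_on S0 q" and h: "pos_homogeneous r q" and w: "w \<in> Basis"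
  shows "pos_homogeneous (r - (if fst w = 0 then 1 else 0)) (pd w q)"
  unfolding pos_homogeneous_def
proof (intro allI impI)
  fix x :: 'a and \<xi> :: 'b and t :: real assume t: "0 < t" "\<xi> \<noteq> 0"
  let ?l = "\<lambda>p::'a \<times> 'b. (fst p, t *\<^sub>R snd p)"
  have d: "q differentiable at p" if "p \<in> S0" for p using smooth_on_diff[OF q that] .
  have "pd w (\<lambda>p. q (?l p)) (x, \<xi>) = pd (?l w) q (?l (x, \<xi>))"
    using pd_compose_affine'[OF bounded_linear_scale_snd[of t], of q "(x, \<xi>)" 0 w] d[of "(x, t *\<^sub>R \<xi>)"] t by simp
  moreover have "pd w (\<lambda>p. q (?l p)) (x, \<xi>) = pd w (\<lambda>p. of_real (t powr r) * q p) (x, \<xi>)"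
  proof (rule pd_cong_open[OF open_S0])
    show "(x, \<xi>) \<in> S0" using t by simp
    fix p :: "'a \<times> 'b" assume "p \<in> S0"
    then show "q (?l p) = of_real (t powr r) * q p"
      using h[unfolded pos_homogeneous_def, rule_format, of t "snd p" "fst p"] t by (cases p) auto
  qed
  moreover have "\<dots> = of_real (t powr r) * pd w q (x, \<xi>)"
    by (rule pd_cmult[OF d]) (use t in simp)
  moreover have "pd (?l w) q (x, t *\<^sub>R \<xi>) = (if fst w = 0 then of_real t else 1) * pd w q (x, t *\<^sub>R \<xi>)"
    using w
  proof (cases rule: Basis_cases)
    case (1 v)
    then have "?l w = t *\<^sub>R w" by simp
    then show ?thesis using 1 pd_scale_dir[OF d, of "(x, t *\<^sub>R \<xi>)" t w] t by simp
  next
    case (2 u)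
    then have "?l w = w" by simp
    then show ?thesis using 2 by simp
  qed
  ultimately have "(if fst w = 0 then of_real t else 1) * pd w q (x, t *\<^sub>R \<xi>) = of_real (t powr r) * pd w q (x, \<xi>)"
    by simp
  then show "pd w q (x, t *\<^sub>R \<xi>) = of_real (t powr (r - (if fst w = 0 then 1 else 0))) * pd w q (x, \<xi>)"
    using t by (auto simp: powr_diff field_simps split: if_splits)
qed

lemma hom_D_iter:
  assumes q: "smooth_on S0 q" and h: "pos_homogeneous r q"
  shows "set ws \<subseteq> Basis \<Longrightarrow> pos_homogeneous (r - real (cnt ws)) (D_iter ws q)"
proof (induction ws)
  case (Cons w ws)
  have e: "r - real (cnt ws) - (if fst w = 0 then 1 else 0) = r - real (cnt (w # ws))" by simp
  have "pos_homogeneous (r - real (cnt ws) - (if fst w = 0 then 1 else 0)) (pd w (D_iter ws q))"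
    by (rule hom_pd[OF smooth_on_D_iter[OF q]]) (use Cons in auto)
  then show ?case unfolding e by simp
qed (use h in simp)

text \<open>Homogeneity reduces the bound to the compact set
  \<open>K \<times> sphere 0 1\<close>.\<close>

lemma hom_bound:
  fixes q :: "'a::euclidean_space \<times> 'b::euclidean_space \<Rightarrow> complex"
  assumes q: "continuous_on S0 q" and h: "pos_homogeneous r q" and K: "compact K"
  shows "\<exists>C\<ge>0. \<forall>x\<in>K. \<forall>\<xi>. \<xi> \<noteq> 0 \<longrightarrow> cmod (q (x, \<xi>)) \<le> C * norm \<xi> powr r"
proof -
  have "compact (q ` (K \<times> sphere 0 1))"
    by (intro compact_continuous_image compact_Times K compact_sphere continuous_on_subset[OF q]) auto
  then obtain C where C: "C > 0" "\<forall>y\<in>q ` (K \<times> sphere 0 1). cmod y \<le> C"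
    unfolding compact_eq_bounded_closed bounded_pos by blast
  have "cmod (q (x, \<xi>)) \<le> C * norm \<xi> powr r" if "x \<in> K" "\<xi> \<noteq> 0" for x \<xi>
  proof -
    have "q (x, norm \<xi> *\<^sub>R (\<xi> /\<^sub>R norm \<xi>)) = of_real (norm \<xi> powr r) * q (x, \<xi> /\<^sub>R norm \<xi>)"
      using h[unfolded pos_homogeneous_def, rule_format, of "norm \<xi>" "\<xi> /\<^sub>R norm \<xi>" x] that(2) by simp
    then have "cmod (q (x, \<xi>)) = norm \<xi> powr r * cmod (q (x, \<xi> /\<^sub>R norm \<xi>))"
      using that(2) by (simp add: norm_mult)
    also have "\<dots> \<le> norm \<xi> powr r * C" using C(2) that by (intro mult_left_mono) auto
    finally show ?thesis by (simp add: mult.commute)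
  qed
  then show ?thesis using C(1) by (intro exI[of _ C]) auto
qed

lemma powr_compare:
  fixes a b c s :: real
  assumes "0 < a" "a \<le> b" "b \<le> c * a"
  shows "b powr s \<le> c powr \<bar>s\<bar> * a powr s" "a powr s \<le> c powr \<bar>s\<bar> * b powr s"
proof -
  have "1 * a \<le> c * a" using assms by linarith
  then have c: "1 \<le> c" using assms(1) by (simp only: mult_le_cancel_right_pos)
  have c1: "1 \<le> c powr \<bar>s\<bar>" using c by (simp add: ge_one_powr_ge_zero)
  have b: "b > 0" using assms by linarith
  show "b powr s \<le> c powr \<bar>s\<bar> * a powr s"
  proof (cases "s \<ge> 0")
    case True
    have "b powr s \<le> (c * a) powr s" using True assms b by (intro powr_mono2) auto
    then show ?thesis using True c assms by (simp add: powr_mult)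
  next
    case False
    have "b powr s \<le> 1 * a powr s" using False assms by (simp add: powr_mono2')
    also have "\<dots> \<le> c powr \<bar>s\<bar> * a powr s" by (intro mult_right_mono c1) auto
    finally show ?thesis .
  qed
  show "a powr s \<le> c powr \<bar>s\<bar> * b powr s"
  proof (cases "s \<ge> 0")
    case True
    have "a powr s \<le> 1 * b powr s" using True assms by (simp add: powr_mono2)
    also have "\<dots> \<le> c powr \<bar>s\<bar> * b powr s" by (intro mult_right_mono c1) auto
    finally show ?thesis .
  next
    case False
    have "a powr s = c powr (- s) * (c * a) powr s" using c assms by (simp add: powr_mult powr_minus field_simps)
    also have "\<dots> \<le> c powr (- s) * b powr s" using False assms b by (intro mult_left_mono powr_mono2') auto
    finally show ?thesis using False by simp
  qed
qed

abbreviation Reg :: "real \<Rightarrow> ('a::euclidean_space \<times> 'b::euclidean_space) set" where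
  "Reg R \<equiv> UNIV \<times> {\<xi>. norm \<xi> > R}"

text \<open>Where \<open>norm \<xi> > R\<close>, the norm and the bracket are comparable, with
  constant \<open>1 + 1 / R\<close>, so bounds by powers of the norm become bounds by powers of the
  bracket for exponents of either sign.\<close>

lemma hom_symb:
  fixes q :: "'a::euclidean_space \<times> 'b::euclidean_space \<Rightarrow> complex"
  assumes q: "smooth_on S0 q" and h: "pos_homogeneous r q" and R: "R > 0"
  shows "symb (Reg R) r q"
  unfolding symb_def
proof (intro conjI allI impI)
  show "smooth_on (Reg R) q" by (rule smooth_on_subset[OF q]) (use R in auto)
  fix ws :: "('a \<times> 'b) list" and K :: "'a set" assume *: "set ws \<subseteq> Basis \<and> compact K"
  let ?s = "r - real (cnt ws)"
  obtain C where C: "C \<ge> 0" "\<And>x \<xi>. x \<in> K \<Longrightarrow> \<xi> \<noteq> 0 \<Longrightarrow> cmod (D_iter ws q (x, \<xi>)) \<le> C * norm \<xi> powr ?s"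
    using hom_bound[OF smooth_on_imp_continuous_on[OF smooth_on_D_iter[OF q]] hom_D_iter[OF q h], of ws K] * by auto
  show "\<exists>C. \<forall>x\<in>K. \<forall>\<xi>. (x, \<xi>) \<in> Reg R \<longrightarrow> cmod (D_iter ws q (x, \<xi>)) \<le> C * jb \<xi> powr ?s"
  proof (intro exI ballI allI impI)
    fix x \<xi> assume x: "x \<in> K" "(x, \<xi>) \<in> (Reg R :: ('a \<times> 'b) set)"
    then have n: "norm \<xi> > R" "\<xi> \<noteq> 0" using R by auto
    have "1 \<le> norm \<xi> / R" using n R by (simp add: field_simps)
    then have "jb \<xi> \<le> (1 + 1 / R) * norm \<xi>" using jb_le_norm[of \<xi>] by (simp add: algebra_simps)
    then have "norm \<xi> powr ?s \<le> (1 + 1 / R) powr \<bar>?s\<bar> * jb \<xi> powr ?s"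
      by (intro powr_compare(2)) (use n jb_ge_norm in auto)
    then have "C * norm \<xi> powr ?s \<le> C * ((1 + 1 / R) powr \<bar>?s\<bar> * jb \<xi> powr ?s)" by (rule mult_left_mono) (rule C(1))
    then show "cmod (D_iter ws q (x, \<xi>)) \<le> (C * (1 + 1 / R) powr \<bar>?s\<bar>) * jb \<xi> powr ?s"
      using C(2)[OF x(1) n(2)] by (simp add: mult.assoc)
  qed
qed

section \<open>Homogeneous functions with the origin excised\<close>

definition excised :: "('b::euclidean_space \<Rightarrow> complex) \<Rightarrow> ('a::euclidean_space \<times> 'b \<Rightarrow> complex) \<Rightarrow> 'a \<times> 'b \<Rightarrow> complex" where
  "excised \<phi> q = (\<lambda>(x, \<xi>). (1 - \<phi> \<xi>) * q (x, \<xi>))"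

lemma cutoffsE:
  assumes "\<phi> \<in> cutoffs"
  obtains e R where "e > 0" "R > 0" "\<And>\<xi>. norm \<xi> < e \<Longrightarrow> \<phi> \<xi> = 1" "\<And>\<xi>. norm \<xi> > R \<Longrightarrow> \<phi> \<xi> = 0"
proof -
  have t: "\<phi> \<in> test_functions" and n: "\<forall>\<^sub>F x in nhds 0. \<phi> x = 1" using assms by (auto simp: cutoffs_def)
  obtain e where e: "e > 0" "\<And>\<xi>. dist \<xi> 0 < e \<Longrightarrow> \<phi> \<xi> = 1" using n unfolding eventually_nhds_metric by auto
  obtain R where R: "R > 0" "\<And>\<xi>. \<xi> \<in> fun_support \<phi> \<Longrightarrow> norm \<xi> \<le> R"
    using compact_imp_bounded[OF test_functionsD(2)[OF t]] unfolding bounded_pos by auto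
  have "\<phi> \<xi> = 0" if "norm \<xi> > R" for \<xi> using R(2)[of \<xi>] that fun_support_zero[of \<xi> \<phi>] by fastforce
  then show ?thesis using e R(1) that by simp
qed

lemma cutoffs_smooth: "\<phi> \<in> cutoffs \<Longrightarrow> smooth_on UNIV \<phi>"
  using test_functionsD(1) by (auto simp: cutoffs_def)

lemma cutoffs_scale:
  assumes \<phi>: "\<phi> \<in> cutoffs" and R: "R > 0"
  shows "(\<lambda>\<xi>. \<phi> ((1 / R) *\<^sub>R \<xi>)) \<in> cutoffs"
proof -
  obtain e Q where e: "e > 0" "Q > 0" "\<And>\<xi>. norm \<xi> < e \<Longrightarrow> \<phi> \<xi> = 1" "\<And>\<xi>. norm \<xi> > Q \<Longrightarrow> \<phi> \<xi> = 0"
    by (rule cutoffsE[OF \<phi>]) (rule that)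
  have s: "smooth_on UNIV (\<lambda>\<xi>. \<phi> ((1 / R) *\<^sub>R \<xi>))"
    by (rule smooth_on_compose_linear[OF _ cutoffs_smooth[OF \<phi>]]) (intro bounded_linear_intros)
  have "(\<lambda>\<xi>. \<phi> ((1 / R) *\<^sub>R \<xi>)) \<in> test_functions"
    by (rule test_functionsI(1)[OF s compact_cball[of 0 "Q * R"]], rule e(4)) (use R in \<open>auto simp: field_simps\<close>)
  moreover have "\<forall>\<^sub>F \<xi> in nhds 0. \<phi> ((1 / R) *\<^sub>R \<xi>) = 1"
    unfolding eventually_nhds_metric
    by (intro exI[of _ "e * R"]) (use e R in \<open>auto simp: field_simps\<close>)
  ultimately show ?thesis by (simp add: cutoffs_def)
qed

lemma excised_smooth:
  fixes q :: "'a::euclidean_space \<times> 'b::euclidean_space \<Rightarrow> complex"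
  assumes \<phi>: "\<phi> \<in> cutoffs" and q: "smooth_on S0 q"
  shows "smooth_on UNIV (excised \<phi> q)"
proof -
  obtain e Q where e: "e > 0" "Q > 0" "\<And>\<xi>. norm \<xi> < e \<Longrightarrow> \<phi> \<xi> = 1" "\<And>\<xi>. norm \<xi> > Q \<Longrightarrow> \<phi> \<xi> = 0"
    by (rule cutoffsE[OF \<phi>]) (rule that)
  have s1: "smooth_on UNIV (\<lambda>p::'a \<times> 'b. \<phi> (snd p))"
    by (rule smooth_on_compose_linear[OF bounded_linear_snd cutoffs_smooth[OF \<phi>]])
  have "smooth_on S0 (\<lambda>p::'a \<times> 'b. (1 - \<phi> (snd p)) * q p)"
    by (intro smooth_on_mult smooth_on_sub smooth_on_const q open_S0 smooth_on_subset[OF s1]) auto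
  moreover have "(\<lambda>p. (1 - \<phi> (snd p)) * q p) = excised \<phi> q" by (auto simp: excised_def)
  ultimately have 1: "smooth_on S0 (excised \<phi> q)" by simp
  have "smooth_on (UNIV \<times> ball 0 e) (excised \<phi> q) \<longleftrightarrow> smooth_on (UNIV \<times> ball 0 e) (\<lambda>_ :: 'a \<times> 'b. 0)"
    by (rule smooth_on_cong) (use e in \<open>auto simp: excised_def intro: open_Times\<close>)
  then have 2: "smooth_on (UNIV \<times> ball 0 e) (excised \<phi> q)" by simp
  have "S0 \<union> UNIV \<times> ball 0 e = (UNIV :: ('a \<times> 'b) set)" using e by auto
  then show ?thesis using smooth_on_Un[OF 1 2] by simp
qed

lemma symb_local_zero:
  fixes a :: "'a::euclidean_space \<times> 'b::euclidean_space \<Rightarrow> complex"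
  assumes a: "smooth_on UNIV a" and z: "\<And>x \<xi>. norm \<xi> > R \<Longrightarrow> a (x, \<xi>) = 0"
  shows "symb UNIV m a"
proof (rule symb_from_region[OF a])
  have "symb (Reg R) m a \<longleftrightarrow> symb (Reg R) m (\<lambda>_ :: 'a \<times> 'b. 0)"
    by (rule symb_cong[OF open_region]) (use z in auto)
  then show "symb (Reg R) m a" using symb_zero by blast
qed

lemma excised_symb:
  fixes q :: "'a::euclidean_space \<times> 'b::euclidean_space \<Rightarrow> complex"
  assumes \<phi>: "\<phi> \<in> cutoffs" and q: "smooth_on S0 q" and h: "pos_homogeneous r q"
  shows "symb UNIV r (excised \<phi> q)"
proof -
  obtain e R where e: "e > 0" "R > 0" "\<And>\<xi>. norm \<xi> < e \<Longrightarrow> \<phi> \<xi> = 1" "\<And>\<xi>. norm \<xi> > R \<Longrightarrow> \<phi> \<xi> = 0"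
    by (rule cutoffsE[OF \<phi>]) (rule that)
  have "symb (Reg R) r (excised \<phi> q) \<longleftrightarrow> symb (Reg R) r q"
    by (rule symb_cong[OF open_region]) (use e in \<open>auto simp: excised_def\<close>)
  then show ?thesis using symb_from_region[OF excised_smooth[OF \<phi> q]] hom_symb[OF q h e(2)] by blast
qed

text \<open>The difference of two excisions vanishes for large \<open>\<xi>\<close> and is thus a
  symbol of every order. Hence in \<open>Borel\<close> each term may carry a cutoff of its own while
  the expansion is tested with a common one.\<close>

lemma excised_diff_symb:
  fixes q :: "'a::euclidean_space \<times> 'b::euclidean_space \<Rightarrow> complex"
  assumes \<phi>: "\<phi> \<in> cutoffs" "\<phi>' \<in> cutoffs" and q: "smooth_on S0 q"
  shows "symb UNIV r (\<lambda>p. excised \<phi> q p - excised \<phi>' q p)"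
proof -
  obtain e R where R: "e > 0" "R > 0" "\<And>\<xi>. norm \<xi> < e \<Longrightarrow> \<phi> \<xi> = 1" "\<And>\<xi>. norm \<xi> > R \<Longrightarrow> \<phi> \<xi> = 0"
    by (rule cutoffsE[OF \<phi>(1)]) (rule that)
  obtain e' R' where R': "e' > 0" "R' > 0" "\<And>\<xi>. norm \<xi> < e' \<Longrightarrow> \<phi>' \<xi> = 1" "\<And>\<xi>. norm \<xi> > R' \<Longrightarrow> \<phi>' \<xi> = 0"
    by (rule cutoffsE[OF \<phi>(2)]) (rule that)
  show ?thesis
  proof (rule symb_local_zero[where R = "max R R'"])
    show "smooth_on UNIV (\<lambda>p. excised \<phi> q p - excised \<phi>' q p)" by (intro smooth_on_sub excised_smooth \<phi> q open_UNIV)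
  qed (use R(4) R'(4) in \<open>auto simp: excised_def\<close>)
qed

lemma D_iter_scale:
  fixes F :: "'a::euclidean_space \<times> 'b::euclidean_space \<Rightarrow> complex"
  assumes F: "smooth_on UNIV F"
  shows "set ws \<subseteq> Basis \<Longrightarrow> D_iter ws (\<lambda>p. F (fst p, c *\<^sub>R snd p)) p = of_real (c ^ cnt ws) * D_iter ws F (fst p, c *\<^sub>R snd p)"
proof (induction ws arbitrary: p)
  case (Cons w ws)
  let ?l = "\<lambda>p::'a \<times> 'b. (fst p, c *\<^sub>R snd p)"
  have w: "w \<in> Basis" using Cons.prems by simp
  have sD: "smooth_on UNIV (D_iter ws F)" by (rule smooth_on_D_iter[OF F]) (use Cons.prems in auto)
  have d: "D_iter ws F differentiable at y" for y using smooth_on_diff[OF sD] by simp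
  have "D_iter ws (\<lambda>p. F (?l p)) = (\<lambda>p. of_real (c ^ cnt ws) * D_iter ws F (?l p))"
    by (rule ext, rule Cons.IH) (use Cons.prems in simp)
  then have "D_iter (w # ws) (\<lambda>p. F (?l p)) p = pd w (\<lambda>p. of_real (c ^ cnt ws) * D_iter ws F (?l p)) p"
    by (simp only: D_iter_Cons)
  also have "\<dots> = of_real (c ^ cnt ws) * pd w (\<lambda>p. D_iter ws F (?l p)) p"
    by (rule pd_cmult, rule smooth_on_diff[OF smooth_on_compose_linear[OF bounded_linear_scale_snd sD]]) simp
  also have "pd w (\<lambda>p. D_iter ws F (?l p)) p = pd (?l w) (D_iter ws F) (?l p)"
    using pd_compose_affine'[OF bounded_linear_scale_snd d, where c = 0] by simp
  also have "\<dots> = of_real (if fst w = 0 then c else 1) * pd w (D_iter ws F) (?l p)"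
    using w
  proof (cases rule: Basis_cases)
    case (1 v)
    then have "?l w = c *\<^sub>R w" by simp
    then show ?thesis using 1 pd_scale_dir[OF d, of c w] by simp
  next
    case (2 u)
    then have "?l w = w" by simp
    then show ?thesis using 2 by simp
  qed
  finally show ?case by (simp add: power_add mult_ac)
qed simp

lemma excised_scale:
  assumes h: "pos_homogeneous r q" and \<phi>: "\<phi> \<in> cutoffs" and R: "R > 0"
  shows "excised (\<lambda>\<xi>. \<phi> ((1 / R) *\<^sub>R \<xi>)) q p = of_real (R powr r) * excised \<phi> q (fst p, (1 / R) *\<^sub>R snd p)"
proof (cases "snd p = 0")
  case True
  obtain e Q where "e > 0" "Q > 0" "\<And>\<xi>. norm \<xi> < e \<Longrightarrow> \<phi> \<xi> = 1" "\<And>\<xi>. norm \<xi> > Q \<Longrightarrow> \<phi> \<xi> = 0"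
    by (rule cutoffsE[OF \<phi>]) (rule that)
  then have "\<phi> 0 = 1" by simp
  then show ?thesis using True by (simp add: excised_def case_prod_beta')
next
  case False
  have "q (fst p, (1 / R) *\<^sub>R snd p) = of_real ((1 / R) powr r) * q (fst p, snd p)"
    using h R False unfolding pos_homogeneous_def by simp
  moreover have "of_real (R powr r) * complex_of_real ((1 / R) powr r) = 1"
    using R by (simp add: powr_divide flip: of_real_mult)
  ultimately show ?thesis by (simp add: excised_def case_prod_beta' mult_ac)
qed

text \<open>By homogeneity the scaled cutoff gives the dilated function times \<open>R^r\<close>. Giving away one order
  yields a factor \<open>1 / R\<close>, hence terms as small as required for the Borel sum.\<close>

lemma excised_scale_bound:
  fixes q :: "'a::euclidean_space \<times> 'b::euclidean_space \<Rightarrow> complex"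
  assumes \<phi>: "\<phi> \<in> cutoffs" and q: "smooth_on S0 q" and h: "pos_homogeneous r q" and K: "compact K" and \<epsilon>: "\<epsilon> > 0"
  shows "\<exists>R0. \<forall>R\<ge>R0. R > 0 \<longrightarrow> (\<forall>ws x \<xi>. set ws \<subseteq> Basis \<longrightarrow> length ws \<le> M \<longrightarrow> x \<in> K \<longrightarrow>
    cmod (D_iter ws (excised (\<lambda>\<xi>. \<phi> ((1 / R) *\<^sub>R \<xi>)) q) (x, \<xi>)) \<le> \<epsilon> * jb \<xi> powr (r + 1 - real (cnt ws)))"
proof -
  obtain e Q where e: "e > 0" "Q > 0" "\<And>\<xi>. norm \<xi> < e \<Longrightarrow> \<phi> \<xi> = 1" "\<And>\<xi>. norm \<xi> > Q \<Longrightarrow> \<phi> \<xi> = 0"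
    by (rule cutoffsE[OF \<phi>]) (rule that)
  obtain C where C: "C \<ge> 0" "\<And>ws x \<xi>. set ws \<subseteq> Basis \<Longrightarrow> length ws \<le> M \<Longrightarrow> x \<in> K \<Longrightarrow>
      cmod (D_iter ws (excised \<phi> q) (x, \<xi>)) \<le> C * jb \<xi> powr (r - real (cnt ws))"
    using symbE_fin[OF excised_symb[OF \<phi> q h] K, of M] by auto
  define c where "c = 1 + 1 / e"
  have c: "c \<ge> 1" using e by (simp add: c_def)
  \<comment> \<open>The lower bound 1 serves \<open>T1\<close>. The other makes
    \<open>C * c powr (\<bar>r\<bar> + M)\<close> at most \<open>e * R * \<epsilon>\<close>, and
    \<open>e * R \<le> jb \<xi>\<close> holds outside the ball on which the excised function
    vanishes.\<close>
  let ?R0 = "max 1 (C * c powr (\<bar>r\<bar> + real M) / (e * \<epsilon>))"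
  have "cmod (D_iter ws (excised (\<lambda>\<xi>. \<phi> ((1 / R) *\<^sub>R \<xi>)) q) (x, \<xi>)) \<le> \<epsilon> * jb \<xi> powr (r + 1 - real (cnt ws))"
    if R: "R \<ge> ?R0" and ws: "set ws \<subseteq> Basis" "length ws \<le> M" and x: "x \<in> K" for R ws x \<xi>
  proof -
    have R1: "R \<ge> 1" and R2: "C * c powr (\<bar>r\<bar> + real M) / (e * \<epsilon>) \<le> R" using R by auto
    have Rp: "R > 0" using R1 by linarith
    let ?s = "r - real (cnt ws)"
    have eq: "excised (\<lambda>\<xi>. \<phi> ((1 / R) *\<^sub>R \<xi>)) q = (\<lambda>p. of_real (R powr r) * excised \<phi> q (fst p, (1 / R) *\<^sub>R snd p))"
      by (rule ext) (rule excised_scale[OF h \<phi> Rp])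
    have sm: "smooth_on UNIV (\<lambda>p. excised \<phi> q (fst p, (1 / R) *\<^sub>R snd p))"
      by (rule smooth_on_compose_linear[OF bounded_linear_scale_snd excised_smooth[OF \<phi> q]])
    have D: "D_iter ws (excised (\<lambda>\<xi>. \<phi> ((1 / R) *\<^sub>R \<xi>)) q) (x, \<xi>) = of_real (R powr r) * (of_real ((1 / R) ^ cnt ws) * D_iter ws (excised \<phi> q) (x, (1 / R) *\<^sub>R \<xi>))"
      unfolding eq using D_iter_cmult[OF open_UNIV sm ws(1), of "(x, \<xi>)" "of_real (R powr r)"]
        D_iter_scale[OF excised_smooth[OF \<phi> q] ws(1), of "1 / R" "(x, \<xi>)"] by simp
    show ?thesis
    proof (cases "norm \<xi> < e * R")
      case True
      have "D_iter ws (excised \<phi> q) (x, (1 / R) *\<^sub>R \<xi>) = D_iter ws (\<lambda>_. 0) (x, (1 / R) *\<^sub>R \<xi>)"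
        by (rule D_iter_cong_open[of "UNIV \<times> ball 0 e"])
          (use e True Rp in \<open>auto simp: excised_def field_simps intro: open_Times\<close>)
      then show ?thesis unfolding D using \<epsilon> by simp
    next
      case False
      have cnt: "cnt ws \<le> M" using ws(2) unfolding cnt_def by (meson le_trans length_filter_le)
      \<comment> \<open>With \<open>T2\<close>: outside the excised ball, \<open>R\<close> times the
        bracket at \<open>\<xi> / R\<close> is comparable to the bracket at \<open>\<xi>\<close>,
        with a constant \<open>c\<close> that does not depend on \<open>R\<close>.\<close>
      have T1: "R * jb ((1 / R) *\<^sub>R \<xi>) \<ge> jb \<xi>"
      proof -
        have "1 + (norm \<xi>)\<^sup>2 \<le> R\<^sup>2 + (norm \<xi>)\<^sup>2" using R1 by simp
        also have "\<dots> = R\<^sup>2 * (1 + (norm ((1 / R) *\<^sub>R \<xi>))\<^sup>2)" using Rp by (simp add: field_simps power_mult_distrib)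
        finally have "sqrt (1 + (norm \<xi>)\<^sup>2) \<le> sqrt (R\<^sup>2 * (1 + (norm ((1 / R) *\<^sub>R \<xi>))\<^sup>2))" by (rule real_sqrt_le_mono)
        then show ?thesis using Rp by (simp add: japanese_bracket_def real_sqrt_mult)
      qed
      have T2: "R * jb ((1 / R) *\<^sub>R \<xi>) \<le> c * jb \<xi>"
      proof -
        have "R * jb ((1 / R) *\<^sub>R \<xi>) \<le> R * (1 + norm ((1 / R) *\<^sub>R \<xi>))" using Rp by (intro mult_left_mono jb_le_norm) auto
        also have "\<dots> = R + norm \<xi>" using Rp by (simp add: field_simps)
        also have "\<dots> \<le> norm \<xi> / e + norm \<xi>" using False e by (simp add: field_simps)
        also have "\<dots> = c * norm \<xi>" by (simp add: c_def algebra_simps)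
        also have "\<dots> \<le> c * jb \<xi>" using c by (intro mult_left_mono jb_ge_norm) auto
        finally show ?thesis .
      qed
      have T3: "jb \<xi> \<ge> e * R" using False jb_ge_norm[of \<xi>] by linarith
      have "cmod (D_iter ws (excised (\<lambda>\<xi>. \<phi> ((1 / R) *\<^sub>R \<xi>)) q) (x, \<xi>)) = (R powr r * (1 / R) ^ cnt ws) * cmod (D_iter ws (excised \<phi> q) (x, (1 / R) *\<^sub>R \<xi>))"
        unfolding D using Rp by (simp add: norm_mult norm_divide norm_power)
      also have "R powr r * (1 / R) ^ cnt ws = R powr ?s" using Rp by (simp add: powr_diff powr_realpow field_simps)
      also have "R powr ?s * cmod (D_iter ws (excised \<phi> q) (x, (1 / R) *\<^sub>R \<xi>)) \<le> R powr ?s * (C * jb ((1 / R) *\<^sub>R \<xi>) powr ?s)"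
        by (intro mult_left_mono C(2) ws x) auto
      also have "\<dots> = C * (R * jb ((1 / R) *\<^sub>R \<xi>)) powr ?s" using Rp by (simp add: powr_mult)
      also have "\<dots> \<le> C * (c powr \<bar>?s\<bar> * jb \<xi> powr ?s)"
        by (intro mult_left_mono C(1) powr_compare(1) T1 T2) simp
      also have "\<dots> \<le> C * (c powr (\<bar>r\<bar> + real M) * jb \<xi> powr ?s)"
        using c cnt by (intro mult_left_mono C(1) mult_right_mono powr_mono) auto
      also have "\<dots> = (C * c powr (\<bar>r\<bar> + real M) / jb \<xi>) * jb \<xi> powr (r + 1 - real (cnt ws))"
        by (simp add: powr_diff powr_add field_simps)
      also have "\<dots> \<le> \<epsilon> * jb \<xi> powr (r + 1 - real (cnt ws))"
      proof (intro mult_right_mono)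
        have "C * c powr (\<bar>r\<bar> + real M) \<le> (e * R) * \<epsilon>" using R2 e \<epsilon> by (simp add: field_simps)
        also have "\<dots> \<le> jb \<xi> * \<epsilon>" using T3 \<epsilon> by (intro mult_right_mono) auto
        finally show "C * c powr (\<bar>r\<bar> + real M) / jb \<xi> \<le> \<epsilon>" by (simp add: field_simps)
      qed simp
      finally show ?thesis .
    qed
  qed
  then show ?thesis by (intro exI[of _ ?R0]) blast
qed

section \<open>Asymptotic sums\<close>

definition classical_sym :: "real \<Rightarrow> ('a::euclidean_space \<times> 'a \<Rightarrow> complex) \<Rightarrow> (nat \<Rightarrow> 'a \<times> 'a \<Rightarrow> complex) \<Rightarrow> bool" where
  "classical_sym m p ps \<longleftrightarrow> symb UNIV m p \<and>
    (\<forall>j. smooth_on S0 (ps j) \<and> pos_homogeneous (m - real j) (ps j)) \<and>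
    (\<forall>\<phi>\<in>cutoffs. \<forall>N. symb UNIV (m - real N) (\<lambda>s. p s - (\<Sum>j<N. excised \<phi> (ps j) s)))"

text \<open>The cutoff radii are so large that the \<open>j\<close>-th term, with all derivatives of
  length at most \<open>j\<close> over the ball of radius \<open>j\<close>, is at most
  \<open>2^(-j)\<close> times a bracket bound of one order more. A given word and compact set are
  covered by all large \<open>j\<close>; finitely many initial terms are treated separately, and
  this also regains the order given away.\<close>

lemma Borel:
  fixes qs :: "nat \<Rightarrow> 'a::euclidean_space \<times> 'a \<Rightarrow> complex"
  assumes q: "\<And>j. smooth_on S0 (qs j)" "\<And>j. pos_homogeneous (m - real j) (qs j)"
  shows "\<exists>q. classical_sym m q qs"
proof -
  have cut: "cutoff \<in> (cutoffs :: ('a \<Rightarrow> complex) set)" using cut_props by blast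
  \<comment> \<open>The factor 2 matches the ball of radius 1/2 on which \<open>cutoff\<close> is 1:
    the \<open>j\<close>-th term then vanishes for \<open>norm \<xi> < j + 1\<close>, so the series
    is a finite sum over every bounded set of covariables.\<close>
  have "\<forall>j. \<exists>R>0. R \<ge> 2 * (real j + 1) \<and> (\<forall>ws x \<xi>. set ws \<subseteq> Basis \<longrightarrow> length ws \<le> j \<longrightarrow> x \<in> cball 0 (real j) \<longrightarrow>
    cmod (D_iter ws (excised (\<lambda>\<xi>. cutoff ((1 / R) *\<^sub>R \<xi>)) (qs j)) (x, \<xi>)) \<le> (1/2) ^ j * jb \<xi> powr (m - real j + 1 - real (cnt ws)))"
  proof
    fix j
    obtain R0 where R0: "\<forall>R\<ge>R0. R > 0 \<longrightarrow> (\<forall>ws x \<xi>. set ws \<subseteq> Basis \<longrightarrow> length ws \<le> j \<longrightarrow> x \<in> cball (0::'a) (real j) \<longrightarrow>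
      cmod (D_iter ws (excised (\<lambda>\<xi>. cutoff ((1 / R) *\<^sub>R \<xi>)) (qs j)) (x, \<xi>)) \<le> (1/2) ^ j * jb \<xi> powr (m - real j + 1 - real (cnt ws)))"
      using excised_scale_bound[OF cut q(1)[of j] q(2)[of j] compact_cball[of 0 "real j"], of "(1/2) ^ j" j] by auto
    show "\<exists>R>0. R \<ge> 2 * (real j + 1) \<and> (\<forall>ws x \<xi>. set ws \<subseteq> Basis \<longrightarrow> length ws \<le> j \<longrightarrow> x \<in> cball (0::'a) (real j) \<longrightarrow>
      cmod (D_iter ws (excised (\<lambda>\<xi>. cutoff ((1 / R) *\<^sub>R \<xi>)) (qs j)) (x, \<xi>)) \<le> (1/2) ^ j * jb \<xi> powr (m - real j + 1 - real (cnt ws)))"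
      using R0[rule_format, of "max R0 (2 * (real j + 1))"] by (intro exI[of _ "max R0 (2 * (real j + 1))"]) auto
  qed
  from choice[OF this] obtain R where R: "\<And>j. R j > 0" "\<And>j. R j \<ge> 2 * (real j + 1)"
    "\<And>j ws x \<xi>. set ws \<subseteq> Basis \<Longrightarrow> length ws \<le> j \<Longrightarrow> x \<in> cball 0 (real j) \<Longrightarrow>
    cmod (D_iter ws (excised (\<lambda>\<xi>. cutoff ((1 / R j) *\<^sub>R \<xi>)) (qs j)) (x, \<xi>)) \<le> (1/2) ^ j * jb \<xi> powr (m - real j + 1 - real (cnt ws))"
    by blast
  define \<phi> where "\<phi> = (\<lambda>j \<xi>::'a. cutoff ((1 / R j) *\<^sub>R \<xi>) :: complex)"
  have \<phi>: "\<phi> j \<in> cutoffs" for j unfolding \<phi>_def by (rule cutoffs_scale[OF cut R(1)])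
  define g where "g = (\<lambda>j. excised (\<phi> j) (qs j))"
  have sg: "smooth_on UNIV (g j)" for j unfolding g_def by (rule excised_smooth[OF \<phi> q(1)])
  have yg: "symb UNIV (m - real j) (g j)" for j unfolding g_def by (rule excised_symb[OF \<phi> q(1) q(2)])
  have bg: "cmod (D_iter ws (g j) (x, \<xi>)) \<le> (1/2) ^ j * jb \<xi> powr (m - real j + 1 - real (cnt ws))"
    if "set ws \<subseteq> Basis" "length ws \<le> j" "x \<in> cball 0 (real j)" for j ws x \<xi>
    unfolding g_def \<phi>_def by (rule R(3)[OF that])
  have zg: "g j (x, \<xi>) = 0" if "norm \<xi> < real j + 1" for j x \<xi>
  proof -
    have "norm ((1 / R j) *\<^sub>R \<xi>) < 1 / 2" using that R(1)[of j] R(2)[of j] by (simp add: field_simps)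
    then have "cutoff ((1 / R j) *\<^sub>R \<xi>) = (1::complex)" by (intro cut_1) simp
    then show ?thesis by (simp add: g_def excised_def \<phi>_def)
  qed
  define F where "F = (\<lambda>N p. \<Sum>j. g (j + N) p)"
  have Ffin: "F N (x, \<xi>) = (\<Sum>j\<in>{N..<N+J}. g j (x, \<xi>))" if "norm \<xi> < real J" for N J x \<xi>
  proof -
    have "F N (x, \<xi>) = (\<Sum>j<J. g (j + N) (x, \<xi>))"
      unfolding F_def by (rule suminf_finite) (use that zg in \<open>auto simp: not_less\<close>)
    also have "\<dots> = (\<Sum>j\<in>{N..<N+J}. g j (x, \<xi>))"
      using sum.shift_bounds_nat_ivl[of "\<lambda>j. g j (x, \<xi>)" 0 N J] by (simp add: atLeast0LessThan add.commute)
    finally show ?thesis .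
  qed
  have opJ: "open (UNIV \<times> ball 0 (real J) :: ('a \<times> 'a) set)" for J by (intro open_Times) auto
  have FJ: "F N p = (\<Sum>j\<in>{N..<N+J}. g j p)" if "p \<in> UNIV \<times> ball 0 (real J)" for N J p
    using that Ffin[of "snd p" J N "fst p"] by (cases p) auto
  have sF: "smooth_on UNIV (F N)" for N
  proof -
    have "smooth_on (UNIV \<times> ball 0 (real J)) (F N) \<longleftrightarrow> smooth_on (UNIV \<times> ball 0 (real J)) (\<lambda>p. \<Sum>j\<in>{N..<N+J}. g j p)" for J
      by (rule smooth_on_cong[OF opJ FJ])
    moreover have "smooth_on (UNIV \<times> ball 0 (real J)) (\<lambda>p. \<Sum>j\<in>{N..<N+J}. g j p)" for J
      by (rule smooth_on_subset[OF smooth_on_sum[OF open_UNIV sg]]) auto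
    ultimately have sJ: "smooth_on (UNIV \<times> ball 0 (real J)) (F N)" for J by blast
    show ?thesis
      unfolding smooth_on_def
    proof (intro allI impI ballI)
      fix vs :: "('a \<times> 'a) list" and p :: "'a \<times> 'a" assume "set vs \<subseteq> Basis"
      moreover obtain J :: nat where "norm (snd p) < real J" using reals_Archimedean2 by blast
      moreover then have "p \<in> UNIV \<times> ball 0 (real J)" by (cases p) auto
      ultimately show "D_iter vs (F N) differentiable at p" using sJ unfolding smooth_on_def by blast
    qed
  qed
  have DF: "cmod (D_iter ws (F N) (x, \<xi>)) \<le> 2 * jb \<xi> powr (m - real N + 1 - real (cnt ws))"
    if ws: "set ws \<subseteq> Basis" "length ws \<le> N" and x: "x \<in> cball 0 (real N)" for ws N x \<xi>
  proof -
    obtain J :: nat where "norm \<xi> < real J" using reals_Archimedean2 by blast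
    then have p: "(x, \<xi>) \<in> UNIV \<times> ball 0 (real J)" by simp
    have "D_iter ws (F N) (x, \<xi>) = D_iter ws (\<lambda>p. \<Sum>j\<in>{N..<N+J}. g j p) (x, \<xi>)"
      by (rule D_iter_cong_open[OF opJ FJ p])
    also have "\<dots> = (\<Sum>j\<in>{N..<N+J}. D_iter ws (g j) (x, \<xi>))"
      by (rule D_iter_sum[OF open_UNIV sg ws(1) UNIV_I])
    finally have "cmod (D_iter ws (F N) (x, \<xi>)) \<le> (\<Sum>j\<in>{N..<N+J}. cmod (D_iter ws (g j) (x, \<xi>)))"
      by (simp add: norm_sum)
    also have "\<dots> \<le> (\<Sum>j\<in>{N..<N+J}. (1/2) ^ j * jb \<xi> powr (m - real N + 1 - real (cnt ws)))"
    proof (rule sum_mono)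
      fix j assume j: "j \<in> {N..<N+J}"
      have "cmod (D_iter ws (g j) (x, \<xi>)) \<le> (1/2) ^ j * jb \<xi> powr (m - real j + 1 - real (cnt ws))"
        by (rule bg) (use ws x j in auto)
      also have "\<dots> \<le> (1/2) ^ j * jb \<xi> powr (m - real N + 1 - real (cnt ws))"
        using j by (intro mult_left_mono jb_powr_mono) auto
      finally show "cmod (D_iter ws (g j) (x, \<xi>)) \<le> (1/2) ^ j * jb \<xi> powr (m - real N + 1 - real (cnt ws))" .
    qed
    also have "\<dots> = (\<Sum>j\<in>{N..<N+J}. (1/2) ^ j) * jb \<xi> powr (m - real N + 1 - real (cnt ws))"
      by (simp add: sum_distrib_right)
    also have "(\<Sum>j\<in>{N..<N+J}. (1/2::real) ^ j) \<le> 2"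
      using sum_le_suminf[OF summable_geometric[of "1/2::real"], of "{N..<N+J}"] by (simp add: suminf_geometric)
    finally show ?thesis by (simp add: mult_right_mono)
  qed
  have split: "F N p = (\<Sum>j\<in>{N..<J}. g j p) + F J p" if "N \<le> J" for N J p
  proof -
    obtain L :: nat where L: "norm (snd p) < real L" using reals_Archimedean2 by blast
    have 1: "F N p = (\<Sum>j\<in>{N..<N+(J+L)}. g j p)" by (rule FJ) (use L in \<open>cases p; auto\<close>)
    have 2: "F J p = (\<Sum>j\<in>{J..<J+(N+L)}. g j p)" by (rule FJ) (use L in \<open>cases p; auto\<close>)
    show ?thesis unfolding 1 2 using that by (simp add: sum.atLeastLessThan_concat algebra_simps)
  qed
  have yF: "symb UNIV (m - real N) (F N)" for N
    unfolding symb_def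
  proof (intro conjI allI impI sF)
    fix ws :: "('a \<times> 'a) list" and K :: "'a set" assume *: "set ws \<subseteq> Basis \<and> compact K"
    obtain B where B: "\<And>x. x \<in> K \<Longrightarrow> norm x \<le> B" using compact_imp_bounded[of K] * unfolding bounded_iff by auto
    obtain J0 :: nat where J0: "B < real J0" using reals_Archimedean2 by blast
    \<comment> \<open>\<open>J > N\<close> makes up for the additional order in \<open>DF\<close>;
      the other summands make \<open>J\<close> at least the length of the word and put
      \<open>K\<close> into the ball of radius \<open>J\<close>.\<close>
    define J where "J = N + 1 + J0 + length ws"
    have y1: "symb UNIV (m - real N) (\<lambda>p. \<Sum>j\<in>{N..<J}. g j p)"
      by (intro symb_sum open_UNIV symb_mono[OF yg]) auto
    obtain C where C: "C \<ge> 0" "\<forall>x\<in>K. \<forall>\<xi>. (x, \<xi>) \<in> UNIV \<longrightarrow> cmod (D_iter ws (\<lambda>p. \<Sum>j\<in>{N..<J}. g j p) (x, \<xi>)) \<le> C * jb \<xi> powr (m - real N - real (cnt ws))"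
      using symbE[OF y1, of ws K] * by blast
    have FN: "F N = (\<lambda>p. (\<Sum>j\<in>{N..<J}. g j p) + F J p)" by (rule ext, rule split) (simp add: J_def)
    show "\<exists>C. \<forall>x\<in>K. \<forall>\<xi>. (x, \<xi>) \<in> UNIV \<longrightarrow> cmod (D_iter ws (F N) (x, \<xi>)) \<le> C * jb \<xi> powr (m - real N - real (cnt ws))"
    proof (intro exI ballI allI impI)
      fix x \<xi> assume x: "x \<in> K"
      have "cmod (D_iter ws (F J) (x, \<xi>)) \<le> 2 * jb \<xi> powr (m - real J + 1 - real (cnt ws))"
        by (rule DF) (use * B[OF x] J0 in \<open>auto simp: J_def\<close>)
      also have "\<dots> \<le> 2 * jb \<xi> powr (m - real N - real (cnt ws))"
        by (intro mult_left_mono jb_powr_mono) (auto simp: J_def)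
      finally have "cmod (D_iter ws (F N) (x, \<xi>)) \<le> C * jb \<xi> powr (m - real N - real (cnt ws)) + 2 * jb \<xi> powr (m - real N - real (cnt ws))"
        unfolding FN D_iter_add[OF open_UNIV symb_smooth[OF y1] sF conjunct1[OF *] UNIV_I]
        using C(2) x by (intro norm_triangle_le add_mono) auto
      then show "cmod (D_iter ws (F N) (x, \<xi>)) \<le> (C + 2) * jb \<xi> powr (m - real N - real (cnt ws))"
        by (simp add: distrib_right)
    qed
  qed
  have "classical_sym m (F 0) qs"
    unfolding classical_sym_def
  proof (intro conjI allI ballI q)
    show "symb UNIV m (F 0)" using yF[of 0] by simp
    fix \<psi> N assume \<psi>: "\<psi> \<in> (cutoffs :: ('a \<Rightarrow> complex) set)"
    have eq: "(\<lambda>s. F 0 s - (\<Sum>j<N. excised \<psi> (qs j) s)) = (\<lambda>s. (\<Sum>j<N. g j s - excised \<psi> (qs j) s) + F N s)"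
      by (rule ext) (simp add: split[of 0 N] sum_subtractf atLeast0LessThan)
    show "symb UNIV (m - real N) (\<lambda>s. F 0 s - (\<Sum>j<N. excised \<psi> (qs j) s))"
      unfolding eq by (intro symb_add symb_sum open_UNIV yF) (unfold g_def, rule excised_diff_symb[OF \<phi> \<psi> q(1)])
  qed
  then show ?thesis by blast
qed


section \<open>Parametrices modulo smooth kernels\<close>

lemma hom_mult:
  assumes "pos_homogeneous r a" "pos_homogeneous s b"
  shows "pos_homogeneous (r + s) (\<lambda>p. a p * b p)"
  using assms unfolding pos_homogeneous_def by (simp add: powr_add mult_ac)

lemma hom_zero: "pos_homogeneous r (\<lambda>p. 0)"
  unfolding pos_homogeneous_def by simp

lemma hom_add:
  assumes "pos_homogeneous r a" "pos_homogeneous r b"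
  shows "pos_homogeneous r (\<lambda>p. a p + b p)"
  using assms unfolding pos_homogeneous_def by (simp add: distrib_left)

lemma hom_cmult:
  assumes "pos_homogeneous r a"
  shows "pos_homogeneous r (\<lambda>p. c * a p)"
  using assms unfolding pos_homogeneous_def by (simp add: mult_ac)

lemma hom_diff:
  assumes "pos_homogeneous r a" "pos_homogeneous r b"
  shows "pos_homogeneous r (\<lambda>p. a p - b p)"
  using hom_add[OF assms(1) hom_cmult[OF assms(2), of "-1"]] by simp

lemma hom_sum:
  assumes "\<And>i. i \<in> I \<Longrightarrow> pos_homogeneous r (a i)"
  shows "pos_homogeneous r (\<lambda>p. \<Sum>i\<in>I. a i p)"
  using assms by (induction I rule: infinite_finite_induct) (auto intro: hom_zero hom_add)

lemma hom_inverse: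
  assumes "pos_homogeneous r a"
  shows "pos_homogeneous (- r) (\<lambda>p. inverse (a p))"
  using assms unfolding pos_homogeneous_def by (simp add: powr_minus)

lemma hom_comp_term:
  assumes a: "smooth_on S0 a" "pos_homogeneous r a" and b: "smooth_on S0 b" "pos_homogeneous s b"
  shows "pos_homogeneous (r + s - real k) (comp_term k a b)"
  unfolding comp_term_def
proof (intro hom_cmult hom_sum)
  fix vs :: "'a list" assume vs: "vs \<in> words k"
  have 1: "pos_homogeneous (r - real k) (D_iter (map (Pair 0) vs) a)"
    using hom_D_iter[OF a, of "map (Pair 0) vs"] wordsD[OF vs] by simp
  have 2: "pos_homogeneous s (D_iter (map (\<lambda>v. (v, 0)) vs) b)"
    using hom_D_iter[OF b, of "map (\<lambda>v. (v, 0)) vs"] wordsD[OF vs] by simp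
  show "pos_homogeneous (r + s - real k) (\<lambda>s. D_iter (map (Pair 0) vs) a s * D_iter (map (\<lambda>v. (v, 0)) vs) b s)"
    using hom_mult[OF 1 2] by (simp add: algebra_simps)
qed

lemma comp_term_0 [simp]: "comp_term 0 a b s = a s * b s"
  by (simp add: comp_term_def)

lemma comp_term_sum1:
  assumes S: "open S" and a: "\<And>i. i \<in> I \<Longrightarrow> smooth_on S (a i)" and x: "x \<in> S"
  shows "comp_term k (\<lambda>s. \<Sum>i\<in>I. a i s) b x = (\<Sum>i\<in>I. comp_term k (a i) b x)"
proof -
  have "D_iter (map (Pair 0) vs) (\<lambda>s. \<Sum>i\<in>I. a i s) x = (\<Sum>i\<in>I. D_iter (map (Pair 0) vs) (a i) x)" if "vs \<in> words k" for vs
    by (rule D_iter_sum[OF S a _ x]) (use wordsD[OF that] in simp_all)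
  then have "comp_term k (\<lambda>s. \<Sum>i\<in>I. a i s) b x = \<i> ^ k / fact k * (\<Sum>vs\<in>words k. \<Sum>i\<in>I. D_iter (map (Pair 0) vs) (a i) x * D_iter (map (\<lambda>v. (v, 0)) vs) b x)"
    by (simp add: comp_term_def sum_distrib_right)
  then show ?thesis by (subst (asm) sum.swap) (simp add: comp_term_def sum_distrib_left)
qed

lemma comp_term_sum2:
  assumes S: "open S" and b: "\<And>i. i \<in> I \<Longrightarrow> smooth_on S (b i)" and x: "x \<in> S"
  shows "comp_term k a (\<lambda>s. \<Sum>i\<in>I. b i s) x = (\<Sum>i\<in>I. comp_term k a (b i) x)"
proof -
  have "D_iter (map (\<lambda>v. (v, 0)) vs) (\<lambda>s. \<Sum>i\<in>I. b i s) x = (\<Sum>i\<in>I. D_iter (map (\<lambda>v. (v, 0)) vs) (b i) x)" if "vs \<in> words k" for vs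
    by (rule D_iter_sum[OF S b _ x]) (use wordsD[OF that] in simp_all)
  then have "comp_term k a (\<lambda>s. \<Sum>i\<in>I. b i s) x = \<i> ^ k / fact k * (\<Sum>vs\<in>words k. \<Sum>i\<in>I. D_iter (map (Pair 0) vs) a x * D_iter (map (\<lambda>v. (v, 0)) vs) (b i) x)"
    by (simp add: comp_term_def sum_distrib_left sum_divide_distrib)
  then show ?thesis by (subst (asm) sum.swap) (simp only: comp_term_def sum_distrib_left)
qed

lemma comp_term_add1:
  assumes S: "open S" and a: "smooth_on S a" "smooth_on S a'" and x: "x \<in> S"
  shows "comp_term k (\<lambda>s. a s + a' s) b x = comp_term k a b x + comp_term k a' b x"
  using comp_term_sum1[OF S, of "{True, False}" "\<lambda>i. if i then a else a'" x k b] a x by simp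

lemma comp_term_add2:
  assumes S: "open S" and b: "smooth_on S b" "smooth_on S b'" and x: "x \<in> S"
  shows "comp_term k a (\<lambda>s. b s + b' s) x = comp_term k a b x + comp_term k a b' x"
  using comp_term_sum2[OF S, of "{True, False}" "\<lambda>i. if i then b else b'" x k a] b x by simp

text \<open>Solves \<open>\<Sum> comp_term k (p i) (q j) = \<delta>\<close> (sum over \<open>k + i + j = l\<close>) for \<open>q l\<close>, which only occurs in \<open>comp_term 0 (p 0) (q l)\<close>.\<close>

fun parametrix_term :: "(nat \<Rightarrow> 'a::euclidean_space \<times> 'a \<Rightarrow> complex) \<Rightarrow> nat \<Rightarrow> 'a \<times> 'a \<Rightarrow> complex" where
  "parametrix_term p l = (\<lambda>s. inverse (p 0 s) * ((if l = 0 then 1 else 0) - (\<Sum>j<l. \<Sum>k\<le>l - j. comp_term k (p (l - j - k)) (parametrix_term p j) s)))"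

declare parametrix_term.simps [simp del]

lemma parametrix_term_smooth_hom:
  fixes p :: "nat \<Rightarrow> 'a::euclidean_space \<times> 'a \<Rightarrow> complex"
  assumes p: "\<And>j. smooth_on S0 (p j)" "\<And>j. pos_homogeneous (m - real j) (p j)"
    and nz: "\<And>x \<xi>. \<xi> \<noteq> 0 \<Longrightarrow> p 0 (x, \<xi>) \<noteq> 0"
  shows "smooth_on S0 (parametrix_term p l) \<and> pos_homogeneous (- m - real l) (parametrix_term p l)"
proof (induction l rule: less_induct)
  case (less l)
  have IH: "smooth_on S0 (parametrix_term p j)" "pos_homogeneous (- m - real j) (parametrix_term p j)" if "j < l" for j
    using less[OF that] by auto
  have h0: "pos_homogeneous (- real l) (\<lambda>s::'a \<times> 'a. if l = 0 then 1 else 0)"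
    by (auto simp: pos_homogeneous_def)
  have hT: "pos_homogeneous (- real l) (comp_term k (p (l - j - k)) (parametrix_term p j))" if "j < l" "k \<le> l - j" for j k
    using hom_comp_term[OF p(1) p(2)[of "l - j - k"] IH[OF that(1)], of k] that by (simp add: of_nat_diff)
  have "pos_homogeneous (- m + - real l) (parametrix_term p l)"
    unfolding parametrix_term.simps[of p l]
    by (intro hom_mult hom_diff h0 hom_sum hT) (use hom_inverse[OF p(2)[of 0]] in auto)
  moreover have "smooth_on S0 (parametrix_term p l)"
    unfolding parametrix_term.simps[of p l]
    by (intro smooth_on_mult smooth_on_inverse smooth_on_sub smooth_on_sum comp_term_smooth smooth_on_const p open_S0 IH)
      (use nz in auto)
  ultimately show ?case by simp
qed

lemma parametrix_term_identity:
  assumes "p 0 s \<noteq> 0"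
  shows "(\<Sum>j\<le>l. \<Sum>k\<le>l - j. comp_term k (p (l - j - k)) (parametrix_term p j) s) = (if l = 0 then 1 else 0)"
proof -
  let ?f = "\<lambda>j. \<Sum>k\<le>l - j. comp_term k (p (l - j - k)) (parametrix_term p j) s"
  have "(\<Sum>j\<le>l. ?f j) = (\<Sum>j<l. ?f j) + ?f l"
    by (simp flip: lessThan_Suc_atMost)
  also have "?f l = p 0 s * parametrix_term p l s" by simp
  also have "\<dots> = (if l = 0 then 1 else 0) - (\<Sum>j<l. ?f j)"
    using assms by (subst parametrix_term.simps) (simp del: of_nat_diff)
  finally show ?thesis by simp
qed

text \<open>Sorting by the total degree \<open>l\<close>, so that
  \<open>parametrix_term_identity\<close> evaluates each inner double sum.\<close>

lemma sum_reorganize: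
  fixes f :: "nat \<Rightarrow> nat \<Rightarrow> nat \<Rightarrow> complex"
  shows "(\<Sum>(k, i, j)\<in>{(k, i, j). k + i + j < N}. f k i j) = (\<Sum>l<N. \<Sum>j\<le>l. \<Sum>k\<le>l - j. f k (l - j - k) j)"
proof -
  have "(\<Sum>l<N. \<Sum>j\<le>l. \<Sum>k\<le>l - j. f k (l - j - k) j) = (\<Sum>(l, j, k)\<in>(SIGMA l:{..<N}. SIGMA j:{..l}. {..l - j}). f k (l - j - k) j)"
    by (simp add: sum.Sigma)
  also have "\<dots> = (\<Sum>(k, i, j)\<in>{(k, i, j). k + i + j < N}. f k i j)"
    by (rule sum.reindex_bij_witness[where i = "\<lambda>(k, i, j). (k + i + j, j, k)" and j = "\<lambda>(l, j, k). (k, l - j - k, j)"]) auto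
  finally show ?thesis ..
qed

text \<open>Below total degree \<open>N\<close> the expansions of \<open>p\<close> and
  \<open>q\<close> contribute exactly 1 by the choice of the terms of \<open>q\<close>; all other
  products, and the remainders of the two expansions and of \<open>comp_sym\<close>, have order at
  most \<open>- N\<close>. That the leading term of \<open>q\<close> has no zeros is recorded so
  that the statement can be applied to \<open>q\<close> in turn.\<close>

theorem right_parametrix_symbol:
  fixes p :: "'a::euclidean_space \<times> 'a \<Rightarrow> complex"
  assumes p: "classical_sym m p ps" and nz: "\<And>x \<xi>. \<xi> \<noteq> 0 \<Longrightarrow> ps 0 (x, \<xi>) \<noteq> 0"
  shows "\<exists>q qs. classical_sym (- m) q qs \<and> (\<forall>x \<xi>. \<xi> \<noteq> 0 \<longrightarrow> qs 0 (x, \<xi>) \<noteq> 0) \<and> rapid (\<lambda>s. comp_sym p q s - 1)"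
proof -
  define qs where "qs = parametrix_term ps"
  have yp: "symb UNIV m p" and ps: "\<And>j. smooth_on S0 (ps j)" "\<And>j. pos_homogeneous (m - real j) (ps j)"
    and pe: "\<And>\<phi> N. \<phi> \<in> cutoffs \<Longrightarrow> symb UNIV (m - real N) (\<lambda>s. p s - (\<Sum>j<N. excised \<phi> (ps j) s))"
    using p by (auto simp: classical_sym_def)
  have qs: "smooth_on S0 (qs j)" "pos_homogeneous (- m - real j) (qs j)" for j
    using parametrix_term_smooth_hom[OF ps nz, of j] by (auto simp: qs_def)
  obtain q where q: "classical_sym (- m) q qs" using Borel[OF qs] by blast
  have yq: "symb UNIV (- m) q"
    and qe: "\<And>\<phi> N. \<phi> \<in> cutoffs \<Longrightarrow> symb UNIV (- m - real N) (\<lambda>s. q s - (\<Sum>j<N. excised \<phi> (qs j) s))"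
    using q by (auto simp: classical_sym_def)
  have q0: "qs 0 (x, \<xi>) \<noteq> 0" if "\<xi> \<noteq> 0" for x \<xi>
    using nz[OF that] by (simp add: qs_def parametrix_term.simps[of ps 0])
  have cut: "cutoff \<in> (cutoffs :: ('a \<Rightarrow> complex) set)" using cut_props by blast
  \<comment> \<open>On this region \<open>cutoff\<close> is 0 and the homogeneous terms are smooth
    symbols, so that the computation is algebra with \<open>comp_term\<close>; bounded
    \<open>\<xi>\<close> are added at the end by \<open>symb_from_region\<close>.\<close>
  let ?S = "Reg 1 :: ('a \<times> 'a) set"
  have S: "open ?S" by (rule open_region)
  have SS: "?S \<subseteq> S0" by auto
  have zc: "cutoff \<xi> = (0::complex)" if "norm \<xi> > 1" for \<xi> :: 'a using cut_0[of \<xi>] that by simp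
  have main: "symb UNIV (- real N) (\<lambda>s. comp_sym p q s - 1)" if N: "N \<ge> 1" for N
  proof -
    let ?P = "\<lambda>s. \<Sum>i<N. ps i s" and ?Q = "\<lambda>s. \<Sum>j<N. qs j s"
    let ?P' = "\<lambda>s. p s - ?P s" and ?Q' = "\<lambda>s. q s - ?Q s"
    let ?f = "\<lambda>k i j s. comp_term k (ps i) (qs j) s"
    have yps: "symb ?S (m - real i) (ps i)" for i by (rule hom_symb[OF ps]) simp
    have yqs: "symb ?S (- m - real i) (qs i)" for i by (rule hom_symb[OF qs]) simp
    have yP: "symb ?S m ?P" by (intro symb_sum S symb_mono[OF yps]) simp
    have yQ: "symb ?S (- m) ?Q" by (intro symb_sum S symb_mono[OF yqs]) simp
    have yP': "symb ?S (m - real N) ?P'"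
    proof -
      have "symb ?S (m - real N) ?P' \<longleftrightarrow> symb ?S (m - real N) (\<lambda>s. p s - (\<Sum>j<N. excised cutoff (ps j) s))"
        by (rule symb_cong[OF S]) (auto simp: excised_def zc)
      then show ?thesis using symb_subset[OF pe[OF cut]] by blast
    qed
    have yQ': "symb ?S (- m - real N) ?Q'"
    proof -
      have "symb ?S (- m - real N) ?Q' \<longleftrightarrow> symb ?S (- m - real N) (\<lambda>s. q s - (\<Sum>j<N. excised cutoff (qs j) s))"
        by (rule symb_cong[OF S]) (auto simp: excised_def zc)
      then show ?thesis using symb_subset[OF qe[OF cut]] by blast
    qed
    have ypS: "symb ?S m p" and yqS: "symb ?S (- m) q" by (rule symb_subset[OF yp], simp) (rule symb_subset[OF yq], simp)
    let ?T = "{..<N} \<times> {..<N} \<times> {..<N}"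
    let ?A = "{(k, i, j). k + i + j < N}"
    let ?D = "\<lambda>s. (\<Sum>k<N. comp_term k p q s) - 1"
    \<comment> \<open>Three sources of error: products of homogeneous terms of total degree at least
      \<open>N\<close>, the tail of \<open>q\<close> against the partial sum for \<open>p\<close>,
      and the tail of \<open>p\<close> against all of \<open>q\<close>.\<close>
    let ?E = "\<lambda>s. (\<Sum>(k, i, j)\<in>?T - ?A. ?f k i j s) + (\<Sum>k<N. comp_term k ?P ?Q' s + comp_term k ?P' q s)"
    have DE: "?D s = ?E s" if s: "s \<in> ?S" for s
    proof -
      have "snd s \<noteq> 0" using s by (cases s) auto
      then have s0: "ps 0 s \<noteq> 0" using nz[of "snd s" "fst s"] by (cases s) simp
      have "comp_term k p q s = (\<Sum>i<N. \<Sum>j<N. ?f k i j s) + (comp_term k ?P ?Q' s + comp_term k ?P' q s)" for k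
      proof -
        have "comp_term k p q s = comp_term k (\<lambda>s. ?P s + ?P' s) q s" by simp
        also have "\<dots> = comp_term k ?P q s + comp_term k ?P' q s"
          by (rule comp_term_add1[OF S symb_smooth[OF yP] symb_smooth[OF yP'] s])
        also have "comp_term k ?P q s = comp_term k ?P (\<lambda>s. ?Q s + ?Q' s) s" by simp
        also have "\<dots> = comp_term k ?P ?Q s + comp_term k ?P ?Q' s"
          by (rule comp_term_add2[OF S symb_smooth[OF yQ] symb_smooth[OF yQ'] s])
        also have "comp_term k ?P ?Q s = (\<Sum>i<N. comp_term k (ps i) ?Q s)"
          by (rule comp_term_sum1[OF S symb_smooth[OF yps] s])
        also have "\<dots> = (\<Sum>i<N. \<Sum>j<N. ?f k i j s)"
          by (intro sum.cong refl comp_term_sum2[OF S symb_smooth[OF yqs] s])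
        finally show ?thesis by simp
      qed
      then have "(\<Sum>k<N. comp_term k p q s) = (\<Sum>k<N. \<Sum>i<N. \<Sum>j<N. ?f k i j s) + (\<Sum>k<N. comp_term k ?P ?Q' s + comp_term k ?P' q s)"
        by (simp add: sum.distrib)
      also have "(\<Sum>k<N. \<Sum>i<N. \<Sum>j<N. ?f k i j s) = (\<Sum>(k, i, j)\<in>?T. ?f k i j s)"
        by (simp add: sum.cartesian_product)
      also have "\<dots> = (\<Sum>(k, i, j)\<in>?T - ?A. ?f k i j s) + (\<Sum>(k, i, j)\<in>?A. ?f k i j s)"
        by (rule sum.subset_diff) auto
      also have "(\<Sum>(k, i, j)\<in>?A. ?f k i j s) = (\<Sum>l<N. \<Sum>j\<le>l. \<Sum>k\<le>l - j. comp_term k (ps (l - j - k)) (qs j) s)"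
        by (rule sum_reorganize)
      also have "\<dots> = (\<Sum>l<N. if l = 0 then 1 else 0)"
        unfolding qs_def by (intro sum.cong refl parametrix_term_identity[of ps s, OF s0])
      also have "\<dots> = 1" using N by (simp add: sum.delta)
      finally show ?thesis by simp
    qed
    have yE: "symb ?S (- real N) ?E"
    proof (intro symb_add symb_sum S)
      fix t assume t: "t \<in> ?T - ?A"
      obtain k i j where tt: "t = (k, i, j)" by (cases t) auto
      have "symb ?S (- real N) (?f k i j)"
        by (rule symb_mono[OF comp_term_symb[OF S yps yqs]]) (use t tt in auto)
      then show "symb ?S (- real N) (\<lambda>s. case t of (k, i, j) \<Rightarrow> ?f k i j s)" by (simp add: tt)
    next
      fix k
      show "symb ?S (- real N) (comp_term k ?P ?Q')" by (rule symb_mono[OF comp_term_symb[OF S yP yQ']]) simp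
      show "symb ?S (- real N) (comp_term k ?P' q)" by (rule symb_mono[OF comp_term_symb[OF S yP' yqS]]) simp
    qed
    have "symb ?S (- real N) ?D \<longleftrightarrow> symb ?S (- real N) ?E" by (rule symb_cong[OF S DE])
    then have yD: "symb ?S (- real N) ?D" using yE by blast
    have "symb UNIV (- real N) ?D"
      by (rule symb_from_region[OF _ yD])
        (intro smooth_on_sub smooth_on_sum smooth_on_const open_UNIV comp_term_smooth symb_smooth[OF yp] symb_smooth[OF yq])
    moreover have "symb UNIV (- real N) (comp_rem N p q)" using comp_rem_symb[OF yp yq, of N] by simp
    ultimately have "symb UNIV (- real N) (\<lambda>s. ?D s + comp_rem N p q s)" by (intro symb_add open_UNIV)
    then show ?thesis by (simp add: comp_rem_def algebra_simps)
  qed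
  have "rapid (\<lambda>s. comp_sym p q s - 1)"
    unfolding rapid_def
  proof
    fix M
    show "symb UNIV (- real M) (\<lambda>s. comp_sym p q s - 1)"
      by (rule symb_mono[OF main[of "Suc M"]]) auto
  qed
  then show ?thesis using q q0 by blast
qed

section \<open>Calculus modulo operators with smooth kernels\<close>

definition smoothing :: "(('a::euclidean_space \<Rightarrow> complex) \<Rightarrow> 'a \<Rightarrow> complex) \<Rightarrow> bool" where
  "smoothing T \<longleftrightarrow> (\<exists>k. smooth_on UNIV k \<and> (\<forall>u\<in>test_functions. \<forall>x. T u x = kernel_op k u x))"

lemma smoothingE:
  assumes "smoothing T"
  obtains k where "smooth_on UNIV k" "\<And>u. u \<in> test_functions \<Longrightarrow> T u = kernel_op k u"
  using assms unfolding smoothing_def by (metis ext)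

lemma smoothingI: "smooth_on UNIV k \<Longrightarrow> (\<And>u x. u \<in> test_functions \<Longrightarrow> T u x = kernel_op k u x) \<Longrightarrow> smoothing T"
  unfolding smoothing_def by blast

lemma smoothing_cong: "smoothing T \<Longrightarrow> (\<And>u x. u \<in> test_functions \<Longrightarrow> T' u x = T u x) \<Longrightarrow> smoothing T'"
  unfolding smoothing_def by auto

lemma smoothing_smooth: "smoothing T \<Longrightarrow> u \<in> test_functions \<Longrightarrow> smooth_on UNIV (T u)"
  by (erule smoothingE) (simp add: kernel_op_smooth)

lemma kernel_op_integrable:
  assumes k: "smooth_on UNIV k" and u: "u \<in> test_functions"
  shows "integrable lborel (\<lambda>y. k (x, y) * u y)"
  by (rule integrable_compact_support[OF _ test_functionsD(2)[OF u]])
    (auto intro!: continuous_intros continuous_on_section[OF smooth_on_imp_continuous_on[OF k]] test_cont[OF u] simp: fun_support_zero)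

lemma smoothing_add:
  assumes "smoothing T" "smoothing T'"
  shows "smoothing (\<lambda>u x. T u x + T' u x)"
proof -
  obtain k where k: "smooth_on UNIV k" "\<And>u. u \<in> test_functions \<Longrightarrow> T u = kernel_op k u" by (rule smoothingE[OF assms(1)]) (rule that)
  obtain k' where k': "smooth_on UNIV k'" "\<And>u. u \<in> test_functions \<Longrightarrow> T' u = kernel_op k' u" by (rule smoothingE[OF assms(2)]) (rule that)
  show ?thesis
  proof (rule smoothingI)
    show "smooth_on UNIV (\<lambda>s. k s + k' s)" by (intro smooth_on_add open_UNIV k k')
    fix u x assume u: "u \<in> (test_functions :: ('a \<Rightarrow> complex) set)"
    show "T u x + T' u x = kernel_op (\<lambda>s. k s + k' s) u x"
      unfolding k(2)[OF u] k'(2)[OF u] kernel_op_def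
      using kernel_op_integrable[OF k(1) u, of x] kernel_op_integrable[OF k'(1) u, of x] by (simp add: distrib_right)
  qed
qed

lemma smoothing_cmult:
  assumes "smoothing T"
  shows "smoothing (\<lambda>u x. c * T u x)"
proof -
  obtain k where k: "smooth_on UNIV k" "\<And>u. u \<in> test_functions \<Longrightarrow> T u = kernel_op k u" by (rule smoothingE[OF assms(1)]) (rule that)
  show ?thesis
    by (rule smoothingI[OF smooth_on_cmult[OF open_UNIV k(1), of c]]) (simp add: k(2) kernel_op_def mult.assoc)
qed

lemma smoothing_diff:
  assumes "smoothing T" "smoothing T'"
  shows "smoothing (\<lambda>u x. T u x - T' u x)"
  using smoothing_add[OF assms(1) smoothing_cmult[OF assms(2), of "-1"]] by simp

lemma smoothing_OpT_left:
  assumes a: "symb UNIV m a" and T: "smoothing T"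
  shows "smoothing (\<lambda>u. OpT a (T u))"
proof -
  obtain k where k: "smooth_on UNIV k" "\<And>u. u \<in> test_functions \<Longrightarrow> T u = kernel_op k u" by (rule smoothingE[OF T]) (rule that)
  show ?thesis
    by (rule smoothingI[OF osc_int_smooth(1)[OF amplitude_left[OF a k(1)]]]) (simp add: k(2) OpT_kernel_op[OF a k(1)])
qed

lemma smoothing_OpT_right:
  assumes a: "symb UNIV m a" and T: "smoothing T"
  shows "smoothing (\<lambda>u. T (OpT a u))"
proof -
  obtain k where k: "smooth_on UNIV k" "\<And>u. u \<in> test_functions \<Longrightarrow> T u = kernel_op k u" by (rule smoothingE[OF T]) (rule that)
  show ?thesis
    by (rule smoothingI[OF osc_int_smooth(1)[OF amplitude_right[OF a k(1)]]]) (simp add: k(2) OpT_test[OF a] kernel_op_OpT[OF a k(1)])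
qed

lemma smoothing_rapid: "rapid d \<Longrightarrow> smoothing (Op d)"
  using Op_rapid unfolding smoothing_def .

lemma D_iter_one: "vs \<noteq> [] \<Longrightarrow> D_iter vs (\<lambda>_. 1) = (\<lambda>_. 0)"
proof (induction vs)
  case (Cons v vs)
  then show ?case by (cases "vs = []") auto
qed simp

text \<open>All terms of order \<open>k > 0\<close> differentiate the constant 1 and vanish, and the
  term of order 0 is \<open>q\<close>. So the difference is \<open>comp_rem N\<close> for every
  \<open>N \<ge> 1\<close>, and its order can be made as low as desired.\<close>

lemma comp_sym_one_rapid:
  assumes q: "symb UNIV m q"
  shows "rapid (\<lambda>s. comp_sym q (\<lambda>_. 1) s - q s)"
  unfolding rapid_def
proof
  fix M :: nat
  obtain N0 :: nat where N0: "m + real M \<le> real N0" using real_arch_simple by blast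
  \<comment> \<open>The successor ensures that the term of order 0 is among those
    subtracted.\<close>
  let ?N = "Suc N0"
  have "comp_term k q (\<lambda>_. 1) s = 0" if "k > 0" for k s
  proof -
    have "(D_iter (map (\<lambda>v. (v, 0)) vs) (\<lambda>_. 1) :: 'a \<times> 'a \<Rightarrow> complex) = (\<lambda>_. 0)" if "vs \<in> words k" for vs
      using wordsD[OF that] \<open>k > 0\<close> by (intro D_iter_one) auto
    then show ?thesis unfolding comp_term_def by simp
  qed
  then have "(\<Sum>k<?N. comp_term k q (\<lambda>_. 1) s) = q s" for s
    by (subst sum.lessThan_Suc_shift) simp
  then have eq: "(\<lambda>s. comp_sym q (\<lambda>_. 1) s - q s) = comp_rem ?N q (\<lambda>_. 1)" by (simp add: comp_rem_def)
  show "symb UNIV (- real M) (\<lambda>s. comp_sym q (\<lambda>_. 1) s - q s)"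
    unfolding eq by (rule symb_mono[OF comp_rem_symb[OF q symb_const]]) (use N0 in simp)
qed

text \<open>The difference has the rapidly decreasing symbol \<open>comp_sym q 1 - q\<close>.\<close>

lemma smoothing_OpT_Op:
  assumes q: "symb UNIV m q"
  shows "smoothing (\<lambda>u x. OpT q u x - Op q u x)"
proof (rule smoothing_cong[OF smoothing_rapid[OF comp_sym_one_rapid[OF q]]])
  fix u x assume u: "u \<in> (test_functions :: ('a \<Rightarrow> complex) set)"
  \<comment> \<open>Writing \<open>u\<close> as the operator with symbol 1 applied to
    \<open>u\<close> makes \<open>OpT q u\<close> a composition, to which the exact formula
    applies.\<close>
  have "u = Op (\<lambda>_. 1) u" by (rule ext) (simp add: Op_one[OF u])
  then have "OpT q u x = OpT q (Op (\<lambda>_. 1) u) x" by simp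
  also have "\<dots> = Op (comp_sym q (\<lambda>_. 1)) u x" by (rule composition[OF q symb_const u])
  also have "\<dots> = Op (\<lambda>s. q s + (comp_sym q (\<lambda>_. 1) s - q s)) u x" by simp
  also have "\<dots> = Op q u x + Op (\<lambda>s. comp_sym q (\<lambda>_. 1) s - q s) u x"
    by (rule Op_symbol_add[OF q rapidD[OF comp_sym_one_rapid[OF q]] u])
  finally show "OpT q u x - Op q u x = Op (\<lambda>s. comp_sym q (\<lambda>_. 1) s - q s) u x" by simp
qed

lemma smoothing_comp1:
  assumes p: "symb UNIV m p" and q: "symb UNIV m' q" and r: "rapid (\<lambda>s. comp_sym p q s - 1)"
  shows "smoothing (\<lambda>u x. OpT p (Op q u) x - u x)"
proof (rule smoothing_cong[OF smoothing_rapid[OF r]])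
  fix u x assume u: "u \<in> (test_functions :: ('a \<Rightarrow> complex) set)"
  have "OpT p (Op q u) x = Op (comp_sym p q) u x" by (rule composition[OF p q u])
  also have "\<dots> = Op (\<lambda>s. 1 + (comp_sym p q s - 1)) u x" by simp
  also have "\<dots> = Op (\<lambda>_. 1) u x + Op (\<lambda>s. comp_sym p q s - 1) u x"
    by (rule Op_symbol_add[OF symb_const rapidD[OF r] u])
  finally show "OpT p (Op q u) x - u x = Op (\<lambda>s. comp_sym p q s - 1) u x" by (simp add: Op_one[OF u])
qed

text \<open>Replacing \<open>Op q\<close> by \<open>OpT q\<close> changes the composite by
  \<open>OpT p\<close> after a smoothing operator. With both factors truncated, composites can be
  iterated, as the left parametrix requires.\<close>

lemma smoothing_comp2:
  assumes p: "symb UNIV m p" and q: "symb UNIV m' q" and r: "rapid (\<lambda>s. comp_sym p q s - 1)"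
  shows "smoothing (\<lambda>u x. OpT p (OpT q u) x - u x)"
proof (rule smoothing_cong[OF smoothing_add[OF smoothing_comp1[OF p q r] smoothing_OpT_left[OF p smoothing_OpT_Op[OF q]]]])
  fix u x assume u: "u \<in> (test_functions :: ('a \<Rightarrow> complex) set)"
  have "OpT p (\<lambda>x. OpT q u x - Op q u x) x = OpT p (OpT q u) x - OpT p (Op q u) x"
    by (rule OpT_diff[OF p OpT_smooth[OF q test_functionsD(1)[OF u]] Op_smooth[OF q u]])
  then show "OpT p (OpT q u) x - u x = OpT p (Op q u) x - u x + OpT p (\<lambda>x. OpT q u x - Op q u x) x" by simp
qed

text \<open>With \<open>A B = 1 + K1\<close> and \<open>B S = 1 + K2\<close>, computing \<open>A B S\<close> in two ways gives \<open>A = S - A K2 + K1 S\<close>; then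
  apply \<open>B\<close>.\<close>

theorem left_parametrix:
  fixes p q s :: "'a::euclidean_space \<times> 'a \<Rightarrow> complex"
  assumes p: "symb UNIV m1 p" and q: "symb UNIV m2 q" and s: "symb UNIV m3 s"
    and pq: "rapid (\<lambda>x. comp_sym p q x - 1)" and qs: "rapid (\<lambda>x. comp_sym q s x - 1)"
  shows "smoothing (\<lambda>u x. OpT q (OpT p u) x - u x)"
proof -
  define K1 where "K1 = (\<lambda>u x. OpT p (OpT q u) x - u x)"
  define K2 where "K2 = (\<lambda>u x. OpT q (OpT s u) x - u x)"
  have k1: "smoothing K1" unfolding K1_def by (rule smoothing_comp2[OF p q pq])
  have k2: "smoothing K2" unfolding K2_def by (rule smoothing_comp2[OF q s qs])
  have "smoothing (\<lambda>u x. K2 u x - OpT q (OpT p (K2 u)) x + OpT q (K1 (OpT s u)) x)"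
    by (intro smoothing_add smoothing_diff k2 smoothing_OpT_left[OF q] smoothing_OpT_left[OF p] smoothing_OpT_right[OF s k1])
  then show ?thesis
  proof (rule smoothing_cong)
    fix u x assume u: "u \<in> (test_functions :: ('a \<Rightarrow> complex) set)"
    have su: "smooth_on UNIV u" by (rule test_functionsD(1)[OF u])
    have tS: "OpT s u \<in> test_functions" by (rule OpT_test[OF s u])
    have sS: "smooth_on UNIV (OpT s u)" by (rule test_functionsD(1)[OF tS])
    have sK2: "smooth_on UNIV (K2 u)" by (rule smoothing_smooth[OF k2 u])
    have sK1: "smooth_on UNIV (K1 (OpT s u))" by (rule smoothing_smooth[OF k1 tS])
    have BS: "OpT q (OpT s u) = (\<lambda>x. u x + K2 u x)" by (simp add: K2_def)
    have A: "OpT p u = (\<lambda>x. (OpT s u x - OpT p (K2 u) x) + K1 (OpT s u) x)"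
    proof
      fix x
      have "K1 (OpT s u) x = OpT p (OpT q (OpT s u)) x - OpT s u x" by (simp add: K1_def)
      also have "OpT p (OpT q (OpT s u)) x = OpT p u x + OpT p (K2 u) x"
        unfolding BS by (rule OpT_add[OF p su sK2])
      finally show "OpT p u x = (OpT s u x - OpT p (K2 u) x) + K1 (OpT s u) x" by simp
    qed
    have sA: "smooth_on UNIV (OpT p (K2 u))" by (rule OpT_smooth[OF p sK2])
    have "OpT q (OpT p u) x = OpT q (\<lambda>x. OpT s u x - OpT p (K2 u) x) x + OpT q (K1 (OpT s u)) x"
      unfolding A by (rule OpT_add[OF q smooth_on_sub[OF open_UNIV sS sA] sK1])
    also have "OpT q (\<lambda>x. OpT s u x - OpT p (K2 u) x) x = OpT q (OpT s u) x - OpT q (OpT p (K2 u)) x"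
      by (rule OpT_diff[OF q sS sA])
    finally show "OpT q (OpT p u) x - u x = K2 u x - OpT q (OpT p (K2 u)) x + OpT q (K1 (OpT s u)) x"
      unfolding BS by simp
  qed
qed


section \<open>Schwartz kernels\<close>

lemma integral_pair_compact:
  fixes H :: "'a::euclidean_space \<times> 'b::euclidean_space \<Rightarrow> complex"
  assumes H: "continuous_on UNIV H" and L: "compact L" and z: "\<And>p. p \<notin> L \<Longrightarrow> H p = 0"
  shows "(LINT p|lborel. H p) = (LINT x|lborel. (LINT y|lborel. H (x, y)))"
    and "(LINT p|lborel. H p) = (LINT y|lborel. (LINT x|lborel. H (x, y)))"
proof -
  have i: "integrable (lborel \<Otimes>\<^sub>M lborel) H"
    using integrable_compact_support[OF H L z] by (simp add: lborel_prod)
  show "(LINT p|lborel. H p) = (LINT x|lborel. (LINT y|lborel. H (x, y)))"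
    using lborel_pair.integral_fst'[OF i] by (simp add: lborel_prod)
  then show "(LINT p|lborel. H p) = (LINT y|lborel. (LINT x|lborel. H (x, y)))"
    using lborel_pair.Fubini_integral[of "\<lambda>x y. H (x, y)"] i by simp
qed

lemma test_functions_tensor:
  assumes u: "u \<in> test_functions" and v: "v \<in> test_functions"
  shows "(\<lambda>(x, y). v x * u y) \<in> test_functions"
proof (rule test_functionsI)
  show "compact (fun_support v \<times> fun_support u)" by (intro compact_Times test_functionsD u v)
  have "smooth_on UNIV (\<lambda>p. v (fst p) * u (snd p))"
    by (intro smooth_on_mult open_UNIV smooth_on_compose_linear[OF bounded_linear_fst test_functionsD(1)[OF v]]
        smooth_on_compose_linear[OF bounded_linear_snd test_functionsD(1)[OF u]])
  then show "smooth_on UNIV (\<lambda>(x, y). v x * u y)" by (simp add: case_prod_beta')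
qed (use fun_support_zero[of _ v] fun_support_zero[of _ u] in force)

definition test_norm :: "nat \<Rightarrow> ('a::euclidean_space \<Rightarrow> complex) \<Rightarrow> real" where
  "test_norm N f = (\<Sum>vs | set vs \<subseteq> Basis \<and> length vs \<le> N. SUP x. cmod (D_iter vs f x))"

lemma finite_basis_lists [simp]: "finite {vs :: 'a::euclidean_space list. set vs \<subseteq> Basis \<and> length vs \<le> N}"
  using finite_lists_length_le[of "Basis :: 'a set" N] by simp

lemma D_iter_le_test_norm:
  assumes f: "f \<in> test_functions" and vs: "set vs \<subseteq> Basis" "length vs \<le> N"
  shows "cmod (D_iter vs f x) \<le> test_norm N f" and "0 \<le> test_norm N f"
proof -
  obtain B where B: "B \<ge> 0" "\<And>vs z. set vs \<subseteq> Basis \<Longrightarrow> length vs \<le> N \<Longrightarrow> cmod (D_iter vs f z) \<le> B"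
    by (rule D_iter_bounded[OF test_functionsD[OF f], of N]) (auto simp: fun_support_zero)
  have le: "cmod (D_iter ws f z) \<le> (SUP x. cmod (D_iter ws f x))" if "set ws \<subseteq> Basis" "length ws \<le> N" for ws z
    by (rule cSUP_upper) (use B(2)[OF that] in \<open>auto intro!: bdd_aboveI[of _ B]\<close>)
  have nn: "0 \<le> (SUP x. cmod (D_iter ws f x))" if "set ws \<subseteq> Basis" "length ws \<le> N" for ws
    using le[OF that, of 0] norm_ge_zero order_trans by blast
  have "(SUP x. cmod (D_iter vs f x)) \<le> test_norm N f"
    unfolding test_norm_def by (rule member_le_sum) (use vs nn in auto)
  then show "cmod (D_iter vs f x) \<le> test_norm N f" using le[OF vs, of x] by linarith
  show "0 \<le> test_norm N f" unfolding test_norm_def by (rule sum_nonneg) (use nn in auto)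
qed

lemma D_iter_section1:
  assumes "smooth_on UNIV f" "set vs \<subseteq> Basis"
  shows "D_iter vs (\<lambda>t. f (t, z)) t = D_iter (map (\<lambda>u. (u, 0)) vs) f (t, z)"
  using assms(2)
proof (induction vs arbitrary: t)
  case (Cons v vs)
  have "D_iter vs (\<lambda>t. f (t, z)) = (\<lambda>t. D_iter (map (\<lambda>u. (u, 0)) vs) f (t, z))"
    using Cons by auto
  moreover have "D_iter (map (\<lambda>u. (u, 0)) vs) f differentiable at (t, z)"
    using Cons.prems by (intro smooth_on_diff[OF smooth_on_D_iter[OF assms(1)]]) auto
  ultimately show ?case by (simp add: pd_section1(2))
qed simp

section \<open>Oscillatory integrals as distributions\<close>

definition osc_inner :: "('a::euclidean_space \<times> 'a \<Rightarrow> complex) \<Rightarrow> ('a \<times> 'a \<Rightarrow> complex) \<Rightarrow> 'a \<Rightarrow> complex" where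
  "osc_inner a f \<xi> = (LINT w|lborel. ph (fst w - snd w) \<xi> * (a (fst w, \<xi>) * f w))"

definition osc_dist :: "('a::euclidean_space \<times> 'a \<Rightarrow> complex) \<Rightarrow> ('a \<times> 'a \<Rightarrow> complex) \<Rightarrow> complex" where
  "osc_dist a f = 1 / (2 * of_real pi) ^ DIM('a) * (LINT \<xi>|lborel. osc_inner a f \<xi>)"

text \<open>For a fixed covariable the integral over \<open>(x, y)\<close> is a Fourier transform on
  the product space, taken at \<open>(\<xi>, - \<xi>)\<close>. This is the source of the rapid decay
  in \<open>\<xi>\<close> that lets the integral in \<open>osc_dist\<close> converge
  absolutely.\<close>

lemma osc_inner_ft: "osc_inner a f \<xi> = ft (\<lambda>w. a (fst w, \<xi>) * f w) (\<xi>, - \<xi>)"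
  by (simp add: osc_inner_def ft_def ph_def inner_prod_def inner_diff_left)

text \<open>The bound is linear in a seminorm of \<open>f\<close>, and the same \<open>C\<close> and
  \<open>N\<close> serve all test functions supported in \<open>K\<close>: this becomes the
  continuity estimate required of a distribution.\<close>

lemma osc_inner_decay:
  fixes a :: "'a::euclidean_space \<times> 'a \<Rightarrow> complex"
  assumes a: "symb UNIV m a" and K: "compact K"
  shows "\<exists>C\<ge>0. \<exists>N. \<forall>f\<in>test_functions. fun_support f \<subseteq> K \<longrightarrow>
    (\<forall>\<xi>. cmod (osc_inner a f \<xi>) \<le> C * test_norm N f * jb \<xi> powr s)"
proof -
  obtain M :: nat where M: "m - s \<le> real M" using real_arch_simple by blast
  let ?b = "\<lambda>(w::'a \<times> 'a, \<xi>). a (fst w, \<xi>)"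
  have b: "symb UNIV m ?b" by (rule symb_pullback_fst[OF bounded_linear_fst a])
  obtain C0 where C0: "C0 \<ge> 0" "\<And>ws w \<xi>. set ws \<subseteq> Basis \<Longrightarrow> length ws \<le> M \<Longrightarrow> w \<in> K \<Longrightarrow>
      cmod (D_iter ws ?b (w, \<xi>)) \<le> C0 * jb \<xi> powr (m - real (cnt ws))"
    using symbE_fin[OF b K, of M] by auto
  define C where "C = (1 + real DIM('a \<times> 'a)) ^ M * (2 ^ M * C0) * measure lborel K"
  have "cmod (osc_inner a f \<xi>) \<le> C * test_norm M f * jb \<xi> powr s"
    if f: "f \<in> test_functions" and fK: "fun_support f \<subseteq> K" for f \<xi>
  proof -
    let ?g = "\<lambda>w. a (fst w, \<xi>) * f w"
    have sb: "smooth_on UNIV (\<lambda>w. ?b (w, \<xi>))" by (rule smooth_on_section1[OF symb_smooth[OF b]])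
    then have sb': "smooth_on UNIV (\<lambda>w::'a \<times> 'a. a (fst w, \<xi>))" by simp
    have sg: "smooth_on UNIV ?g" by (intro smooth_on_mult open_UNIV sb' test_functionsD(1)[OF f])
    have g0: "?g w = 0" if "w \<notin> K" for w using that fK fun_support_zero[of w f] by auto
    have SN0: "0 \<le> test_norm M f" by (rule D_iter_le_test_norm(2)[OF f, of "[]"]) auto
    let ?B = "2 ^ M * (C0 * jb \<xi> powr m) * test_norm M f"
    have B0: "0 \<le> ?B" using C0(1) SN0 by simp
    have B: "cmod (D_iter vs ?g w) \<le> ?B" if vs: "set vs \<subseteq> Basis" "length vs \<le> M" for vs w
    proof (cases "w \<in> K")
      case True
      have "cmod (D_iter vs ?g w) \<le> 2 ^ length vs * (C0 * jb \<xi> powr m) * test_norm M f * 1 ^ length (filter (\<lambda>_. True) vs)"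
      proof (rule D_iter_mult_bound[OF open_UNIV UNIV_I zero_le_one sb' test_functionsD(1)[OF f] vs(1)])
        fix us :: "('a \<times> 'a) list" assume us: "set us \<subseteq> Basis" "length us \<le> length vs"
        have "D_iter us (\<lambda>w. ?b (w, \<xi>)) w = D_iter (map (\<lambda>u. (u, 0)) us) ?b (w, \<xi>)"
          by (rule D_iter_section1[OF symb_smooth[OF b] us(1)])
        then show "cmod (D_iter us (\<lambda>w. a (fst w, \<xi>)) w) \<le> C0 * jb \<xi> powr m * 1 ^ length (filter (\<lambda>_. True) us)"
          using C0(2)[of "map (\<lambda>u. (u, 0)) us" w \<xi>] us vs True by simp
        show "cmod (D_iter us f w) \<le> test_norm M f * 1 ^ length (filter (\<lambda>_. True) us)"
          using D_iter_le_test_norm(1)[OF f us(1), of M w] us vs by simp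
      qed
      also have "\<dots> \<le> 2 ^ M * (C0 * jb \<xi> powr m) * test_norm M f"
        using vs C0(1) SN0 by (auto intro!: mult_right_mono power_increasing)
      finally show ?thesis .
    next
      case False
      have "D_iter vs ?g w = 0" by (rule D_iter_zero_outside[where L = K and x = w]) (use K g0 False in auto)
      then show ?thesis using B0 by simp
    qed
    have "jb (\<xi>, - \<xi>) ^ M * cmod (ft ?g (\<xi>, - \<xi>)) \<le> (1 + real DIM('a \<times> 'a)) ^ M * ?B * measure lborel K"
      by (rule ft_decay[OF sg K g0 B])
    then have 1: "jb (\<xi>, - \<xi>) ^ M * cmod (osc_inner a f \<xi>) \<le> C * test_norm M f * jb \<xi> powr m"
      by (simp add: C_def osc_inner_ft mult_ac)
    \<comment> \<open>The norm of \<open>(\<xi>, - \<xi>)\<close> is at least that of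
      \<open>\<xi>\<close>, so decay in the doubled covariable is decay in
      \<open>\<xi>\<close>.\<close>
    have "jb \<xi> ^ M * cmod (osc_inner a f \<xi>) \<le> jb (\<xi>, - \<xi>) ^ M * cmod (osc_inner a f \<xi>)"
      by (intro mult_right_mono power_mono jb_mono) (auto simp: norm_Pair intro!: real_le_rsqrt)
    with 1 have "jb \<xi> powr real M * cmod (osc_inner a f \<xi>) \<le> C * test_norm M f * jb \<xi> powr m"
      by (simp add: powr_realpow)
    then have "jb \<xi> powr (- real M) * (jb \<xi> powr real M * cmod (osc_inner a f \<xi>)) \<le> jb \<xi> powr (- real M) * (C * test_norm M f * jb \<xi> powr m)"
      by (rule mult_left_mono) simp
    also have "jb \<xi> powr (- real M) * (jb \<xi> powr real M * cmod (osc_inner a f \<xi>)) = cmod (osc_inner a f \<xi>)"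
      by (simp flip: mult.assoc powr_add)
    also have "jb \<xi> powr (- real M) * (C * test_norm M f * jb \<xi> powr m) = C * test_norm M f * jb \<xi> powr (m - real M)"
      by (simp add: powr_diff powr_minus divide_simps)
    also have "\<dots> \<le> C * test_norm M f * jb \<xi> powr s"
      using M C0(1) SN0 by (intro mult_left_mono jb_powr_mono) (auto simp: C_def)
    finally show ?thesis .
  qed
  moreover have "C \<ge> 0" using C0(1) by (simp add: C_def)
  ultimately show ?thesis by blast
qed

lemma osc_inner_integrand:
  assumes a: "symb UNIV m a" and f: "f \<in> test_functions"
  shows "smooth_on UNIV (\<lambda>(\<xi>, w). ph (fst w - snd w) \<xi> * (a (fst w, \<xi>) * f w))"
proof -
  have 1: "smooth_on UNIV (\<lambda>p::'a \<times> 'a \<times> 'a. (\<lambda>(z, \<eta>). ph z \<eta>) (fst (snd p) - snd (snd p), fst p))"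
    by (rule smooth_on_compose_linear[OF _ smooth_on_ph]) (intro bounded_linear_intros)
  have 2: "smooth_on UNIV (\<lambda>p::'a \<times> 'a \<times> 'a. a (fst (snd p), fst p))"
    by (rule smooth_on_compose_linear[OF _ symb_smooth[OF a]]) (intro bounded_linear_intros)
  have 3: "smooth_on UNIV (\<lambda>p::'a \<times> 'a \<times> 'a. f (snd p))"
    by (rule smooth_on_compose_linear[OF bounded_linear_snd test_functionsD(1)[OF f]])
  have "smooth_on UNIV (\<lambda>p::'a \<times> 'a \<times> 'a. ph (fst (snd p) - snd (snd p)) (fst p) * (a (fst (snd p), fst p) * f (snd p)))"
    using smooth_on_mult[OF open_UNIV 1 smooth_on_mult[OF open_UNIV 2 3]] by simp
  then show ?thesis by (simp add: case_prod_beta')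
qed

lemma osc_inner_cont:
  assumes a: "symb UNIV m a" and f: "f \<in> test_functions"
  shows "continuous_on UNIV (osc_inner a f)"
proof -
  have "smooth_on UNIV (\<lambda>\<xi>. LINT w|lborel. (\<lambda>(\<xi>, w). ph (fst w - snd w) \<xi> * (a (fst w, \<xi>) * f w)) (\<xi>, w))"
    by (rule smooth_on_integral[OF osc_inner_integrand[OF a f]], rule zsupp_compact[OF test_functionsD(2)[OF f]]) (simp add: fun_support_zero)
  then show ?thesis by (intro smooth_on_imp_continuous_on) (simp add: osc_inner_def[abs_def])
qed

lemma osc_inner_section_integrable:
  assumes a: "symb UNIV m a" and f: "f \<in> test_functions"
  shows "integrable lborel (\<lambda>w. ph (fst w - snd w) \<xi> * (a (fst w, \<xi>) * f w))"
proof (rule integrable_compact_support[OF _ test_functionsD(2)[OF f]])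
  show "continuous_on UNIV (\<lambda>w. ph (fst w - snd w) \<xi> * (a (fst w, \<xi>) * f w))"
    using continuous_on_section[OF smooth_on_imp_continuous_on[OF osc_inner_integrand[OF a f]], of \<xi>] by simp
qed (simp add: fun_support_zero)

lemma osc_inner_bound:
  fixes a :: "'a::euclidean_space \<times> 'a \<Rightarrow> complex"
  assumes a: "symb UNIV m a" and f: "f \<in> test_functions"
  shows "\<exists>C\<ge>0. \<forall>\<xi>. cmod (osc_inner a f \<xi>) \<le> C * jb \<xi> powr s"
proof -
  obtain C N where C: "C \<ge> 0" "\<forall>f\<in>test_functions. fun_support f \<subseteq> fun_support f \<longrightarrow> True" and
    le: "\<And>g. g \<in> test_functions \<Longrightarrow> fun_support g \<subseteq> fun_support f \<Longrightarrow> \<forall>\<xi>. cmod (osc_inner a g \<xi>) \<le> C * test_norm N g * jb \<xi> powr s"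
    using osc_inner_decay[OF a test_functionsD(2)[OF f], of s] by blast
  have "0 \<le> test_norm N f" by (rule D_iter_le_test_norm(2)[OF f, of "[]"]) auto
  then show ?thesis using le[OF f] C(1) by (intro exI[of _ "C * test_norm N f"]) auto
qed

lemma osc_inner_integrable:
  fixes a :: "'a::euclidean_space \<times> 'a \<Rightarrow> complex"
  assumes a: "symb UNIV m a" and f: "f \<in> test_functions"
  shows "integrable lborel (osc_inner a f)"
proof -
  obtain C where C: "\<And>\<xi>. cmod (osc_inner a f \<xi>) \<le> C * jb \<xi> powr (- 2 * real DIM('a))" using osc_inner_bound[OF a f] by blast
  show ?thesis
  proof (rule Bochner_Integration.integrable_bound)
    show "integrable lborel (\<lambda>\<xi>::'a. C * jb \<xi> powr (- 2 * real DIM('a)))"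
      by (intro integrable_mult_right integrable_jb) simp
    show "osc_inner a f \<in> borel_measurable lborel"
      using borel_measurable_continuous_onI[OF osc_inner_cont[OF a f]] by simp
    show "AE \<xi> in lborel. norm (osc_inner a f \<xi>) \<le> norm (C * jb \<xi> powr (- 2 * real DIM('a)))"
      by (rule AE_I2) (use C in \<open>auto intro: order_trans[OF _ abs_ge_self]\<close>)
  qed
qed

text \<open>For \<open>\<epsilon> > 0\<close> all supports are compact and Fubini gives the integral
  of \<open>\<psi> (\<epsilon> *\<^sub>R \<xi>) * osc_inner a f \<xi>\<close>. The first factor is
  bounded and tends to 1 pointwise, so dominated convergence yields the same limit for every
  cutoff.\<close>

lemma osc_dist_osc:
  fixes a :: "'a::euclidean_space \<times> 'a \<Rightarrow> complex"
  assumes a: "symb UNIV m a" and f: "f \<in> test_functions"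
  shows "has_oscillatory_integral (\<lambda>((x, y), \<xi>). a (x, \<xi>)) f (osc_dist a f)"
  unfolding has_oscillatory_integral_def
proof
  fix \<psi> :: "'a \<Rightarrow> complex" assume \<psi>: "\<psi> \<in> cutoffs"
  then have t\<psi>: "\<psi> \<in> test_functions" by (simp add: cutoffs_def)
  have c\<psi>: "continuous_on UNIV \<psi>" by (rule test_cont[OF t\<psi>])
  obtain e R where eR: "e > 0" "R > 0" "\<And>\<xi>. norm \<xi> < e \<Longrightarrow> \<psi> \<xi> = 1" "\<And>\<xi>. norm \<xi> > R \<Longrightarrow> \<psi> \<xi> = 0"
    by (rule cutoffsE[OF \<psi>]) (rule that)
  obtain B where B: "B \<ge> 0" "\<And>vs z. set vs \<subseteq> Basis \<Longrightarrow> length vs \<le> 0 \<Longrightarrow> cmod (D_iter vs \<psi> z) \<le> B"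
    by (rule D_iter_bounded[OF test_functionsD[OF t\<psi>], of 0]) (auto simp: fun_support_zero)
  have B: "cmod (\<psi> z) \<le> B" for z using B(2)[of "[]" z] by simp
  let ?F = "\<lambda>\<epsilon>. (LINT ((x, y), \<xi>)|lborel.
      exp (\<i> * of_real ((x - y) \<bullet> \<xi>)) * (\<lambda>((x, y), \<xi>). a (x, \<xi>)) ((x, y), \<xi>) * \<psi> (\<epsilon> *\<^sub>R \<xi>) * f (x, y))"
  have F: "?F \<epsilon> = (LINT \<xi>|lborel. \<psi> (\<epsilon> *\<^sub>R \<xi>) * osc_inner a f \<xi>)" if \<epsilon>: "\<epsilon> > 0" for \<epsilon>
  proof -
    let ?H = "\<lambda>p::('a \<times> 'a) \<times> 'a. \<psi> (\<epsilon> *\<^sub>R snd p) * (\<lambda>(\<xi>, w). ph (fst w - snd w) \<xi> * (a (fst w, \<xi>) * f w)) (snd p, fst p)"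
    have "?F \<epsilon> = (LINT p|lborel. ?H p)"
      by (intro Bochner_Integration.integral_cong refl) (simp add: ph_def case_prod_beta' mult_ac)
    also have "\<dots> = (LINT \<xi>|lborel. (LINT w|lborel. ?H (w, \<xi>)))"
    proof (rule integral_pair_compact(2)[where L = "fun_support f \<times> cball 0 (R / \<epsilon>)"])
      show "continuous_on UNIV ?H"
        by (intro continuous_intros continuous_on_compose2[OF c\<psi>]
            continuous_on_compose2[OF smooth_on_imp_continuous_on[OF osc_inner_integrand[OF a f]]]) auto
      show "compact (fun_support f \<times> (cball 0 (R / \<epsilon>) :: 'a set))" by (intro compact_Times test_functionsD(2)[OF f] compact_cball)
      fix p :: "('a \<times> 'a) \<times> 'a" assume p: "p \<notin> fun_support f \<times> cball 0 (R / \<epsilon>)"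
      show "?H p = 0"
      proof (cases "fst p \<in> fun_support f")
        case True
        then have "norm (snd p) > R / \<epsilon>" using p by (cases p) auto
        then have "norm (\<epsilon> *\<^sub>R snd p) > R" using \<epsilon> by (simp add: field_simps)
        then show ?thesis using eR(4) by simp
      qed (simp add: fun_support_zero case_prod_beta')
    qed
    also have "\<dots> = (LINT \<xi>|lborel. \<psi> (\<epsilon> *\<^sub>R \<xi>) * osc_inner a f \<xi>)"
      by (simp add: osc_inner_def)
    finally show ?thesis .
  qed
  have I: "integrable lborel (osc_inner a f)" by (rule osc_inner_integrable[OF a f])
  have m: "osc_inner a f \<in> borel_measurable borel" using borel_measurable_continuous_onI[OF osc_inner_cont[OF a f]] .
  \<comment> \<open>\<open>\<epsilon>\<close> is written as \<open>1 / t\<close> with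
    \<open>t\<close> tending to infinity, to match the form of dominated convergence used.\<close>
  have "((\<lambda>t. LINT \<xi>|lborel. \<psi> (inverse t *\<^sub>R \<xi>) * osc_inner a f \<xi>) \<longlongrightarrow> (LINT \<xi>|lborel. osc_inner a f \<xi>)) at_top"
  proof (rule integral_dominated_convergence_at_top)
    show "integrable lborel (\<lambda>\<xi>. B * cmod (osc_inner a f \<xi>))" using I by (intro integrable_mult_right integrable_norm)
    show "(\<lambda>\<xi>. \<psi> (inverse t *\<^sub>R \<xi>) * osc_inner a f \<xi>) \<in> borel_measurable lborel" for t
      using borel_measurable_continuous_onI[of "\<lambda>\<xi>. \<psi> (inverse t *\<^sub>R \<xi>) * osc_inner a f \<xi>"]
      by (simp, intro borel_measurable_continuous_onI continuous_intros continuous_on_compose2[OF c\<psi>] osc_inner_cont[OF a f]) auto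
    show "\<forall>\<^sub>F t in at_top. AE \<xi> in lborel. norm (\<psi> (inverse t *\<^sub>R \<xi>) * osc_inner a f \<xi>) \<le> B * cmod (osc_inner a f \<xi>)"
      by (intro always_eventually allI AE_I2) (simp add: norm_mult mult_right_mono B)
    show "AE \<xi> in lborel. ((\<lambda>t. \<psi> (inverse t *\<^sub>R \<xi>) * osc_inner a f \<xi>) \<longlongrightarrow> osc_inner a f \<xi>) at_top"
    proof (rule AE_I2)
      fix \<xi> :: 'a
      have "((\<lambda>t::real. inverse t *\<^sub>R \<xi>) \<longlongrightarrow> 0 *\<^sub>R \<xi>) at_top"
        by (intro tendsto_intros tendsto_inverse_0_at_top filterlim_ident)
      then have "\<forall>\<^sub>F t::real in at_top. dist (inverse t *\<^sub>R \<xi>) 0 < e"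
        using eR(1) by (auto dest: tendstoD)
      then have "\<forall>\<^sub>F t in at_top. \<psi> (inverse t *\<^sub>R \<xi>) * osc_inner a f \<xi> = osc_inner a f \<xi>"
        by eventually_elim (simp add: eR(3))
      then show "((\<lambda>t. \<psi> (inverse t *\<^sub>R \<xi>) * osc_inner a f \<xi>) \<longlongrightarrow> osc_inner a f \<xi>) at_top" by (rule tendsto_eventually)
    qed
  qed (use m in simp)
  then have "((\<lambda>\<epsilon>. LINT \<xi>|lborel. \<psi> (\<epsilon> *\<^sub>R \<xi>) * osc_inner a f \<xi>) \<longlongrightarrow> (LINT \<xi>|lborel. osc_inner a f \<xi>)) (at_right 0)"
    by (simp add: filterlim_at_right_to_top)
  moreover have "\<forall>\<^sub>F \<epsilon> in at_right 0. (LINT \<xi>|lborel. \<psi> (\<epsilon> *\<^sub>R \<xi>) * osc_inner a f \<xi>) = ?F \<epsilon>"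
    using eventually_at_right_less[of 0] by eventually_elim (rule F[symmetric])
  ultimately have "(?F \<longlongrightarrow> (LINT \<xi>|lborel. osc_inner a f \<xi>)) (at_right 0)" by (rule Lim_transform_eventually)
  then show "((\<lambda>\<epsilon>. 1 / (2 * of_real pi) ^ DIM('a) * ?F \<epsilon>) \<longlongrightarrow> osc_dist a f) (at_right 0)"
    unfolding osc_dist_def by (intro tendsto_mult tendsto_const)
qed

lemma cutoffs_nonempty: "\<exists>\<psi>. \<psi> \<in> (cutoffs :: ('a::euclidean_space \<Rightarrow> complex) set)"
  using cut_props by blast

lemma oscillatory_integral_unique:
  fixes a :: "('a::euclidean_space \<times> 'a) \<times> 'a \<Rightarrow> complex"
  assumes "has_oscillatory_integral a f I" "has_oscillatory_integral a f J"
  shows "I = J"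
proof -
  obtain \<psi> where "\<psi> \<in> (cutoffs :: ('a \<Rightarrow> complex) set)" using cutoffs_nonempty by blast
  then show ?thesis
    using assms unfolding has_oscillatory_integral_def by (blast intro: tendsto_unique[OF trivial_limit_at_right_real])
qed

lemma distribution_osc_dist:
  fixes a :: "'a::euclidean_space \<times> 'a \<Rightarrow> complex"
  assumes a: "symb UNIV m a"
  shows "distribution (osc_dist a)"
  unfolding distribution_def
proof (intro conjI ballI allI impI)
  fix f g :: "'a \<times> 'a \<Rightarrow> complex" assume f: "f \<in> test_functions" and g: "g \<in> test_functions"
  have "osc_inner a (\<lambda>x. f x + g x) \<xi> = osc_inner a f \<xi> + osc_inner a g \<xi>" for \<xi>
    unfolding osc_inner_def
    by (simp add: distrib_left Bochner_Integration.integral_add[OF osc_inner_section_integrable[OF a f] osc_inner_section_integrable[OF a g]])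
  then show "osc_dist a (\<lambda>x. f x + g x) = osc_dist a f + osc_dist a g"
    by (simp add: osc_dist_def Bochner_Integration.integral_add[OF osc_inner_integrable[OF a f] osc_inner_integrable[OF a g]] add_divide_distrib)
next
  fix c :: complex and f :: "'a \<times> 'a \<Rightarrow> complex"
  have "osc_inner a (\<lambda>x. c * f x) \<xi> = c * osc_inner a f \<xi>" for \<xi>
    unfolding osc_inner_def by (simp add: mult.left_commute[of _ c])
  then show "osc_dist a (\<lambda>x. c * f x) = c * osc_dist a f" by (simp add: osc_dist_def)
next
  fix K :: "('a \<times> 'a) set" assume K: "compact K"
  let ?s = "- 2 * real DIM('a)"
  let ?cn = "cmod (1 / (2 * of_real pi) ^ DIM('a))"
  let ?J = "LINT \<xi>|(lborel :: 'a measure). jb \<xi> powr ?s"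
  obtain C N where C: "C \<ge> 0" and le: "\<And>f \<xi>. f \<in> test_functions \<Longrightarrow> fun_support f \<subseteq> K \<Longrightarrow>
      cmod (osc_inner a f \<xi>) \<le> C * test_norm N f * jb \<xi> powr ?s"
    using osc_inner_decay[OF a K, of ?s] by blast
  have "cmod (osc_dist a f) \<le> (?cn * C * ?J) * test_norm N f" if f: "f \<in> test_functions" "fun_support f \<subseteq> K" for f
  proof -
    have "cmod (LINT \<xi>|lborel. osc_inner a f \<xi>) \<le> (LINT \<xi>|(lborel :: 'a measure). C * test_norm N f * jb \<xi> powr ?s)"
      by (rule Bochner_Integration.integral_norm_bound_integral[OF osc_inner_integrable[OF a f(1)]])
        (use le[OF f] in \<open>auto intro!: integrable_mult_right integrable_jb\<close>)
    also have "\<dots> = C * test_norm N f * ?J" by simp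
    finally have "?cn * cmod (LINT \<xi>|lborel. osc_inner a f \<xi>) \<le> ?cn * (C * test_norm N f * ?J)" by (rule mult_left_mono) simp
    then show ?thesis unfolding osc_dist_def norm_mult by (simp add: mult_ac)
  qed
  then show "\<exists>C N. \<forall>f\<in>test_functions. fun_support f \<subseteq> K \<longrightarrow>
      cmod (osc_dist a f) \<le> C * (\<Sum>vs | set vs \<subseteq> Basis \<and> length vs \<le> N. SUP x. cmod (D_iter vs f x))"
    unfolding test_norm_def by blast
qed

text \<open>The integrals over \<open>x\<close> and \<open>\<xi>\<close> in the pairing of
  \<open>Op a u\<close> with \<open>v\<close> are interchanged; on the support of \<open>v\<close>
  the decay of \<open>ft u\<close> beats the growth of \<open>a\<close> and leaves a majorant in
  product form.\<close>

lemma osc_dist_tensor: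
  fixes a :: "'a::euclidean_space \<times> 'a \<Rightarrow> complex"
  assumes a: "symb UNIV m a" and u: "u \<in> test_functions" and v: "v \<in> test_functions"
  shows "fun_dist (Op a u) v = osc_dist a (\<lambda>(x, y). v x * u y)"
proof -
  let ?cn = "1 / (2 * complex_of_real pi) ^ DIM('a)"
  let ?K = "fun_support v"
  let ?f = "\<lambda>(x, y). v x * u y"
  let ?H = "\<lambda>(x, \<xi>). v x * (ph x \<xi> * (a (x, \<xi>) * ft u (- \<xi>)))"
  have f: "?f \<in> test_functions" by (rule test_functions_tensor[OF u v])
  have cv: "continuous_on UNIV v" and cu: "continuous_on UNIV u" by (intro test_cont u v)+
  have ca: "continuous_on UNIV a" by (rule smooth_on_imp_continuous_on[OF symb_smooth[OF a]])
  have cH: "continuous_on UNIV ?H"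
    unfolding case_prod_beta'
    by (intro continuous_intros continuous_on_compose2[OF cv] continuous_on_compose2[OF ca]
        continuous_on_compose2[OF test_ft_cont[OF u]]) auto
  obtain C1 where C1: "C1 \<ge> 0" "\<And>x \<xi>. x \<in> ?K \<Longrightarrow> cmod (a (x, \<xi>)) \<le> C1 * jb \<xi> powr m"
    using symb_bound[OF a test_functionsD(2)[OF v]] by auto
  obtain C2 where C2: "C2 \<ge> 0" "\<And>\<xi>. cmod (ft u (- \<xi>)) \<le> C2 * jb \<xi> powr (- m - 2 * real DIM('a))"
    using test_ft_decay[OF u, of "- m - 2 * real DIM('a)"] by auto
  have bd: "cmod (?H (x, \<xi>)) \<le> cmod (v x) * (C1 * C2 * jb \<xi> powr (- 2 * real DIM('a)))" for x \<xi>
  proof (cases "x \<in> ?K")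
    case True
    have "cmod (a (x, \<xi>)) * cmod (ft u (- \<xi>)) \<le> (C1 * jb \<xi> powr m) * (C2 * jb \<xi> powr (- m - 2 * real DIM('a)))"
      by (intro mult_mono C1(2)[OF True] C2(2)) (use C1(1) in auto)
    also have "\<dots> = C1 * C2 * (jb \<xi> powr m * jb \<xi> powr (- m - 2 * real DIM('a)))" by simp
    also have "\<dots> = C1 * C2 * jb \<xi> powr (- 2 * real DIM('a))" by (simp flip: powr_add)
    finally show ?thesis by (simp add: norm_mult mult_left_mono)
  qed (simp add: fun_support_zero)
  have "fun_dist (Op a u) v = ?cn * (LINT x|lborel. (LINT \<xi>|lborel. ?H (x, \<xi>)))"
    by (simp add: fun_dist_def Op_expand[OF u] mult.commute[of _ "v _"])
  also have "(LINT x|lborel. (LINT \<xi>|lborel. ?H (x, \<xi>))) = (LINT \<xi>|lborel. (LINT x|lborel. ?H (x, \<xi>)))"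
  proof (rule Fubini_bound(2)[OF borel_measurable_continuous_onI[OF cH] _ _ bd])
    show "integrable lborel (\<lambda>x. cmod (v x))" by (intro integrable_norm integrable_test v)
    show "integrable lborel (\<lambda>\<xi>::'a. C1 * C2 * jb \<xi> powr (- 2 * real DIM('a)))"
      by (intro integrable_mult_right integrable_jb) simp
  qed
  also have "\<dots> = (LINT \<xi>|lborel. osc_inner a ?f \<xi>)"
  proof (rule Bochner_Integration.integral_cong[OF refl])
    fix \<xi> :: 'a
    let ?G = "\<lambda>w. ph (fst w - snd w) \<xi> * (a (fst w, \<xi>) * ?f w)"
    have cG: "continuous_on UNIV ?G"
      using continuous_on_section[OF smooth_on_imp_continuous_on[OF osc_inner_integrand[OF a f]], of \<xi>] by simp
    have "osc_inner a ?f \<xi> = (LINT x|lborel. (LINT y|lborel. ?G (x, y)))"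
      unfolding osc_inner_def
      by (rule integral_pair_compact(1)[OF cG test_functionsD(2)[OF f]]) (simp add: fun_support_zero[of _ ?f])
    also have "\<dots> = (LINT x|lborel. ?H (x, \<xi>))"
    proof (rule Bochner_Integration.integral_cong[OF refl])
      fix x :: 'a
      have "(LINT y|lborel. ?G (x, y)) = (LINT y|lborel. (v x * (ph x \<xi> * a (x, \<xi>))) * (ph y (- \<xi>) * u y))"
        by (rule Bochner_Integration.integral_cong[OF refl]) (simp add: ph_diff mult_ac)
      also have "\<dots> = ?H (x, \<xi>)" by (simp add: ft_def)
      finally show "(LINT y|lborel. ?G (x, y)) = ?H (x, \<xi>)" .
    qed
    finally show "(LINT x|lborel. ?H (x, \<xi>)) = osc_inner a ?f \<xi>" ..
  qed
  finally show ?thesis by (simp add: osc_dist_def)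
qed

section \<open>Kernels of the operators\<close>

lemma kernel_Op:
  assumes a: "symb UNIV m a"
  shows "has_schwartz_kernel (Op a) (osc_dist a)"
  unfolding has_schwartz_kernel_def smooth_operator_def
proof (intro conjI ballI allI)
  show "smooth_on UNIV (Op a u)" if "u \<in> test_functions" for u by (rule Op_smooth[OF a that])
  show "Op a (\<lambda>x. u x + v x) = (\<lambda>x. Op a u x + Op a v x)" if "u \<in> test_functions" "v \<in> test_functions" for u v
    using Op_add[OF a that] by auto
  show "Op a (\<lambda>x. c * u x) = (\<lambda>x. c * Op a u x)" for c u by (simp add: Op_cmult fun_eq_iff)
  show "distribution (osc_dist a)" by (rule distribution_osc_dist[OF a])
  show "fun_dist (Op a u) v = osc_dist a (\<lambda>(x, y). v x * u y)" if "u \<in> test_functions" "v \<in> test_functions" for u v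
    by (rule osc_dist_tensor[OF a that])
qed

lemma fun_dist_tensor:
  assumes k: "smooth_on UNIV k" and u: "u \<in> test_functions" and v: "v \<in> test_functions"
  shows "fun_dist (kernel_op k u) v = fun_dist k (\<lambda>(x, y). v x * u y)"
proof -
  have ck: "continuous_on UNIV k" by (rule smooth_on_imp_continuous_on[OF k])
  have cv: "continuous_on UNIV v" and cu: "continuous_on UNIV u" by (intro test_cont u v)+
  have "fun_dist k (\<lambda>(x, y). v x * u y) = (LINT p|lborel. k p * (v (fst p) * u (snd p)))"
    by (simp add: fun_dist_def case_prod_beta')
  also have "\<dots> = (LINT x|lborel. (LINT y|lborel. k (x, y) * (v (fst (x, y)) * u (snd (x, y)))))"
  proof (rule integral_pair_compact(1)[where L = "fun_support v \<times> fun_support u"])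
    show "continuous_on UNIV (\<lambda>p. k p * (v (fst p) * u (snd p)))"
      by (intro continuous_intros ck continuous_on_compose2[OF cv] continuous_on_compose2[OF cu]) auto
    show "compact (fun_support v \<times> fun_support u)" by (intro compact_Times test_functionsD u v)
  qed (auto simp: mem_Times_iff fun_support_zero)
  also have "\<dots> = (LINT x|lborel. (LINT y|lborel. v x * (k (x, y) * u y)))" by (simp add: mult_ac)
  also have "\<dots> = (LINT x|lborel. v x * (LINT y|lborel. k (x, y) * u y))" by simp
  also have "\<dots> = fun_dist (kernel_op k u) v" by (simp add: fun_dist_def kernel_op_def mult.commute)
  finally show ?thesis ..
qed

lemma distribution_fun_dist:
  fixes k :: "'a::euclidean_space \<Rightarrow> complex"
  assumes k: "continuous_on UNIV k"
  shows "distribution (fun_dist k)"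
  unfolding distribution_def
proof (intro conjI ballI allI impI)
  have i: "integrable lborel (\<lambda>x. k x * f x)" if "f \<in> test_functions" for f
    by (rule integrable_compact_support[OF _ test_functionsD(2)[OF that]])
      (intro continuous_intros k test_cont that, simp add: fun_support_zero)
  show "fun_dist k (\<lambda>x. f x + g x) = fun_dist k f + fun_dist k g"
    if "f \<in> test_functions" "g \<in> test_functions" for f g
    by (simp add: fun_dist_def distrib_left Bochner_Integration.integral_add[OF i[OF that(1)] i[OF that(2)]])
  show "fun_dist k (\<lambda>x. c * f x) = c * fun_dist k f" for c f
    by (simp add: fun_dist_def mult.left_commute[of _ c])
  fix K :: "'a set" assume K: "compact K"
  have "bounded (k ` K)" by (intro compact_imp_bounded compact_continuous_image K continuous_on_subset[OF k]) auto
  then obtain B where B: "\<And>x. x \<in> K \<Longrightarrow> cmod (k x) \<le> B" unfolding bounded_iff by auto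
  have "cmod (fun_dist k f) \<le> (B * measure lborel K) * test_norm 0 f" if f: "f \<in> test_functions" "fun_support f \<subseteq> K" for f
  proof -
    have iK: "integrable lborel (indicat_real K)"
      using emeasure_compact_finite[OF K] by (intro integrable_real_indicator borel_compact K) (simp add: borel_compact K)
    have "cmod (fun_dist k f) \<le> (LINT x|lborel. B * test_norm 0 f * indicat_real K x)"
      unfolding fun_dist_def
    proof (rule Bochner_Integration.integral_norm_bound_integral[OF i[OF f(1)]])
      show "integrable lborel (\<lambda>x. B * test_norm 0 f * indicat_real K x)" by (intro integrable_mult_right iK)
      show "norm (k x * f x) \<le> B * test_norm 0 f * indicat_real K x" if "x \<in> space lborel" for x
      proof (cases "x \<in> K")
        case True
        have "cmod (f x) \<le> test_norm 0 f" using D_iter_le_test_norm(1)[OF f(1), of "[]" 0 x] by simp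
        then show ?thesis using True B[OF True] by (simp add: norm_mult mult_mono' )
      next
        case False
        then have "f x = 0" using f(2) fun_support_zero[of x f] by auto
        then show ?thesis using False by simp
      qed
    qed
    then show ?thesis using borel_compact[OF K] by (simp add: mult_ac)
  qed
  then show "\<exists>C N. \<forall>f\<in>test_functions. fun_support f \<subseteq> K \<longrightarrow>
      cmod (fun_dist k f) \<le> C * (\<Sum>vs | set vs \<subseteq> Basis \<and> length vs \<le> N. SUP x. cmod (D_iter vs f x))"
    unfolding test_norm_def by blast
qed

lemma smoothing_has_smooth_kernel:
  fixes T :: "('a::euclidean_space \<Rightarrow> complex) \<Rightarrow> 'a \<Rightarrow> complex"
  assumes "smoothing T"
  shows "has_smooth_kernel T"
proof -
  obtain k where k: "smooth_on UNIV k" and T: "\<And>u. u \<in> test_functions \<Longrightarrow> T u = kernel_op k u"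
    by (rule smoothingE[OF assms]) (rule that)
  have "has_schwartz_kernel T (fun_dist k)"
    unfolding has_schwartz_kernel_def smooth_operator_def
  proof (intro conjI ballI allI)
    show "smooth_on UNIV (T u)" if "u \<in> test_functions" for u using kernel_op_smooth[OF k that] T[OF that] by simp
    show "T (\<lambda>x. u x + v x) = (\<lambda>x. T u x + T v x)" if uv: "u \<in> test_functions" "v \<in> test_functions" for u v
      using T[OF test_functions_add[OF uv]] T[OF uv(1)] T[OF uv(2)]
      by (simp add: kernel_op_def distrib_left fun_eq_iff
          Bochner_Integration.integral_add[OF kernel_op_integrable[OF k uv(1)] kernel_op_integrable[OF k uv(2)]])
    show "T (\<lambda>x. c * u x) = (\<lambda>x. c * T u x)" if u: "u \<in> test_functions" for c u
      using T[OF test_functions_cmult[OF u, of c]] T[OF u] by (simp add: kernel_op_def fun_eq_iff mult.left_commute[of _ c])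
    show "distribution (fun_dist k)" by (rule distribution_fun_dist[OF smooth_on_imp_continuous_on[OF k]])
    show "fun_dist (T u) v = fun_dist k (\<lambda>(x, y). v x * u y)" if uv: "u \<in> test_functions" "v \<in> test_functions" for u v
      using fun_dist_tensor[OF k uv] T[OF uv(1)] by simp
  qed
  then show ?thesis unfolding has_smooth_kernel_def using k by blast
qed

lemma Op_total_left_symbol:
  assumes a: "symb UNIV m a"
  shows "total_left_symbol m (Op a) a"
  unfolding total_left_symbol_def
proof (intro conjI exI ballI)
  show "a \<in> symbol_class m" using a by (simp add: symbol_class_symb)
  show "has_schwartz_kernel (Op a) (osc_dist a)" by (rule kernel_Op[OF a])
  show "smooth_on UNIV (\<lambda>_::'a \<times> 'a. 0)" by simp
  show "has_oscillatory_integral (\<lambda>((x, y), \<xi>). a (x, \<xi>)) f (osc_dist a f - fun_dist (\<lambda>_. 0) f)" if "f \<in> test_functions" for f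
    using osc_dist_osc[OF a that] by (simp add: fun_dist_def)
qed

lemma Op_PsiDO:
  fixes a :: "'a::euclidean_space \<times> 'a \<Rightarrow> complex"
  assumes a: "symb UNIV m a"
  shows "Op a \<in> PsiDO m"
  unfolding PsiDO_def
proof (intro CollectI exI conjI ballI)
  have "symb UNIV m (\<lambda>(w::'a \<times> 'a, \<xi>). a (fst w, \<xi>))" by (rule symb_pullback_fst[OF bounded_linear_fst a])
  then show "(\<lambda>((x, y :: 'a), \<xi>). a (x, \<xi>)) \<in> symbol_class m"
    by (simp add: symbol_class_symb case_prod_beta')
  show "has_schwartz_kernel (Op a) (osc_dist a)" by (rule kernel_Op[OF a])
  show "has_oscillatory_integral (\<lambda>((x, y), \<xi>). a (x, \<xi>)) f (osc_dist a f)" if "f \<in> test_functions" for f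
    by (rule osc_dist_osc[OF a that])
qed

lemma Op_PsiDO_cl:
  assumes "classical_sym m q qs"
  shows "Op q \<in> PsiDO_cl m"
proof -
  have "classical_expansion m (Op q) qs"
    unfolding classical_expansion_def
  proof (intro conjI exI)
    show "\<forall>j. smooth_on S0 (qs j) \<and> pos_homogeneous (m - real j) (qs j)"
      using assms by (simp add: classical_sym_def)
    show "total_left_symbol m (Op q) q" using assms by (intro Op_total_left_symbol) (simp add: classical_sym_def)
    show "\<forall>\<phi>\<in>cutoffs. \<forall>N. (\<lambda>(x, \<xi>). q (x, \<xi>) - (\<Sum>j<N. (1 - \<phi> \<xi>) * qs j (x, \<xi>))) \<in> symbol_class (m - real N)"
      using assms by (simp add: classical_sym_def symbol_class_symb excised_def case_prod_beta')
  qed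
  moreover have "Op q \<in> PsiDO m" using assms by (intro Op_PsiDO) (simp add: classical_sym_def)
  ultimately show ?thesis by (auto simp: PsiDO_cl_def)
qed

text \<open>On tensor products the kernels of \<open>P\<close> and \<open>Op p\<close> differ by
  integration against \<open>k\<close>, by uniqueness of oscillatory integrals. For fixed
  \<open>u\<close> and varying \<open>v\<close> this is an equality of distributions in
  \<open>x\<close> given by smooth functions, and \<open>fundamental_lemma\<close> makes it
  pointwise.\<close>

lemma schwartz_kernel_symbol:
  fixes P :: "('a::euclidean_space \<Rightarrow> complex) \<Rightarrow> 'a \<Rightarrow> complex"
  assumes "total_left_symbol m P p"
  shows "symb UNIV m p" and "smoothing (\<lambda>u x. P u x - Op p u x)"
proof -
  show p: "symb UNIV m p" using assms by (simp add: total_left_symbol_def symbol_class_symb)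
  obtain K k where K: "has_schwartz_kernel P K" and k: "smooth_on UNIV k"
    and o: "\<And>f. f \<in> test_functions \<Longrightarrow> has_oscillatory_integral (\<lambda>((x, y), \<xi>). p (x, \<xi>)) f (K f - fun_dist k f)"
    using assms unfolding total_left_symbol_def by blast
  show "smoothing (\<lambda>u x. P u x - Op p u x)"
  proof (rule smoothingI[OF k])
    fix u :: "'a \<Rightarrow> complex" and x assume u: "u \<in> test_functions"
    have sP: "smooth_on UNIV (P u)" using K u by (auto simp: has_schwartz_kernel_def smooth_operator_def)
    note s = sP Op_smooth[OF p u] kernel_op_smooth[OF k u]
    note c = s[THEN smooth_on_imp_continuous_on]
    have "(P u x - Op p u x) - kernel_op k u x = 0"
    proof (rule fundamental_lemma[of "\<lambda>x. (P u x - Op p u x) - kernel_op k u x" UNIV])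
      show "continuous_on UNIV (\<lambda>x. (P u x - Op p u x) - kernel_op k u x)" by (intro continuous_intros c)
      fix v :: "'a \<Rightarrow> complex" assume v: "v \<in> test_functions"
      have i: "integrable lborel (\<lambda>x. g x * v x)" if "continuous_on UNIV g" for g
        by (rule integrable_compact_support[OF _ test_functionsD(2)[OF v]])
          (intro continuous_intros that test_cont v, simp add: fun_support_zero)
      let ?f = "\<lambda>(x, y). v x * u y"
      have f: "?f \<in> test_functions" by (rule test_functions_tensor[OF u v])
      have "fun_dist (P u) v = K ?f" using K u v by (simp add: has_schwartz_kernel_def)
      moreover have "K ?f - fun_dist k ?f = osc_dist p ?f" by (rule oscillatory_integral_unique[OF o[OF f] osc_dist_osc[OF p f]])
      ultimately have 0: "fun_dist (P u) v - fun_dist (Op p u) v - fun_dist (kernel_op k u) v = 0"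
        using osc_dist_tensor[OF p u v] fun_dist_tensor[OF k u v] by (simp add: algebra_simps)
      have "(LINT x|lborel. v x * ((P u x - Op p u x) - kernel_op k u x)) =
          (LINT x|lborel. P u x * v x - Op p u x * v x - kernel_op k u x * v x)"
        by (rule Bochner_Integration.integral_cong[OF refl]) (simp add: algebra_simps)
      also have "\<dots> = fun_dist (P u) v - fun_dist (Op p u) v - fun_dist (kernel_op k u) v"
        using i[OF c(1)] i[OF c(2)] i[OF c(3)] by (simp add: fun_dist_def)
      finally show "(LINT x|lborel. v x * ((P u x - Op p u x) - kernel_op k u x)) = 0" using 0 by simp
    qed auto
    then show "P u x - Op p u x = kernel_op k u x" by simp
  qed
qed


section \<open>Proper supports\<close>

lemma test_functions_zero: "(\<lambda>_. 0) \<in> test_functions"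
  by (rule test_functionsI[of _ "{}"]) auto

lemma schwartz_kernel_linear:
  assumes "has_schwartz_kernel P K"
  shows "u \<in> test_functions \<Longrightarrow> smooth_on UNIV (P u)"
    and "u \<in> test_functions \<Longrightarrow> v \<in> test_functions \<Longrightarrow> P (\<lambda>x. u x + v x) x = P u x + P v x"
    and "P (\<lambda>_. 0) x = 0"
proof -
  show "u \<in> test_functions \<Longrightarrow> smooth_on UNIV (P u)"
    and "u \<in> test_functions \<Longrightarrow> v \<in> test_functions \<Longrightarrow> P (\<lambda>x. u x + v x) x = P u x + P v x"
    using assms by (auto simp: has_schwartz_kernel_def smooth_operator_def)
  have "\<forall>c. \<forall>u\<in>test_functions. P (\<lambda>x. c * u x) = (\<lambda>x. c * P u x)"
    using assms by (simp add: has_schwartz_kernel_def smooth_operator_def)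
  from this[rule_format, OF test_functions_zero, of 0] show "P (\<lambda>_. 0) x = 0" by (simp add: fun_eq_iff)
qed

text \<open>A product neighbourhood of \<open>(x0, y0)\<close> lies in an open set on which the
  kernel vanishes. For \<open>g\<close> supported near \<open>y0\<close> the smooth function
  \<open>P g\<close> thus integrates to 0 against every \<open>v\<close> supported near
  \<open>x0\<close>, and so it vanishes at \<open>x0\<close>.\<close>

lemma kernel_vanishes_near:
  fixes P :: "('a::euclidean_space \<Rightarrow> complex) \<Rightarrow> 'a \<Rightarrow> complex"
  assumes K: "has_schwartz_kernel P K" and xy: "(x0, y0) \<notin> dist_support K"
  shows "\<exists>d>0. \<forall>g\<in>test_functions. fun_support g \<subseteq> ball y0 d \<longrightarrow> P g x0 = 0"
proof -
  obtain U where U: "open U" "(x0, y0) \<in> U" and U0: "\<And>f. f \<in> test_functions \<Longrightarrow> fun_support f \<subseteq> U \<Longrightarrow> K f = 0"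
    using xy unfolding dist_support_def by auto
  obtain A B where AB: "open A" "open B" "x0 \<in> A" "y0 \<in> B" "A \<times> B \<subseteq> U"
    using open_prod_elim[OF U] by (metis mem_Sigma_iff)
  obtain d where d: "d > 0" "ball y0 d \<subseteq> B" using AB openE by blast
  have "P g x0 = 0" if g: "g \<in> test_functions" "fun_support g \<subseteq> ball y0 d" for g
  proof (rule fundamental_lemma[OF smooth_on_imp_continuous_on[OF schwartz_kernel_linear(1)[OF K g(1)]] AB(1,3)])
    fix v :: "'a \<Rightarrow> complex" assume v: "v \<in> test_functions" "fun_support v \<subseteq> A"
    let ?f = "\<lambda>(x, y). v x * g y"
    have f: "?f \<in> test_functions" by (rule test_functions_tensor[OF g(1) v(1)])
    have "fun_support ?f \<subseteq> fun_support v \<times> fun_support g"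
    proof (rule test_functionsI(2)[OF test_functionsD(1)[OF f]])
      show "compact (fun_support v \<times> fun_support g)" by (intro compact_Times test_functionsD g v)
    qed (use fun_support_zero[of _ v] fun_support_zero[of _ g] in force)
    also have "\<dots> \<subseteq> U" using v(2) g(2) d(2) AB(5) by blast
    finally have "K ?f = 0" by (rule U0[OF f])
    then have "fun_dist (P g) v = 0" using K g(1) v(1) by (simp add: has_schwartz_kernel_def)
    then show "(LINT x|lborel. v x * P g x) = 0" by (simp add: fun_dist_def mult.commute)
  qed
  with d(1) show ?thesis by blast
qed

text \<open>A partition of the test function by bumps reduces to the local statement.\<close>

lemma kernel_vanishes:
  fixes P :: "('a::euclidean_space \<Rightarrow> complex) \<Rightarrow> 'a \<Rightarrow> complex"
  assumes K: "has_schwartz_kernel P K" and g: "g \<in> test_functions"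
    and off: "\<And>y. y \<in> fun_support g \<Longrightarrow> (x, y) \<notin> dist_support K"
  shows "P g x = 0"
proof -
  have "\<exists>d>0. \<forall>g\<in>test_functions. fun_support g \<subseteq> ball y d \<longrightarrow> P g x = 0" if "y \<in> fun_support g" for y
    by (rule kernel_vanishes_near[OF K off[OF that]])
  then obtain d where d: "\<And>y. y \<in> fun_support g \<Longrightarrow> d y > 0"
    and d0: "\<And>y g'. y \<in> fun_support g \<Longrightarrow> g' \<in> test_functions \<Longrightarrow> fun_support g' \<subseteq> ball y (d y) \<Longrightarrow> P g' x = 0"
    by metis
  \<comment> \<open>Induction over the balls of a finite cover: a bump splits off the part of
    \<open>h\<close> near one centre, which the local statement handles, and the rest vanishes
    outside the remaining balls.\<close>
  have fin: "P h x = 0" if "finite F" "F \<subseteq> fun_support g" "h \<in> test_functions"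
    "\<And>z. z \<notin> (\<Union>y\<in>F. ball y (d y / 2)) \<Longrightarrow> h z = 0" for F h
    using that
  proof (induction F arbitrary: h rule: finite_induct)
    case empty
    then have "h = (\<lambda>_. 0)" by auto
    then show ?case by (simp add: schwartz_kernel_linear(3)[OF K])
  next
    case (insert y F)
    have dy: "d y > 0" using insert.prems by (intro d) auto
    \<comment> \<open>The cover uses half radii: the bump is 1 on the half ball and lives within
      three quarters of the radius, so its closed support still lies in the open ball of radius
      \<open>d y\<close>.\<close>
    obtain \<phi> where \<phi>: "smooth_on UNIV (\<lambda>z. complex_of_real (\<phi> z))"
      "\<And>z. dist y z \<le> d y / 2 \<Longrightarrow> \<phi> z = 1" "\<And>z. 3 / 4 * d y \<le> dist y z \<Longrightarrow> \<phi> z = 0"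
      using bump_exists[of "d y / 2" "3 / 4 * d y" y] dy by auto
    let ?h1 = "\<lambda>z. complex_of_real (\<phi> z) * h z" and ?h2 = "\<lambda>z. (1 - complex_of_real (\<phi> z)) * h z"
    have s2: "smooth_on UNIV (\<lambda>z. 1 - complex_of_real (\<phi> z))" by (intro smooth_on_sub smooth_on_const open_UNIV \<phi>(1))
    have t1: "?h1 \<in> test_functions" and t2: "?h2 \<in> test_functions"
      by (rule test_functions_mult[OF insert.prems(2)], rule \<phi>(1) s2)+
    have "fun_support ?h1 \<subseteq> cball y (3 / 4 * d y)"
      by (rule test_functionsI(2)[OF test_functionsD(1)[OF t1]]) (auto simp: \<phi>(3))
    also have "\<dots> \<subseteq> ball y (d y)" using dy by auto
    finally have 1: "P ?h1 x = 0" using insert.prems by (intro d0[OF _ t1]) auto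
    have 2: "P ?h2 x = 0"
    proof (rule insert.IH[OF _ t2])
      show "?h2 z = 0" if "z \<notin> (\<Union>y\<in>F. ball y (d y / 2))" for z
        using insert.prems(3)[of z] that \<phi>(2)[of z] by (cases "dist y z < d y / 2") auto
    qed (use insert.prems in auto)
    have "h = (\<lambda>z. ?h1 z + ?h2 z)" by (simp add: algebra_simps)
    then have "P h x = P (\<lambda>z. ?h1 z + ?h2 z) x" by simp
    then show ?case using schwartz_kernel_linear(2)[OF K t1 t2, of x] 1 2 by simp
  qed
  have "compact (fun_support g)" by (rule test_functionsD(2)[OF g])
  then obtain F where F: "F \<subseteq> fun_support g" "finite F" "fun_support g \<subseteq> (\<Union>y\<in>F. ball y (d y / 2))"
    by (rule compactE_image[where C = "fun_support g" and f = "\<lambda>y. ball y (d y / 2)"]) (use d in force)+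
  show ?thesis by (rule fin[OF F(2,1) g]) (use F(3) fun_support_zero[of _ g] in blast)
qed

text \<open>Off the kernel support and away from the diagonal \<open>OpT p\<close> contributes nothing to \<open>P\<close>, so that \<open>r\<close>
  inherits proper support from \<open>P\<close>.\<close>

definition proper_decomp :: "(('a::euclidean_space \<Rightarrow> complex) \<Rightarrow> 'a \<Rightarrow> complex) \<Rightarrow> real \<Rightarrow>
    ('a \<times> 'a \<Rightarrow> complex) \<Rightarrow> ('a \<times> 'a \<Rightarrow> complex) \<Rightarrow> bool" where
  "proper_decomp P m p r \<longleftrightarrow> properly_supported P \<and> symb UNIV m p \<and> smooth_on UNIV r \<and>
    (\<forall>u\<in>test_functions. P u = (\<lambda>x. OpT p u x + kernel_op r u x))"

lemma kernel_supportE: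
  assumes "properly_supported P"
  shows "\<exists>K. has_schwartz_kernel P K \<and> kernel_support P = dist_support K"
proof (intro exI conjI)
  have "\<exists>K. has_schwartz_kernel P K" using assms by (simp add: properly_supported_def)
  then show "has_schwartz_kernel P (SOME K. has_schwartz_kernel P K)" by (rule someI_ex)
qed (simp add: kernel_support_def)

lemma kernel_support_compact:
  fixes P :: "('a::euclidean_space \<Rightarrow> complex) \<Rightarrow> 'a \<Rightarrow> complex"
  assumes P: "properly_supported P" and K: "compact K"
  shows "compact {s \<in> kernel_support P. fst s \<in> K}" "compact {s \<in> kernel_support P. snd s \<in> K}"
proof -
  have "compactin (top_of_set (kernel_support P)) {s \<in> topspace (top_of_set (kernel_support P)). fst s \<in> K}"
    using P K by (intro compactin_proper_map_preimage) (auto simp: properly_supported_def)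
  then show "compact {s \<in> kernel_support P. fst s \<in> K}" by (simp add: compactin_subtopology)
  have "compactin (top_of_set (kernel_support P)) {s \<in> topspace (top_of_set (kernel_support P)). snd s \<in> K}"
    using P K by (intro compactin_proper_map_preimage) (auto simp: properly_supported_def)
  then show "compact {s \<in> kernel_support P. snd s \<in> K}" by (simp add: compactin_subtopology)
qed

lemma OpT_zero: "OpT a (\<lambda>_. 0) x = 0"
  using OpT_cmult[of a 0 "\<lambda>_. 0" x] by simp

lemma proper_decomp_zero:
  fixes P :: "('a::euclidean_space \<Rightarrow> complex) \<Rightarrow> 'a \<Rightarrow> complex"
  assumes P: "proper_decomp P m p r" and xy: "(x, y) \<notin> kernel_support P" "dist x y > 1"
  shows "r (x, y) = 0"
proof -
  have r: "smooth_on UNIV r" and Pu: "\<And>u. u \<in> test_functions \<Longrightarrow> P u = (\<lambda>x. OpT p u x + kernel_op r u x)"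
    using P by (auto simp: proper_decomp_def)
  obtain K where K: "has_schwartz_kernel P K" "kernel_support P = dist_support K"
    using P kernel_supportE unfolding proper_decomp_def by blast
  have "\<exists>d>0. \<forall>g\<in>test_functions. fun_support g \<subseteq> ball y d \<longrightarrow> P g x = 0"
    by (rule kernel_vanishes_near[OF K(1)]) (use xy(1) K(2) in simp)
  then obtain d where d: "d > 0" "\<And>g. g \<in> test_functions \<Longrightarrow> fun_support g \<subseteq> ball y d \<Longrightarrow> P g x = 0"
    by blast
  \<comment> \<open>Near \<open>y\<close>, where test functions contribute nothing to
    \<open>P\<close> at \<open>x\<close>, and at distance more than 1 from \<open>x\<close>, where
    \<open>OpT p\<close> does not read its argument.\<close>
  let ?V = "ball y d \<inter> - cball x 1"
  show ?thesis
  proof (rule fundamental_lemma[of "\<lambda>y. r (x, y)" ?V])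
    show "continuous_on UNIV (\<lambda>y. r (x, y))" by (rule continuous_on_section[OF smooth_on_imp_continuous_on[OF r]])
    show "open ?V" by (intro open_Int open_ball open_Compl closed_cball)
    show "y \<in> ?V" using d(1) xy(2) by simp
    fix v :: "'a \<Rightarrow> complex" assume v: "v \<in> test_functions" "fun_support v \<subseteq> ?V"
    have "P v x = 0" using d(2)[OF v(1)] v(2) by auto
    moreover have "OpT p v x = OpT p (\<lambda>_. 0) x"
    proof (rule OpT_local)
      fix z :: 'a assume "z \<in> cball 0 1"
      then have "x - z \<notin> ?V" by (simp add: dist_norm)
      then show "v (x - z) = 0" using v(2) fun_support_zero[of "x - z" v] by blast
    qed
    ultimately have "kernel_op r v x = 0" using Pu[OF v(1)] by (simp add: OpT_zero)
    then show "(LINT y|lborel. v y * r (x, y)) = 0" by (simp add: kernel_op_def mult.commute)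
  qed
qed

lemma compact_thicken: "compact K \<Longrightarrow> compact ((\<lambda>(x, z). x + z) ` (K \<times> cball (0::'a::euclidean_space) 1))"
  by (intro compact_continuous_image compact_Times compact_cball) (auto simp: case_prod_beta' intro!: continuous_intros)

lemma thicken_mem: "x \<in> K \<Longrightarrow> dist x y \<le> 1 \<Longrightarrow> y \<in> (\<lambda>(x, z). x + z) ` (K \<times> cball (0::'a::euclidean_space) 1)"
  by (rule image_eqI[of _ _ "(x, y - x)"]) (auto simp: dist_norm norm_minus_commute)

text \<open>One compact set contains every \<open>y\<close> that matters for some \<open>x\<close>
  in \<open>K\<close>: properness of the kernel support gives one part, the unit neighbourhood of
  \<open>K\<close> the other. A single cutoff then serves \<open>P\<close>, \<open>OpT p\<close> and
  \<open>r\<close> together in \<open>proper_extension_eq\<close>.\<close>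

lemma proper_decomp_right:
  fixes P :: "('a::euclidean_space \<Rightarrow> complex) \<Rightarrow> 'a \<Rightarrow> complex"
  assumes P: "proper_decomp P m p r" and K: "compact K"
  shows "\<exists>L. compact L \<and> (\<forall>x\<in>K. \<forall>y. y \<notin> L \<longrightarrow> (x, y) \<notin> kernel_support P \<and> dist x y > 1 \<and> r (x, y) = 0)"
proof (intro exI conjI ballI allI impI)
  let ?L = "snd ` {s \<in> kernel_support P. fst s \<in> K} \<union> (\<lambda>(x, z). x + z) ` (K \<times> cball (0::'a) 1)"
  show "compact ?L"
    using P K by (intro compact_Un compact_thicken compact_continuous_image continuous_on_snd continuous_on_id
      kernel_support_compact) (auto simp: proper_decomp_def)
  fix x y assume x: "x \<in> K" and y: "y \<notin> ?L"
  show 1: "(x, y) \<notin> kernel_support P" using x y by (force simp: image_iff)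
  show 2: "dist x y > 1" using y thicken_mem[OF x, of y] by (auto simp: not_le)
  show "r (x, y) = 0" by (rule proper_decomp_zero[OF P 1 2])
qed

lemma proper_decomp_left:
  fixes P :: "('a::euclidean_space \<Rightarrow> complex) \<Rightarrow> 'a \<Rightarrow> complex"
  assumes P: "proper_decomp P m p r" and K: "compact K"
  shows "\<exists>L. compact L \<and> (\<forall>y\<in>K. \<forall>x. x \<notin> L \<longrightarrow> r (x, y) = 0)"
proof (intro exI conjI ballI allI impI)
  let ?L = "fst ` {s \<in> kernel_support P. snd s \<in> K} \<union> (\<lambda>(x, z). x + z) ` (K \<times> cball (0::'a) 1)"
  show "compact ?L"
    using P K by (intro compact_Un compact_thicken compact_continuous_image continuous_on_fst continuous_on_id
      kernel_support_compact) (auto simp: proper_decomp_def)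
  fix y x assume y: "y \<in> K" and x: "x \<notin> ?L"
  have 1: "(x, y) \<notin> kernel_support P" using x y by (force simp: image_iff)
  have 2: "dist x y > 1" using x thicken_mem[OF y, of x] by (auto simp: not_le dist_commute)
  show "r (x, y) = 0" by (rule proper_decomp_zero[OF P 1 2])
qed

lemma proper_decomp_test:
  fixes P :: "('a::euclidean_space \<Rightarrow> complex) \<Rightarrow> 'a \<Rightarrow> complex"
  assumes P: "proper_decomp P m p r" and u: "u \<in> test_functions"
  shows "kernel_op r u \<in> test_functions"
proof -
  have r: "smooth_on UNIV r" using P by (simp add: proper_decomp_def)
  obtain L where L: "compact L" "\<And>x y. y \<in> fun_support u \<Longrightarrow> x \<notin> L \<Longrightarrow> r (x, y) = 0"
    using proper_decomp_left[OF P test_functionsD(2)[OF u]] by blast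
  show ?thesis
  proof (rule test_functionsI(1)[OF kernel_op_smooth[OF r u] L(1)])
    fix x assume "x \<notin> L"
    then have "(\<lambda>y. r (x, y) * u y) = (\<lambda>_. 0)" using L(2) fun_support_zero[of _ u] by fastforce
    then show "kernel_op r u x = 0" by (simp add: kernel_op_def)
  qed
qed

lemma proper_decomp_integrable:
  fixes P :: "('a::euclidean_space \<Rightarrow> complex) \<Rightarrow> 'a \<Rightarrow> complex"
  assumes P: "proper_decomp P m p r" and w: "smooth_on UNIV w"
  shows "integrable lborel (\<lambda>y. r (x, y) * w y)"
proof -
  have r: "smooth_on UNIV r" using P by (simp add: proper_decomp_def)
  obtain L where "compact L" "\<And>y. y \<notin> L \<Longrightarrow> r (x, y) = 0"
    using proper_decomp_right[OF P, of "{x}"] by auto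
  then show ?thesis
    by (intro integrable_compact_support[of _ L] continuous_intros smooth_on_imp_continuous_on[OF w]
      continuous_on_section[OF smooth_on_imp_continuous_on[OF r]]) auto
qed

text \<open>For a bump that is 1 on a large ball the value follows from the locality of
  \<open>OpT p\<close> and the compact support of \<open>r (x, y)\<close> in \<open>y\<close>. Every
  other admissible cutoff gives the same value by \<open>kernel_vanishes\<close>, so the definite
  description is resolved.\<close>

lemma proper_extension_eq:
  fixes P :: "('a::euclidean_space \<Rightarrow> complex) \<Rightarrow> 'a \<Rightarrow> complex"
  assumes P: "proper_decomp P m p r" and w: "smooth_on UNIV w"
  shows "proper_extension P w x = OpT p w x + kernel_op r w x"
proof -
  have Pu: "\<And>u. u \<in> test_functions \<Longrightarrow> P u = (\<lambda>x. OpT p u x + kernel_op r u x)"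
    using P by (auto simp: proper_decomp_def)
  obtain K where K: "has_schwartz_kernel P K" "kernel_support P = dist_support K"
    using P kernel_supportE unfolding proper_decomp_def by blast
  obtain L where L: "compact L" "\<And>y. y \<notin> L \<Longrightarrow> (x, y) \<notin> kernel_support P \<and> dist x y > 1 \<and> r (x, y) = 0"
    using proper_decomp_right[OF P, of "{x}"] by auto
  obtain R where R: "R > 0" "L \<subseteq> ball 0 R"
    using bounded_subset_ballD[OF compact_imp_bounded[OF L(1)], of 0] by blast
  obtain \<phi> where \<phi>: "smooth_on UNIV (\<lambda>z::'a. complex_of_real (\<phi> z))"
      "\<And>z. dist 0 z \<le> R \<Longrightarrow> \<phi> z = 1" "\<And>z. R + 1 \<le> dist 0 z \<Longrightarrow> \<phi> z = 0"
    using bump_exists[of R "R + 1" "0::'a"] R(1) by auto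
  let ?\<phi> = "\<lambda>z. complex_of_real (\<phi> z)"
  let ?c = "OpT p w x + kernel_op r w x"
  have t\<phi>: "?\<phi> \<in> test_functions" by (rule test_functionsI(1)[OF \<phi>(1) compact_cball[of 0 "R + 1"]]) (simp add: \<phi>(3))
  have one: "?\<phi> z = 1" if "z \<in> ball 0 R" for z using that \<phi>(2)[of z] by simp
  let ?adm = "\<lambda>\<psi>. \<exists>U. open U \<and> {y. (x, y) \<in> kernel_support P} \<subseteq> U \<and> (\<forall>y\<in>U. \<psi> y = (1::complex))"
  have tw: "(\<lambda>y. \<psi> y * w y) \<in> test_functions" if "\<psi> \<in> test_functions" for \<psi>
    using test_functions_mult[OF that w] by (simp add: mult.commute)
  have adm\<phi>: "?adm ?\<phi>"
    using L(2) R(2) by (intro exI[of _ "ball 0 R"] conjI ballI one) auto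
  have val\<phi>: "P (\<lambda>y. ?\<phi> y * w y) x = ?c"
  proof -
    have "OpT p (\<lambda>y. ?\<phi> y * w y) x = OpT p w x"
    proof (rule OpT_local)
      fix z :: 'a assume "z \<in> cball 0 1"
      then have "dist x (x - z) \<le> 1" by (simp add: dist_norm)
      then have "x - z \<in> L" using L(2)[of "x - z"] by force
      then show "?\<phi> (x - z) * w (x - z) = w (x - z)" using R(2) one[of "x - z"] by auto
    qed
    moreover have "kernel_op r (\<lambda>y. ?\<phi> y * w y) x = kernel_op r w x"
      unfolding kernel_op_def
    proof (rule Bochner_Integration.integral_cong[OF refl])
      show "r (x, y) * (?\<phi> y * w y) = r (x, y) * w y" for y
        using L(2)[of y] R(2) one[of y] by (cases "y \<in> L") auto
    qed
    ultimately show ?thesis using Pu[OF tw[OF t\<phi>]] by simp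
  qed
  have val: "P (\<lambda>y. \<psi> y * w y) x = ?c" if \<psi>: "\<psi> \<in> test_functions" and adm: "?adm \<psi>" for \<psi>
  proof -
    obtain U where U: "open U" "{y. (x, y) \<in> kernel_support P} \<subseteq> U" "\<And>y. y \<in> U \<Longrightarrow> \<psi> y = 1" using adm by blast
    \<comment> \<open>Two admissible cutoffs agree near every \<open>y\<close> with
      \<open>(x, y)\<close> in the kernel support, so their difference times \<open>w\<close> is a
      test function supported off it, which \<open>P\<close> sends to a function vanishing at
      \<open>x\<close>.\<close>
    let ?g = "\<lambda>y. \<psi> y * w y + (- 1) * (?\<phi> y * w y)"
    have g: "?g \<in> test_functions" by (intro test_functions_add test_functions_cmult tw \<psi> t\<phi>)
    have "P ?g x = 0"
    proof (rule kernel_vanishes[OF K(1) g])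
      fix y assume y: "y \<in> fun_support ?g"
      show "(x, y) \<notin> dist_support K"
      proof
        assume "(x, y) \<in> dist_support K"
        then have s: "(x, y) \<in> kernel_support P" using K(2) by simp
        then have "y \<in> L" using L(2)[of y] by auto
        then have yU: "y \<in> U \<inter> ball 0 R" using s U(2) R(2) by blast
        \<comment> \<open>The support is a closure: vanishing of \<open>?g\<close> on an open set
          around \<open>y\<close> keeps \<open>y\<close> out of it, while vanishing at
          \<open>y\<close> alone would not.\<close>
        have "open (U \<inter> ball 0 R)" by (intro open_Int U(1) open_ball)
        moreover have "U \<inter> ball 0 R \<inter> {y. ?g y \<noteq> 0} = {}" using U(3) one by auto
        ultimately have "U \<inter> ball 0 R \<inter> closure {y. ?g y \<noteq> 0} = {}" by (subst open_Int_closure_eq_empty)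
        then show False using y yU unfolding fun_support_def by blast
      qed
    qed
    moreover have "(\<lambda>y. \<psi> y * w y) = (\<lambda>y. ?\<phi> y * w y + ?g y)" by (simp add: algebra_simps)
    ultimately show ?thesis
      using schwartz_kernel_linear(2)[OF K(1) tw[OF t\<phi>] g, of x] val\<phi> by simp
  qed
  show ?thesis
    unfolding proper_extension_def
  proof (rule the_equality)
    show "\<forall>\<psi>\<in>test_functions. ?adm \<psi> \<longrightarrow> P (\<lambda>y. \<psi> y * w y) x = ?c" using val by blast
    show "c = ?c" if "\<forall>\<psi>\<in>test_functions. ?adm \<psi> \<longrightarrow> P (\<lambda>y. \<psi> y * w y) x = c" for c
      using that t\<phi> adm\<phi> val\<phi> by metis
  qed
qed

lemma kernel_op_diff_smooth:
  fixes P :: "('a::euclidean_space \<Rightarrow> complex) \<Rightarrow> 'a \<Rightarrow> complex"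
  assumes P: "proper_decomp P m p r" and w: "smooth_on UNIV w" "smooth_on UNIV w'"
  shows "kernel_op r (\<lambda>x. w x - w' x) x = kernel_op r w x - kernel_op r w' x"
  unfolding kernel_op_def
  by (simp add: right_diff_distrib Bochner_Integration.integral_diff[OF proper_decomp_integrable[OF P w(1)] proper_decomp_integrable[OF P w(2)]])

text \<open>For \<open>x\<close> in a compact set, \<open>r (x, z)\<close> vanishes for
  \<open>z\<close> outside a compact set, whatever the kernel of \<open>T\<close>; hence the product
  of kernels is integrable and smooth.\<close>

lemma smoothing_proper_right:
  fixes P :: "('a::euclidean_space \<Rightarrow> complex) \<Rightarrow> 'a \<Rightarrow> complex"
  assumes P: "proper_decomp P m p r" and T: "smoothing T"
  shows "smoothing (\<lambda>u. kernel_op r (T u))"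
proof -
  have r: "smooth_on UNIV r" using P by (simp add: proper_decomp_def)
  obtain k where k: "smooth_on UNIV k" and Tk: "\<And>u. u \<in> test_functions \<Longrightarrow> T u = kernel_op k u"
    by (rule smoothingE[OF T]) (rule that)
  have z: "zsupp (\<lambda>(s::'a \<times> 'a, z). r (fst s, z) * k (z, snd s))"
    unfolding zsupp_def
  proof (intro allI impI)
    fix S :: "('a \<times> 'a) set" assume "compact S"
    then have "compact (fst ` S)" by (intro compact_continuous_image continuous_on_fst continuous_on_id)
    then obtain L where "compact L" "\<forall>x\<in>fst ` S. \<forall>y. y \<notin> L \<longrightarrow> r (x, y) = 0"
      using proper_decomp_right[OF P] by meson
    then show "\<exists>L. compact L \<and> (\<forall>t\<in>S. \<forall>z. z \<notin> L \<longrightarrow> (\<lambda>(s, z). r (fst s, z) * k (z, snd s)) (t, z) = 0)" by auto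
  qed
  show ?thesis
    by (rule smoothingI[OF kernel_op_kernel_op_smooth[OF r k z]]) (simp add: Tk kernel_op_kernel_op[OF r k _ z])
qed

lemma smoothing_proper_left:
  fixes P :: "('a::euclidean_space \<Rightarrow> complex) \<Rightarrow> 'a \<Rightarrow> complex"
  assumes P: "proper_decomp P m p r" and T: "smoothing T"
  shows "smoothing (\<lambda>u. T (kernel_op r u))"
proof -
  have r: "smooth_on UNIV r" using P by (simp add: proper_decomp_def)
  obtain k where k: "smooth_on UNIV k" and Tk: "\<And>u. u \<in> test_functions \<Longrightarrow> T u = kernel_op k u"
    by (rule smoothingE[OF T]) (rule that)
  have z: "zsupp (\<lambda>(s::'a \<times> 'a, z). k (fst s, z) * r (z, snd s))"
    unfolding zsupp_def
  proof (intro allI impI)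
    fix S :: "('a \<times> 'a) set" assume "compact S"
    then have "compact (snd ` S)" by (intro compact_continuous_image continuous_on_snd continuous_on_id)
    then obtain L where "compact L" "\<forall>y\<in>snd ` S. \<forall>x. x \<notin> L \<longrightarrow> r (x, y) = 0"
      using proper_decomp_left[OF P] by meson
    then show "\<exists>L. compact L \<and> (\<forall>t\<in>S. \<forall>z. z \<notin> L \<longrightarrow> (\<lambda>(s, z). k (fst s, z) * r (z, snd s)) (t, z) = 0)" by auto
  qed
  show ?thesis
    by (rule smoothingI[OF kernel_op_kernel_op_smooth[OF k r z]]) (simp add: Tk proper_decomp_test[OF P] kernel_op_kernel_op[OF k r _ z])
qed

section \<open>The two parametrix identities for \<open>P\<close>\<close>

lemma smoothing_kernel_op: "smooth_on UNIV r \<Longrightarrow> smoothing (kernel_op r)"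
  by (rule smoothingI) auto

lemma proper_decomp_exists:
  fixes P :: "('a::euclidean_space \<Rightarrow> complex) \<Rightarrow> 'a \<Rightarrow> complex"
  assumes P: "properly_supported P" and p: "total_left_symbol m P p"
  shows "\<exists>r. proper_decomp P m p r"
proof -
  have sp: "symb UNIV m p" by (rule schwartz_kernel_symbol(1)[OF p])
  \<comment> \<open>\<open>P - OpT p\<close> is the difference of \<open>P - Op p\<close> and
    \<open>OpT p - Op p\<close>, both of which are smoothing.\<close>
  have "smoothing (\<lambda>u x. (P u x - Op p u x) - (OpT p u x - Op p u x))"
    by (intro smoothing_diff schwartz_kernel_symbol(2)[OF p] smoothing_OpT_Op[OF sp])
  then have "smoothing (\<lambda>u x. P u x - OpT p u x)" by (rule smoothing_cong) simp
  then obtain r where r: "smooth_on UNIV r" and e: "\<And>u. u \<in> test_functions \<Longrightarrow> (\<lambda>x. P u x - OpT p u x) = kernel_op r u"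
    by (rule smoothingE) (rule that)
  have "P u = (\<lambda>x. OpT p u x + kernel_op r u x)" if "u \<in> test_functions" for u
    by (simp flip: e[OF that])
  then show ?thesis using P sp r unfolding proper_decomp_def by blast
qed

text \<open>\<open>Op q u\<close> need not have compact support, so \<open>kernel_op r\<close> is
  split along \<open>Op q = OpT q - (OpT q - Op q)\<close>: the first part preserves test functions,
  and for the smoothing second part the proper support of \<open>r\<close> makes the product of
  kernels converge.\<close>

lemma right_parametrix:
  fixes P :: "('a::euclidean_space \<Rightarrow> complex) \<Rightarrow> 'a \<Rightarrow> complex"
  assumes P: "proper_decomp P m p r" and q: "symb UNIV m' q" and pq: "rapid (\<lambda>s. comp_sym p q s - 1)"
  shows "smoothing (\<lambda>u x. proper_extension P (Op q u) x - u x)"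
proof -
  have p: "symb UNIV m p" and r: "smooth_on UNIV r" using P by (auto simp: proper_decomp_def)
  let ?D = "\<lambda>u x. OpT q u x - Op q u x"
  have "smoothing (\<lambda>u x. (OpT p (Op q u) x - u x) + (kernel_op r (OpT q u) x - kernel_op r (?D u) x))"
    by (intro smoothing_add smoothing_diff smoothing_comp1[OF p q pq] smoothing_OpT_right[OF q smoothing_kernel_op[OF r]] smoothing_proper_right[OF P smoothing_OpT_Op[OF q]])
  then show ?thesis
  proof (rule smoothing_cong)
    fix u :: "'a \<Rightarrow> complex" and x assume u: "u \<in> test_functions"
    have s: "smooth_on UNIV (OpT q u)" "smooth_on UNIV (Op q u)"
      by (rule OpT_smooth[OF q test_functionsD(1)[OF u]], rule Op_smooth[OF q u])
    have "kernel_op r (?D u) x = kernel_op r (OpT q u) x - kernel_op r (Op q u) x" by (rule kernel_op_diff_smooth[OF P s])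
    then show "proper_extension P (Op q u) x - u x = (OpT p (Op q u) x - u x) + (kernel_op r (OpT q u) x - kernel_op r (?D u) x)"
      by (simp add: proper_extension_eq[OF P s(2)])
  qed
qed

text \<open>Both parts of \<open>P u\<close> are test functions, so \<open>Op q\<close> applies to
  each and may be replaced by \<open>OpT q\<close> up to smoothing operators. What remains of the
  main part is the truncated product of \<open>left_parametrix\<close>.\<close>

lemma left_parametrix_Op:
  fixes P :: "('a::euclidean_space \<Rightarrow> complex) \<Rightarrow> 'a \<Rightarrow> complex"
  assumes P: "proper_decomp P m p r" and q: "symb UNIV m' q" and s: "symb UNIV m'' s"
    and pq: "rapid (\<lambda>x. comp_sym p q x - 1)" and qs: "rapid (\<lambda>x. comp_sym q s x - 1)"
  shows "smoothing (\<lambda>u x. Op q (P u) x - u x)"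
proof -
  have p: "symb UNIV m p" and r: "smooth_on UNIV r"
    and Pu: "\<And>u. u \<in> test_functions \<Longrightarrow> P u = (\<lambda>x. OpT p u x + kernel_op r u x)"
    using P by (auto simp: proper_decomp_def)
  let ?D = "\<lambda>u x. OpT q u x - Op q u x"
  have D: "smoothing ?D" by (rule smoothing_OpT_Op[OF q])
  have "smoothing (\<lambda>u x. ((OpT q (OpT p u) x - u x) + OpT q (kernel_op r u) x) - (?D (OpT p u) x + ?D (kernel_op r u) x))"
    by (intro smoothing_diff smoothing_add left_parametrix[OF p q s pq qs] smoothing_OpT_left[OF q smoothing_kernel_op[OF r]]
        smoothing_OpT_right[OF p D] smoothing_proper_left[OF P D])
  then show ?thesis
  proof (rule smoothing_cong)
    fix u :: "'a \<Rightarrow> complex" and x assume u: "u \<in> test_functions"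
    have t: "OpT p u \<in> test_functions" "kernel_op r u \<in> test_functions"
      by (rule OpT_test[OF p u], rule proper_decomp_test[OF P u])
    have "Op q (P u) x = Op q (OpT p u) x + Op q (kernel_op r u) x"
      unfolding Pu[OF u] by (rule Op_add[OF q t])
    then show "Op q (P u) x - u x = ((OpT q (OpT p u) x - u x) + OpT q (kernel_op r u) x) - (?D (OpT p u) x + ?D (kernel_op r u) x)"
      by simp
  qed
qed

theorem theorem5p8:
  fixes P :: "(real ^ 'n \<Rightarrow> complex) \<Rightarrow> real ^ 'n \<Rightarrow> complex" and m :: real
  assumes "P \<in> PsiDO_cl m" and "properly_supported P" and "elliptic m P"
  shows "\<exists>Q \<in> PsiDO_cl (- m).
    has_smooth_kernel (\<lambda>u x. proper_extension P (Q u) x - u x) \<and>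
    has_smooth_kernel (\<lambda>u x. Q (P u) x - u x)"
proof -
  \<comment> \<open>\<open>principal_symbol\<close> is the leading term of an expansion picked by
    \<open>SOME\<close>. Continuing with exactly this expansion makes ellipticity a statement about
    \<open>ps 0\<close>.\<close>
  have "\<exists>s. \<exists>q. classical_expansion m P q \<and> s = q 0" using assms(1) by (auto simp: PsiDO_cl_def)
  then have "\<exists>q. classical_expansion m P q \<and> principal_symbol m P = q 0"
    unfolding principal_symbol_def by (rule someI_ex)
  then obtain ps where ps: "classical_expansion m P ps" "principal_symbol m P = ps 0" by blast
  have nz: "ps 0 (x, \<xi>) \<noteq> 0" if "\<xi> \<noteq> 0" for x \<xi>
    using assms(3) that ps(2) by (simp add: elliptic_def)
  obtain p where p: "total_left_symbol m P p"
    and e: "\<forall>\<phi>\<in>cutoffs. \<forall>N. (\<lambda>(x, \<xi>). p (x, \<xi>) - (\<Sum>j<N. (1 - \<phi> \<xi>) * ps j (x, \<xi>))) \<in> symbol_class (m - real N)"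
    using ps(1) unfolding classical_expansion_def by blast
  have cp: "classical_sym m p ps"
    using ps(1) e schwartz_kernel_symbol(1)[OF p]
    by (simp add: classical_expansion_def classical_sym_def symbol_class_symb excised_def case_prod_beta')
  obtain r where P: "proper_decomp P m p r" using proper_decomp_exists[OF assms(2) p] by blast
  obtain q qs where q: "classical_sym (- m) q qs" "\<And>x \<xi>. \<xi> \<noteq> 0 \<Longrightarrow> qs 0 (x, \<xi>) \<noteq> 0" and pq: "rapid (\<lambda>s. comp_sym p q s - 1)"
    using right_parametrix_symbol[OF cp nz] by blast
  \<comment> \<open>The roles are shifted by one place: \<open>q\<close> now has the right inverse
    \<open>s\<close> at the level of symbols, which \<open>left_parametrix\<close> converts into
    \<open>q\<close> being a left inverse of \<open>p\<close>.\<close>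
  obtain s ss where s: "classical_sym m s ss" and qs: "rapid (\<lambda>x. comp_sym q s x - 1)"
    using right_parametrix_symbol[OF q] by auto
  have sq: "symb UNIV (- m) q" and sm: "symb UNIV m s" using q(1) s by (auto simp: classical_sym_def)
  show ?thesis
  proof (intro bexI[of _ "Op q"] conjI)
    show "Op q \<in> PsiDO_cl (- m)" by (rule Op_PsiDO_cl[OF q(1)])
    show "has_smooth_kernel (\<lambda>u x. proper_extension P (Op q u) x - u x)"
      by (rule smoothing_has_smooth_kernel[OF right_parametrix[OF P sq pq]])
    show "has_smooth_kernel (\<lambda>u x. Op q (P u) x - u x)"
      by (rule smoothing_has_smooth_kernel[OF left_parametrix_Op[OF P sq sm pq qs]])
  qed
qed

end
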